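(* For every integer $n\ge2$ there is a constant $\lambda(n)\ge1$, depending only on $n$, such that the following holds. Let $m\ge n$, $K\ge1$, let $\omega\in\Lambda^n\mathbb{R}^m$ be a calibration, let $\Omega\subset\mathbb{R}^n$ be open, and let $s\in(q(K,n,\|\omega\|_{\ell^1}),\,p(K,n,\|\omega\|_{\ell^1}))$, where $$q(K,n,t)=\frac{K\lambda(n)t}{K\lambda(n)t+1}\,n,\qquad p(K,n,t)=\frac{K\lambda(n)t}{K\lambda(n)t-1}\,n .$$ Suppose that $f\in W^{1,s}_{loc}(\Omega,\mathbb{R}^m)$ satisfies $\|Df\|^n\le K\star f^\star\omega$ almost everywhere. Then, for every nonnegative $\phi\in\mathcal C^\infty_c(\Omega)$, $$\|\phi Df\|_{L^s(\Omega,\mathbb{R}^{m\times n})}\le C\,\|f\otimes D\phi\|_{L^s(\Omega,\mathbb{R}^{m\times n})}$$ for a constant $C$ depending only on $s$, $n$, $\|\omega\|_{\ell^1}$ and $K$.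
   Context: $\Lambda^n\mathbb{R}^m$ denotes the $n$-covectors on $\mathbb{R}^m$, identified with constant-coefficient $n$-forms. The comass of $\omega$ is $\|\omega\|=\sup\{\omega(v_1\wedge\dots\wedge v_n):(v_1,\dots,v_n)\text{ orthonormal}\}$; $\omega$ is a calibration if $\|\omega\|=1$. Writing $\omega=\sum_I\omega_I\,dx^I$ in the standard basis ($I=(i_1<\dots<i_n)$), $\|\omega\|_{\ell^1}=\sum_I|\omega_I|$; for a calibration $1\le\|\omega\|_{\ell^1}\le\binom mn$. The value $p(K,n,t)$ is read as $+\infty$ if $K\lambda(n)t=1$. $\|Df\|$ is the operator norm of the weak differential, and $\star f^\star\omega=\omega(Df e_1\wedge\dots\wedge Df e_n)$ almost everywhere. $f\otimes D\phi$ is the tensor product of the column vector $f$ and the row vector $D\phi$, i.e. the $\mathbb{R}^{m\times n}$-valued function with entries $f^i\partial_j\phi$. The $L^s$ norms of matrix-valued functions are taken with respect to the operator norm. *)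

theory Defs
  imports "HOL-Analysis.Analysis"
begin

text \<open>
  The domain is R^n, rendered as \<open>real ^ 'n\<close>.  Since m has to be quantified after the constants
  of the theorem, the target R^m is rendered with m a natural number: a vector of R^m is a function
  \<open>v :: nat \<Rightarrow> real\<close> of which only the coordinates \<open>v i\<close> with \<open>i < m\<close> are relevant, and an m by n
  matrix is a function \<open>A :: nat \<Rightarrow> real ^ 'n\<close> giving its rows \<open>A i\<close>, \<open>i < m\<close>.  An n-tuple of vectors
  of R^m is indexed by \<open>'n\<close>, whose order (\<open>wellorder\<close>, as in the library's numeral types) serves
  only to single out the increasing multi-indices.
\<close>


section \<open>Covectors\<close>

definition inner_upto :: "nat \<Rightarrow> (nat \<Rightarrow> real) \<Rightarrow> (nat \<Rightarrow> real) \<Rightarrow> real" where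
  "inner_upto m v w = (\<Sum>i<m. v i * w i)"

definition orthonormal_frame :: "nat \<Rightarrow> ('n \<Rightarrow> nat \<Rightarrow> real) \<Rightarrow> bool" where
  "orthonormal_frame m v \<longleftrightarrow>
     (\<forall>j k. inner_upto m (v j) (v k) = (if j = k then 1 else 0))"

text \<open>
  Alternating multilinear forms, with \<open>\<omega> v\<close> standing for the value on the wedge product of the
  \<open>v j\<close> taken in the order of \<open>'n\<close>.  The first clause makes \<open>\<omega>\<close> a form on R^m.
\<close>
definition covector :: "nat \<Rightarrow> (('n::finite \<Rightarrow> nat \<Rightarrow> real) \<Rightarrow> real) \<Rightarrow> bool" where
  "covector m \<omega> \<longleftrightarrow>
     (\<forall>v w. (\<forall>j. \<forall>i<m. v j i = w j i) \<longrightarrow> \<omega> v = \<omega> w) \<and>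
     (\<forall>v j a b x y. \<omega> (v(j := (\<lambda>i. a * x i + b * y i))) = a * \<omega> (v(j := x)) + b * \<omega> (v(j := y))) \<and>
     (\<forall>v j k. j \<noteq> k \<and> v j = v k \<longrightarrow> \<omega> v = 0)"

definition comass :: "nat \<Rightarrow> (('n::finite \<Rightarrow> nat \<Rightarrow> real) \<Rightarrow> real) \<Rightarrow> real" where
  "comass m \<omega> = (SUP v \<in> {v. orthonormal_frame m v}. \<omega> v)"

definition calibration :: "nat \<Rightarrow> (('n::finite \<Rightarrow> nat \<Rightarrow> real) \<Rightarrow> real) \<Rightarrow> bool" where
  "calibration m \<omega> \<longleftrightarrow> covector m \<omega> \<and> comass m \<omega> = 1"

definition std_basis :: "nat \<Rightarrow> nat \<Rightarrow> real" where
  "std_basis k i = (if i = k then 1 else 0)"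

definition multi_indices :: "nat \<Rightarrow> ('n::{finite,wellorder} \<Rightarrow> nat) set" where
  "multi_indices m = {I. strict_mono I \<and> range I \<subseteq> {..<m}}"

text \<open>The coefficient of \<open>\<omega>\<close> at the multi-index \<open>I\<close> is its value on the basis vectors \<open>e (I j)\<close>.\<close>
definition l1_norm :: "nat \<Rightarrow> (('n::{finite,wellorder} \<Rightarrow> nat \<Rightarrow> real) \<Rightarrow> real) \<Rightarrow> real" where
  "l1_norm m \<omega> = (\<Sum>I\<in>multi_indices m. \<bar>\<omega> (\<lambda>j. std_basis (I j))\<bar>)"


section \<open>Matrices\<close>

text \<open>Modelled on \<open>onorm\<close>, which needs a normed target space.\<close>
definition op_norm :: "nat \<Rightarrow> (nat \<Rightarrow> real ^ 'n) \<Rightarrow> real" where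
  "op_norm m A = (SUP v. L2_set (\<lambda>i. A i \<bullet> v) {..<m} / norm v)"

text \<open>The value of \<open>\<omega>\<close> on the wedge product of the columns \<open>A e_j\<close>; for \<open>A = Df x\<close> this is the
  coefficient of the volume form in the pullback of \<open>\<omega>\<close> by \<open>f\<close> at \<open>x\<close>.\<close>
definition star_pullback ::
    "(('n::finite \<Rightarrow> nat \<Rightarrow> real) \<Rightarrow> real) \<Rightarrow> (nat \<Rightarrow> real ^ 'n) \<Rightarrow> real" where
  "star_pullback \<omega> A = \<omega> (\<lambda>j i. A i $ j)"

text \<open>The L^s norm of a matrix field with respect to the operator norm, with value \<open>\<infinity>\<close> if the
  integral diverges.\<close>
definition matrix_Lnorm ::
    "real \<Rightarrow> nat \<Rightarrow> (real ^ 'n::finite) set \<Rightarrow> (real ^ 'n \<Rightarrow> nat \<Rightarrow> real ^ 'n) \<Rightarrow> ennreal" where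
  "matrix_Lnorm s m \<Omega> A =
     (let J = (\<integral>\<^sup>+x\<in>\<Omega>. ennreal (op_norm m (A x) powr s) \<partial>lebesgue)
      in if J = \<infinity> then \<infinity> else ennreal (enn2real J powr (1 / s)))"


section \<open>Test functions\<close>

definition partial_deriv :: "'n \<Rightarrow> (real ^ 'n::finite \<Rightarrow> real) \<Rightarrow> real ^ 'n \<Rightarrow> real" where
  "partial_deriv j \<phi> x = frechet_derivative \<phi> (at x) (axis j 1)"

definition gradient :: "(real ^ 'n::finite \<Rightarrow> real) \<Rightarrow> real ^ 'n \<Rightarrow> real ^ 'n" where
  "gradient \<phi> x = (\<chi> j. partial_deriv j \<phi> x)"

primrec C_k :: "nat \<Rightarrow> (real ^ 'n::finite \<Rightarrow> real) \<Rightarrow> bool" where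
  "C_k 0 \<phi> \<longleftrightarrow> continuous_on UNIV \<phi>"
| "C_k (Suc k) \<phi> \<longleftrightarrow> (\<forall>x. \<phi> differentiable (at x)) \<and> (\<forall>j. C_k k (partial_deriv j \<phi>))"

text \<open>Test functions on \<open>\<Omega>\<close> are identified with their extensions by zero.\<close>
definition test_functions :: "(real ^ 'n::finite) set \<Rightarrow> (real ^ 'n \<Rightarrow> real) set" where
  "test_functions \<Omega> =
     {\<phi>. (\<forall>k. C_k k \<phi>) \<and> compact (closure {x. \<phi> x \<noteq> 0}) \<and> closure {x. \<phi> x \<noteq> 0} \<subseteq> \<Omega>}"


section \<open>Sobolev functions\<close>

definition Lloc :: "real \<Rightarrow> (real ^ 'n::finite) set \<Rightarrow> (real ^ 'n \<Rightarrow> real) set" where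
  "Lloc s \<Omega> = {u. set_borel_measurable lebesgue \<Omega> u \<and>
     (\<forall>S. compact S \<and> S \<subseteq> \<Omega> \<longrightarrow> set_integrable lebesgue S (\<lambda>x. \<bar>u x\<bar> powr s))}"

definition weak_gradient ::
    "(real ^ 'n::finite) set \<Rightarrow> (real ^ 'n \<Rightarrow> real) \<Rightarrow> (real ^ 'n \<Rightarrow> real ^ 'n) \<Rightarrow> bool" where
  "weak_gradient \<Omega> u G \<longleftrightarrow>
     u \<in> Lloc 1 \<Omega> \<and> (\<forall>j. (\<lambda>x. G x $ j) \<in> Lloc 1 \<Omega>) \<and>
     (\<forall>\<eta>\<in>test_functions \<Omega>. \<forall>j.
        (LINT x:\<Omega>|lebesgue. u x * partial_deriv j \<eta> x) = - (LINT x:\<Omega>|lebesgue. G x $ j * \<eta> x))"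

definition W1loc :: "real \<Rightarrow> nat \<Rightarrow> (real ^ 'n::finite) set \<Rightarrow> (real ^ 'n \<Rightarrow> nat \<Rightarrow> real) set" where
  "W1loc s m \<Omega> = {f. \<forall>i<m. (\<lambda>x. f x i) \<in> Lloc s \<Omega> \<and>
     (\<exists>G. weak_gradient \<Omega> (\<lambda>x. f x i) G \<and> (\<forall>j. (\<lambda>x. G x $ j) \<in> Lloc s \<Omega>))}"

text \<open>The weak differential is determined only up to null sets, hence a relation.\<close>
definition weak_differential ::
    "nat \<Rightarrow> (real ^ 'n::finite) set \<Rightarrow> (real ^ 'n \<Rightarrow> nat \<Rightarrow> real)
      \<Rightarrow> (real ^ 'n \<Rightarrow> nat \<Rightarrow> real ^ 'n) \<Rightarrow> bool" where
  "weak_differential m \<Omega> f Df \<longleftrightarrow> (\<forall>i<m. weak_gradient \<Omega> (\<lambda>x. f x i) (\<lambda>x. Df x i))"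


section \<open>The exponents\<close>

text \<open>The argument \<open>l\<close> is the value of the constant \<open>\<lambda>\<close> in dimension n.\<close>

definition q_exp :: "real \<Rightarrow> real \<Rightarrow> nat \<Rightarrow> real \<Rightarrow> real" where
  "q_exp l K n t = K * l * t / (K * l * t + 1) * real n"

definition p_exp :: "real \<Rightarrow> real \<Rightarrow> nat \<Rightarrow> real \<Rightarrow> ereal" where
  "p_exp l K n t =
     (if K * l * t = 1 then \<infinity> else ereal (K * l * t / (K * l * t - 1) * real n))"

end

theory Submission
  imports Defs
begin

text \<open>
  Let \<open>n\<close> be the dimension, \<open>t\<close> the l1-norm of \<open>\<omega>\<close>, \<open>A = \<phi> Df\<close> and \<open>T = f \<otimes> D\<phi>\<close>, so that
  \<open>H = A + T\<close> is the weak differential of the compactly supported map \<open>\<phi> f\<close>.  Multiplied by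
  \<open>\<phi>^n\<close>, the hypothesis reads \<open>\<parallel>A\<parallel>^n \<le> K \<star>A\<close>, where \<open>\<star>A\<close> stands for \<open>star_pullback \<omega> A\<close>.

  For \<open>s = n\<close> the inequality is classical.  The form \<open>\<star>H\<close> is a combination of n by n minors of \<open>H\<close>
  with coefficients of total size \<open>t\<close>, and each minor is a Jacobian determinant of compactly
  supported functions, hence has integral 0.  So \<open>\<integral> \<parallel>A\<parallel>^n \<le> K \<integral> (\<star>A - \<star>H)\<close>; the integrand on the
  right is at most a multiple (depending on \<open>n\<close> and \<open>t\<close>) of \<open>\<parallel>T\<parallel> (\<parallel>A\<parallel> + \<parallel>T\<parallel>)^(n - 1)\<close>, and Young's inequality absorbs \<open>\<parallel>A\<parallel>\<close>.

  For other \<open>s\<close> the integrals are taken with a weight \<open>g powr (s - n)\<close>, where \<open>g\<close> is a maximal function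
  of \<open>F = \<parallel>A\<parallel> + \<parallel>T\<parallel>\<close>: it dominates \<open>F\<close>, and its L^s norm is comparable to that of \<open>F\<close>.  The minors
  of \<open>H\<close> no longer have integral 0, but
    \<open>\<bar>\<integral> g powr (s - n) det\<bar> \<le> C(n) \<bar>s - n\<bar> \<integral> g powr s\<close>,
  with a factor that is linear in \<open>\<bar>s - n\<bar>\<close>.  Summed over the minors and multiplied by \<open>K\<close>, this
  error is at most \<open>K t C(n) \<bar>s - n\<bar>\<close> times the integral of \<open>\<parallel>A\<parallel> powr s + \<parallel>T\<parallel> powr s\<close>, with
  another constant \<open>C(n)\<close>.  The part with \<open>\<parallel>A\<parallel>\<close> can be absorbed as soon as
  \<open>\<bar>s - n\<bar>\<close> is a small multiple of \<open>1 / (K t)\<close>.  The interval of the theorem has half-length about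
  \<open>n / (K \<lambda>(n) t)\<close>, so a large \<open>\<lambda>(n)\<close> suffices.  Replacing \<open>\<parallel>A\<parallel> powr (s - n)\<close> by the weight itself
  costs a second error of the same order (\<open>powr_difference_le\<close>).

  The weighted estimate rests on Lipschitz truncation.  Where \<open>g < L\<close>, the components \<open>u\<close> of a
  compactly supported map whose differential is bounded by \<open>F\<close> are Lipschitz with a constant
  proportional to \<open>L\<close> (\<open>pointwise_lipschitz\<close>).  If one of them is replaced by a Lipschitz extension
  from this set, the Jacobian does not change there and still integrates to 0, so that
    \<open>\<bar>\<integral> over {g < L} of det Du\<bar> \<le> C L \<integral> over {g \<ge> L} of g^(n - 1)\<close>
  (\<open>good_lambda\<close>).  Integrating this against \<open>\<bar>s - n\<bar> L powr (s - n - 1)\<close> over \<open>L > 0\<close> produces the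
  weight on the left and \<open>\<bar>s - n\<bar> \<integral> g powr s\<close> on the right (\<open>good_lambda_weighted\<close>).  All of this
  is carried out for mollified functions and a maximal function over radii at least the mollification
  scale \<open>\<rho>\<close>, uniformly in \<open>\<rho>\<close>; the limit \<open>\<rho> \<longrightarrow> 0\<close> is \<open>maximal_weight\<close>.  The absorption is
  \<open>caccioppoli_borel\<close>, and \<open>caccioppoli_integral\<close> passes from Borel functions on the whole space to
  Lebesgue measurable functions on \<open>\<Omega>\<close>.
\<close>

section \<open>Functions of class C^k\<close>

lemma partial_deriv_eqI:
  assumes "(f has_derivative f') (at x)"
  shows "partial_deriv j f x = f' (axis j 1)"
  unfolding partial_deriv_def using frechet_derivative_at[OF assms] by simp

lemma has_derivative_gradient:
  assumes "v differentiable (at x)"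
  shows "(v has_derivative (\<lambda>h. gradient v x \<bullet> h)) (at x)"
proof -
  let ?D = "frechet_derivative v (at x)"
  have D: "(v has_derivative ?D) (at x)"
    using assms frechet_derivative_works by blast
  then have lin: "linear ?D" by (rule has_derivative_linear)
  have "?D h = gradient v x \<bullet> h" for h
  proof -
    have "?D h = ?D (\<Sum>j\<in>UNIV. (h $ j) *\<^sub>R axis j 1)"
      by (metis (no_types) basis_expansion scalar_mult_eq_scaleR)
    also have "\<dots> = (\<Sum>j\<in>UNIV. h $ j * ?D (axis j 1))"
      by (simp add: linear_sum[OF lin] linear_scale[OF lin])
    also have "\<dots> = gradient v x \<bullet> h"
      by (simp add: inner_vec_def gradient_def partial_deriv_def mult.commute)
    finally show ?thesis .
  qed
  then have "?D = (\<lambda>h. gradient v x \<bullet> h)" by blast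
  with D show ?thesis by simp
qed

lemma C_k_Suc_imp: "C_k (Suc k) v \<Longrightarrow> C_k k v"
proof (induction k arbitrary: v)
  case 0
  then show ?case
    by (auto simp: continuous_on_eq_continuous_at intro!: differentiable_imp_continuous_within)
next
  case (Suc k)
  then show ?case by (metis C_k.simps(2))
qed

lemma C_k_le: "C_k k v \<Longrightarrow> l \<le> k \<Longrightarrow> C_k l v"
  by (induction k) (auto simp: le_Suc_eq simp del: C_k.simps dest: C_k_Suc_imp)

lemma C_k_differentiable: "C_k (Suc k) v \<Longrightarrow> v differentiable (at x)"
  by simp

lemma C_k_partial: "C_k (Suc k) v \<Longrightarrow> C_k k (partial_deriv j v)"
  by simp

lemma C_k_continuous: "C_k k v \<Longrightarrow> continuous_on UNIV v"
  using C_k_le[of k v 0] by simp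

lemma C_k_const: "C_k k (\<lambda>x :: real ^ 'n::finite. c)"
proof (induction k arbitrary: c)
  case (Suc k)
  have "partial_deriv j (\<lambda>x :: real ^ 'n. c) = (\<lambda>x. 0)" for j
    by (rule ext, subst partial_deriv_eqI[OF has_derivative_const]) simp
  then show ?case using Suc by simp
qed simp

lemma partial_deriv_add:
  assumes "u differentiable (at x)" "v differentiable (at x)"
  shows "partial_deriv j (\<lambda>x. u x + v x) x = partial_deriv j u x + partial_deriv j v x"
  by (subst partial_deriv_eqI[OF has_derivative_add[OF has_derivative_gradient[OF assms(1)]
      has_derivative_gradient[OF assms(2)]]])
    (simp add: gradient_def inner_axis)

lemma partial_deriv_mult:
  assumes "u differentiable (at x)" "v differentiable (at x)"
  shows "partial_deriv j (\<lambda>x. u x * v x) x = u x * partial_deriv j v x + partial_deriv j u x * v x"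
  by (subst partial_deriv_eqI[OF has_derivative_mult[OF has_derivative_gradient[OF assms(1)]
      has_derivative_gradient[OF assms(2)]]])
    (simp add: gradient_def inner_axis)

lemma C_k_add: "C_k k u \<Longrightarrow> C_k k v \<Longrightarrow> C_k k (\<lambda>x. u x + v x)"
proof (induction k arbitrary: u v)
  case (Suc k)
  have "partial_deriv j (\<lambda>x. u x + v x) = (\<lambda>x. partial_deriv j u x + partial_deriv j v x)" for j
    using Suc.prems by (intro ext partial_deriv_add) auto
  then show ?case using Suc by auto
qed (auto intro: continuous_intros)

lemma C_k_mult: "C_k k u \<Longrightarrow> C_k k v \<Longrightarrow> C_k k (\<lambda>x. u x * v x)"
proof (induction k arbitrary: u v)
  case (Suc k)
  have "partial_deriv j (\<lambda>x. u x * v x) =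
      (\<lambda>x. u x * partial_deriv j v x + partial_deriv j u x * v x)" for j
    using Suc.prems by (intro ext partial_deriv_mult) auto
  moreover have "C_k k u" "C_k k v" using Suc.prems C_k_Suc_imp by blast+
  ultimately show ?case using Suc by (auto intro!: C_k_add)
qed (auto intro: continuous_intros)

lemma partial_deriv_nth: "partial_deriv j (\<lambda>x. x $ i) = (\<lambda>x. if i = j then 1 else 0)"
proof
  fix x :: "real^'a"
  have "((\<lambda>x. x $ i) has_derivative (\<lambda>h. h $ i)) (at x)"
    by (intro bounded_linear.has_derivative[OF bounded_linear_vec_nth] has_derivative_ident)
  from partial_deriv_eqI[OF this] show "partial_deriv j (\<lambda>x. x $ i) x = (if i = j then 1 else 0)"
    by (auto simp: axis_def)
qed

lemma C_k_nth: "C_k k (\<lambda>x. x $ i)"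
proof (cases k)
  case 0
  then show ?thesis by (simp add: continuous_on_component continuous_on_id)
next
  case (Suc l)
  have "(\<lambda>x. x $ i) differentiable (at x)" for x :: "real^'a"
    by (intro bounded_linear_imp_differentiable bounded_linear_vec_nth)
  then show ?thesis using Suc by (simp add: partial_deriv_nth C_k_const)
qed

text \<open>
  The exponents \<open>a\<close> make the family closed under differentiation, up to linear
  combinations, so that smoothness of all members follows by one induction.
\<close>
definition flat_exp :: "nat \<Rightarrow> real \<Rightarrow> real" where
  "flat_exp a t = (if t > 0 then exp (- 1 / t) / t ^ a else 0)"

lemma power_le_fact_exp:
  fixes x :: real
  assumes "x \<ge> 0"
  shows "x ^ k \<le> fact k * exp x"
proof -
  have "(\<Sum>n\<in>{k}. x ^ n /\<^sub>R fact n) \<le> (\<Sum>n. x ^ n /\<^sub>R fact n)"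
    using assms by (intro sum_le_suminf summable_exp_generic) auto
  then show ?thesis by (simp add: exp_def field_simps)
qed

text \<open>
  Quadratic decay at \<open>t = 0\<close> gives the derivative 0 there; it comes from a single
  term of the exponential series at \<open>1 / t\<close>.
\<close>
lemma flat_exp_le: "\<bar>flat_exp a t\<bar> \<le> fact (a + 2) * t\<^sup>2"
proof (cases "t > 0")
  case True
  have "(1 / t) ^ (a + 2) \<le> fact (a + 2) * exp (1 / t)"
    using True by (intro power_le_fact_exp) simp
  then have "(1 / t) ^ (a + 2) * exp (- (1 / t)) * t\<^sup>2 \<le> fact (a + 2) * exp (1 / t) * exp (- (1 / t)) * t\<^sup>2"
    by (intro mult_right_mono) auto
  also have "\<dots> = fact (a + 2) * t\<^sup>2" by (simp add: exp_minus)
  finally show ?thesis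
    using True by (simp add: flat_exp_def power_add power_divide field_simps power2_eq_square)
qed (simp add: flat_exp_def)

lemma flat_exp_deriv:
  "(flat_exp a has_real_derivative (flat_exp (a + 2) t - a * flat_exp (a + 1) t)) (at t)"
proof -
  consider "t > 0" | "t < 0" | "t = 0" by linarith
  then show ?thesis
  proof cases
    case 1
    have "((\<lambda>t. exp (- 1 / t) / t ^ a) has_real_derivative (flat_exp (a + 2) t - a * flat_exp (a + 1) t)) (at t)"
    proof (cases a)
      case 0
      then show ?thesis
        using 1 by (auto intro!: derivative_eq_intros simp: flat_exp_def field_simps power2_eq_square)
    next
      case (Suc b)
      have p: "((\<lambda>t. t ^ a) has_real_derivative (real a * t ^ b)) (at t)"
        using DERIV_pow[of a t] Suc by simp
      have e: "((\<lambda>t. exp (- 1 / t)) has_real_derivative (exp (- 1 / t) / t\<^sup>2)) (at t)"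
        using 1 by (auto intro!: derivative_eq_intros simp: field_simps power2_eq_square)
      have "(exp (- 1 / t) / t\<^sup>2 * t ^ a - exp (- 1 / t) * (real a * t ^ b)) / (t ^ a * t ^ a) =
          flat_exp (a + 2) t - a * flat_exp (a + 1) t"
        using 1 Suc by (simp add: flat_exp_def field_simps power2_eq_square)
      with DERIV_divide[OF e p] 1 show ?thesis by simp
    qed
    then show ?thesis
      by (rule has_field_derivative_transform_within_open[where S="{0<..}"])
        (use 1 in \<open>auto simp: flat_exp_def\<close>)
  next
    case 2
    have "((\<lambda>t. 0) has_real_derivative 0) (at t)" by simp
    then have "(flat_exp a has_real_derivative 0) (at t)"
      by (rule has_field_derivative_transform_within_open[where S="{..<0}"])
        (use 2 in \<open>auto simp: flat_exp_def\<close>)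
    then show ?thesis using 2 by (simp add: flat_exp_def)
  next
    case 3
    have "((\<lambda>h. flat_exp a h / h) \<longlongrightarrow> 0) (at 0)"
    proof (rule Lim_null_comparison)
      show "\<forall>\<^sub>F h in at 0. norm (flat_exp a h / h) \<le> fact (a + 2) * \<bar>h\<bar>"
      proof (rule eventually_at_filter[THEN iffD2], rule always_eventually, intro allI impI)
        fix h :: real assume "h \<noteq> 0"
        then show "norm (flat_exp a h / h) \<le> fact (a + 2) * \<bar>h\<bar>"
          using flat_exp_le[of a h]
          by (simp add: divide_simps power2_eq_square abs_mult_self_eq mult.assoc del: fact_Suc)
      qed
      show "((\<lambda>h::real. fact (a + 2) * \<bar>h\<bar>) \<longlongrightarrow> 0) (at 0)"
        by (intro tendsto_eq_intros) auto
    qed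
    then have "(flat_exp a has_real_derivative 0) (at 0)"
      by (simp add: has_field_derivative_iff flat_exp_def)
    then show ?thesis using 3 by (simp add: flat_exp_def)
  qed
qed

text \<open>
  For \<open>c = 1 / r^2\<close> this is a smooth function supported in the ball of radius
  \<open>r\<close>.
\<close>
definition bump :: "nat \<Rightarrow> real \<Rightarrow> real ^ 'n::finite \<Rightarrow> real" where
  "bump a c x = flat_exp a (1 - c * (x \<bullet> x))"

lemma bump_has_derivative:
  "(bump a c has_derivative
     (\<lambda>h. (bump (a + 2) c x - a * bump (a + 1) c x) * (- 2 * c * (x \<bullet> h)))) (at x)"
proof -
  have "((\<lambda>x. 1 - c * (x \<bullet> x)) has_derivative (\<lambda>h. - 2 * c * (x \<bullet> h))) (at x)"
    by (auto intro!: derivative_eq_intros simp: inner_commute)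
  from has_derivative_compose[OF this flat_exp_deriv[unfolded has_field_derivative_def]]
  show ?thesis by (simp add: bump_def[abs_def])
qed

lemma partial_deriv_bump:
  "partial_deriv j (bump a c) = (\<lambda>x. (bump (a + 2) c x + - real a * bump (a + 1) c x) * (- 2 * c * x $ j))"
  by (rule ext, subst partial_deriv_eqI[OF bump_has_derivative]) (simp add: inner_axis algebra_simps)

lemma C_k_bump: "C_k k (bump a c :: real ^ 'n::finite \<Rightarrow> real)"
proof (induction k arbitrary: a)
  case 0
  then show ?case
    using has_derivative_continuous[OF bump_has_derivative] by (auto simp: continuous_on_eq_continuous_at)
next
  case (Suc k)
  have "C_k k (\<lambda>x :: real ^ 'n. (bump (a + 2) c x + - real a * bump (a + 1) c x) * (- 2 * c * x $ j))" for j
    by (intro C_k_mult C_k_add C_k_const C_k_nth Suc)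
  then show ?case
    using bump_has_derivative unfolding C_k.simps partial_deriv_bump differentiable_def by blast
qed

text \<open>
  The cancellation in \<open>integral_jac_eq_0\<close> needs symmetric second derivatives.
  Symmetry is read off the explicit kernel and inherited by every function mollified with it.
\<close>
lemma partial_deriv_bump_commute:
  fixes x :: "real ^ 'n::finite"
  shows "partial_deriv i (partial_deriv j (bump 0 c)) x = partial_deriv j (partial_deriv i (bump 0 c)) x"
proof -
  have *: "partial_deriv i (partial_deriv j (bump 0 c)) x =
      bump 2 c x * (- 2 * c * (if j = i then 1 else 0)) +
      (bump 4 c x - 2 * bump 3 c x) * (- 2 * c * x $ i) * (- 2 * c * x $ j)" for i j
  proof -
    have p1: "partial_deriv j (bump 0 c) = (\<lambda>x :: real ^ 'n. bump 2 c x * (- 2 * c * x $ j))"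
      by (simp add: partial_deriv_bump numeral_2_eq_2)
    have p2: "bump 2 c differentiable (at x)"
      by (rule C_k_differentiable[of 0]) (rule C_k_bump)
    have p3: "(\<lambda>x :: real ^ 'n. - 2 * c * x $ j) differentiable (at x)"
      by (rule C_k_differentiable[of 0]) (intro C_k_mult C_k_const C_k_nth)
    have p4: "partial_deriv i (\<lambda>x :: real ^ 'n. - 2 * c * x $ j) x = - 2 * c * (if j = i then 1 else 0)"
    proof -
      have "((\<lambda>x :: real ^ 'n. - 2 * c * x $ j) has_derivative (\<lambda>h. - 2 * c * h $ j)) (at x)"
        by (intro has_derivative_mult_right bounded_linear.has_derivative[OF bounded_linear_vec_nth] has_derivative_ident)
      from partial_deriv_eqI[OF this] show ?thesis by (auto simp: axis_def)
    qed
    show ?thesis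
      unfolding p1 partial_deriv_mult[OF p2 p3] p4 by (simp add: partial_deriv_bump algebra_simps numeral_eq_Suc)
  qed
  show ?thesis unfolding * by (auto simp: algebra_simps)
qed

lemma test_functions_mult:
  assumes "\<phi> \<in> test_functions \<Omega>" "\<And>k. C_k k \<psi>"
  shows "(\<lambda>x. \<phi> x * \<psi> x) \<in> test_functions \<Omega>"
proof -
  have sub: "closure {x. \<phi> x * \<psi> x \<noteq> 0} \<subseteq> closure {x. \<phi> x \<noteq> 0}"
    by (intro closure_mono) auto
  have "compact (closure {x. \<phi> x * \<psi> x \<noteq> 0})"
    using sub assms(1) closed_Int_compact[of "closure {x. \<phi> x * \<psi> x \<noteq> 0}" "closure {x. \<phi> x \<noteq> 0}"]
    by (simp add: test_functions_def Int_absorb2)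
  then show ?thesis using assms sub unfolding test_functions_def by (blast intro: C_k_mult)
qed

lemma C_k_cmult: "C_k k v \<Longrightarrow> C_k k (\<lambda>x. c * v x)"
  by (intro C_k_mult C_k_const)

lemma partial_deriv_cmult:
  assumes "v differentiable (at x)"
  shows "partial_deriv j (\<lambda>x. c * v x) x = c * partial_deriv j v x"
  by (subst partial_deriv_eqI[OF has_derivative_mult_right[OF has_derivative_gradient[OF assms]]])
    (simp add: gradient_def inner_axis)

section \<open>Convolution\<close>

lemma norm_lebesgue_integral_le:
  fixes f :: "'a \<Rightarrow> real"
  assumes "integrable M f" "integrable M g" "\<And>x. norm (f x) \<le> g x"
  shows "norm (\<integral>x. f x \<partial>M) \<le> (\<integral>x. g x \<partial>M)"
proof -
  have "norm (\<integral>x. f x \<partial>M) \<le> (\<integral>x. norm (f x) \<partial>M)"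
    by (rule integral_norm_bound)
  also have "\<dots> \<le> (\<integral>x. g x \<partial>M)"
    using assms by (intro integral_mono) auto
  finally show ?thesis .
qed

text \<open>
  Dividing by \<open>I + 1\<close> rather than \<open>I\<close> covers the case \<open>I =
  0\<close> when a tolerance is chosen in terms of an integral.
\<close>
lemma absorb_quotient:
  fixes e t I :: real
  assumes "e > 0" "t \<ge> 0" "I \<ge> 0"
  shows "e / (I + 1) * t * I \<le> e * t"
proof -
  have "e * t * (I / (I + 1)) \<le> e * t * 1"
    using assms by (intro mult_left_mono) (auto simp: divide_le_eq)
  then show ?thesis by (simp add: mult_ac)
qed

definition loc_integrable :: "(real ^ 'n::finite \<Rightarrow> real) \<Rightarrow> bool" where
  "loc_integrable u \<longleftrightarrow> u \<in> borel_measurable borel \<and>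
     (\<forall>r. integrable lborel (\<lambda>y. indicator (cball 0 r) y * u y))"

definition conv :: "(real ^ 'n::finite \<Rightarrow> real) \<Rightarrow> (real ^ 'n \<Rightarrow> real) \<Rightarrow> real ^ 'n \<Rightarrow> real" where
  "conv u k x = (\<integral>y. u y * k (x - y) \<partial>lborel)"

lemma integrable_imp_loc_integrable:
  assumes "integrable lborel u"
  shows "loc_integrable u"
proof -
  have "integrable lborel (\<lambda>y. indicator (cball 0 r) y *\<^sub>R u y)" for r
    using assms by (intro integrable_mult_indicator) auto
  with borel_measurable_integrable[OF assms] show ?thesis by (simp add: loc_integrable_def)
qed

lemma continuous_imp_loc_integrable:
  assumes "continuous_on UNIV u"
  shows "loc_integrable u"
proof -
  have "set_integrable lborel (cball 0 r) u" for r
    unfolding set_integrable_def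
    by (intro borel_integrable_compact continuous_on_subset[OF assms]) auto
  then show ?thesis
    using borel_measurable_continuous_onI[OF assms] by (simp add: loc_integrable_def set_integrable_def)
qed

lemma continuous_bounded_of_compact_support:
  fixes k :: "'a::euclidean_space \<Rightarrow> real"
  assumes "continuous_on UNIV k" "\<And>z. norm z > R \<Longrightarrow> k z = 0"
  obtains B where "B > 0" "\<And>z. \<bar>k z\<bar> \<le> B"
proof -
  have "compact (k ` cball 0 R)"
    by (intro compact_continuous_image continuous_on_subset[OF assms(1)]) auto
  then obtain B where B: "B > 0" "\<forall>y\<in>k ` cball 0 R. norm y \<le> B"
    using compact_imp_bounded bounded_pos by blast
  have "\<bar>k z\<bar> \<le> B" for z
    using B assms(2)[of z] by (cases "norm z > R") auto
  with B(1) show ?thesis by (intro that)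
qed

lemma conv_integrable:
  assumes u: "loc_integrable u" and k: "continuous_on UNIV k" "\<And>z. norm z > R \<Longrightarrow> k z = 0"
  shows "integrable lborel (\<lambda>y. u y * k (x - y))"
proof -
  obtain B where B: "B > 0" "\<And>z. \<bar>k z\<bar> \<le> B"
    using continuous_bounded_of_compact_support[OF k] by blast
  have [measurable]: "u \<in> borel_measurable borel" "k \<in> borel_measurable borel"
    using u k(1) by (auto simp: loc_integrable_def intro: borel_measurable_continuous_onI)
  show ?thesis
  proof (rule Bochner_Integration.integrable_bound)
    show "integrable lborel (\<lambda>y. B * (indicator (cball 0 (norm x + R)) y * u y))"
      using u by (auto simp: loc_integrable_def)
    show "AE y in lborel. norm (u y * k (x - y)) \<le> norm (B * (indicator (cball 0 (norm x + R)) y * u y))"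
    proof (rule always_eventually, rule allI)
      fix y
      show "norm (u y * k (x - y)) \<le> norm (B * (indicator (cball 0 (norm x + R)) y * u y))"
      proof (cases "norm (x - y) > R")
        case False
        then have "norm y \<le> norm x + R"
          using norm_triangle_ineq2[of y x] by (simp add: norm_minus_commute)
        moreover have "\<bar>u y\<bar> * \<bar>k (x - y)\<bar> \<le> \<bar>u y\<bar> * B"
          using B by (intro mult_left_mono) auto
        ultimately show ?thesis using B by (simp add: abs_mult mult.commute)
      qed (simp add: k)
    qed
  qed simp
qed

lemma partial_deriv_outside:
  fixes k :: "real ^ 'n::finite \<Rightarrow> real"
  assumes "\<And>z. norm z > R \<Longrightarrow> k z = 0" "norm z > R"
  shows "partial_deriv j k z = 0"
proof -
  have "((\<lambda>x. 0) has_derivative (\<lambda>h. 0 :: real)) (at z)" by simp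
  then have "(k has_derivative (\<lambda>h. 0)) (at z)"
    by (rule has_derivative_transform_within_open[where s="{z. norm z > R}"])
      (use assms in \<open>auto intro!: open_Collect_less continuous_intros\<close>)
  then show ?thesis by (simp add: partial_deriv_eqI)
qed

lemma gradient_uniformly_continuous:
  fixes k :: "real ^ 'n::finite \<Rightarrow> real"
  assumes "C_k 1 k" "\<And>z. norm z > R \<Longrightarrow> k z = 0" "e > 0"
  shows "\<exists>d>0. \<forall>z w. dist z w < d \<longrightarrow> norm (gradient k z - gradient k w) \<le> e"
proof -
  have zero: "gradient k z = 0" if "norm z > R" for z
    using partial_deriv_outside[OF assms(2) that] by (simp add: gradient_def vec_eq_iff)
  have cont: "continuous_on UNIV (gradient k)"
    using assms(1) by (auto simp: gradient_def[abs_def] intro!: continuous_on_vec_lambda)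
  have "uniformly_continuous_on (cball 0 (R + 1)) (gradient k)"
    by (intro compact_uniformly_continuous continuous_on_subset[OF cont]) auto
  then obtain d where d: "d > 0" "\<And>z w. z \<in> cball 0 (R + 1) \<Longrightarrow> w \<in> cball 0 (R + 1) \<Longrightarrow> dist w z < d \<Longrightarrow>
      dist (gradient k w) (gradient k z) < e"
    using \<open>e > 0\<close> unfolding uniformly_continuous_on_def by blast
  have "norm (gradient k z - gradient k w) \<le> e" if "dist z w < min d 1" for z w
  proof (cases "norm z \<le> R + 1 \<and> norm w \<le> R + 1")
    case True
    then show ?thesis using d(2)[of w z] that by (auto simp: dist_norm intro: less_imp_le)
  next
    case False
    have "\<bar>norm z - norm w\<bar> < 1" using that norm_triangle_ineq3[of z w] by (simp add: dist_norm)
    with False have "norm z > R" "norm w > R" by auto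
    then show ?thesis using zero \<open>e > 0\<close> by simp
  qed
  with d(1) show ?thesis by (intro exI[of _ "min d 1"]) auto
qed

text \<open>
  Uniformity in \<open>z\<close> is what allows differentiation under the integral sign, both in
  convolutions and in \<open>integral_partial_deriv_eq_0\<close>.
\<close>
lemma first_order_remainder_uniform:
  fixes k :: "real ^ 'n::finite \<Rightarrow> real"
  assumes "C_k 1 k" "\<And>z. norm z > R \<Longrightarrow> k z = 0" "e > 0"
  shows "\<exists>d>0. \<forall>z h. norm h < d \<longrightarrow> \<bar>k (z + h) - k z - gradient k z \<bullet> h\<bar> \<le> e * norm h"
proof -
  obtain d where d: "d > 0" "\<And>z w. dist z w < d \<Longrightarrow> norm (gradient k z - gradient k w) \<le> e"
    using gradient_uniformly_continuous[OF assms] by blast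
  have "\<bar>k (z + h) - k z - gradient k z \<bullet> h\<bar> \<le> e * norm h" if "norm h < d" for z h
  proof -
    have der: "((\<lambda>w. k w - gradient k z \<bullet> w) has_derivative (\<lambda>h. gradient k w \<bullet> h - gradient k z \<bullet> h)) (at w)" for w
      using assms(1) by (intro derivative_intros has_derivative_gradient C_k_differentiable[of 0]) simp
    have "norm ((k (z + h) - gradient k z \<bullet> (z + h)) - (k z - gradient k z \<bullet> z)) \<le> e * norm ((z + h) - z)"
    proof (rule differentiable_bound[where S="ball z d" and f'="\<lambda>w h. gradient k w \<bullet> h - gradient k z \<bullet> h"])
      show "((\<lambda>w. k w - gradient k z \<bullet> w) has_derivative (\<lambda>h. gradient k w \<bullet> h - gradient k z \<bullet> h)) (at w within ball z d)" for w
        using der by (rule has_derivative_at_withinI)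
      fix w assume "w \<in> ball z d"
      then have "norm (gradient k w - gradient k z) \<le> e"
        using d(2)[of w z] by (simp add: dist_commute)
      then have "norm (gradient k w - gradient k z) * norm h \<le> e * norm h" for h
        by (intro mult_right_mono) auto
      then have "norm (gradient k w \<bullet> h - gradient k z \<bullet> h) \<le> e * norm h" for h
        using Cauchy_Schwarz_ineq2[of "gradient k w - gradient k z" h] order_trans
        unfolding inner_diff_left real_norm_def by blast
      then show "onorm (\<lambda>h. gradient k w \<bullet> h - gradient k z \<bullet> h) \<le> e"
        by (intro onorm_le)
    qed (use that d in \<open>auto simp: dist_norm\<close>)
    then show ?thesis by (simp add: inner_add_right algebra_simps)
  qed
  with d(1) show ?thesis by blast
qed

text \<open>
  For \<open>\<bar>h\<bar> \<le> 1\<close> all kernels involved live in one ball, on which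
  \<open>u\<close> is integrable; there the remainder of the kernel is uniformly small.
\<close>
lemma conv_has_derivative:
  fixes k :: "real ^ 'n::finite \<Rightarrow> real"
  assumes u: "loc_integrable u" and k: "C_k 1 k" "\<And>z. norm z > R \<Longrightarrow> k z = 0"
  shows "(conv u k has_derivative (\<lambda>h. \<Sum>j\<in>UNIV. conv u (partial_deriv j k) x * h $ j)) (at x)"
proof -
  let ?I = "\<integral>y. \<bar>indicator (cball 0 (norm x + \<bar>R\<bar> + 1)) y * u y\<bar> \<partial>lborel"
  have kc: "continuous_on UNIV k" using k(1) C_k_continuous by blast
  have pc: "continuous_on UNIV (partial_deriv j k)" for j using k(1) by simp
  have p0: "partial_deriv j k z = 0" if "norm z > R" for j z
    using partial_deriv_outside[OF k(2) that] by simp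
  have int_p: "integrable lborel (\<lambda>y. u y * partial_deriv j k (x - y))" for j
    using conv_integrable[OF u pc p0] .
  have lin: "(\<Sum>j\<in>UNIV. conv u (partial_deriv j k) x * h $ j) = (\<integral>y. u y * (gradient k (x - y) \<bullet> h) \<partial>lborel)" for h
  proof -
    have "(\<integral>y. u y * (gradient k (x - y) \<bullet> h) \<partial>lborel) =
        (\<integral>y. (\<Sum>j\<in>UNIV. u y * partial_deriv j k (x - y) * h $ j) \<partial>lborel)"
      by (simp add: inner_vec_def gradient_def sum_distrib_left mult.assoc)
    also have "\<dots> = (\<Sum>j\<in>UNIV. conv u (partial_deriv j k) x * h $ j)"
      using int_p by (subst Bochner_Integration.integral_sum) (auto simp: conv_def)
    finally show ?thesis ..
  qed
  have int_g: "integrable lborel (\<lambda>y. u y * (gradient k (x - y) \<bullet> h))" for h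
    using int_p by (auto simp: inner_vec_def gradient_def sum_distrib_left mult.assoc[symmetric]
      intro!: Bochner_Integration.integrable_sum integrable_mult_left)
  have I0: "?I \<ge> 0" by simp
  have ui: "integrable lborel (\<lambda>y. \<bar>indicator (cball 0 (norm x + \<bar>R\<bar> + 1)) y * u y\<bar>)"
    using u by (auto simp: loc_integrable_def)
  show ?thesis
    unfolding has_derivative_at_alt
  proof (intro conjI allI impI)
    show "bounded_linear (\<lambda>h. \<Sum>j\<in>UNIV. conv u (partial_deriv j k) x * h $ j)"
      by (intro bounded_linear_sum bounded_linear_const_mult bounded_linear_vec_nth)
    fix e :: real assume "e > 0"
    define e' where "e' = e / (?I + 1)"
    have "e' > 0" unfolding e'_def by (rule divide_pos_pos[OF \<open>e > 0\<close> add_nonneg_pos[OF I0]]) simp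
    obtain d where d: "d > 0"
      "\<And>z h. norm h < d \<Longrightarrow> \<bar>k (z + h) - k z - gradient k z \<bullet> h\<bar> \<le> e' * norm h"
      using first_order_remainder_uniform[OF k \<open>e' > 0\<close>] by blast
    show "\<exists>d>0. \<forall>y. norm (y - x) < d \<longrightarrow> norm (conv u k y - conv u k x -
        (\<Sum>j\<in>UNIV. conv u (partial_deriv j k) x * (y - x) $ j)) \<le> e * norm (y - x)"
    proof (intro exI[of _ "min d 1"] conjI allI impI)
      fix y' assume y': "norm (y' - x) < min d 1"
      define h where "h = y' - x"
      have h: "norm h < d" "norm h < 1" "y' = x + h" using y' by (auto simp: h_def)
      have "conv u k y' - conv u k x - (\<Sum>j\<in>UNIV. conv u (partial_deriv j k) x * h $ j) =
          (\<integral>y. u y * k (x + h - y) - u y * k (x - y) - u y * (gradient k (x - y) \<bullet> h) \<partial>lborel)"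
        using conv_integrable[OF u kc k(2), where x="x + h"] conv_integrable[OF u kc k(2), where x=x] int_g
        by (simp add: lin) (simp add: conv_def h(3))
      also have "norm \<dots> \<le> (\<integral>y. (e' * norm h) * \<bar>indicator (cball 0 (norm x + \<bar>R\<bar> + 1)) y * u y\<bar> \<partial>lborel)"
      proof (rule norm_lebesgue_integral_le)
        show "integrable lborel (\<lambda>y. u y * k (x + h - y) - u y * k (x - y) - u y * (gradient k (x - y) \<bullet> h))"
          using conv_integrable[OF u kc k(2)] int_g by auto
        show "integrable lborel (\<lambda>y. (e' * norm h) * \<bar>indicator (cball 0 (norm x + \<bar>R\<bar> + 1)) y * u y\<bar>)"
          using ui by simp
        fix y
        have rem: "\<bar>k (x + h - y) - k (x - y) - gradient k (x - y) \<bullet> h\<bar> \<le> e' * norm h"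
          using d(2)[OF h(1), of "x - y"] by (simp add: algebra_simps)
        show "norm (u y * k (x + h - y) - u y * k (x - y) - u y * (gradient k (x - y) \<bullet> h))
            \<le> (e' * norm h) * \<bar>indicator (cball 0 (norm x + \<bar>R\<bar> + 1)) y * u y\<bar>"
        proof (cases "norm y \<le> norm x + \<bar>R\<bar> + 1")
          case True
          have "norm (u y * k (x + h - y) - u y * k (x - y) - u y * (gradient k (x - y) \<bullet> h)) =
              \<bar>u y\<bar> * \<bar>k (x + h - y) - k (x - y) - gradient k (x - y) \<bullet> h\<bar>"
            by (simp add: abs_mult[symmetric] algebra_simps)
          also have "\<dots> \<le> \<bar>u y\<bar> * (e' * norm h)" using rem by (intro mult_left_mono) auto
          finally show ?thesis using True by (simp add: mult.commute)
        next
          case False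
          have 1: "norm (x - y) > R"
            using False norm_triangle_ineq2[of y x] by (simp add: norm_minus_commute)
          have 2: "norm (x + h - y) > R"
            using False norm_triangle_ineq2[of y "x + h"] norm_triangle_ineq[of x h] h
            by (simp add: norm_minus_commute)
          have "gradient k (x - y) = 0" using p0[OF 1] by (simp add: gradient_def vec_eq_iff)
          then show ?thesis using 1 2 False k(2) by simp
        qed
      qed
      also have "\<dots> = e' * norm h * ?I" by simp
      also have "\<dots> \<le> e * norm h"
        unfolding e'_def by (rule absorb_quotient[OF \<open>e > 0\<close> norm_ge_zero I0])
      finally show "norm (conv u k y' - conv u k x -
        (\<Sum>j\<in>UNIV. conv u (partial_deriv j k) x * (y' - x) $ j)) \<le> e * norm (y' - x)"
        by (simp add: h_def)
    qed (use d in auto)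
  qed
qed

lemma partial_deriv_conv:
  fixes k :: "real ^ 'n::finite \<Rightarrow> real"
  assumes u: "loc_integrable u" and k: "C_k 1 k" "\<And>z. norm z > R \<Longrightarrow> k z = 0"
  shows "partial_deriv j (conv u k) = conv u (partial_deriv j k)"
proof
  fix x
  have "partial_deriv j (conv u k) x = (\<Sum>i\<in>UNIV. conv u (partial_deriv i k) x * axis j 1 $ i)"
    using conv_has_derivative[OF assms] by (rule partial_deriv_eqI)
  also have "\<dots> = (\<chi> i. conv u (partial_deriv i k) x) \<bullet> axis j 1"
    by (simp add: inner_vec_def)
  finally show "partial_deriv j (conv u k) x = conv u (partial_deriv j k) x"
    by (simp add: inner_axis)
qed

text \<open>
  The kernel has one derivative more than the conclusion because continuity of a convolution is
  obtained from its differentiability.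
\<close>
lemma C_k_conv:
  fixes k :: "real ^ 'n::finite \<Rightarrow> real"
  assumes u: "loc_integrable u" and k: "C_k (Suc l) k" "\<And>z. norm z > R \<Longrightarrow> k z = 0"
  shows "C_k l (conv u k)"
  using k
proof (induction l arbitrary: k)
  case 0
  then have "C_k 1 k" by simp
  from has_derivative_continuous[OF conv_has_derivative[OF u this 0(2)]] show ?case
    by (auto simp: continuous_on_eq_continuous_at)
next
  case (Suc l)
  have 1: "C_k 1 k" using Suc.prems(1) C_k_le[of "Suc (Suc l)" k 1] by simp
  have "conv u k differentiable at x" for x
    using conv_has_derivative[OF u 1 Suc.prems(2)] unfolding differentiable_def by blast
  moreover have "C_k l (conv u (partial_deriv j k))" for j
  proof (rule Suc.IH)
    show "C_k (Suc l) (partial_deriv j k)" using Suc.prems(1) by simp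
    show "partial_deriv j k z = 0" if "norm z > R" for z
      using partial_deriv_outside[OF Suc.prems(2) that] by simp
  qed
  ultimately show ?case by (simp add: partial_deriv_conv[OF u 1 Suc.prems(2)])
qed

lemma conv_outside:
  assumes "\<And>y. norm y > S \<Longrightarrow> u y = 0" "\<And>z. norm z > R \<Longrightarrow> k z = 0" "norm x > R + S"
  shows "conv u k x = 0"
proof -
  have "u y * k (x - y) = 0" for y
    using assms norm_triangle_ineq4[of "x - y" "- y"] by (cases "norm y > S") (force simp: not_less)+
  then have "(\<lambda>y. u y * k (x - y)) = (\<lambda>y. 0)" by blast
  then show ?thesis by (simp add: conv_def)
qed

section \<open>Mollifiers and weak gradients\<close>

definition mollifier :: "real \<Rightarrow> real ^ 'n::finite \<Rightarrow> real" where
  "mollifier r x = bump 0 (1 / r\<^sup>2) x / (\<integral>z. bump 0 (1 / r\<^sup>2) (z :: real ^ 'n) \<partial>lborel)"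

lemma bump_nonneg: "bump a c x \<ge> 0"
  by (simp add: bump_def flat_exp_def)

lemma bump_le_1: "bump 0 c x \<le> 1"
  by (simp add: bump_def flat_exp_def)

lemma bump_outside:
  assumes "r > 0" "norm x > r"
  shows "bump a (1 / r\<^sup>2) x = 0"
proof -
  have "r\<^sup>2 < (norm x)\<^sup>2" using assms by (intro power_strict_mono) auto
  then have "1 - 1 / r\<^sup>2 * (x \<bullet> x) \<le> 0"
    using assms by (simp add: dot_square_norm field_simps)
  then show ?thesis unfolding bump_def flat_exp_def by (simp only: not_less[symmetric] if_False)
qed

lemma bump_inside:
  assumes "r > 0" "norm x < r / 2"
  shows "bump 0 (1 / r\<^sup>2) x \<ge> exp (- 2)"
proof -
  have "(norm x)\<^sup>2 \<le> (r / 2)\<^sup>2" using assms by (intro power_mono) auto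
  then have "(norm x)\<^sup>2 / r\<^sup>2 \<le> 1 / 4"
    using assms by (simp add: field_simps power2_eq_square)
  moreover have "1 - 1 / r\<^sup>2 * (x \<bullet> x) = 1 - (norm x)\<^sup>2 / r\<^sup>2"
    by (simp add: dot_square_norm)
  ultimately have *: "1 - 1 / r\<^sup>2 * (x \<bullet> x) \<ge> 1 / 2"
    by linarith
  have "exp (- 2) \<le> flat_exp 0 t" if "t \<ge> 1 / 2" for t
    using that by (simp add: flat_exp_def divide_le_eq)
  with * show ?thesis by (simp only: bump_def)
qed

lemma integrable_compact_support:
  fixes k :: "real ^ 'n::finite \<Rightarrow> real"
  assumes "continuous_on UNIV k" "\<And>z. norm z > R \<Longrightarrow> k z = 0"
  shows "integrable lborel k"
proof -
  have "set_integrable lborel (cball 0 R) k"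
    unfolding set_integrable_def
    by (intro borel_integrable_compact continuous_on_subset[OF assms(1)]) auto
  moreover have "(\<lambda>x. indicator (cball 0 R) x *\<^sub>R k x) = k"
    using assms(2) by (auto simp: indicator_def fun_eq_iff not_le)
  ultimately show ?thesis by (simp add: set_integrable_def)
qed

lemma integrable_bump:
  assumes "r > 0"
  shows "integrable lborel (bump a (1 / r\<^sup>2) :: real ^ 'n::finite \<Rightarrow> real)"
  using assms bump_outside by (intro integrable_compact_support[of _ r] C_k_continuous[OF C_k_bump]) auto

lemma bump_integral_ge:
  assumes "r > 0"
  shows "(\<integral>z. bump 0 (1 / r\<^sup>2) (z :: real ^ 'n::finite) \<partial>lborel) \<ge>
    exp (- 2) * ((r / 2) ^ CARD('n) * measure lborel (ball (0 :: real ^ 'n) 1))"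
proof -
  have "exp (- 2) * ((r / 2) ^ CARD('n) * measure lborel (ball (0 :: real ^ 'n) 1)) =
      (\<integral>z. exp (- 2) * indicator (ball 0 (r / 2)) (z :: real ^ 'n) \<partial>lborel)"
    using assms content_ball_conv_unit_ball[of "r / 2" "0 :: real ^ 'n"] by simp
  also have "\<dots> \<le> (\<integral>z. bump 0 (1 / r\<^sup>2) (z :: real ^ 'n) \<partial>lborel)"
  proof (rule integral_mono)
    show "integrable lborel (\<lambda>z :: real ^ 'n. exp (- 2) * (indicator (ball 0 (r / 2)) z :: real))"
    proof -
      have "integrable lborel (indicator (ball 0 (r / 2)) :: real ^ 'n \<Rightarrow> real)"
        by (intro integrable_real_indicator emeasure_lborel_ball_finite) auto
      then show ?thesis by simp
    qed
    show "exp (- 2) * indicator (ball 0 (r / 2)) z \<le> bump 0 (1 / r\<^sup>2) z" for z :: "real ^ 'n"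
      using bump_inside[OF assms, of z] bump_nonneg[of 0 "1 / r\<^sup>2" z]
      by (cases "z \<in> ball 0 (r / 2)") (auto simp del: minus_mult_minus)
  qed (rule integrable_bump[OF assms])
  finally show ?thesis .
qed

lemma content_unit_ball_pos: "measure lborel (ball (0 :: 'a::euclidean_space) 1) > 0"
  by (rule content_ball_pos) simp

lemma bump_integral_pos:
  assumes "r > 0"
  shows "(\<integral>z. bump 0 (1 / r\<^sup>2) (z :: real ^ 'n::finite) \<partial>lborel) > 0"
  by (rule less_le_trans[OF _ bump_integral_ge[OF assms]])
    (use assms content_unit_ball_pos[where 'a="real^'n"] in simp)

lemma mollifier_nonneg: "mollifier r x \<ge> 0"
  unfolding mollifier_def by (intro divide_nonneg_nonneg integral_nonneg_AE) (auto simp: bump_nonneg)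

lemma mollifier_outside: "r > 0 \<Longrightarrow> norm x > r \<Longrightarrow> mollifier r x = 0"
  by (simp add: mollifier_def bump_outside)

lemma C_k_mollifier: "C_k k (mollifier r :: real ^ 'n::finite \<Rightarrow> real)"
  using C_k_cmult[OF C_k_bump, of k "inverse (\<integral>z. bump 0 (1 / r\<^sup>2) (z :: real ^ 'n) \<partial>lborel)" 0 "1 / r\<^sup>2"]
  by (simp add: mollifier_def[abs_def] divide_inverse mult.commute)

lemma integral_mollifier:
  assumes "r > 0"
  shows "(\<integral>z. mollifier r (z :: real ^ 'n::finite) \<partial>lborel) = 1"
  using bump_integral_pos[OF assms, where 'n='n] by (simp add: mollifier_def)

definition moll_bound :: "'n::finite itself \<Rightarrow> real" where
  "moll_bound _ = exp 2 * 2 ^ CARD('n) / measure lborel (ball (0 :: real ^ 'n) 1)"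

lemma moll_bound_pos: "moll_bound TYPE('n::finite) > 0"
  using content_unit_ball_pos[where 'a="real^'n"] by (simp add: moll_bound_def)

text \<open>
  The mass of the bump is bounded below by its values on the half ball. The resulting scaling
  \<open>r ^ (- n)\<close> is that of an average over a ball, which makes mollifications
  comparable to a maximal function.
\<close>
lemma mollifier_le:
  assumes "r > 0"
  shows "mollifier r (x :: real ^ 'n::finite) \<le> moll_bound TYPE('n) / r ^ CARD('n)"
proof -
  let ?V = "measure lborel (ball (0 :: real ^ 'n) 1)"
  have "mollifier r x \<le> 1 / (exp (- 2) * ((r / 2) ^ CARD('n) * ?V))"
    unfolding mollifier_def
    using bump_le_1 bump_integral_ge[OF assms, where 'n='n] assms content_unit_ball_pos[where 'a="real^'n"]
    by (intro frac_le) auto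
  also have "\<dots> = moll_bound TYPE('n) / r ^ CARD('n)"
    by (simp add: moll_bound_def exp_minus power_divide field_simps)
  finally show ?thesis .
qed

lemma mollifier_commute:
  "partial_deriv i (partial_deriv j (mollifier r)) (x :: real ^ 'n::finite) = partial_deriv j (partial_deriv i (mollifier r)) x"
proof -
  define c where "c = inverse (\<integral>z. bump 0 (1 / r\<^sup>2) (z :: real ^ 'n) \<partial>lborel)"
  have m: "mollifier r = (\<lambda>x :: real ^ 'n. c * bump 0 (1 / r\<^sup>2) x)"
    by (simp add: mollifier_def[abs_def] c_def divide_inverse mult.commute)
  have d1: "bump 0 c' differentiable (at x)" for x :: "real ^ 'n" and c'
    by (rule C_k_differentiable[of 0]) (rule C_k_bump)
  have d2: "partial_deriv j (bump 0 c') differentiable (at x)" for x :: "real ^ 'n" and c' j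
    by (rule C_k_differentiable[of 0]) (rule C_k_partial, rule C_k_bump)
  have "partial_deriv j (mollifier r) = (\<lambda>x :: real ^ 'n. c * partial_deriv j (bump 0 (1 / r\<^sup>2)) x)" for j
    unfolding m by (intro ext partial_deriv_cmult d1)
  then show ?thesis
    by (simp add: partial_deriv_cmult[OF d2] partial_deriv_bump_commute[of i j])
qed

lemma partial_deriv_reflect:
  assumes "k differentiable (at (a - y))"
  shows "partial_deriv j (\<lambda>y. k (a - y)) y = - partial_deriv j k (a - y)"
proof -
  have "((\<lambda>y. a - y) has_derivative (\<lambda>h. - h)) (at y)"
    by (auto intro!: derivative_eq_intros)
  from has_derivative_compose[OF this has_derivative_gradient[OF assms]]
  show ?thesis by (subst partial_deriv_eqI) (assumption, simp add: gradient_def inner_axis)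
qed

lemma C_k_reflect: "C_k l k \<Longrightarrow> C_k l (\<lambda>y. k (a - y))"
proof (induction l arbitrary: k)
  case 0
  then show ?case
    by (auto intro!: continuous_on_compose2[of UNIV k] continuous_intros)
next
  case (Suc l)
  have "(\<lambda>y. k (a - y)) differentiable at x" for x
    by (rule differentiable_compose[of k]) (use Suc.prems in \<open>auto intro!: differentiable_diff differentiable_const\<close>)
  moreover have "partial_deriv j (\<lambda>y. k (a - y)) = (\<lambda>y. (-1) * partial_deriv j k (a - y))" for j
    using Suc.prems by (intro ext) (subst partial_deriv_reflect, auto)
  moreover have "C_k l (\<lambda>y. (-1) * partial_deriv j k (a - y))" for j
    using Suc by (intro C_k_cmult) auto
  ultimately show ?case by simp
qed

text \<open>
  The counterpart of \<^const>\<open>weak_gradient\<close> for Borel functions on the whole space.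
\<close>
definition has_weak_gradient :: "(real ^ 'n::finite \<Rightarrow> real) \<Rightarrow> (real ^ 'n \<Rightarrow> real ^ 'n) \<Rightarrow> bool" where
  "has_weak_gradient u G \<longleftrightarrow> loc_integrable u \<and> (\<forall>j. loc_integrable (\<lambda>x. G x $ j)) \<and>
     (\<forall>\<eta>\<in>test_functions UNIV. \<forall>j.
        (\<integral>x. u x * partial_deriv j \<eta> x \<partial>lborel) = - (\<integral>x. G x $ j * \<eta> x \<partial>lborel))"

lemma test_functions_UNIV_I:
  fixes \<eta> :: "real ^ 'n::finite \<Rightarrow> real"
  assumes "\<And>k. C_k k \<eta>" "\<And>z. norm z > R \<Longrightarrow> \<eta> z = 0"
  shows "\<eta> \<in> test_functions UNIV"
proof -
  have "closure {x. \<eta> x \<noteq> 0} \<subseteq> cball 0 R"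
    using assms(2) by (intro closure_minimal) (auto simp: not_less[symmetric])
  then have "compact (closure {x. \<eta> x \<noteq> 0})"
    by (metis bounded_cball bounded_subset closed_closure compact_eq_bounded_closed)
  with assms(1) show ?thesis by (simp add: test_functions_def)
qed

text \<open>
  Reflected at \<open>x\<close>, the kernel is a test function.
\<close>
lemma conv_weak_gradient:
  fixes k :: "real ^ 'n::finite \<Rightarrow> real"
  assumes "has_weak_gradient u G" "\<And>l. C_k l k" "\<And>z. norm z > R \<Longrightarrow> k z = 0"
  shows "conv u (partial_deriv j k) = conv (\<lambda>x. G x $ j) k"
proof
  fix x
  have "(\<lambda>y. k (x - y)) \<in> test_functions UNIV"
  proof (rule test_functions_UNIV_I[where R="norm x + R"])
    show "k (x - z) = 0" if "norm z > norm x + R" for z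
      using that norm_triangle_ineq2[of z x] by (intro assms(3)) (simp add: norm_minus_commute)
  qed (intro C_k_reflect assms(2))
  then have "(\<integral>y. u y * partial_deriv j (\<lambda>y. k (x - y)) y \<partial>lborel) = - (\<integral>y. G y $ j * k (x - y) \<partial>lborel)"
    using assms(1) unfolding has_weak_gradient_def by blast
  moreover have "partial_deriv j (\<lambda>y. k (x - y)) y = - partial_deriv j k (x - y)" for y
    by (intro partial_deriv_reflect C_k_differentiable[of 0] assms(2))
  ultimately show "conv u (partial_deriv j k) x = conv (\<lambda>x. G x $ j) k x"
    by (simp add: conv_def)
qed

section \<open>Jacobian determinants integrate to zero\<close>

text \<open>
  A function that is not integrable stays so under translation, and both integrals then have the
  default value 0.
\<close>
lemma integral_lborel_shift:
  fixes w :: "'a::euclidean_space \<Rightarrow> real"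
  shows "(\<integral>x. w (x + a) \<partial>lborel) = (\<integral>x. w x \<partial>lborel)"
    "integrable lborel w \<Longrightarrow> integrable lborel (\<lambda>x. w (x + a))"
proof -
  have d: "distr lborel borel ((+) a) = (lborel :: 'a measure)" by (rule lborel_distr_plus)
  show "integrable lborel w \<Longrightarrow> integrable lborel (\<lambda>x. w (x + a))"
  proof -
    assume w: "integrable lborel w"
    then have [measurable]: "w \<in> borel_measurable borel" by simp
    have "integrable (distr lborel borel ((+) a)) w" using w d by simp
    then show ?thesis by (subst (asm) integrable_distr_eq) (auto simp: add.commute)
  qed
  show "(\<integral>x. w (x + a) \<partial>lborel) = (\<integral>x. w x \<partial>lborel)"
  proof (cases "w \<in> borel_measurable borel")
    case True
    then show ?thesis by (subst d[symmetric], subst integral_distr) (auto simp: add.commute)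
  next
    case False
    have "(\<lambda>x. w (x + a)) \<notin> borel_measurable borel"
    proof
      assume "(\<lambda>x. w (x + a)) \<in> borel_measurable borel"
      then have "(\<lambda>x. (\<lambda>x. w (x + a)) (x - a)) \<in> borel_measurable borel"
        by (rule measurable_compose_rev) simp
      with False show False by simp
    qed
    with False show ?thesis
      by (subst (1 2) not_integrable_integral_eq) (auto dest: borel_measurable_integrable)
  qed
qed

text \<open>
  The integral of a difference quotient is 0 by translation invariance, and the difference
  quotients converge uniformly on a fixed ball.
\<close>
lemma integral_partial_deriv_eq_0:
  fixes w :: "real ^ 'n::finite \<Rightarrow> real"
  assumes "C_k 1 w" "\<And>z. norm z > R \<Longrightarrow> w z = 0"
  shows "(\<integral>x. partial_deriv j w x \<partial>lborel) = 0"
proof -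
  let ?B = "cball (0 :: real ^ 'n) (\<bar>R\<bar> + 1)"
  have c: "continuous_on UNIV w" "continuous_on UNIV (partial_deriv j w)"
    using assms(1) C_k_continuous by (blast, simp)
  have iw: "integrable lborel w" by (rule integrable_compact_support[OF c(1) assms(2)])
  have ip: "integrable lborel (partial_deriv j w)"
    by (rule integrable_compact_support[OF c(2), of R]) (rule partial_deriv_outside[OF assms(2)], auto)
  have iB: "integrable lborel (indicator ?B :: _ \<Rightarrow> real)"
    by (intro integrable_real_indicator emeasure_lborel_cball_finite) auto
  have "\<bar>\<integral>x. partial_deriv j w x \<partial>lborel\<bar> \<le> e * measure lborel ?B" if e: "e > 0" for e
  proof -
    obtain d where d: "d > 0"
      "\<And>z h. norm h < d \<Longrightarrow> \<bar>w (z + h) - w z - gradient w z \<bullet> h\<bar> \<le> e * norm h"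
      using first_order_remainder_uniform[OF assms e] by blast
    define t where "t = min (d / 2) 1"
    have t: "t > 0" "t < d" "t \<le> 1" using d(1) by (auto simp: t_def)
    let ?h = "axis j t :: real ^ 'n"
    have nh: "norm ?h = t" using t by (simp add: norm_eq_sqrt_inner inner_axis_axis)
    have "t * \<bar>\<integral>x. partial_deriv j w x \<partial>lborel\<bar> = norm (\<integral>x. w (x + ?h) - w x - t * partial_deriv j w x \<partial>lborel)"
      using iw ip integral_lborel_shift[of w ?h] t(1) by (simp add: abs_mult)
    also have "\<dots> \<le> (\<integral>x. e * t * indicator ?B x \<partial>lborel)"
    proof (rule norm_lebesgue_integral_le)
      show "integrable lborel (\<lambda>x. w (x + ?h) - w x - t * partial_deriv j w x)"
        using iw ip integral_lborel_shift[of w ?h] by auto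
      show "integrable lborel (\<lambda>x. e * t * indicator ?B x)" using iB by simp
      fix x :: "real ^ 'n"
      show "norm (w (x + ?h) - w x - t * partial_deriv j w x) \<le> e * t * indicator ?B x"
      proof (cases "x \<in> ?B")
        case True
        have "gradient w x \<bullet> ?h = t * partial_deriv j w x"
          by (simp add: inner_axis gradient_def)
        then show ?thesis using True d(2)[of ?h x] nh t by simp
      next
        case False
        then have "norm x > \<bar>R\<bar> + 1" by simp
        moreover have "norm (x + ?h) > \<bar>R\<bar>"
          using calculation nh t norm_diff_ineq[of x ?h] by simp
        ultimately show ?thesis
          using assms(2) partial_deriv_outside[OF assms(2), where z=x and j=j] False by simp
      qed
    qed
    also have "\<dots> = t * (e * measure lborel ?B)" by simp
    finally show ?thesis using t(1) by simp
  qed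
  note * = this
  have "\<bar>\<integral>x. partial_deriv j w x \<partial>lborel\<bar> \<le> 0"
  proof (rule field_le_epsilon)
    fix e :: real assume "e > 0"
    then have "e / (measure lborel ?B + 1) > 0"
      by (rule divide_pos_pos) (rule add_nonneg_pos, auto)
    from *[OF this] have "\<bar>\<integral>x. partial_deriv j w x \<partial>lborel\<bar> \<le> e / (measure lborel ?B + 1) * measure lborel ?B" .
    also have "\<dots> \<le> e" using absorb_quotient[OF \<open>e > 0\<close>, of 1 "measure lborel ?B"] by simp
    finally show "\<bar>\<integral>x. partial_deriv j w x \<partial>lborel\<bar> \<le> 0 + e" by simp
  qed
  then show ?thesis by simp
qed

lemma C_k_prod:
  assumes "finite S" "\<And>i. i \<in> S \<Longrightarrow> C_k l (v i)"
  shows "C_k l (\<lambda>x. \<Prod>i\<in>S. v i x)"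
  using assms by (induction S rule: finite_induct) (auto intro: C_k_const C_k_mult)

lemma partial_deriv_prod:
  assumes "finite S" "\<And>i. i \<in> S \<Longrightarrow> C_k 1 (v i)"
  shows "partial_deriv j (\<lambda>x. \<Prod>i\<in>S. v i x) x =
    (\<Sum>l\<in>S. partial_deriv j (v l) x * (\<Prod>i\<in>S - {l}. v i x))"
  using assms
proof (induction S rule: finite_induct)
  case empty
  then show ?case by (simp add: partial_deriv_eqI[OF has_derivative_const])
next
  case (insert a S)
  have "partial_deriv j (\<lambda>x. v a x * (\<Prod>i\<in>S. v i x)) x =
      v a x * (\<Sum>l\<in>S. partial_deriv j (v l) x * (\<Prod>i\<in>S - {l}. v i x)) + partial_deriv j (v a) x * (\<Prod>i\<in>S. v i x)"
    using insert by (subst partial_deriv_mult)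
      (auto intro!: C_k_differentiable[of 0] C_k_prod simp del: C_k.simps)
  also have "v a x * (\<Sum>l\<in>S. partial_deriv j (v l) x * (\<Prod>i\<in>S - {l}. v i x)) =
      (\<Sum>l\<in>S. partial_deriv j (v l) x * (\<Prod>i\<in>insert a S - {l}. v i x))"
    unfolding sum_distrib_left
  proof (rule sum.cong[OF refl])
    fix l assume "l \<in> S"
    then have "insert a S - {l} = insert a (S - {l})" "a \<notin> S - {l}" using insert(2) by auto
    then show "v a x * (partial_deriv j (v l) x * (\<Prod>i\<in>S - {l}. v i x)) =
        partial_deriv j (v l) x * (\<Prod>i\<in>insert a S - {l}. v i x)"
      using insert(1) by simp
  qed
  also have "S = insert a S - {a}" using insert(2) by auto
  finally show ?case using insert(1,2) by (simp add: add.commute)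
qed

definition jac :: "('n \<Rightarrow> real ^ 'n::finite \<Rightarrow> real) \<Rightarrow> real ^ 'n \<Rightarrow> real" where
  "jac u x = det (\<chi> i j. partial_deriv j (u i) x)"

text \<open>
  The Jacobian is the divergence of the field whose components are \<open>u k0\<close> times the
  cofactors of row \<open>k0\<close>: the terms with second derivatives cancel in pairs. In
  \<open>good_lambda\<close> the component \<open>k0\<close> is a mollified Lipschitz extension
  without compact support; row \<open>l0\<close> confines the Jacobian to a ball.
\<close>
lemma integral_jac_eq_0:
  fixes u :: "'n::finite \<Rightarrow> real ^ 'n \<Rightarrow> real"
  assumes u1: "C_k 1 (u k0)"
    and u2: "\<And>i. i \<noteq> k0 \<Longrightarrow> C_k 2 (u i)"
    and sym: "\<And>i a b x. i \<noteq> k0 \<Longrightarrow> partial_deriv a (partial_deriv b (u i)) x = partial_deriv b (partial_deriv a (u i)) x"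
    and supp: "\<And>i z. i \<noteq> k0 \<Longrightarrow> norm z > R \<Longrightarrow> u i z = 0"
    and l0: "l0 \<noteq> k0"
  shows "(\<integral>x. jac u x \<partial>lborel) = 0"
proof -
  let ?S = "UNIV - {k0}"
  let ?P = "{p. p permutes (UNIV :: 'n set)}"
  define w where "w p x = u k0 x * (\<Prod>i\<in>?S. partial_deriv (p i) (u i) x)" for p x
  define T where "T p l x = partial_deriv (p k0) (partial_deriv (p l) (u l)) x *
      (\<Prod>i\<in>?S - {l}. partial_deriv (p i) (u i) x)" for p l x
  have C1: "C_k 1 (partial_deriv j (u i))" if "i \<noteq> k0" for i j
    using u2[OF that] by (simp add: numeral_2_eq_2)
  have Cprod: "C_k 1 (\<lambda>x. \<Prod>i\<in>?S. partial_deriv (p i) (u i) x)" for p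
    using C1 by (intro C_k_prod) auto
  have Cw: "C_k 1 (w p)" for p
    unfolding w_def[abs_def] using u1 Cprod by (intro C_k_mult)
  have w0: "w p z = 0" if "norm z > R" for p z
  proof -
    have "partial_deriv (p l0) (u l0) z = 0"
      using supp[OF l0] that by (rule partial_deriv_outside)
    then show ?thesis using l0 unfolding w_def by (auto simp: prod_zero_iff)
  qed
  have dw: "partial_deriv (p k0) (w p) x = (\<Prod>i\<in>UNIV. partial_deriv (p i) (u i) x) + u k0 x * (\<Sum>l\<in>?S. T p l x)" for p x
  proof -
    have "partial_deriv (p k0) (w p) x =
        u k0 x * partial_deriv (p k0) (\<lambda>x. \<Prod>i\<in>?S. partial_deriv (p i) (u i) x) x +
        partial_deriv (p k0) (u k0) x * (\<Prod>i\<in>?S. partial_deriv (p i) (u i) x)"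
      unfolding w_def[abs_def]
      using u1 Cprod by (intro partial_deriv_mult C_k_differentiable[of 0]) auto
    also have "partial_deriv (p k0) (\<lambda>x. \<Prod>i\<in>?S. partial_deriv (p i) (u i) x) x = (\<Sum>l\<in>?S. T p l x)"
      unfolding T_def using C1 by (intro partial_deriv_prod) auto
    also have "partial_deriv (p k0) (u k0) x * (\<Prod>i\<in>?S. partial_deriv (p i) (u i) x) =
        (\<Prod>i\<in>UNIV. partial_deriv (p i) (u i) x)"
      by (simp add: prod.remove[of UNIV k0])
    finally show ?thesis by simp
  qed
  \<comment> \<open>Exchanging \<open>p k0\<close> and \<open>p l\<close> leaves the second derivative
     unchanged but flips the sign of \<open>p\<close>.\<close>
  have cancel: "(\<Sum>p\<in>?P. of_int (sign p) * T p l x) = 0" if "l \<noteq> k0" for l x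
  proof -
    let ?t = "Transposition.transpose k0 l"
    have inv: "(\<lambda>p. p \<circ> ?t) \<circ> (\<lambda>p. p \<circ> ?t) = id"
      by (simp add: fun_eq_iff)
    have bij: "bij_betw (\<lambda>p. p \<circ> ?t) ?P ?P"
      by (intro bij_betwI[where g="\<lambda>p. p \<circ> ?t"])
        (auto simp: comp_assoc intro!: permutes_compose permutes_swap_id)
    have "(\<Sum>p\<in>?P. of_int (sign p) * T p l x) = (\<Sum>p\<in>?P. of_int (sign (p \<circ> ?t)) * T (p \<circ> ?t) l x)"
      by (rule sum.reindex_bij_betw[OF bij, symmetric])
    also have "\<dots> = (\<Sum>p\<in>?P. - (of_int (sign p) * T p l x))"
    proof (rule sum.cong[OF refl])
      fix p assume "p \<in> ?P"
      then have "permutation p" by (auto simp: permutation_permutes)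
      then have "sign (p \<circ> ?t) = - sign p"
        using that by (simp add: sign_compose permutation_swap_id sign_swap_id)
      moreover have "(\<Prod>i\<in>?S - {l}. partial_deriv (p (?t i)) (u i) x) = (\<Prod>i\<in>?S - {l}. partial_deriv (p i) (u i) x)"
        by (intro prod.cong) (auto simp: Transposition.transpose_def)
      then have "T (p \<circ> ?t) l x = T p l x"
        using sym[OF that] by (simp add: T_def)
      ultimately show "of_int (sign (p \<circ> ?t)) * T (p \<circ> ?t) l x = - (of_int (sign p) * T p l x)" by simp
    qed
    finally show ?thesis by (simp add: sum_negf)
  qed
  have "jac u x = (\<Sum>p\<in>?P. of_int (sign p) * partial_deriv (p k0) (w p) x)" for x
  proof -
    have "(\<Sum>p\<in>?P. of_int (sign p) * partial_deriv (p k0) (w p) x) =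
        jac u x + (\<Sum>p\<in>?P. \<Sum>l\<in>?S. u k0 x * (of_int (sign p) * T p l x))"
      by (simp add: jac_def det_def dw sum.distrib[symmetric] sum_distrib_left distrib_left mult_ac)
    also have "(\<Sum>p\<in>?P. \<Sum>l\<in>?S. u k0 x * (of_int (sign p) * T p l x)) =
        (\<Sum>l\<in>?S. u k0 x * (\<Sum>p\<in>?P. of_int (sign p) * T p l x))"
      by (subst sum.swap) (simp add: sum_distrib_left)
    also have "\<dots> = 0" using cancel by (intro sum.neutral) auto
    finally show ?thesis by simp
  qed
  moreover have "integrable lborel (partial_deriv (p k0) (w p))" for p
  proof (rule integrable_compact_support[where R=R])
    show "continuous_on UNIV (partial_deriv (p k0) (w p))" using Cw[of p] by simp
    show "partial_deriv (p k0) (w p) z = 0" if "norm z > R" for z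
      using partial_deriv_outside[OF w0 that] by simp
  qed
  moreover have "(\<integral>x. partial_deriv (p k0) (w p) x \<partial>lborel) = 0" for p
    using integral_partial_deriv_eq_0[OF Cw w0] .
  ultimately show ?thesis
    by (simp add: Bochner_Integration.integral_sum)
qed

section \<open>A truncated maximal function\<close>

abbreviation ball_vol :: "'n::finite itself \<Rightarrow> real" where
  "ball_vol (_ :: 'n itself) \<equiv> measure lborel (ball (0 :: real ^ 'n) 1)"

lemma emeasure_cball_vec:
  assumes "r \<ge> 0"
  shows "emeasure lborel (cball (x :: real ^ 'n::finite) r) = ennreal (ball_vol TYPE('n) * r ^ CARD('n))"
proof -
  have "measure lborel (cball x r) = ball_vol TYPE('n) * r ^ CARD('n)"
    using content_ball_conv_unit_ball[OF assms, of x] by (simp add: content_cball_conv_ball)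
  then show ?thesis
    using emeasure_lborel_cball_finite[of x r] by (subst emeasure_eq_ennreal_measure) auto
qed

text \<open>
  A Lipschitz kernel between the indicator of the unit ball and twice that of the ball of radius
  2: averages with it are comparable to averages over balls and depend continuously on the centre.
\<close>
definition tent :: "'a::real_normed_vector \<Rightarrow> real" where
  "tent z = max 0 (2 - norm z)"

lemma tent_bounds: "0 \<le> tent z" "tent z \<le> 2"
  by (auto simp: tent_def)

lemma tent_ge_1: "norm z \<le> 1 \<Longrightarrow> 1 \<le> tent z"
  by (simp add: tent_def)

lemma tent_eq_0: "norm z \<ge> 2 \<Longrightarrow> tent z = 0"
  by (simp add: tent_def)

lemma tent_lipschitz: "\<bar>tent z - tent w\<bar> \<le> norm (z - w)"
  using norm_triangle_ineq3[of z w] by (auto simp: tent_def max_def)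

lemma borel_measurable_tent[measurable]: "(tent :: 'a::real_normed_vector \<Rightarrow> real) \<in> borel_measurable borel"
  unfolding tent_def by (intro borel_measurable_continuous_onI continuous_intros)

definition wavg :: "(real ^ 'n::finite \<Rightarrow> real) \<Rightarrow> real \<Rightarrow> real ^ 'n \<Rightarrow> real" where
  "wavg F r x = (\<integral>y. F y * tent ((1 / r) *\<^sub>R (x - y)) \<partial>lborel) / r ^ CARD('n)"

text \<open>
  With radii bounded below by \<open>\<rho>\<close> the maximal function of an integrable function
  is finite and Lipschitz, so that its sublevel sets are open.
\<close>
definition maxf :: "(real ^ 'n::finite \<Rightarrow> real) \<Rightarrow> real \<Rightarrow> real ^ 'n \<Rightarrow> real" where
  "maxf F \<rho> x = (SUP r\<in>{\<rho>..}. wavg F r x)"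

locale maximal =
  fixes F :: "real ^ 'n::finite \<Rightarrow> real"
  assumes int: "integrable lborel F" and nonneg: "\<And>x. F x \<ge> 0"
begin

lemma meas[measurable]: "F \<in> borel_measurable borel"
  using int by auto

lemma integral_nonneg: "0 \<le> (\<integral>y. F y \<partial>lborel)"
  using nonneg by (intro Bochner_Integration.integral_nonneg) auto

lemma integrable_weight: "integrable lborel (\<lambda>y. F y * tent ((1 / r) *\<^sub>R (x - y)))"
proof (rule Bochner_Integration.integrable_bound[where f="\<lambda>y. 2 * F y"])
  show "AE y in lborel. norm (F y * tent ((1 / r) *\<^sub>R (x - y))) \<le> norm (2 * F y)"
  proof (rule always_eventually, rule allI)
    fix y
    have "F y * tent ((1 / r) *\<^sub>R (x - y)) \<le> F y * 2"
      using nonneg tent_bounds by (intro mult_left_mono) auto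
    then show "norm (F y * tent ((1 / r) *\<^sub>R (x - y))) \<le> norm (2 * F y)"
      using nonneg[of y] tent_bounds(1)[of "(1 / r) *\<^sub>R (x - y)"] by simp
  qed
qed (use int in auto)

lemma wavg_nonneg:
  assumes "r > 0"
  shows "wavg F r x \<ge> 0"
  unfolding wavg_def using assms nonneg tent_bounds
  by (intro divide_nonneg_nonneg Bochner_Integration.integral_nonneg mult_nonneg_nonneg) auto

lemma wavg_le:
  assumes "r > 0"
  shows "wavg F r x \<le> 2 * (\<integral>y. F y \<partial>lborel) / r ^ CARD('n)"
proof -
  have "(\<integral>y. F y * tent ((1 / r) *\<^sub>R (x - y)) \<partial>lborel) \<le> (\<integral>y. F y * 2 \<partial>lborel)"
    using int nonneg tent_bounds
    by (intro integral_mono integrable_weight mult_left_mono) auto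
  then show ?thesis unfolding wavg_def using assms by (intro divide_right_mono) auto
qed

lemma wavg_le_scale:
  assumes "\<rho> > 0" "r \<ge> \<rho>"
  shows "wavg F r x \<le> 2 * (\<integral>y. F y \<partial>lborel) / \<rho> ^ CARD('n)"
proof -
  have "2 * (\<integral>y. F y \<partial>lborel) / r ^ CARD('n) \<le> 2 * (\<integral>y. F y \<partial>lborel) / \<rho> ^ CARD('n)"
    using assms integral_nonneg by (intro divide_left_mono power_mono mult_pos_pos) auto
  then show ?thesis using wavg_le[of r x] assms by simp
qed

lemma maxf_bdd: "\<rho> > 0 \<Longrightarrow> bdd_above ((\<lambda>r. wavg F r x) ` {\<rho>..})"
  using wavg_le_scale by (intro bdd_aboveI2) auto

lemma wavg_le_maxf: "\<rho> > 0 \<Longrightarrow> r \<ge> \<rho> \<Longrightarrow> wavg F r x \<le> maxf F \<rho> x"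
  unfolding maxf_def by (intro cSUP_upper maxf_bdd) auto

lemma maxf_nonneg: "\<rho> > 0 \<Longrightarrow> maxf F \<rho> x \<ge> 0"
  using wavg_le_maxf[of \<rho> \<rho> x] wavg_nonneg[of \<rho> x] by simp

lemma maxf_antimono:
  assumes "0 < \<rho>'" "\<rho>' \<le> \<rho>"
  shows "maxf F \<rho> x \<le> maxf F \<rho>' x"
  unfolding maxf_def using assms by (intro cSUP_subset_mono maxf_bdd) auto

lemma wavg_lipschitz:
  assumes "\<rho> > 0" "r \<ge> \<rho>"
  shows "wavg F r x \<le> wavg F r z + (\<integral>y. F y \<partial>lborel) / \<rho> ^ (CARD('n) + 1) * norm (x - z)"
proof -
  have "(\<integral>y. F y * tent ((1 / r) *\<^sub>R (x - y)) \<partial>lborel) - (\<integral>y. F y * tent ((1 / r) *\<^sub>R (z - y)) \<partial>lborel)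
      = (\<integral>y. F y * tent ((1 / r) *\<^sub>R (x - y)) - F y * tent ((1 / r) *\<^sub>R (z - y)) \<partial>lborel)"
    by (intro Bochner_Integration.integral_diff[symmetric] integrable_weight)
  also have "\<dots> \<le> (\<integral>y. F y * (norm (x - z) / r) \<partial>lborel)"
  proof (rule integral_mono)
    show "integrable lborel (\<lambda>y. F y * tent ((1 / r) *\<^sub>R (x - y)) - F y * tent ((1 / r) *\<^sub>R (z - y)))"
      by (intro Bochner_Integration.integrable_diff integrable_weight)
    show "integrable lborel (\<lambda>y. F y * (norm (x - z) / r))" using int by (intro integrable_mult_left)
    fix y
    have "(1 / r) *\<^sub>R (x - y) - (1 / r) *\<^sub>R (z - y) = (1 / r) *\<^sub>R (x - z)"
      by (simp add: scaleR_right_diff_distrib)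
    then have "tent ((1 / r) *\<^sub>R (x - y)) - tent ((1 / r) *\<^sub>R (z - y)) \<le> norm (x - z) / r"
      using tent_lipschitz[of "(1 / r) *\<^sub>R (x - y)" "(1 / r) *\<^sub>R (z - y)"] assms by simp
    from mult_left_mono[OF this nonneg[of y]]
    show "F y * tent ((1 / r) *\<^sub>R (x - y)) - F y * tent ((1 / r) *\<^sub>R (z - y)) \<le> F y * (norm (x - z) / r)"
      by (simp only: right_diff_distrib)
  qed
  also have "\<dots> = (\<integral>y. F y \<partial>lborel) * norm (x - z) / r" using assms by simp
  finally have "wavg F r x - wavg F r z \<le> ((\<integral>y. F y \<partial>lborel) * norm (x - z) / r) / r ^ CARD('n)"
    unfolding wavg_def diff_divide_distrib[symmetric] using assms by (intro divide_right_mono) auto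
  also have "\<dots> = (\<integral>y. F y \<partial>lborel) * norm (x - z) / r ^ (CARD('n) + 1)" by (simp add: mult.commute)
  also have "\<dots> \<le> (\<integral>y. F y \<partial>lborel) * norm (x - z) / \<rho> ^ (CARD('n) + 1)"
    using assms integral_nonneg by (intro divide_left_mono power_mono mult_pos_pos mult_nonneg_nonneg zero_less_power) auto
  finally show ?thesis by simp
qed

lemma maxf_lipschitz:
  assumes "\<rho> > 0"
  shows "\<bar>maxf F \<rho> x - maxf F \<rho> z\<bar> \<le> (\<integral>y. F y \<partial>lborel) / \<rho> ^ (CARD('n) + 1) * norm (x - z)"
proof -
  have le: "maxf F \<rho> x \<le> maxf F \<rho> z + (\<integral>y. F y \<partial>lborel) / \<rho> ^ (CARD('n) + 1) * norm (x - z)" for x z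
    unfolding maxf_def[of F \<rho> x]
  proof (rule cSUP_least)
    fix r assume "r \<in> {\<rho>..}"
    then show "wavg F r x \<le> maxf F \<rho> z + (\<integral>y. F y \<partial>lborel) / \<rho> ^ (CARD('n) + 1) * norm (x - z)"
      using wavg_lipschitz[OF assms, of r x z] wavg_le_maxf[OF assms, of r z] by simp
  qed simp
  show ?thesis using le[of x z] le[of z x] by (simp add: norm_minus_commute abs_le_iff)
qed

lemma maxf_continuous:
  assumes "\<rho> > 0"
  shows "continuous_on UNIV (maxf F \<rho>)"
proof -
  have "((\<integral>y. F y \<partial>lborel) / \<rho> ^ (CARD('n) + 1))-lipschitz_on UNIV (maxf F \<rho>)"
    using maxf_lipschitz[OF assms] integral_nonneg assms
    by (intro lipschitz_onI) (auto simp: dist_norm)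
  then show ?thesis by (rule lipschitz_on_continuous_on)
qed

lemma borel_measurable_maxf: "\<rho> > 0 \<Longrightarrow> maxf F \<rho> \<in> borel_measurable borel"
  by (intro borel_measurable_continuous_onI maxf_continuous)

definition ballint :: "real ^ 'n \<Rightarrow> real \<Rightarrow> ennreal" where
  "ballint x r = (\<integral>\<^sup>+y. ennreal (F y) * indicator (cball x r) y \<partial>lborel)"

lemma ballint_meas: "(\<lambda>y. ennreal (F y) * indicator (cball x r) y) \<in> borel_measurable lborel"
  by (intro borel_measurable_times_ennreal borel_measurable_indicator) auto

lemma ballint_mono:
  assumes "cball x r \<subseteq> cball x' r'"
  shows "ballint x r \<le> ballint x' r'"
  unfolding ballint_def using assms by (intro nn_integral_mono mult_left_mono) (auto simp: indicator_def)

lemma wavg_eq_nn: "r > 0 \<Longrightarrow> ennreal (wavg F r x * r ^ CARD('n)) = (\<integral>\<^sup>+y. ennreal (F y * tent ((1 / r) *\<^sub>R (x - y))) \<partial>lborel)"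
  by (subst nn_integral_eq_integral[OF integrable_weight]) (auto simp: wavg_def nonneg tent_bounds)

lemma ballint_le_maxf:
  assumes "\<rho> > 0" "r \<ge> \<rho>"
  shows "ballint x r \<le> ennreal (r ^ CARD('n) * maxf F \<rho> x)"
proof -
  have "ballint x r \<le> (\<integral>\<^sup>+y. ennreal (F y * tent ((1 / r) *\<^sub>R (x - y))) \<partial>lborel)"
    unfolding ballint_def
  proof (rule nn_integral_mono)
    fix y
    show "ennreal (F y) * indicator (cball x r) y \<le> ennreal (F y * tent ((1 / r) *\<^sub>R (x - y)))"
    proof (cases "y \<in> cball x r")
      case True
      then have "1 \<le> tent ((1 / r) *\<^sub>R (x - y))"
        using assms by (intro tent_ge_1) (simp add: dist_norm divide_le_eq)
      from mult_left_mono[OF this nonneg[of y]] True show ?thesis by (simp add: ennreal_leI)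
    qed simp
  qed
  also have "\<dots> = ennreal (wavg F r x * r ^ CARD('n))" using wavg_eq_nn[of r x] assms by simp
  also have "\<dots> \<le> ennreal (r ^ CARD('n) * maxf F \<rho> x)"
    using wavg_le_maxf[OF assms, of x] assms by (intro ennreal_leI) (simp add: mult.commute mult_left_mono)
  finally show ?thesis .
qed

lemma wavg_le_ballint:
  assumes "r > 0"
  shows "ennreal (wavg F r x * r ^ CARD('n)) \<le> 2 * ballint x (2 * r)"
proof -
  have "(\<integral>\<^sup>+y. ennreal (F y * tent ((1 / r) *\<^sub>R (x - y))) \<partial>lborel) \<le>
      (\<integral>\<^sup>+y. 2 * (ennreal (F y) * indicator (cball x (2 * r)) y) \<partial>lborel)"
  proof (rule nn_integral_mono)
    fix y
    show "ennreal (F y * tent ((1 / r) *\<^sub>R (x - y))) \<le> 2 * (ennreal (F y) * indicator (cball x (2 * r)) y)"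
    proof (cases "y \<in> cball x (2 * r)")
      case True
      have "F y * tent ((1 / r) *\<^sub>R (x - y)) \<le> 2 * F y"
        using mult_left_mono[OF tent_bounds(2) nonneg[of y]] by (simp add: mult.commute)
      then show ?thesis using True nonneg[of y]
        by (simp add: ennreal_mult[symmetric] ennreal_leI flip: ennreal_numeral)
    next
      case False
      then have "tent ((1 / r) *\<^sub>R (x - y)) = 0"
        using assms by (intro tent_eq_0) (simp add: dist_norm le_divide_eq)
      then show ?thesis by simp
    qed
  qed
  also have "\<dots> = 2 * ballint x (2 * r)" unfolding ballint_def by (intro nn_integral_cmult ballint_meas)
  finally show ?thesis using wavg_eq_nn[OF assms] by simp
qed

lemma ballint_le: "ballint x r \<le> ennreal (\<integral>y. F y \<partial>lborel)"
proof -
  have "ballint x r \<le> (\<integral>\<^sup>+y. ennreal (F y) \<partial>lborel)"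
    unfolding ballint_def by (intro nn_integral_mono) (auto simp: indicator_def)
  also have "\<dots> = ennreal (\<integral>y. F y \<partial>lborel)"
    by (rule nn_integral_eq_integral[OF int]) (simp add: nonneg)
  finally show ?thesis .
qed

text \<open>
  Positivity at every point makes negative powers of the maximal function usable as weights.
\<close>
lemma maxf_pos:
  assumes "\<rho> > 0" "(\<integral>y. F y \<partial>lborel) > 0"
  shows "maxf F \<rho> x > 0"
proof (rule ccontr)
  assume "\<not> maxf F \<rho> x > 0"
  then have "maxf F \<rho> x = 0" using maxf_nonneg[OF assms(1), of x] by simp
  then have "ballint x r \<le> 0" if "r \<ge> \<rho>" for r
    using ballint_le_maxf[OF assms(1) that, of x] by simp
  then have *: "AE y in lborel. F y * indicator (cball x (\<rho> + real k)) y = 0" for k :: nat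
  proof -
    have "ballint x (\<rho> + real k) = 0" using \<open>\<And>r. r \<ge> \<rho> \<Longrightarrow> ballint x r \<le> 0\<close>[of "\<rho> + real k"] by simp
    then have "AE y in lborel. ennreal (F y) * indicator (cball x (\<rho> + real k)) y = 0"
      unfolding ballint_def by (subst (asm) nn_integral_0_iff_AE[OF ballint_meas]) simp
    then show ?thesis
      by (rule AE_mp) (rule AE_I2, auto simp: indicator_def ennreal_eq_0_iff nonneg antisym split: if_splits)
  qed
  have "AE y in lborel. \<forall>k :: nat. F y * indicator (cball x (\<rho> + real k)) y = 0"
    using * by (subst AE_all_countable) auto
  then have "AE y in lborel. F y = 0"
  proof (rule AE_mp, intro AE_I2 impI)
    fix y assume y: "\<forall>k :: nat. F y * indicator (cball x (\<rho> + real k)) y = 0"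
    obtain k :: nat where "dist x y < real k" using reals_Archimedean2 by blast
    then have "y \<in> cball x (\<rho> + real k)" using assms(1) by simp
    then show "F y = 0" using y by (metis indicator_simps(1) mult.right_neutral)
  qed
  then have "(\<integral>y. F y \<partial>lborel) = 0" by (rule integral_eq_zero_AE)
  then show False using assms(2) by simp
qed

text \<open>
  Around each point of the superlevel set there is a ball over which the integral of
  \<open>F\<close> is large compared to its volume. Vitali's covering lemma selects disjoint ones
  whose five-fold enlargements cover the set.
\<close>
theorem weak_type:
  assumes "\<rho> > 0" "L > 0"
  shows "emeasure lborel {x. L < maxf F \<rho> x} \<le>
    ennreal (2 * 10 ^ CARD('n) * ball_vol TYPE('n) / L) * (\<integral>\<^sup>+y. ennreal (F y) \<partial>lborel)"
proof -
  let ?N = "CARD('n)" let ?V = "ball_vol TYPE('n)" let ?I = "\<integral>y. F y \<partial>lborel"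
  let ?U = "{x. L < maxf F \<rho> x}"
  have "\<exists>r. r \<ge> \<rho> \<and> L < wavg F r x" if "x \<in> ?U" for x
  proof -
    have "L < (SUP r\<in>{\<rho>..}. wavg F r x)" using that by (simp add: maxf_def)
    then show ?thesis using less_cSUP_iff[OF _ maxf_bdd[OF assms(1)]] by auto
  qed
  then obtain R0 where R0: "\<And>x. x \<in> ?U \<Longrightarrow> R0 x \<ge> \<rho> \<and> L < wavg F (R0 x) x" by metis
  \<comment> \<open>the tent at scale \<open>R0 x\<close> lives on the ball of radius \<open>2 * R0 x\<close>\<close>
  define R where "R x = 2 * R0 x" for x
  have Rpos: "R x > 0" if "x \<in> ?U" for x using R0[OF that] assms(1) by (simp add: R_def)
  have Rball: "ennreal (L * (R x / 2) ^ ?N) \<le> 2 * ballint x (R x)" if "x \<in> ?U" for x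
  proof -
    have "ennreal (L * R0 x ^ ?N) \<le> ennreal (wavg F (R0 x) x * R0 x ^ ?N)"
      using R0[OF that] assms(1) by (intro ennreal_leI mult_right_mono) auto
    also have "\<dots> \<le> 2 * ballint x (R x)"
      unfolding R_def using R0[OF that] assms(1) by (intro wavg_le_ballint) auto
    finally show ?thesis by (simp add: R_def)
  qed
  define B where "B = 2 * max 1 (2 * ?I / L)"
  have Rle: "R x \<le> B" if "x \<in> ?U" for x
  proof (cases "R x / 2 \<le> 1")
    case False
    have "ennreal (L * (R x / 2) ^ ?N) \<le> 2 * ennreal ?I"
      using Rball[OF that] ballint_le[of x "R x"] by (meson mult_left_mono order_trans zero_le)
    also have "\<dots> = ennreal (2 * ?I)" by (simp add: ennreal_mult' integral_nonneg)
    finally have "L * (R x / 2) ^ ?N \<le> 2 * ?I" using integral_nonneg by (simp add: ennreal_le_iff)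
    then have "(R x / 2) ^ ?N \<le> 2 * ?I / L" using assms(2) by (simp add: field_simps)
    moreover have "R x / 2 \<le> (R x / 2) ^ ?N" using False by (intro self_le_power) auto
    ultimately show ?thesis by (simp add: B_def)
  qed (simp add: B_def)
  obtain C where C: "countable C" "C \<subseteq> ?U"
    "pairwise (\<lambda>i j. disjnt (cball (id i) (R i)) (cball (id j) (R j))) C"
    "?U \<subseteq> (\<Union>i\<in>C. cball (id i) (5 * R i))"
  proof (rule Vitali_covering_lemma_cballs[where S="?U" and K="?U" and a=id and r=R and B=B])
    show "?U \<subseteq> (\<Union>i\<in>?U. cball (id i) (R i))"
    proof
      fix x assume "x \<in> ?U"
      then show "x \<in> (\<Union>i\<in>?U. cball (id i) (R i))" using Rpos[of x] by (intro UN_I[of x]) auto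
    qed
  qed (use Rpos Rle in auto)
  have Umeas: "?U \<in> sets lborel"
    using borel_measurable_maxf[OF assms(1)] by measurable
  have Cpos: "R i > 0" if "i \<in> C" for i using Rpos C(2) that by blast
  have "emeasure lborel ?U = (\<integral>\<^sup>+x. indicator ?U x \<partial>lborel)" using Umeas by simp
  also have "\<dots> \<le> (\<integral>\<^sup>+x. \<integral>\<^sup>+i. indicator (cball i (5 * R i)) x \<partial>count_space C \<partial>lborel)"
  proof (rule nn_integral_mono)
    fix x
    show "indicator ?U x \<le> (\<integral>\<^sup>+i. indicator (cball i (5 * R i)) x \<partial>count_space C)"
    proof (cases "x \<in> ?U")
      case True
      then obtain i where i: "i \<in> C" "x \<in> cball i (5 * R i)" using C(4) by auto
      have "indicator ?U x = (1 :: ennreal)" using True by simp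
      also have "\<dots> = (\<integral>\<^sup>+j. indicator {i} j \<partial>count_space C)" using i(1) by simp
      also have "\<dots> \<le> (\<integral>\<^sup>+i. indicator (cball i (5 * R i)) x \<partial>count_space C)"
        using i(2) by (intro nn_integral_mono) (auto simp: indicator_def)
      finally show ?thesis .
    qed simp
  qed
  also have "\<dots> = (\<integral>\<^sup>+i. \<integral>\<^sup>+x. indicator (cball i (5 * R i)) x \<partial>lborel \<partial>count_space C)"
    by (rule nn_integral_count_space_nn_integral[OF C(1)]) (auto intro: borel_measurable_indicator)
  also have "\<dots> \<le> (\<integral>\<^sup>+i. ennreal (2 * 10 ^ ?N * ?V / L) * ballint i (R i) \<partial>count_space C)"
  proof (rule nn_integral_mono)
    fix i assume "i \<in> space (count_space C)"
    then have i: "i \<in> C" by simp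
    have "(\<integral>\<^sup>+x. indicator (cball i (5 * R i)) x \<partial>lborel) = ennreal (?V * (5 * R i) ^ ?N)"
      using Cpos[OF i] by (simp add: emeasure_cball_vec)
    also have "\<dots> = ennreal (10 ^ ?N * ?V / L * (L * (R i / 2) ^ ?N))"
    proof -
      have "10 ^ ?N * (R i / 2) ^ ?N = (5 * R i) ^ ?N" unfolding power_mult_distrib[symmetric] by simp
      then have "10 ^ ?N * ?V / L * (L * (R i / 2) ^ ?N) = ?V * (5 * R i) ^ ?N"
        using assms(2) by (simp add: field_simps)
      then show ?thesis by simp
    qed
    also have "\<dots> = ennreal (10 ^ ?N * ?V / L) * ennreal (L * (R i / 2) ^ ?N)"
      using assms(2) Cpos[OF i] by (intro ennreal_mult) auto
    also have "\<dots> \<le> ennreal (10 ^ ?N * ?V / L) * (2 * ballint i (R i))"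
      using Rball C(2) i by (intro mult_left_mono) auto
    also have "\<dots> = ennreal (2 * 10 ^ ?N * ?V / L) * ballint i (R i)"
    proof -
      have "ennreal (2 * 10 ^ ?N * ?V / L) = ennreal (10 ^ ?N * ?V / L * 2)" by (simp add: mult_ac)
      also have "\<dots> = ennreal (10 ^ ?N * ?V / L) * ennreal 2" by (rule ennreal_mult'') simp
      finally show ?thesis by (simp add: mult.assoc)
    qed
    finally show "(\<integral>\<^sup>+x. indicator (cball i (5 * R i)) x \<partial>lborel) \<le> ennreal (2 * 10 ^ ?N * ?V / L) * ballint i (R i)" .
  qed
  also have "\<dots> = ennreal (2 * 10 ^ ?N * ?V / L) * (\<integral>\<^sup>+i. ballint i (R i) \<partial>count_space C)"
    by (rule nn_integral_cmult) simp
  also have "(\<integral>\<^sup>+i. ballint i (R i) \<partial>count_space C) =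
      (\<integral>\<^sup>+y. \<integral>\<^sup>+i. ennreal (F y) * indicator (cball i (R i)) y \<partial>count_space C \<partial>lborel)"
    unfolding ballint_def by (rule nn_integral_count_space_nn_integral[OF C(1) ballint_meas, symmetric])
  also have "\<dots> \<le> (\<integral>\<^sup>+y. ennreal (F y) \<partial>lborel)"
  proof (rule nn_integral_mono)
    fix y
    have "(\<integral>\<^sup>+i. indicator (cball i (R i)) y \<partial>count_space C) \<le> 1"
    proof (cases "\<exists>i\<in>C. y \<in> cball i (R i)")
      case True
      then obtain i where i: "i \<in> C" "y \<in> cball i (R i)" by blast
      have "j = i" if "j \<in> C" "y \<in> cball j (R j)" for j
      proof (rule ccontr)
        assume "j \<noteq> i"
        then have "disjnt (cball j (R j)) (cball i (R i))" using C(3) that(1) i(1) by (auto simp: pairwise_def)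
        then show False using that(2) i(2) by (auto simp: disjnt_def)
      qed
      then have "(\<integral>\<^sup>+i. indicator (cball i (R i)) y \<partial>count_space C) \<le> (\<integral>\<^sup>+j. indicator {i} j \<partial>count_space C)"
        by (intro nn_integral_mono) (auto simp: indicator_def)
      also have "\<dots> = 1" using i(1) by simp
      finally show ?thesis .
    next
      case False
      then have "(\<integral>\<^sup>+i. indicator (cball i (R i)) y \<partial>count_space C) = (\<integral>\<^sup>+i. 0 \<partial>count_space C)"
        by (intro nn_integral_cong) (auto simp: indicator_def)
      then show ?thesis by simp
    qed
    from mult_left_mono[OF this, of "ennreal (F y)"]
    show "(\<integral>\<^sup>+i. ennreal (F y) * indicator (cball i (R i)) y \<partial>count_space C) \<le> ennreal (F y)"
      by (simp add: nn_integral_cmult)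
  qed
  finally show ?thesis by (simp add: mult_left_mono)
qed

end

section \<open>The maximal function in L^s\<close>

lemma layer_cake_below:
  assumes "a > -1" "c \<ge> 0"
  shows "(\<integral>\<^sup>+L. (if 0 \<le> L \<and> L \<le> c then ennreal (L powr a) else 0) \<partial>lborel) = ennreal (c powr (a + 1) / (a + 1))"
proof -
  have "(\<integral>\<^sup>+L. (if 0 \<le> L \<and> L \<le> c then ennreal (L powr a) else 0) \<partial>lborel) =
      (\<integral>\<^sup>+L. ennreal (L powr a) * indicator {0..c} L \<partial>lborel)"
    by (intro nn_integral_cong) (auto simp: indicator_def)
  also have "\<dots> = ennreal (c powr (a + 1) / (a + 1))"
    by (rule nn_integral_has_integral_lebesgue') (use has_integral_powr_from_0[OF assms] in auto)
  finally show ?thesis .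
qed

lemma layer_cake_above:
  assumes "e < -1" "c > 0"
  shows "(\<integral>\<^sup>+L. (if c \<le> L then ennreal (L powr e) else 0) \<partial>lborel) = ennreal (c powr (e + 1) / - (e + 1))"
proof -
  have "(\<integral>\<^sup>+L. (if c \<le> L then ennreal (L powr e) else 0) \<partial>lborel) =
      (\<integral>\<^sup>+L. ennreal (L powr e) * indicator {c..} L \<partial>lborel)"
    by (intro nn_integral_cong) (auto simp: indicator_def)
  also have "\<dots> = ennreal (- (c powr (e + 1)) / (e + 1))"
    by (rule nn_integral_has_integral_lebesgue') (use has_integral_powr_to_inf[OF assms] in auto)
  finally show ?thesis by (simp add: minus_divide_left[symmetric] minus_divide_right)
qed

lemma nn_integral_lborel_affine:
  fixes f :: "'a::euclidean_space \<Rightarrow> ennreal"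
  assumes [measurable]: "f \<in> borel_measurable borel" and "c > 0"
  shows "(\<integral>\<^sup>+w. f w \<partial>lborel) = ennreal (c ^ DIM('a)) * (\<integral>\<^sup>+z. f (t + c *\<^sub>R z) \<partial>lborel)"
proof -
  have "(\<integral>\<^sup>+w. f w \<partial>lborel) =
      (\<integral>\<^sup>+w. f w \<partial>density (distr lborel borel (\<lambda>x. t + c *\<^sub>R x)) (\<lambda>_. ennreal (\<bar>c\<bar> ^ DIM('a))))"
    using lborel_affine[of c t] assms(2) by simp
  also have "\<dots> = ennreal (c ^ DIM('a)) * (\<integral>\<^sup>+z. f (t + c *\<^sub>R z) \<partial>lborel)"
    using assms(2) by (simp add: nn_integral_density nn_integral_distr nn_integral_cmult)
  finally show ?thesis .
qed

definition kernel_bound :: "'n::finite itself \<Rightarrow> real" where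
  "kernel_bound _ = 1 + 2 ^ (CARD('n) + 1) * ball_vol TYPE('n)"

lemma kernel_bound_ge_1: "kernel_bound TYPE('n::finite) \<ge> 1"
  by (simp add: kernel_bound_def)

definition weak_const :: "'n::finite itself \<Rightarrow> real" where
  "weak_const _ = 2 * 10 ^ CARD('n) * ball_vol TYPE('n)"

lemma weak_const_pos: "weak_const TYPE('n::finite) > 0"
  using content_unit_ball_pos[where 'a="real^'n"] by (simp add: weak_const_def)

definition avg_const :: "'n::finite itself \<Rightarrow> real" where
  "avg_const _ = 2 ^ CARD('n) * (1 + moll_bound TYPE('n) * ball_vol TYPE('n))"

context maximal
begin

lemma truncation:
  assumes "c \<ge> 0"
  shows "maximal (\<lambda>x. if F x > c then F x else 0)"
proof
  show "integrable lborel (\<lambda>x. if F x > c then F x else 0)"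
    by (rule Bochner_Integration.integrable_bound[OF int]) (use nonneg in auto)
qed (use nonneg in auto)

lemma wavg_truncation:
  assumes "c \<ge> 0" "r > 0"
  shows "wavg F r x \<le> wavg (\<lambda>x. if F x > c then F x else 0) r x + c * kernel_bound TYPE('n)"
proof -
  let ?N = "CARD('n)" and ?F = "\<lambda>x. if F x > c then F x else 0"
  interpret T: maximal ?F by (rule truncation[OF assms(1)])
  have tint: "integrable lborel (\<lambda>y. tent ((1 / r) *\<^sub>R (x - y)))"
  proof (rule Bochner_Integration.integrable_bound[where f="\<lambda>y. 2 * indicator (cball x (2 * r)) y :: real"])
    show "integrable lborel (\<lambda>y. 2 * indicator (cball x (2 * r)) y :: real)"
      by (intro integrable_mult_right integrable_real_indicator emeasure_lborel_cball_finite) auto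
    show "AE y in lborel. norm (tent ((1 / r) *\<^sub>R (x - y))) \<le> norm (2 * indicator (cball x (2 * r)) y :: real)"
    proof (rule always_eventually, rule allI)
      fix y
      show "norm (tent ((1 / r) *\<^sub>R (x - y))) \<le> norm (2 * indicator (cball x (2 * r)) y :: real)"
      proof (cases "y \<in> cball x (2 * r)")
        case False
        then have "tent ((1 / r) *\<^sub>R (x - y)) = 0"
          using assms(2) by (intro tent_eq_0) (simp add: dist_norm le_divide_eq)
        then show ?thesis by simp
      qed (use tent_bounds[of "(1 / r) *\<^sub>R (x - y)"] in auto)
    qed
  qed measurable
  have tle: "(\<integral>y. tent ((1 / r) *\<^sub>R (x - y)) \<partial>lborel) \<le> 2 ^ (?N + 1) * ball_vol TYPE('n) * r ^ ?N"
  proof -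
    have "(\<integral>y. tent ((1 / r) *\<^sub>R (x - y)) \<partial>lborel) \<le> (\<integral>y. 2 * indicator (cball x (2 * r)) y \<partial>lborel)"
    proof (rule integral_mono[OF tint])
      show "integrable lborel (\<lambda>y. 2 * indicator (cball x (2 * r)) y :: real)"
        by (intro integrable_mult_right integrable_real_indicator emeasure_lborel_cball_finite) auto
      fix y
      show "tent ((1 / r) *\<^sub>R (x - y)) \<le> 2 * indicator (cball x (2 * r)) y"
      proof (cases "y \<in> cball x (2 * r)")
        case False
        then have "tent ((1 / r) *\<^sub>R (x - y)) = 0"
          using assms(2) by (intro tent_eq_0) (simp add: dist_norm le_divide_eq)
        then show ?thesis by simp
      qed (use tent_bounds[of "(1 / r) *\<^sub>R (x - y)"] in auto)
    qed
    also have "\<dots> = 2 * measure lborel (cball x (2 * r))" by simp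
    also have "\<dots> = 2 ^ (?N + 1) * ball_vol TYPE('n) * r ^ ?N"
      using content_ball_conv_unit_ball[of "2 * r" x] assms(2)
      by (simp add: content_cball_conv_ball power_mult_distrib)
    finally show ?thesis .
  qed
  have "(\<integral>y. F y * tent ((1 / r) *\<^sub>R (x - y)) \<partial>lborel) \<le>
      (\<integral>y. ?F y * tent ((1 / r) *\<^sub>R (x - y)) + c * tent ((1 / r) *\<^sub>R (x - y)) \<partial>lborel)"
  proof (rule integral_mono[OF integrable_weight])
    show "integrable lborel (\<lambda>y. ?F y * tent ((1 / r) *\<^sub>R (x - y)) + c * tent ((1 / r) *\<^sub>R (x - y)))"
      using T.integrable_weight tint by (intro Bochner_Integration.integrable_add integrable_mult_right)
    show "F y * tent ((1 / r) *\<^sub>R (x - y)) \<le> ?F y * tent ((1 / r) *\<^sub>R (x - y)) + c * tent ((1 / r) *\<^sub>R (x - y))" for y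
      using tent_bounds(1)[of "(1 / r) *\<^sub>R (x - y)"] assms(1) by (auto intro: mult_right_mono)
  qed
  also have "\<dots> = (\<integral>y. ?F y * tent ((1 / r) *\<^sub>R (x - y)) \<partial>lborel) + c * (\<integral>y. tent ((1 / r) *\<^sub>R (x - y)) \<partial>lborel)"
    using T.integrable_weight tint by (subst Bochner_Integration.integral_add) auto
  also have "\<dots> \<le> (\<integral>y. ?F y * tent ((1 / r) *\<^sub>R (x - y)) \<partial>lborel) + c * (kernel_bound TYPE('n) * r ^ ?N)"
  proof -
    have "2 ^ (?N + 1) * ball_vol TYPE('n) * r ^ ?N \<le> kernel_bound TYPE('n) * r ^ ?N"
      unfolding kernel_bound_def using assms(2) by (intro mult_right_mono) auto
    then show ?thesis using tle assms(1) by (intro add_left_mono mult_left_mono) auto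
  qed
  finally have "(\<integral>y. F y * tent ((1 / r) *\<^sub>R (x - y)) \<partial>lborel) / r ^ ?N \<le>
      ((\<integral>y. ?F y * tent ((1 / r) *\<^sub>R (x - y)) \<partial>lborel) + c * (kernel_bound TYPE('n) * r ^ ?N)) / r ^ ?N"
    using assms(2) by (intro divide_right_mono) auto
  then show ?thesis unfolding wavg_def using assms(2) by (simp add: add_divide_distrib)
qed

lemma maxf_truncation:
  assumes "c \<ge> 0" "\<rho> > 0"
  shows "maxf F \<rho> x \<le> maxf (\<lambda>x. if F x > c then F x else 0) \<rho> x + c * kernel_bound TYPE('n)"
  unfolding maxf_def[of F]
proof (rule cSUP_least)
  interpret T: maximal "\<lambda>x. if F x > c then F x else 0" by (rule truncation[OF assms(1)])
  fix r assume "r \<in> {\<rho>..}"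
  then show "wavg F r x \<le> maxf (\<lambda>x. if F x > c then F x else 0) \<rho> x + c * kernel_bound TYPE('n)"
    using wavg_truncation[OF assms(1), of r x] T.wavg_le_maxf[OF assms(2), of r x] assms(2) by simp
qed simp

text \<open>
  The part of \<open>F\<close> below \<open>L / (2 * kernel_bound)\<close> contributes at most
  \<open>L / 2\<close> to the maximal function, so only the rest matters, and the weak type bound
  is applied to it at height \<open>L / 4\<close>.
\<close>
lemma maxf_superlevel:
  assumes "\<rho> > 0" "L > 0"
  shows "emeasure lborel {x. L \<le> maxf F \<rho> x} \<le>
    ennreal (4 * weak_const TYPE('n) / L) *
    (\<integral>\<^sup>+y. (if L \<le> 2 * kernel_bound TYPE('n) * F y then ennreal (F y) else 0) \<partial>lborel)"
proof -
  let ?k = "kernel_bound TYPE('n)"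
  define c where "c = L / (2 * ?k)"
  have k: "?k > 0" using kernel_bound_ge_1[where 'n='n] by linarith
  have c: "c > 0" using assms(2) k by (simp add: c_def)
  let ?F = "\<lambda>x. if F x > c then F x else 0"
  interpret T: maximal ?F by (rule truncation) (use c in simp)
  have "emeasure lborel {x. L \<le> maxf F \<rho> x} \<le> emeasure lborel {x. L / 4 < maxf ?F \<rho> x}"
  proof (rule emeasure_mono)
    show "{x. L \<le> maxf F \<rho> x} \<subseteq> {x. L / 4 < maxf ?F \<rho> x}"
    proof
      fix x assume "x \<in> {x. L \<le> maxf F \<rho> x}"
      moreover have "c * ?k = L / 2" using k by (simp add: c_def)
      ultimately show "x \<in> {x. L / 4 < maxf ?F \<rho> x}"
        using maxf_truncation[of c \<rho> x] assms c by simp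
    qed
    show "{x. L / 4 < maxf ?F \<rho> x} \<in> sets lborel"
      using T.borel_measurable_maxf[OF assms(1)] by measurable
  qed
  also have "\<dots> \<le> ennreal (weak_const TYPE('n) / (L / 4)) * (\<integral>\<^sup>+y. ennreal (?F y) \<partial>lborel)"
    using T.weak_type[OF assms(1), of "L / 4"] assms(2) by (simp add: weak_const_def)
  also have "\<dots> \<le> ennreal (weak_const TYPE('n) / (L / 4)) *
      (\<integral>\<^sup>+y. (if L \<le> 2 * ?k * F y then ennreal (F y) else 0) \<partial>lborel)"
  proof (intro mult_left_mono nn_integral_mono)
    fix y
    have "L \<le> 2 * ?k * F y" if "c < F y"
      using that k by (simp add: c_def divide_less_eq mult.commute)
    then show "ennreal (?F y) \<le> (if L \<le> 2 * ?k * F y then ennreal (F y) else 0)" by auto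
  qed simp
  finally show ?thesis by (simp add: mult.commute)
qed

text \<open>
  Marcinkiewicz interpolation between the weak type bound and the trivial bound for bounded
  functions: the layer cake formula turns the bound on superlevel sets into a double integral,
  which is evaluated in the other order.
\<close>
theorem strong_type:
  assumes "\<rho> > 0" "s > 1"
  shows "(\<integral>\<^sup>+x. ennreal (maxf F \<rho> x powr s) \<partial>lborel) \<le>
    ennreal (4 * weak_const TYPE('n) * s / (s - 1) * (2 * kernel_bound TYPE('n)) powr (s - 1)) *
    (\<integral>\<^sup>+x. ennreal (F x powr s) \<partial>lborel)"
proof -
  let ?k = "kernel_bound TYPE('n)" and ?W = "weak_const TYPE('n)"
  have k: "?k > 0" using kernel_bound_ge_1[where 'n='n] by linarith
  have W: "?W > 0" by (rule weak_const_pos)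
  have [measurable]: "maxf F \<rho> \<in> borel_measurable borel" by (rule borel_measurable_maxf[OF assms(1)])
  have "ennreal (maxf F \<rho> x powr s) =
      (\<integral>\<^sup>+L. ennreal s * (if 0 \<le> L \<and> L \<le> maxf F \<rho> x then ennreal (L powr (s - 1)) else 0) \<partial>lborel)" for x
    using layer_cake_below[of "s - 1" "maxf F \<rho> x"] maxf_nonneg[OF assms(1), of x] assms(2)
    by (subst nn_integral_cmult) (auto simp: ennreal_mult''[symmetric])
  then have "(\<integral>\<^sup>+x. ennreal (maxf F \<rho> x powr s) \<partial>lborel) =
      (\<integral>\<^sup>+x. \<integral>\<^sup>+L. ennreal s * (if 0 \<le> L \<and> L \<le> maxf F \<rho> x then ennreal (L powr (s - 1)) else 0) \<partial>lborel \<partial>lborel)"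
    by simp
  also have "\<dots> = (\<integral>\<^sup>+L. \<integral>\<^sup>+x. ennreal s * (if 0 \<le> L \<and> L \<le> maxf F \<rho> x then ennreal (L powr (s - 1)) else 0) \<partial>lborel \<partial>lborel)"
    by (rule lborel_pair.Fubini') measurable
  also have "\<dots> \<le> (\<integral>\<^sup>+L. \<integral>\<^sup>+y. ennreal (4 * ?W * s) * (ennreal (F y) *
      (if 0 \<le> L \<and> L \<le> 2 * ?k * F y then ennreal (L powr (s - 2)) else 0)) \<partial>lborel \<partial>lborel)"
  proof (rule nn_integral_mono)
    fix L :: real
    show "(\<integral>\<^sup>+x. ennreal s * (if 0 \<le> L \<and> L \<le> maxf F \<rho> x then ennreal (L powr (s - 1)) else 0) \<partial>lborel) \<le>
        (\<integral>\<^sup>+y. ennreal (4 * ?W * s) * (ennreal (F y) *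
          (if 0 \<le> L \<and> L \<le> 2 * ?k * F y then ennreal (L powr (s - 2)) else 0)) \<partial>lborel)"
    proof (cases "L > 0")
      case False
      then have "(if 0 \<le> L \<and> L \<le> maxf F \<rho> x then ennreal (L powr (s - 1)) else 0) = 0" for x by auto
      then show ?thesis by simp
    next
      case True
      have "(\<integral>\<^sup>+x. ennreal s * (if 0 \<le> L \<and> L \<le> maxf F \<rho> x then ennreal (L powr (s - 1)) else 0) \<partial>lborel) =
          (\<integral>\<^sup>+x. ennreal (s * L powr (s - 1)) * indicator {x. L \<le> maxf F \<rho> x} x \<partial>lborel)"
        using True assms(2) by (intro nn_integral_cong) (auto simp: indicator_def ennreal_mult)
      also have "\<dots> = ennreal (s * L powr (s - 1)) * emeasure lborel {x. L \<le> maxf F \<rho> x}"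
        by (subst nn_integral_cmult_indicator) auto
      also have "\<dots> \<le> ennreal (s * L powr (s - 1)) * (ennreal (4 * ?W / L) *
          (\<integral>\<^sup>+y. (if L \<le> 2 * ?k * F y then ennreal (F y) else 0) \<partial>lborel))"
        using maxf_superlevel[OF assms(1) True] by (intro mult_left_mono) auto
      also have "\<dots> = ennreal (4 * ?W * s * L powr (s - 2)) *
          (\<integral>\<^sup>+y. (if L \<le> 2 * ?k * F y then ennreal (F y) else 0) \<partial>lborel)"
      proof -
        have "L powr (s - 1) / L = L powr (s - 2)" using True by (simp add: powr_diff power2_eq_square)
        moreover have "s * L powr (s - 1) * (4 * ?W / L) = 4 * ?W * s * (L powr (s - 1) / L)" by simp
        ultimately have "s * L powr (s - 1) * (4 * ?W / L) = 4 * ?W * s * L powr (s - 2)" by (simp only:)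
        then show ?thesis using assms(2) W True
          by (simp add: mult.assoc[symmetric] ennreal_mult[symmetric])
      qed
      also have "\<dots> = (\<integral>\<^sup>+y. ennreal (4 * ?W * s * L powr (s - 2)) *
          (if L \<le> 2 * ?k * F y then ennreal (F y) else 0) \<partial>lborel)"
        by (rule nn_integral_cmult[symmetric]) measurable
      also have "\<dots> = (\<integral>\<^sup>+y. ennreal (4 * ?W * s) * (ennreal (F y) *
          (if 0 \<le> L \<and> L \<le> 2 * ?k * F y then ennreal (L powr (s - 2)) else 0)) \<partial>lborel)"
        using True assms(2) W by (intro nn_integral_cong) (auto simp: ennreal_mult mult_ac)
      finally show ?thesis .
    qed
  qed
  also have "\<dots> = (\<integral>\<^sup>+y. \<integral>\<^sup>+L. ennreal (4 * ?W * s) * (ennreal (F y) *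
      (if 0 \<le> L \<and> L \<le> 2 * ?k * F y then ennreal (L powr (s - 2)) else 0)) \<partial>lborel \<partial>lborel)"
    by (rule lborel_pair.Fubini') measurable
  also have "\<dots> = (\<integral>\<^sup>+y. ennreal (4 * ?W * s / (s - 1) * (2 * ?k) powr (s - 1)) * ennreal (F y powr s) \<partial>lborel)"
  proof (rule nn_integral_cong)
    fix y
    have "(\<integral>\<^sup>+L. ennreal (4 * ?W * s) * (ennreal (F y) *
        (if 0 \<le> L \<and> L \<le> 2 * ?k * F y then ennreal (L powr (s - 2)) else 0)) \<partial>lborel) =
        ennreal (4 * ?W * s) * (ennreal (F y) * ennreal ((2 * ?k * F y) powr (s - 1) / (s - 1)))"
      using layer_cake_below[of "s - 2" "2 * ?k * F y"] assms(2) k nonneg[of y]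
      by (simp add: nn_integral_cmult)
    also have "\<dots> = ennreal (4 * ?W * s * (F y * ((2 * ?k * F y) powr (s - 1) / (s - 1))))"
    proof -
      have P: "(2 * ?k * F y) powr (s - 1) / (s - 1) \<ge> 0" using assms(2) by simp
      show ?thesis
        by (simp only: ennreal_mult''[OF P] ennreal_mult''[OF mult_nonneg_nonneg[OF nonneg P]])
    qed
    also have "F y * ((2 * ?k * F y) powr (s - 1) / (s - 1)) = (2 * ?k) powr (s - 1) * F y powr s / (s - 1)"
    proof (cases "F y = 0")
      case False
      then have "F y > 0" using nonneg[of y] by simp
      then have "F y * F y powr (s - 1) = F y powr s" by (simp add: powr_diff)
      then show ?thesis using k \<open>F y > 0\<close> by (simp add: powr_mult mult_ac)
    qed simp
    finally show "(\<integral>\<^sup>+L. ennreal (4 * ?W * s) * (ennreal (F y) *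
        (if 0 \<le> L \<and> L \<le> 2 * ?k * F y then ennreal (L powr (s - 2)) else 0)) \<partial>lborel) =
        ennreal (4 * ?W * s / (s - 1) * (2 * ?k) powr (s - 1)) * ennreal (F y powr s)"
      using assms(2) W by (simp add: ennreal_mult[symmetric] mult_ac)
  qed
  also have "\<dots> = ennreal (4 * ?W * s / (s - 1) * (2 * ?k) powr (s - 1)) * (\<integral>\<^sup>+x. ennreal (F x powr s) \<partial>lborel)"
    by (rule nn_integral_cmult) measurable
  finally show ?thesis .
qed

lemma mollified_nn:
  assumes "\<rho> > 0"
  shows "ennreal (conv F (mollifier \<rho>) x) = (\<integral>\<^sup>+y. ennreal (F y * mollifier \<rho> (x - y)) \<partial>lborel)"
  unfolding conv_def
proof (rule nn_integral_eq_integral[symmetric])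
  show "integrable lborel (\<lambda>y. F y * mollifier \<rho> (x - y))"
    using mollifier_outside[OF assms]
    by (intro conv_integrable[OF integrable_imp_loc_integrable[OF int] C_k_continuous[OF C_k_mollifier]]) auto
qed (auto intro!: AE_I2 mult_nonneg_nonneg nonneg mollifier_nonneg)

lemma mollified_nonneg: "conv F (mollifier \<rho>) x \<ge> 0"
  unfolding conv_def using nonneg mollifier_nonneg
  by (intro Bochner_Integration.integral_nonneg mult_nonneg_nonneg) auto

lemma mollified_le_ballint:
  assumes "\<rho> > 0"
  shows "ennreal (conv F (mollifier \<rho>) x) \<le> ennreal (moll_bound TYPE('n) / \<rho> ^ CARD('n)) * ballint x \<rho>"
proof -
  have "ennreal (conv F (mollifier \<rho>) x) \<le>
      (\<integral>\<^sup>+y. ennreal (moll_bound TYPE('n) / \<rho> ^ CARD('n)) * (ennreal (F y) * indicator (cball x \<rho>) y) \<partial>lborel)"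
    unfolding mollified_nn[OF assms]
  proof (rule nn_integral_mono)
    fix y
    show "ennreal (F y * mollifier \<rho> (x - y)) \<le>
        ennreal (moll_bound TYPE('n) / \<rho> ^ CARD('n)) * (ennreal (F y) * indicator (cball x \<rho>) y)"
    proof (cases "y \<in> cball x \<rho>")
      case True
      have "F y * mollifier \<rho> (x - y) \<le> F y * (moll_bound TYPE('n) / \<rho> ^ CARD('n))"
        using nonneg mollifier_le[OF assms] by (intro mult_left_mono) auto
      then have "ennreal (F y * mollifier \<rho> (x - y)) \<le>
          ennreal (moll_bound TYPE('n) / \<rho> ^ CARD('n)) * ennreal (F y)"
        unfolding ennreal_mult''[OF nonneg, symmetric] by (intro ennreal_leI) (simp add: mult.commute)
      then show ?thesis using True by simp
    next
      case False
      then have "mollifier \<rho> (x - y) = 0" using assms by (intro mollifier_outside) (auto simp: dist_norm)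
      then show ?thesis by simp
    qed
  qed
  also have "\<dots> = ennreal (moll_bound TYPE('n) / \<rho> ^ CARD('n)) * ballint x \<rho>"
    unfolding ballint_def by (rule nn_integral_cmult[OF ballint_meas])
  finally show ?thesis .
qed

lemma mollified_le_maxf:
  assumes "\<rho> > 0"
  shows "conv F (mollifier \<rho>) x \<le> moll_bound TYPE('n) * maxf F \<rho> x"
proof -
  have "ennreal (conv F (mollifier \<rho>) x) \<le>
      ennreal (moll_bound TYPE('n) / \<rho> ^ CARD('n)) * ennreal (\<rho> ^ CARD('n) * maxf F \<rho> x)"
    using mollified_le_ballint[OF assms, of x] ballint_le_maxf[OF assms order_refl, of x]
    by (meson mult_left_mono order_trans zero_le)
  also have "\<dots> = ennreal (moll_bound TYPE('n) / \<rho> ^ CARD('n) * (\<rho> ^ CARD('n) * maxf F \<rho> x))"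
    using moll_bound_pos[where 'n='n] assms maxf_nonneg[OF assms, of x] by (intro ennreal_mult[symmetric]) auto
  finally have "ennreal (conv F (mollifier \<rho>) x) \<le> ennreal (moll_bound TYPE('n) * maxf F \<rho> x)"
    using assms by simp
  then show ?thesis
    using moll_bound_pos[where 'n='n] maxf_nonneg[OF assms, of x] by (subst (asm) ennreal_le_iff) auto
qed

text \<open>
  The truncated maximal function also controls averages over balls with radii below
  \<open>\<rho>\<close>, provided that \<open>F\<close> has been mollified at scale
  \<open>\<rho>\<close>. Large balls are treated by Fubini's theorem; on a small one the
  mollification is bounded pointwise by the average of \<open>F\<close> over the ball of radius
  \<open>2 * \<rho>\<close> with the same centre.
\<close>
lemma mollified_ball_le_maxf:
  assumes "\<rho> > 0" "r > 0"
  shows "(\<integral>\<^sup>+z. ennreal (conv F (mollifier \<rho>) z) * indicator (cball x r) z \<partial>lborel) \<le>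
    ennreal (avg_const TYPE('n) * (r ^ CARD('n) * maxf F \<rho> x))"
proof (cases "r \<ge> \<rho>")
  case True
  have [measurable]: "mollifier \<rho> \<in> borel_measurable (borel :: (real ^ 'n) measure)"
    by (intro borel_measurable_continuous_onI C_k_continuous[OF C_k_mollifier])
  have cb: "(\<lambda>z. indicator (cball x r) z :: ennreal) \<in> borel_measurable borel"
    by (intro borel_measurable_indicator) auto
  have "(\<integral>\<^sup>+z. ennreal (conv F (mollifier \<rho>) z) * indicator (cball x r) z \<partial>lborel) =
      (\<integral>\<^sup>+z. \<integral>\<^sup>+y. ennreal (F y * mollifier \<rho> (z - y)) * indicator (cball x r) z \<partial>lborel \<partial>lborel)"
    unfolding mollified_nn[OF assms(1)] by (intro nn_integral_cong nn_integral_multc[symmetric]) measurable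
  also have "\<dots> = (\<integral>\<^sup>+y. \<integral>\<^sup>+z. ennreal (F y * mollifier \<rho> (z - y)) * indicator (cball x r) z \<partial>lborel \<partial>lborel)"
    using cb by (intro lborel_pair.Fubini') (auto intro!: borel_measurable_times_ennreal measurable_compose[OF measurable_fst])
  also have "\<dots> \<le> (\<integral>\<^sup>+y. ennreal (F y) * indicator (cball x (r + \<rho>)) y \<partial>lborel)"
  proof (rule nn_integral_mono)
    fix y
    show "(\<integral>\<^sup>+z. ennreal (F y * mollifier \<rho> (z - y)) * indicator (cball x r) z \<partial>lborel) \<le>
        ennreal (F y) * indicator (cball x (r + \<rho>)) y"
    proof (cases "y \<in> cball x (r + \<rho>)")
      case True
      have "(\<integral>\<^sup>+z. ennreal (F y * mollifier \<rho> (z - y)) * indicator (cball x r) z \<partial>lborel) \<le>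
          (\<integral>\<^sup>+z. ennreal (F y) * ennreal (mollifier \<rho> (z - y)) \<partial>lborel)"
        by (intro nn_integral_mono) (auto simp: indicator_def ennreal_mult'' mollifier_nonneg)
      also have "\<dots> = ennreal (F y) * (\<integral>\<^sup>+z. ennreal (mollifier \<rho> (z - y)) \<partial>lborel)"
        by (rule nn_integral_cmult) measurable
      also have "(\<integral>\<^sup>+z. ennreal (mollifier \<rho> (z - y)) \<partial>lborel) = ennreal (\<integral>z. mollifier \<rho> (z + - y) \<partial>lborel)"
      proof -
        have "integrable lborel (mollifier \<rho> :: real ^ 'n \<Rightarrow> real)"
          using mollifier_outside[OF assms(1)]
          by (intro integrable_compact_support[OF C_k_continuous[OF C_k_mollifier]]) auto
        from integral_lborel_shift(2)[OF this, of "- y"] show ?thesis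
          by (subst nn_integral_eq_integral) (auto simp: mollifier_nonneg)
      qed
      also have "\<dots> = 1" unfolding integral_lborel_shift(1) by (simp add: integral_mollifier[OF assms(1)])
      finally show ?thesis using True by simp
    next
      case False
      have "ennreal (F y * mollifier \<rho> (z - y)) * indicator (cball x r) z = 0" for z
      proof (cases "z \<in> cball x r")
        case True
        then have "dist z y > \<rho>" using False dist_triangle[of x y z] by simp
        then have "mollifier \<rho> (z - y) = 0" using assms(1) by (intro mollifier_outside) (auto simp: dist_norm)
        then show ?thesis by simp
      qed simp
      then have "(\<integral>\<^sup>+z. ennreal (F y * mollifier \<rho> (z - y)) * indicator (cball x r) z \<partial>lborel) =
          (\<integral>\<^sup>+z. 0 \<partial>(lborel :: (real ^ 'n) measure))"
        by (rule nn_integral_cong)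
      then show ?thesis by simp
    qed
  qed
  also have "\<dots> = ballint x (r + \<rho>)" by (simp add: ballint_def)
  also have "\<dots> \<le> ballint x (2 * r)" using True by (intro ballint_mono subset_cball) simp
  also have "\<dots> \<le> ennreal ((2 * r) ^ CARD('n) * maxf F \<rho> x)" using True assms by (intro ballint_le_maxf) auto
  also have "\<dots> \<le> ennreal (avg_const TYPE('n) * (r ^ CARD('n) * maxf F \<rho> x))"
  proof (rule ennreal_leI)
    have "2 ^ CARD('n) \<le> avg_const TYPE('n)"
      unfolding avg_const_def using moll_bound_pos[where 'n='n] by (simp add: algebra_simps)
    then have "2 ^ CARD('n) * (r ^ CARD('n) * maxf F \<rho> x) \<le> avg_const TYPE('n) * (r ^ CARD('n) * maxf F \<rho> x)"
      using assms maxf_nonneg[OF assms(1), of x] by (intro mult_right_mono mult_nonneg_nonneg) auto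
    then show "(2 * r) ^ CARD('n) * maxf F \<rho> x \<le> avg_const TYPE('n) * (r ^ CARD('n) * maxf F \<rho> x)"
      by (simp add: power_mult_distrib mult.assoc)
  qed
  finally show ?thesis .
next
  case False
  let ?c = "moll_bound TYPE('n) * 2 ^ CARD('n) * maxf F \<rho> x"
  have c: "?c \<ge> 0" using moll_bound_pos[where 'n='n] maxf_nonneg[OF assms(1), of x] by simp
  have le: "ennreal (conv F (mollifier \<rho>) z) \<le> ennreal ?c" if "z \<in> cball x r" for z
  proof -
    have "cball z \<rho> \<subseteq> cball x (2 * \<rho>)"
    proof
      fix w assume "w \<in> cball z \<rho>"
      then show "w \<in> cball x (2 * \<rho>)" using that False dist_triangle[of x w z] by simp
    qed
    then have "ballint z \<rho> \<le> ennreal ((2 * \<rho>) ^ CARD('n) * maxf F \<rho> x)"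
      using ballint_mono[of z \<rho> x "2 * \<rho>"] ballint_le_maxf[of \<rho> "2 * \<rho>" x] assms(1) by simp
    then have "ennreal (moll_bound TYPE('n) / \<rho> ^ CARD('n)) * ballint z \<rho> \<le>
        ennreal (moll_bound TYPE('n) / \<rho> ^ CARD('n)) * ennreal ((2 * \<rho>) ^ CARD('n) * maxf F \<rho> x)"
      by (intro mult_left_mono) auto
    also have "\<dots> = ennreal (moll_bound TYPE('n) / \<rho> ^ CARD('n) * ((2 * \<rho>) ^ CARD('n) * maxf F \<rho> x))"
      using moll_bound_pos[where 'n='n] assms maxf_nonneg[OF assms(1), of x]
      by (intro ennreal_mult[symmetric] mult_nonneg_nonneg) auto
    also have "moll_bound TYPE('n) / \<rho> ^ CARD('n) * ((2 * \<rho>) ^ CARD('n) * maxf F \<rho> x) = ?c"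
      using assms(1) by (simp add: power_mult_distrib)
    finally show ?thesis using mollified_le_ballint[OF assms(1), of z] by simp
  qed
  have "(\<integral>\<^sup>+z. ennreal (conv F (mollifier \<rho>) z) * indicator (cball x r) z \<partial>lborel) \<le>
      (\<integral>\<^sup>+z. ennreal ?c * indicator (cball x r) z \<partial>lborel)"
    using le by (intro nn_integral_mono) (auto simp: indicator_def)
  also have "\<dots> = ennreal ?c * ennreal (ball_vol TYPE('n) * r ^ CARD('n))"
    using assms(2) by (subst nn_integral_cmult_indicator) (auto simp: emeasure_cball_vec)
  also have "\<dots> = ennreal (?c * (ball_vol TYPE('n) * r ^ CARD('n)))"
    using c assms(2) by (intro ennreal_mult[symmetric]) auto
  also have "\<dots> \<le> ennreal (avg_const TYPE('n) * (r ^ CARD('n) * maxf F \<rho> x))"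
  proof (rule ennreal_leI)
    have "moll_bound TYPE('n) * 2 ^ CARD('n) * ball_vol TYPE('n) \<le> avg_const TYPE('n)"
      unfolding avg_const_def by (simp add: algebra_simps)
    then have "moll_bound TYPE('n) * 2 ^ CARD('n) * ball_vol TYPE('n) * (r ^ CARD('n) * maxf F \<rho> x) \<le>
        avg_const TYPE('n) * (r ^ CARD('n) * maxf F \<rho> x)"
      using assms maxf_nonneg[OF assms(1), of x] by (intro mult_right_mono mult_nonneg_nonneg) auto
    then show "?c * (ball_vol TYPE('n) * r ^ CARD('n)) \<le> avg_const TYPE('n) * (r ^ CARD('n) * maxf F \<rho> x)"
      by (simp add: mult_ac)
  qed
  finally show ?thesis .
qed

end

section \<open>Lipschitz bounds from averages\<close>

text \<open>
  Only averages centred at \<open>x\<close> enter. The difference \<open>v z - v x\<close> is an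
  integral over the segment from \<open>x\<close> to \<open>z\<close>; for each parameter
  \<open>t\<close>, the dilation with factor \<open>t\<close> about \<open>x\<close> turns the
  integral over \<open>z\<close> into one over the ball of radius \<open>t * r\<close>, and the
  Jacobian of the dilation compensates for its smaller volume.
\<close>
lemma poincare_ball:
  fixes v H :: "real ^ 'n::finite \<Rightarrow> real"
  assumes v: "C_k 1 v" and Hm: "H \<in> borel_measurable borel" and H: "\<And>z. norm (gradient v z) \<le> H z"
    and avg: "\<And>r. r > 0 \<Longrightarrow> (\<integral>\<^sup>+z. ennreal (H z) * indicator (cball x r) z \<partial>lborel) \<le> ennreal (r ^ CARD('n) * a)"
    and "r > 0"
  shows "(\<integral>\<^sup>+z. ennreal \<bar>v z - v x\<bar> * indicator (cball x r) z \<partial>lborel) \<le> ennreal (r ^ (CARD('n) + 1) * a)"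
proof -
  note [measurable] = Hm
  have H0: "H z \<ge> 0" for z using H[of z] norm_ge_zero order_trans by blast
  have cont: "continuous_on UNIV (gradient v)"
    using v by (auto simp: gradient_def[abs_def] intro!: continuous_on_vec_lambda)
  have cb: "(\<lambda>z. indicator (cball x r) z :: ennreal) \<in> borel_measurable borel"
    by (intro borel_measurable_indicator) auto
  have line: "ennreal \<bar>v z - v x\<bar> \<le> (\<integral>\<^sup>+t. ennreal (r * H (x + t *\<^sub>R (z - x))) * indicator {0..1} t \<partial>lborel)"
    if z: "z \<in> cball x r" for z
  proof -
    let ?g = "\<lambda>t. gradient v (x + t *\<^sub>R (z - x)) \<bullet> (z - x)"
    have der: "((\<lambda>t. v (x + t *\<^sub>R (z - x))) has_vector_derivative ?g t) (at t within {0..1})" for t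
    proof -
      have "((\<lambda>t. x + t *\<^sub>R (z - x)) has_derivative (\<lambda>h. h *\<^sub>R (z - x))) (at t)"
        by (auto intro!: derivative_eq_intros)
      moreover have "(v has_derivative (\<lambda>h. gradient v (x + t *\<^sub>R (z - x)) \<bullet> h)) (at (x + t *\<^sub>R (z - x)))"
        using v by (intro has_derivative_gradient C_k_differentiable[of 0]) simp
      ultimately have "((\<lambda>t. v (x + t *\<^sub>R (z - x))) has_derivative (\<lambda>h. gradient v (x + t *\<^sub>R (z - x)) \<bullet> (h *\<^sub>R (z - x)))) (at t)"
        by (rule has_derivative_compose)
      then have "((\<lambda>t. v (x + t *\<^sub>R (z - x))) has_derivative (\<lambda>h. gradient v (x + t *\<^sub>R (z - x)) \<bullet> (h *\<^sub>R (z - x)))) (at t within {0..1})"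
        by (rule has_derivative_at_withinI)
      then show ?thesis by (simp add: has_vector_derivative_def)
    qed
    have contg: "continuous_on {0..1} ?g"
      by (intro continuous_intros continuous_on_compose2[OF cont]) auto
    have ig: "integrable lborel (\<lambda>t. indicator {0..1} t *\<^sub>R ?g t)"
      by (intro borel_integrable_compact contg) auto
    have "v z - v x = (\<integral>t. indicator {0..1} t *\<^sub>R ?g t \<partial>lborel)"
      using integral_FTC_Icc[of 0 1 "\<lambda>t. v (x + t *\<^sub>R (z - x))" ?g] der contg by simp
    then have "ennreal \<bar>v z - v x\<bar> \<le> (\<integral>\<^sup>+t. ennreal (norm (indicator {0..1} t *\<^sub>R ?g t)) \<partial>lborel)"
      using integral_norm_bound_ennreal[OF ig] by simp
    also have "\<dots> \<le> (\<integral>\<^sup>+t. ennreal (r * H (x + t *\<^sub>R (z - x))) * indicator {0..1} t \<partial>lborel)"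
    proof (rule nn_integral_mono)
      fix t :: real
      have "\<bar>?g t\<bar> \<le> norm (gradient v (x + t *\<^sub>R (z - x))) * norm (z - x)" by (rule Cauchy_Schwarz_ineq2)
      also have "\<dots> \<le> H (x + t *\<^sub>R (z - x)) * r"
        using z H H0 by (intro mult_mono) (auto simp: dist_norm norm_minus_commute)
      finally show "ennreal (norm (indicator {0..1} t *\<^sub>R ?g t)) \<le> ennreal (r * H (x + t *\<^sub>R (z - x))) * indicator {0..1} t"
        by (auto simp: indicator_def mult.commute intro: ennreal_leI)
    qed
    finally show ?thesis .
  qed
  have slice: "(\<integral>\<^sup>+z. ennreal (r * H (x + t *\<^sub>R (z - x))) * indicator (cball x r) z \<partial>lborel) \<le> ennreal (r ^ (CARD('n) + 1) * a)"
    if t: "t > 0" for t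
  proof -
    let ?f = "\<lambda>w. ennreal (H w) * indicator (cball x (t * r)) w"
    have fm: "?f \<in> borel_measurable borel" by (intro borel_measurable_times_ennreal borel_measurable_indicator) auto
    have "(\<integral>\<^sup>+w. ?f w \<partial>lborel) = ennreal (t ^ CARD('n)) * (\<integral>\<^sup>+z. ?f ((x - t *\<^sub>R x) + t *\<^sub>R z) \<partial>lborel)"
      using nn_integral_lborel_affine[OF fm t, of "x - t *\<^sub>R x"] by simp
    also have "(\<lambda>z. ?f ((x - t *\<^sub>R x) + t *\<^sub>R z)) = (\<lambda>z. ennreal (H (x + t *\<^sub>R (z - x))) * indicator (cball x r) z)"
    proof
      fix z
      have e: "(x - t *\<^sub>R x) + t *\<^sub>R z = x + t *\<^sub>R (z - x)" by (simp add: scaleR_right_diff_distrib)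
      have "dist x (x + t *\<^sub>R (z - x)) = t * dist x z"
        using t by (simp add: dist_norm norm_minus_commute)
      then show "?f ((x - t *\<^sub>R x) + t *\<^sub>R z) = ennreal (H (x + t *\<^sub>R (z - x))) * indicator (cball x r) z"
        unfolding e using t by (simp add: indicator_def)
    qed
    finally have eq: "(\<integral>\<^sup>+w. ?f w \<partial>lborel) =
        ennreal (t ^ CARD('n)) * (\<integral>\<^sup>+z. ennreal (H (x + t *\<^sub>R (z - x))) * indicator (cball x r) z \<partial>lborel)" .
    have "(\<integral>\<^sup>+z. ennreal (H (x + t *\<^sub>R (z - x))) * indicator (cball x r) z \<partial>lborel) =
        ennreal (inverse (t ^ CARD('n))) * (\<integral>\<^sup>+w. ?f w \<partial>lborel)"
      unfolding eq mult.assoc[symmetric] using t by (simp add: ennreal_mult[symmetric])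
    also have "\<dots> \<le> ennreal (inverse (t ^ CARD('n))) * ennreal ((t * r) ^ CARD('n) * a)"
      using avg[of "t * r"] t \<open>r > 0\<close> by (intro mult_left_mono) auto
    also have "\<dots> = ennreal (inverse (t ^ CARD('n)) * ((t * r) ^ CARD('n) * a))"
      using t by (intro ennreal_mult'[symmetric]) auto
    also have "inverse (t ^ CARD('n)) * ((t * r) ^ CARD('n) * a) = r ^ CARD('n) * a"
      using t by (simp add: power_mult_distrib field_simps)
    finally have *: "(\<integral>\<^sup>+z. ennreal (H (x + t *\<^sub>R (z - x))) * indicator (cball x r) z \<partial>lborel) \<le> ennreal (r ^ CARD('n) * a)" .
    have "(\<integral>\<^sup>+z. ennreal (r * H (x + t *\<^sub>R (z - x))) * indicator (cball x r) z \<partial>lborel) =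
        (\<integral>\<^sup>+z. ennreal r * (ennreal (H (x + t *\<^sub>R (z - x))) * indicator (cball x r) z) \<partial>lborel)"
      using \<open>r > 0\<close> H0 by (simp add: ennreal_mult mult.assoc)
    also have "\<dots> = ennreal r * (\<integral>\<^sup>+z. ennreal (H (x + t *\<^sub>R (z - x))) * indicator (cball x r) z \<partial>lborel)"
      using cb by (intro nn_integral_cmult borel_measurable_times_ennreal) auto
    also have "\<dots> \<le> ennreal r * ennreal (r ^ CARD('n) * a)" using * by (intro mult_left_mono) auto
    also have "\<dots> = ennreal (r ^ (CARD('n) + 1) * a)"
      using \<open>r > 0\<close> by (simp add: ennreal_mult'[symmetric] mult.assoc)
    finally show ?thesis .
  qed
  have "(\<integral>\<^sup>+z. ennreal \<bar>v z - v x\<bar> * indicator (cball x r) z \<partial>lborel) \<le>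
      (\<integral>\<^sup>+z. \<integral>\<^sup>+t. ennreal (r * H (x + t *\<^sub>R (z - x))) * indicator {0..1} t * indicator (cball x r) z \<partial>lborel \<partial>lborel)"
  proof (rule nn_integral_mono)
    fix z
    show "ennreal \<bar>v z - v x\<bar> * indicator (cball x r) z \<le>
        (\<integral>\<^sup>+t. ennreal (r * H (x + t *\<^sub>R (z - x))) * indicator {0..1} t * indicator (cball x r) z \<partial>lborel)"
      using line[of z] by (cases "z \<in> cball x r") auto
  qed
  also have "\<dots> = (\<integral>\<^sup>+t. \<integral>\<^sup>+z. ennreal (r * H (x + t *\<^sub>R (z - x))) * indicator {0..1} t * indicator (cball x r) z \<partial>lborel \<partial>lborel)"
    using cb by (intro lborel_pair.Fubini') (auto intro!: borel_measurable_times_ennreal measurable_compose[OF measurable_fst] measurable_compose[OF measurable_snd])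
  also have "\<dots> \<le> (\<integral>\<^sup>+t. ennreal (r ^ (CARD('n) + 1) * a) * indicator {0..1 :: real} t \<partial>lborel)"
  proof (rule nn_integral_mono_AE)
    have "AE t in lborel. t \<noteq> (0 :: real)" by (rule AE_lborel_singleton)
    then show "AE t in lborel. (\<integral>\<^sup>+z. ennreal (r * H (x + t *\<^sub>R (z - x))) * indicator {0..1} t * indicator (cball x r) z \<partial>lborel)
        \<le> ennreal (r ^ (CARD('n) + 1) * a) * indicator {0..1 :: real} t"
    proof (rule AE_mp, intro AE_I2 impI)
      fix t :: real assume "t \<noteq> 0"
      then show "(\<integral>\<^sup>+z. ennreal (r * H (x + t *\<^sub>R (z - x))) * indicator {0..1} t * indicator (cball x r) z \<partial>lborel)
        \<le> ennreal (r ^ (CARD('n) + 1) * a) * indicator {0..1 :: real} t"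
        using slice[of t] by (cases "t \<in> {0..1}") auto
    qed
  qed
  also have "\<dots> = ennreal (r ^ (CARD('n) + 1) * a)" by (subst nn_integral_cmult_indicator) auto
  finally show ?thesis .
qed

text \<open>
  The ball about the midpoint with radius half the distance lies in both balls of radius
  \<open>norm (x - y)\<close>. Averaging \<open>\<bar>v x - v y\<bar> \<le> \<bar>v z - v x\<bar>
  + \<bar>v z - v y\<bar>\<close> over \<open>z\<close> in it reduces the claim to two
  applications of \<open>poincare_ball\<close>.
\<close>
theorem pointwise_lipschitz:
  fixes v H :: "real ^ 'n::finite \<Rightarrow> real"
  assumes v: "C_k 1 v" and Hm: "H \<in> borel_measurable borel" and H: "\<And>z. norm (gradient v z) \<le> H z"
    and a: "a \<ge> 0"
    and avg: "\<And>r. r > 0 \<Longrightarrow> (\<integral>\<^sup>+z. ennreal (H z) * indicator (cball x r) z \<partial>lborel) \<le> ennreal (r ^ CARD('n) * a)"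
      "\<And>r. r > 0 \<Longrightarrow> (\<integral>\<^sup>+z. ennreal (H z) * indicator (cball y r) z \<partial>lborel) \<le> ennreal (r ^ CARD('n) * a)"
  shows "\<bar>v x - v y\<bar> \<le> 2 ^ (CARD('n) + 1) / ball_vol TYPE('n) * a * norm (x - y)"
proof (cases "x = y")
  case False
  define r where "r = norm (x - y)"
  define c where "c = midpoint x y"
  let ?V = "ball_vol TYPE('n)"
  have r: "r > 0" using False by (simp add: r_def)
  have V: "?V > 0" using content_unit_ball_pos by blast
  have [measurable]: "v \<in> borel_measurable borel"
    using C_k_continuous[OF v] by (rule borel_measurable_continuous_onI)
  have sub: "cball c (r / 2) \<subseteq> cball x r" "cball c (r / 2) \<subseteq> cball y r"
  proof -
    have "dist x c = dist x y / 2" "dist y c = dist x y / 2"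
      by (auto simp: c_def dist_midpoint dist_commute)
    then have "dist x c = r / 2" "dist y c = r / 2" by (auto simp: r_def dist_norm)
    then have "dist x z \<le> r \<and> dist y z \<le> r" if "dist c z \<le> r / 2" for z
      using dist_triangle[of x z c] dist_triangle[of y z c] that by linarith
    then show "cball c (r / 2) \<subseteq> cball x r" "cball c (r / 2) \<subseteq> cball y r" by auto
  qed
  have m: "(\<lambda>z. ennreal \<bar>v z - v w\<bar> * indicator (cball w r) z) \<in> borel_measurable lborel" for w
    by (intro borel_measurable_times_ennreal borel_measurable_indicator) auto
  have "ennreal (\<bar>v x - v y\<bar> * (?V * (r / 2) ^ CARD('n))) = ennreal \<bar>v x - v y\<bar> * emeasure lborel (cball c (r / 2))"
    using r V by (simp add: emeasure_cball_vec ennreal_mult)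
  also have "\<dots> = (\<integral>\<^sup>+z. ennreal \<bar>v x - v y\<bar> * indicator (cball c (r / 2)) z \<partial>lborel)"
    by (subst nn_integral_cmult_indicator) auto
  also have "\<dots> \<le> (\<integral>\<^sup>+z. ennreal \<bar>v z - v x\<bar> * indicator (cball x r) z + ennreal \<bar>v z - v y\<bar> * indicator (cball y r) z \<partial>lborel)"
  proof (rule nn_integral_mono)
    fix z
    show "ennreal \<bar>v x - v y\<bar> * indicator (cball c (r / 2)) z \<le>
        ennreal \<bar>v z - v x\<bar> * indicator (cball x r) z + ennreal \<bar>v z - v y\<bar> * indicator (cball y r) z"
    proof (cases "z \<in> cball c (r / 2)")
      case True
      then have "z \<in> cball x r" "z \<in> cball y r" using sub by blast+
      moreover have "ennreal \<bar>v x - v y\<bar> \<le> ennreal (\<bar>v z - v x\<bar> + \<bar>v z - v y\<bar>)"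
        by (intro ennreal_leI) linarith
      ultimately show ?thesis using True by (simp add: ennreal_plus[symmetric] del: ennreal_plus)
    qed simp
  qed
  also have "\<dots> = (\<integral>\<^sup>+z. ennreal \<bar>v z - v x\<bar> * indicator (cball x r) z \<partial>lborel) +
      (\<integral>\<^sup>+z. ennreal \<bar>v z - v y\<bar> * indicator (cball y r) z \<partial>lborel)"
    by (rule nn_integral_add[OF m m])
  also have "\<dots> \<le> ennreal (r ^ (CARD('n) + 1) * a) + ennreal (r ^ (CARD('n) + 1) * a)"
    using poincare_ball[OF v Hm H avg(1) r] poincare_ball[OF v Hm H avg(2) r] by (intro add_mono) auto
  also have "\<dots> = ennreal (2 * (r ^ (CARD('n) + 1) * a))"
    using r a by (simp add: ennreal_plus[symmetric] del: ennreal_plus)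
  finally have "\<bar>v x - v y\<bar> * (?V * (r / 2) ^ CARD('n)) \<le> 2 * (r ^ (CARD('n) + 1) * a)"
    using r a by (subst (asm) ennreal_le_iff) auto
  then have "\<bar>v x - v y\<bar> * ?V \<le> 2 ^ (CARD('n) + 1) * a * r"
    using r by (simp add: power_divide field_simps)
  then show ?thesis using V by (simp add: r_def field_simps)
qed simp

section \<open>Lipschitz truncation\<close>

lemma integral_lborel_reflect:
  fixes f :: "'a::euclidean_space \<Rightarrow> real"
  assumes "f \<in> borel_measurable borel"
  shows "(\<integral>y. f (x - y) \<partial>lborel) = (\<integral>y. f y \<partial>lborel)"
proof -
  have "lborel = density (distr lborel borel (\<lambda>z. x + (-1) *\<^sub>R z)) (\<lambda>_. ennreal (\<bar>-1\<bar> ^ DIM('a)))"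
    using lborel_affine[of "-1" x] by simp
  then have d: "lborel = distr lborel borel (\<lambda>z :: 'a. x - z)" by (simp add: density_1)
  have "(\<integral>y. f y \<partial>lborel) = (\<integral>y. f y \<partial>distr lborel borel (\<lambda>z. x - z))" using d by simp
  also have "\<dots> = (\<integral>y. f (x - y) \<partial>lborel)" using assms by (subst integral_distr) auto
  finally show ?thesis ..
qed

lemma conv_commute:
  assumes "u \<in> borel_measurable borel" "k \<in> borel_measurable borel"
  shows "conv u k x = (\<integral>y. u (x - y) * k y \<partial>lborel)"
proof -
  note [measurable] = assms
  show ?thesis
    unfolding conv_def using integral_lborel_reflect[of "\<lambda>y. u (x - y) * k y" x] by simp
qed

lemma mollifier_measurable[measurable]: "mollifier r \<in> borel_measurable borel"
  by (intro borel_measurable_continuous_onI C_k_continuous[OF C_k_mollifier])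

lemma integrable_mollifier:
  assumes "r > 0"
  shows "integrable lborel (mollifier r :: real ^ 'n::finite \<Rightarrow> real)"
  using mollifier_outside[OF assms]
  by (intro integrable_compact_support[OF C_k_continuous[OF C_k_mollifier]]) auto

lemma mollify_integrable:
  fixes u :: "real ^ 'n::finite \<Rightarrow> real"
  assumes "continuous_on UNIV u" "r > 0"
  shows "integrable lborel (\<lambda>y. u (x - y) * mollifier r y)"
proof -
  have "continuous_on UNIV (\<lambda>y. u (x - y) * mollifier r y)"
    using assms(1) C_k_continuous[OF C_k_mollifier]
    by (intro continuous_intros) (auto intro!: continuous_on_compose2[OF assms(1)] continuous_intros)
  then show ?thesis
    by (rule integrable_compact_support) (use mollifier_outside[OF assms(2)] in auto)
qed

lemma mollify_close:
  fixes w :: "real ^ 'n::finite \<Rightarrow> real"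
  assumes w: "continuous_on UNIV w" and r: "r > 0" and close: "\<And>y. norm y \<le> r \<Longrightarrow> \<bar>w (x - y) - c\<bar> \<le> e"
  shows "\<bar>conv w (mollifier r) x - c\<bar> \<le> e"
proof -
  note [measurable] = borel_measurable_continuous_onI[OF w]
  have im: "integrable lborel (mollifier r :: real ^ 'n \<Rightarrow> real)" by (rule integrable_mollifier[OF r])
  have "conv w (mollifier r) x - c = (\<integral>y. w (x - y) * mollifier r y \<partial>lborel) - c * (\<integral>y. mollifier r (y :: real ^ 'n) \<partial>lborel)"
    using integral_mollifier[OF r, where 'n='n] by (simp add: conv_commute)
  also have "\<dots> = (\<integral>y. w (x - y) * mollifier r y - c * mollifier r y \<partial>lborel)"
    using mollify_integrable[OF w r, of x] im by simp
  also have "norm \<dots> \<le> (\<integral>y. e * mollifier r (y :: real ^ 'n) \<partial>lborel)"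
  proof (rule norm_lebesgue_integral_le)
    show "integrable lborel (\<lambda>y. w (x - y) * mollifier r y - c * mollifier r y)"
      using mollify_integrable[OF w r, of x] im by simp
    show "norm (w (x - y) * mollifier r y - c * mollifier r y) \<le> e * mollifier r y" for y
    proof (cases "norm y \<le> r")
      case True
      have "norm (w (x - y) * mollifier r y - c * mollifier r y) = \<bar>w (x - y) - c\<bar> * mollifier r y"
        using mollifier_nonneg[of r y] by (simp add: left_diff_distrib[symmetric] abs_mult)
      also have "\<dots> \<le> e * mollifier r y" using close[OF True] mollifier_nonneg by (rule mult_right_mono)
      finally show ?thesis .
    qed (simp add: mollifier_outside[OF r])
  qed (use im in simp)
  also have "\<dots> = e" using integral_mollifier[OF r, where 'n='n] by simp
  finally show ?thesis by simp
qed

lemma mollify_lipschitz: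
  fixes h :: "real ^ 'n::finite \<Rightarrow> real"
  assumes lip: "\<And>x y. \<bar>h x - h y\<bar> \<le> C * norm (x - y)" and r: "r > 0"
  shows "\<bar>conv h (mollifier r) x - conv h (mollifier r) z\<bar> \<le> C * norm (x - z)"
proof -
  have C: "C \<ge> 0"
  proof -
    have "0 \<le> C * norm (axis undefined 1 - 0 :: real ^ 'n)"
      using lip[of "axis undefined 1" 0] abs_ge_zero order_trans by blast
    then show ?thesis by simp
  qed
  have "C-lipschitz_on UNIV h" using lip C by (intro lipschitz_onI) (auto simp: dist_norm)
  then have h: "continuous_on UNIV h" by (rule lipschitz_on_continuous_on)
  note [measurable] = borel_measurable_continuous_onI[OF h]
  have "conv h (mollifier r) x - conv h (mollifier r) z =
      (\<integral>y. h (x - y) * mollifier r y - h (z - y) * mollifier r y \<partial>lborel)"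
    using mollify_integrable[OF h r] by (simp add: conv_commute)
  also have "norm \<dots> \<le> (\<integral>y. (C * norm (x - z)) * mollifier r (y :: real ^ 'n) \<partial>lborel)"
  proof (rule norm_lebesgue_integral_le)
    show "integrable lborel (\<lambda>y. h (x - y) * mollifier r y - h (z - y) * mollifier r y)"
      using mollify_integrable[OF h r] by simp
    show "integrable lborel (\<lambda>y. (C * norm (x - z)) * mollifier r (y :: real ^ 'n))"
      using integrable_mollifier[OF r, where 'n='n] by simp
    fix y :: "real ^ 'n"
    have "norm (h (x - y) * mollifier r y - h (z - y) * mollifier r y) = \<bar>h (x - y) - h (z - y)\<bar> * mollifier r y"
      using mollifier_nonneg[of r y] by (simp add: left_diff_distrib[symmetric] abs_mult)
    also have "\<dots> \<le> (C * norm (x - z)) * mollifier r y"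
      using lip[of "x - y" "z - y"] mollifier_nonneg[of r y] by (intro mult_right_mono) auto
    finally show "norm (h (x - y) * mollifier r y - h (z - y) * mollifier r y) \<le> (C * norm (x - z)) * mollifier r y" .
  qed
  also have "\<dots> = C * norm (x - z)" using integral_mollifier[OF r, where 'n='n] by simp
  finally show ?thesis by simp
qed

lemma derivative_le_lipschitz:
  fixes f :: "'a::real_normed_vector \<Rightarrow> real"
  assumes "(f has_derivative f') (at x)" "\<And>y. \<bar>f y - f x\<bar> \<le> C * norm (y - x)"
  shows "\<bar>f' v\<bar> \<le> C * norm v"
proof (rule field_le_epsilon)
  fix e :: real assume e: "e > 0"
  define e' where "e' = e / (norm v + 1)"
  have e': "e' > 0" "e' * norm v \<le> e"
    using absorb_quotient[OF e, of 1 "norm v"] divide_pos_pos[OF e add_nonneg_pos[OF norm_ge_zero[of v] zero_less_one]]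
    by (auto simp: e'_def)
  obtain d where d: "d > 0" "\<forall>y. norm (y - x) < d \<longrightarrow> norm (f y - f x - f' (y - x)) \<le> e' * norm (y - x)"
    using assms(1) e'(1) unfolding has_derivative_at_alt by blast
  define t where "t = d / (2 * (norm v + 1))"
  have t: "t > 0" using d(1) by (simp add: t_def add_nonneg_pos)
  have "t * norm v < d"
  proof -
    have "t * norm v \<le> t * (norm v + 1)" using t by simp
    also have "\<dots> = d / 2" unfolding t_def using add_nonneg_pos[OF norm_ge_zero[of v] zero_less_one] by (simp add: field_simps)
    finally show ?thesis using d(1) by simp
  qed
  then have "norm (f (x + t *\<^sub>R v) - f x - f' (t *\<^sub>R v)) \<le> e' * (t * norm v)"
    using d(2)[rule_format, of "x + t *\<^sub>R v"] t by simp
  moreover have "\<bar>f (x + t *\<^sub>R v) - f x\<bar> \<le> C * (t * norm v)" using assms(2)[of "x + t *\<^sub>R v"] t by simp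
  moreover have "f' (t *\<^sub>R v) = t * f' v"
    using has_derivative_linear[OF assms(1)] by (simp add: linear_scale)
  ultimately have "\<bar>t * f' v\<bar> \<le> (C * norm v + e' * norm v) * t" by (simp add: algebra_simps abs_le_iff)
  then have "\<bar>f' v\<bar> * t \<le> (C * norm v + e' * norm v) * t" using t by (simp add: abs_mult mult.commute)
  then have "\<bar>f' v\<bar> \<le> C * norm v + e' * norm v" using t by simp
  then show "\<bar>f' v\<bar> \<le> C * norm v + e" using e'(2) by simp
qed

text \<open>
  McShane's extension.
\<close>
lemma lipschitz_extension:
  fixes f :: "'a::metric_space \<Rightarrow> real"
  assumes "U \<noteq> {}" "C \<ge> 0" "\<And>x y. x \<in> U \<Longrightarrow> y \<in> U \<Longrightarrow> \<bar>f x - f y\<bar> \<le> C * dist x y"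
  shows "\<exists>h. (\<forall>x\<in>U. h x = f x) \<and> (\<forall>x y. \<bar>h x - h y\<bar> \<le> C * dist x y)"
proof -
  define h where "h x = (INF y\<in>U. f y + C * dist x y)" for x
  obtain z where z: "z \<in> U" using assms(1) by blast
  have bdd: "bdd_below ((\<lambda>y. f y + C * dist x y) ` U)" for x
  proof (rule bdd_belowI2[where m="f z - C * dist z x"])
    fix y assume "y \<in> U"
    then have "f z - f y \<le> C * dist z y" using assms(3)[OF z] by fastforce
    also have "\<dots> \<le> C * (dist z x + dist x y)" using assms(2) by (intro mult_left_mono dist_triangle) auto
    finally show "f z - C * dist z x \<le> f y + C * dist x y" by (simp add: algebra_simps)
  qed
  have le: "h x \<le> h y + C * dist x y" for x y
  proof -
    have "h x - C * dist x y \<le> h y"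
      unfolding h_def[of y]
    proof (rule cINF_greatest[OF assms(1)])
      fix w assume w: "w \<in> U"
      have "h x \<le> f w + C * dist x w" unfolding h_def by (rule cINF_lower[OF bdd w])
      also have "\<dots> \<le> f w + C * (dist x y + dist y w)"
        using assms(2) by (intro add_left_mono mult_left_mono dist_triangle) auto
      finally show "h x - C * dist x y \<le> f w + C * dist y w" by (simp add: algebra_simps)
    qed
    then show ?thesis by simp
  qed
  have "h x = f x" if x: "x \<in> U" for x
  proof (rule antisym)
    show "h x \<le> f x" using cINF_lower[OF bdd x, of x] by (simp add: h_def)
    show "f x \<le> h x" unfolding h_def
    proof (rule cINF_greatest[OF assms(1)])
      fix y assume "y \<in> U"
      then show "f x \<le> f y + C * dist x y" using assms(3)[OF x, of y] by linarith
    qed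
  qed
  moreover have "\<bar>h x - h y\<bar> \<le> C * dist x y" for x y
    using le[of x y] le[of y x] by (simp add: dist_commute abs_le_iff)
  ultimately show ?thesis by blast
qed

lemma has_weak_gradient_C1:
  fixes u :: "real ^ 'n::finite \<Rightarrow> real"
  assumes u: "C_k 1 u" and supp: "\<And>z. norm z > R \<Longrightarrow> u z = 0"
  shows "has_weak_gradient u (gradient u)"
  unfolding has_weak_gradient_def
proof (intro conjI allI ballI)
  have pc: "continuous_on UNIV (partial_deriv j u)" for j using u by simp
  have uc: "continuous_on UNIV u" by (rule C_k_continuous[OF u])
  show "loc_integrable u" by (rule continuous_imp_loc_integrable[OF uc])
  show "loc_integrable (\<lambda>x. gradient u x $ j)" for j
    using continuous_imp_loc_integrable[OF pc] by (simp add: gradient_def)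
  fix \<eta> :: "real ^ 'n \<Rightarrow> real" and j assume "\<eta> \<in> test_functions UNIV"
  then have \<eta>: "C_k 1 \<eta>" by (simp add: test_functions_def)
  have \<eta>c: "continuous_on UNIV \<eta>" "continuous_on UNIV (partial_deriv j \<eta>)"
    using C_k_continuous[OF \<eta>] \<eta> by auto
  have "(\<integral>x. partial_deriv j (\<lambda>x. u x * \<eta> x) x \<partial>lborel) = 0"
    by (rule integral_partial_deriv_eq_0[where R=R]) (auto intro: C_k_mult u \<eta> simp: supp simp del: C_k.simps One_nat_def)
  moreover have "partial_deriv j (\<lambda>x. u x * \<eta> x) x = u x * partial_deriv j \<eta> x + gradient u x $ j * \<eta> x" for x
    using u \<eta> by (subst partial_deriv_mult) (auto simp: gradient_def)
  ultimately have "(\<integral>x. u x * partial_deriv j \<eta> x + gradient u x $ j * \<eta> x \<partial>lborel) = 0" by simp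
  moreover have "integrable lborel (\<lambda>x. u x * partial_deriv j \<eta> x)"
    by (rule integrable_compact_support[of _ R]) (auto intro!: continuous_intros uc \<eta>c simp: supp)
  moreover have "integrable lborel (\<lambda>x. gradient u x $ j * \<eta> x)"
    by (rule integrable_compact_support[of _ R])
      (auto intro!: continuous_intros pc \<eta>c simp: gradient_def partial_deriv_outside[OF supp])
  ultimately show "(\<integral>x. u x * partial_deriv j \<eta> x \<partial>lborel) = - (\<integral>x. gradient u x $ j * \<eta> x \<partial>lborel)" by simp
qed

lemma det_le_fact_prod:
  fixes M :: "real ^ 'n::finite ^ 'n"
  assumes "\<And>i j. \<bar>M $ i $ j\<bar> \<le> c i"
  shows "\<bar>det M\<bar> \<le> fact CARD('n) * (\<Prod>i\<in>UNIV. c i)"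
proof -
  have "\<bar>det M\<bar> \<le> (\<Sum>p\<in>{p. p permutes (UNIV :: 'n set)}. \<bar>of_int (sign p) * (\<Prod>i\<in>UNIV. M $ i $ p i)\<bar>)"
    unfolding det_def by (rule sum_abs)
  also have "\<dots> \<le> (\<Sum>p\<in>{p. p permutes (UNIV :: 'n set)}. \<Prod>i\<in>UNIV. c i)"
    using assms by (intro sum_mono) (auto simp: abs_mult abs_prod sign_def intro!: prod_mono)
  also have "\<dots> = fact CARD('n) * (\<Prod>i\<in>UNIV. c i)"
    by (simp add: card_permutations)
  finally show ?thesis .
qed

lemma jac_continuous:
  assumes "\<And>i. C_k 1 (u i)"
  shows "continuous_on UNIV (jac u)"
proof -
  have "continuous_on UNIV (partial_deriv j (u i))" for i j using assms by simp
  then show ?thesis unfolding jac_def[abs_def] det_def by (auto intro!: continuous_intros)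
qed

lemma jac_outside:
  assumes "\<And>z. norm z > R \<Longrightarrow> u i z = 0" "norm z > R"
  shows "jac u z = 0"
proof -
  have "row i (\<chi> i j. partial_deriv j (u i) z) = 0"
    using partial_deriv_outside[OF assms] by (simp add: row_def vec_eq_iff)
  then show ?thesis unfolding jac_def by (rule det_zero_row)
qed

lemma two_indices:
  assumes "CARD('n::finite) \<ge> 2"
  shows "\<exists>k l :: 'n. l \<noteq> k"
proof (rule ccontr)
  assume "\<not> (\<exists>k l :: 'n. l \<noteq> k)"
  then have "UNIV = {undefined :: 'n}" by auto
  then have "CARD('n) = 1" by (metis card_1_singleton_iff One_nat_def)
  then show False using assms by simp
qed

text \<open>
  On the open set where \<open>g < L\<close> the component \<open>u k0\<close> coincides with a
  Lipschitz function \<open>h\<close>. Exchanging \<open>u k0\<close> for \<open>h\<close> does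
  not affect the Jacobian on this set, and the new Jacobian still has integral 0 over the whole
  space. So the integral over the set equals, up to sign, the one over its complement, where row
  \<open>k0\<close> is of size \<open>L\<close> instead of \<open>g\<close>.
\<close>
theorem good_lambda:
  fixes u :: "'n::finite \<Rightarrow> real ^ 'n \<Rightarrow> real"
  assumes N: "CARD('n) \<ge> 2"
    and u: "\<And>i. C_k 2 (u i)"
    and sym: "\<And>i a b x. partial_deriv a (partial_deriv b (u i)) x = partial_deriv b (partial_deriv a (u i)) x"
    and supp: "\<And>i z. norm z > R \<Longrightarrow> u i z = 0"
    and g: "continuous_on UNIV g" and g0: "\<And>x. g x \<ge> 0" and c: "c \<ge> 0"
    and grad: "\<And>i j x. \<bar>partial_deriv j (u i) x\<bar> \<le> c * g x"
    and lip: "\<And>i x y. g x < L \<Longrightarrow> g y < L \<Longrightarrow> \<bar>u i x - u i y\<bar> \<le> c * L * norm (x - y)"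
    and L: "L > 0"
  shows "ennreal \<bar>\<integral>x. indicator {x. g x < L} x * jac u x \<partial>lborel\<bar> \<le>
    ennreal (fact CARD('n) * c ^ CARD('n) * L) * (\<integral>\<^sup>+x. (if L \<le> g x then ennreal (g x ^ (CARD('n) - 1)) else 0) \<partial>lborel)"
proof (cases "{x. g x < L} = {}")
  case True
  then show ?thesis by simp
next
  case False
  let ?U = "{x. g x < L}" and ?N = "CARD('n)"
  obtain k0 l0 :: 'n where l0: "l0 \<noteq> k0" using two_indices[OF N] by blast
  have opU: "open ?U" using g by (intro open_Collect_less continuous_intros) auto
  have gm[measurable]: "g \<in> borel_measurable borel" using g by (rule borel_measurable_continuous_onI)
  obtain h where hU: "\<And>x. x \<in> ?U \<Longrightarrow> h x = u k0 x" and hlip: "\<And>x y. \<bar>h x - h y\<bar> \<le> c * L * norm (x - y)"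
  proof -
    have "\<exists>h. (\<forall>x\<in>?U. h x = u k0 x) \<and> (\<forall>x y. \<bar>h x - h y\<bar> \<le> c * L * dist x y)"
      using lip c L by (intro lipschitz_extension[OF False]) (auto simp: dist_norm)
    then show ?thesis using that by (auto simp: dist_norm)
  qed
  have "(c * L)-lipschitz_on UNIV h" using hlip c L by (intro lipschitz_onI) (auto simp: dist_norm)
  then have hc: "continuous_on UNIV h" by (rule lipschitz_on_continuous_on)
  have hloc: "loc_integrable h" by (rule continuous_imp_loc_integrable[OF hc])
  \<comment> \<open>\<open>h\<close> itself is not differentiable, hence the mollification, which keeps the
     Lipschitz constant.\<close>
  define v where "v \<delta> = u(k0 := conv h (mollifier \<delta>))" for \<delta>
  have u1: "C_k 1 (u i)" for i using u[of i] by (rule C_k_le) simp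
  have ch: "C_k l (conv h (mollifier \<delta>))" if "\<delta> > 0" for l \<delta>
    using mollifier_outside[OF that] by (intro C_k_conv[OF hloc C_k_mollifier, of \<delta>]) auto
  have v1: "C_k 1 (v \<delta> i)" if "\<delta> > 0" for i \<delta> using u1 ch[OF that] by (simp add: v_def del: C_k.simps)
  have vsupp: "v \<delta> l0 z = 0" if "norm z > R" for z \<delta> using supp[OF that] l0 by (simp add: v_def)
  have vjac: "jac (v \<delta>) z = 0" if "norm z > R" for z \<delta>
    by (rule jac_outside[where i=l0 and R=R and u="v \<delta>"]) (use vsupp that in auto)
  have zero: "(\<integral>x. jac (v \<delta>) x \<partial>lborel) = 0" if \<delta>: "\<delta> > 0" for \<delta>
  proof (rule integral_jac_eq_0[where ?k0.0=k0 and R=R and ?l0.0=l0])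
    show "C_k 1 (v \<delta> k0)" by (rule v1[OF \<delta>])
  qed (use u sym supp l0 in \<open>auto simp: v_def simp del: C_k.simps\<close>)
  have jint: "integrable lborel (jac (v \<delta>))" if "\<delta> > 0" for \<delta>
    by (rule integrable_compact_support[OF jac_continuous[OF v1[OF that]] vjac])
  have prow: "\<bar>partial_deriv j (v \<delta> i) x\<bar> \<le> (if i = k0 then c * L else c * g x)" if \<delta>: "\<delta> > 0" for \<delta> i j x
  proof (cases "i = k0")
    case True
    have "(conv h (mollifier \<delta>) has_derivative (\<lambda>w. gradient (conv h (mollifier \<delta>)) x \<bullet> w)) (at x)"
      by (intro has_derivative_gradient C_k_differentiable[of 0] ch \<delta>)
    from derivative_le_lipschitz[OF this mollify_lipschitz[OF hlip \<delta>], of "axis j 1"] True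
    show ?thesis by (simp add: v_def inner_axis gradient_def)
  qed (use grad in \<open>simp add: v_def\<close>)
  have jle: "\<bar>jac (v \<delta>) x\<bar> \<le> fact ?N * c ^ ?N * L * g x ^ (?N - 1)" if \<delta>: "\<delta> > 0" for \<delta> x
  proof -
    have "\<bar>jac (v \<delta>) x\<bar> \<le> fact ?N * (\<Prod>i\<in>UNIV. (if i = k0 then c * L else c * g x))"
      unfolding jac_def by (intro det_le_fact_prod) (simp add: prow[OF \<delta>])
    also have "(\<Prod>i\<in>UNIV. (if i = k0 then c * L else c * g x)) = c * L * (\<Prod>i\<in>UNIV - {k0}. c * g x)"
      by (subst prod.remove[of UNIV k0]) auto
    also have "\<dots> = c * L * (c * g x) ^ (?N - 1)" by simp
    also have "\<dots> = c ^ ?N * L * g x ^ (?N - 1)"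
      using N by (cases ?N) (auto simp: power_mult_distrib)
    finally show ?thesis by (simp add: mult.assoc)
  qed
  define B where "B = ennreal (fact ?N * c ^ ?N * L) * (\<integral>\<^sup>+x. (if L \<le> g x then ennreal (g x ^ (?N - 1)) else 0) \<partial>lborel)"
  have UL[measurable]: "?U \<in> sets borel" using opU by auto
  have bound: "ennreal \<bar>\<integral>x. indicator ?U x * jac (v \<delta>) x \<partial>lborel\<bar> \<le> B" if \<delta>: "\<delta> > 0" for \<delta>
  proof -
    have i1: "integrable lborel (\<lambda>x. indicator ?U x * jac (v \<delta>) x)"
      using integrable_mult_indicator[of ?U lborel "jac (v \<delta>)"] jint[OF \<delta>] by simp
    have i2: "integrable lborel (\<lambda>x. indicator (- ?U) x * jac (v \<delta>) x)"
      using integrable_mult_indicator[of "- ?U" lborel "jac (v \<delta>)"] jint[OF \<delta>] by simp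
    have "(\<integral>x. jac (v \<delta>) x \<partial>lborel) = (\<integral>x. indicator ?U x * jac (v \<delta>) x + indicator (- ?U) x * jac (v \<delta>) x \<partial>lborel)"
      by (intro Bochner_Integration.integral_cong) (auto simp: indicator_def)
    also have "\<dots> = (\<integral>x. indicator ?U x * jac (v \<delta>) x \<partial>lborel) + (\<integral>x. indicator (- ?U) x * jac (v \<delta>) x \<partial>lborel)"
      using i1 i2 by simp
    finally have "\<bar>\<integral>x. indicator ?U x * jac (v \<delta>) x \<partial>lborel\<bar> = \<bar>\<integral>x. indicator (- ?U) x * jac (v \<delta>) x \<partial>lborel\<bar>"
      using zero[OF \<delta>] by simp
    then have "ennreal \<bar>\<integral>x. indicator ?U x * jac (v \<delta>) x \<partial>lborel\<bar> \<le> (\<integral>\<^sup>+x. ennreal (norm (indicator (- ?U) x * jac (v \<delta>) x)) \<partial>lborel)"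
      using integral_norm_bound_ennreal[OF i2] by simp
    also have "\<dots> \<le> (\<integral>\<^sup>+x. ennreal (fact ?N * c ^ ?N * L) * (if L \<le> g x then ennreal (g x ^ (?N - 1)) else 0) \<partial>lborel)"
    proof (rule nn_integral_mono)
      fix x
      have "ennreal \<bar>jac (v \<delta>) x\<bar> \<le> ennreal (fact ?N * c ^ ?N * L) * ennreal (g x ^ (?N - 1))"
        using jle[OF \<delta>, of x] g0[of x] by (subst ennreal_mult''[symmetric]) (auto intro: ennreal_leI)
      then show "ennreal (norm (indicator (- ?U) x * jac (v \<delta>) x)) \<le>
          ennreal (fact ?N * c ^ ?N * L) * (if L \<le> g x then ennreal (g x ^ (?N - 1)) else 0)"
        by (auto simp: indicator_def)
    qed
    also have "\<dots> = B" unfolding B_def by (rule nn_integral_cmult) measurable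
    finally show ?thesis .
  qed
  define \<delta> where "\<delta> k = 1 / real (Suc k)" for k
  have \<delta>: "\<delta> k > 0" for k by (simp add: \<delta>_def)
  have \<delta>0: "\<delta> \<longlonglongrightarrow> 0" unfolding \<delta>_def using LIMSEQ_inverse_real_of_nat by (simp add: inverse_eq_divide)
  \<comment> \<open>Near a point of the open set, small mollifications of \<open>h\<close> only see values of
     \<open>u k0\<close>.\<close>
  have pconv: "(\<lambda>k. partial_deriv j (conv h (mollifier (\<delta> k))) x) \<longlonglongrightarrow> partial_deriv j (u k0) x" if x: "x \<in> ?U" for j x
  proof (rule LIMSEQ_I)
    fix e :: real assume e: "e > 0"
    have pc: "continuous_on UNIV (partial_deriv j (u k0))" using u1[of k0] by simp
    obtain d1 where d1: "d1 > 0" "ball x d1 \<subseteq> ?U" using opU x by (meson openE)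
    obtain d2 where d2: "d2 > 0" "\<And>y. dist y x < d2 \<Longrightarrow> dist (partial_deriv j (u k0) y) (partial_deriv j (u k0) x) < e / 2"
      using pc e unfolding continuous_on_iff by (metis UNIV_I half_gt_zero)
    obtain K where K: "\<And>k. k \<ge> K \<Longrightarrow> \<delta> k < min d1 d2"
      using LIMSEQ_D[OF \<delta>0, of "min d1 d2"] d1 d2 \<delta> by (auto simp: abs_of_pos)
    have "norm (partial_deriv j (conv h (mollifier (\<delta> k))) x - partial_deriv j (u k0) x) < e" if k: "k \<ge> K" for k
    proof -
      have out: "\<And>z :: real ^ 'n. norm z > \<delta> k \<Longrightarrow> mollifier (\<delta> k) z = 0"
        by (rule mollifier_outside[OF \<delta>])
      have loc: "loc_integrable (u k0)" by (rule continuous_imp_loc_integrable[OF C_k_continuous[OF u1]])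
      have "partial_deriv j (conv h (mollifier (\<delta> k))) x = conv h (partial_deriv j (mollifier (\<delta> k))) x"
        using partial_deriv_conv[OF hloc C_k_mollifier out] by simp
      also have "\<dots> = conv (u k0) (partial_deriv j (mollifier (\<delta> k))) x"
        unfolding conv_def
      proof (rule Bochner_Integration.integral_cong[OF refl])
        fix y
        show "h y * partial_deriv j (mollifier (\<delta> k)) (x - y) = u k0 y * partial_deriv j (mollifier (\<delta> k)) (x - y)"
        proof (cases "norm (x - y) \<le> \<delta> k")
          case True
          then have "y \<in> ball x d1" using K[OF k] by (simp add: dist_norm)
          then show ?thesis using hU d1(2) by auto
        next
          case False
          then have "partial_deriv j (mollifier (\<delta> k)) (x - y) = 0"
            by (intro partial_deriv_outside[OF out]) auto
          then show ?thesis by simp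
        qed
      qed
      also have "\<dots> = conv (partial_deriv j (u k0)) (mollifier (\<delta> k)) x"
        using conv_weak_gradient[OF has_weak_gradient_C1[OF u1 supp] C_k_mollifier out] by (simp add: gradient_def)
      finally have eq: "partial_deriv j (conv h (mollifier (\<delta> k))) x = conv (partial_deriv j (u k0)) (mollifier (\<delta> k)) x" .
      have "\<bar>conv (partial_deriv j (u k0)) (mollifier (\<delta> k)) x - partial_deriv j (u k0) x\<bar> \<le> e / 2"
      proof (rule mollify_close[OF pc \<delta>])
        fix y :: "real ^ 'n" assume "norm y \<le> \<delta> k"
        then have "dist (x - y) x < d2" using K[OF k] by (simp add: dist_norm)
        then show "\<bar>partial_deriv j (u k0) (x - y) - partial_deriv j (u k0) x\<bar> \<le> e / 2"
          using d2(2)[of "x - y"] by (simp add: dist_norm)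
      qed
      then show ?thesis using e by (simp add: eq)
    qed
    then show "\<exists>K. \<forall>k\<ge>K. norm (partial_deriv j (conv h (mollifier (\<delta> k))) x - partial_deriv j (u k0) x) < e" by blast
  qed
  have jconv: "(\<lambda>k. jac (v (\<delta> k)) x) \<longlonglongrightarrow> jac u x" if x: "x \<in> ?U" for x
  proof -
    have "(\<lambda>k. partial_deriv j (v (\<delta> k) i) x) \<longlonglongrightarrow> partial_deriv j (u i) x" for i j
      using pconv[OF x] by (cases "i = k0") (auto simp: v_def)
    then show ?thesis unfolding jac_def det_def by (auto intro!: tendsto_intros)
  qed
  have "(\<lambda>k. \<integral>x. indicator ?U x * jac (v (\<delta> k)) x \<partial>lborel) \<longlonglongrightarrow> (\<integral>x. indicator ?U x * jac u x \<partial>lborel)"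
  proof (rule integral_dominated_convergence[where w="\<lambda>x. fact ?N * c ^ ?N * L * L ^ (?N - 1) * indicator (cball 0 R) x"])
    show "(\<lambda>x. indicator ?U x * jac u x) \<in> borel_measurable lborel"
      using borel_measurable_continuous_onI[OF jac_continuous[OF u1]] by measurable
    show "(\<lambda>x. indicator ?U x * jac (v (\<delta> k)) x) \<in> borel_measurable lborel" for k
      using borel_measurable_continuous_onI[OF jac_continuous[OF v1[OF \<delta>]]] by measurable
    show "integrable lborel (\<lambda>x :: real ^ 'n. fact ?N * c ^ ?N * L * L ^ (?N - 1) * indicator (cball 0 R) x)"
      by (intro integrable_mult_right integrable_real_indicator emeasure_lborel_cball_finite) auto
    show "AE x in lborel. (\<lambda>k. indicator ?U x * jac (v (\<delta> k)) x) \<longlonglongrightarrow> indicator ?U x * jac u x"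
      using jconv by (intro AE_I2) (auto simp: indicator_def)
    show "AE x in lborel. norm (indicator ?U x * jac (v (\<delta> k)) x) \<le>
        fact ?N * c ^ ?N * L * L ^ (?N - 1) * indicator (cball 0 R) x" for k
    proof (rule AE_I2)
      fix x :: "real ^ 'n"
      show "norm (indicator ?U x * jac (v (\<delta> k)) x) \<le> fact ?N * c ^ ?N * L * L ^ (?N - 1) * indicator (cball 0 R) x"
      proof (cases "x \<in> ?U \<and> norm x \<le> R")
        case True
        have "\<bar>jac (v (\<delta> k)) x\<bar> \<le> fact ?N * c ^ ?N * L * g x ^ (?N - 1)" by (rule jle[OF \<delta>])
        also have "\<dots> \<le> fact ?N * c ^ ?N * L * L ^ (?N - 1)"
          using True c L g0[of x] by (intro mult_left_mono power_mono) auto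
        finally show ?thesis using True by simp
      next
        case False
        then show ?thesis using vjac[of x "\<delta> k"] c L by (auto simp: not_le indicator_def)
      qed
    qed
  qed
  then have "(\<lambda>k. ennreal \<bar>\<integral>x. indicator ?U x * jac (v (\<delta> k)) x \<partial>lborel\<bar>) \<longlonglongrightarrow> ennreal \<bar>\<integral>x. indicator ?U x * jac u x \<partial>lborel\<bar>"
    by (intro tendsto_ennrealI tendsto_rabs)
  then have "ennreal \<bar>\<integral>x. indicator ?U x * jac u x \<partial>lborel\<bar> \<le> B"
    by (rule LIMSEQ_le_const2) (use bound[OF \<delta>] in auto)
  then show ?thesis by (simp add: B_def)
qed

section \<open>Jacobians with a weight\<close>

text \<open>
  If \<open>G x\<close> is the integral of the density \<open>k\<close> over those
  \<open>L\<close> with \<open>S x L\<close>, Fubini's theorem transports bounds for the integrals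
  of \<open>d\<close> over the sets \<open>{x. S x L}\<close> to the weighted integral. The
  cancellation within each set is kept.
\<close>
lemma signed_layer_cake:
  fixes d G :: "'a::euclidean_space \<Rightarrow> real" and k :: "real \<Rightarrow> real" and S :: "'a \<Rightarrow> real \<Rightarrow> bool"
  assumes d[measurable]: "d \<in> borel_measurable borel" and k[measurable]: "k \<in> borel_measurable borel"
    and S: "(\<lambda>p. S (fst p) (snd p)) \<in> measurable (borel \<Otimes>\<^sub>M borel) (count_space UNIV)"
    and k0: "\<And>L. k L \<ge> 0" and G0: "\<And>x. G x \<ge> 0"
    and lay: "\<And>x. (\<integral>\<^sup>+L. (if S x L then ennreal (k L) else 0) \<partial>lborel) = ennreal (G x)"
    and fin: "integrable lborel (\<lambda>x. G x * d x)"
    and bd: "\<And>L. k L \<noteq> 0 \<Longrightarrow> ennreal \<bar>\<integral>x. (if S x L then d x else 0) \<partial>lborel\<bar> \<le> B L"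
  shows "ennreal \<bar>\<integral>x. G x * d x \<partial>lborel\<bar> \<le> (\<integral>\<^sup>+L. ennreal (k L) * B L \<partial>lborel)"
proof -
  define f where "f x L = (if S x L then k L * d x else 0)" for x L
  have Sx[measurable]: "Measurable.pred borel (S x)" for x
    using measurable_compose[OF _ S, of "\<lambda>L. (x, L)" borel] by simp
  have [measurable]: "Measurable.pred borel (\<lambda>x. S x L)" for L
    using measurable_compose[OF _ S, of "\<lambda>x. (x, L)" borel] by simp
  have fm: "case_prod f \<in> borel_measurable (lborel \<Otimes>\<^sub>M lborel)"
  proof -
    have "(\<lambda>p. if S (fst p) (snd p) then k (snd p) * d (fst p) else 0) \<in> borel_measurable (borel \<Otimes>\<^sub>M borel)"
      using S by measurable
    then show ?thesis by (simp add: f_def case_prod_beta' cong: measurable_cong_sets sets_pair_measure_cong)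
  qed
  have kx: "has_bochner_integral lborel (\<lambda>L. if S x L then k L else 0) (G x)" for x
  proof (rule has_bochner_integral_nn_integral)
    show "(\<integral>\<^sup>+L. ennreal (if S x L then k L else 0) \<partial>lborel) = ennreal (G x)"
      using lay[of x] by (simp add: if_distrib[of ennreal] cong: if_cong)
  qed (use k0 G0 in auto)
  have fx: "has_bochner_integral lborel (f x) (G x * d x)" for x
    using has_bochner_integral_mult_left[OF kx[of x], of "d x"] by (simp add: f_def[abs_def] if_distrib[of "\<lambda>z. z * d x"] cong: if_cong)
  have nfx: "(\<integral>L. norm (f x L) \<partial>lborel) = G x * \<bar>d x\<bar>" for x
  proof -
    have "(\<lambda>L. norm (f x L)) = (\<lambda>L. (if S x L then k L else 0) * \<bar>d x\<bar>)"
      using k0 by (auto simp: f_def abs_mult)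
    then show ?thesis using has_bochner_integral_integral_eq[OF has_bochner_integral_mult_left[OF kx[of x], of "\<bar>d x\<bar>"]] by simp
  qed
  have int: "integrable (lborel \<Otimes>\<^sub>M lborel) (case_prod f)"
  proof (rule lborel_pair.Fubini_integrable[OF fm])
    show "integrable lborel (\<lambda>x. \<integral>L. norm (case (x, L) of (x, y) \<Rightarrow> f x y) \<partial>lborel)"
      using integrable_norm[OF fin] G0 by (simp add: nfx[unfolded real_norm_def] abs_mult)
    show "AE x in lborel. integrable lborel (\<lambda>L. case (x, L) of (x, y) \<Rightarrow> f x y)"
      using fx by (auto simp: has_bochner_integral_iff)
  qed
  have "(\<integral>x. G x * d x \<partial>lborel) = (\<integral>x. \<integral>L. f x L \<partial>lborel \<partial>lborel)"
    by (simp add: has_bochner_integral_integral_eq[OF fx])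
  also have "\<dots> = (\<integral>L. \<integral>x. f x L \<partial>lborel \<partial>lborel)"
    using lborel_pair.Fubini_integral[OF int] by simp
  finally have eq: "(\<integral>x. G x * d x \<partial>lborel) = (\<integral>L. \<integral>x. f x L \<partial>lborel \<partial>lborel)" .
  have "ennreal \<bar>\<integral>x. G x * d x \<partial>lborel\<bar> \<le> (\<integral>\<^sup>+L. ennreal \<bar>\<integral>x. f x L \<partial>lborel\<bar> \<partial>lborel)"
    unfolding eq
  proof (cases "integrable lborel (\<lambda>L. \<integral>x. f x L \<partial>lborel)")
    case True
    then show "ennreal \<bar>\<integral>L. \<integral>x. f x L \<partial>lborel \<partial>lborel\<bar> \<le> (\<integral>\<^sup>+L. ennreal \<bar>\<integral>x. f x L \<partial>lborel\<bar> \<partial>lborel)"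
      using integral_norm_bound_ennreal by fastforce
  qed (simp add: not_integrable_integral_eq)
  also have "\<dots> \<le> (\<integral>\<^sup>+L. ennreal (k L) * B L \<partial>lborel)"
  proof (rule nn_integral_mono)
    fix L
    have "(\<integral>x. f x L \<partial>lborel) = (\<integral>x. k L * (if S x L then d x else 0) \<partial>lborel)"
      by (intro Bochner_Integration.integral_cong) (auto simp: f_def)
    also have "\<dots> = k L * (\<integral>x. (if S x L then d x else 0) \<partial>lborel)" by simp
    finally have "ennreal \<bar>\<integral>x. f x L \<partial>lborel\<bar> = ennreal (k L) * ennreal \<bar>\<integral>x. (if S x L then d x else 0) \<partial>lborel\<bar>"
      using k0[of L] by (simp add: abs_mult ennreal_mult)
    also have "\<dots> \<le> ennreal (k L) * B L"
      using bd[of L] by (cases "k L = 0") (auto intro: mult_left_mono)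
    finally show "ennreal \<bar>\<integral>x. f x L \<partial>lborel\<bar> \<le> ennreal (k L) * B L" .
  qed
  finally show ?thesis .
qed

text \<open>
  The integral over \<open>L\<close> of the right-hand side of \<open>good_lambda\<close> against
  the density that generates \<open>g powr a\<close>. The factor 2 bounds \<open>1 / (a +
  1)\<close>.
\<close>
lemma superlevel_power_integral:
  fixes g :: "'a::euclidean_space \<Rightarrow> real"
  assumes [measurable]: "g \<in> borel_measurable borel" and g: "\<And>x. g x > 0" and a: "\<bar>a\<bar> \<le> 1 / 2" and A: "A \<ge> 0" and n: "n \<ge> 1"
  shows "(\<integral>\<^sup>+L. ennreal (if L > 0 then \<bar>a\<bar> * L powr (a - 1) else 0) *
      (ennreal (A * L) * (\<integral>\<^sup>+x. (if L \<le> g x then ennreal (g x ^ (n - 1)) else 0) \<partial>lborel)) \<partial>lborel) \<le>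
    ennreal (2 * A * \<bar>a\<bar>) * (\<integral>\<^sup>+x. ennreal (g x powr (n + a)) \<partial>lborel)"
proof -
  have "(\<integral>\<^sup>+L. ennreal (if L > 0 then \<bar>a\<bar> * L powr (a - 1) else 0) *
      (ennreal (A * L) * (\<integral>\<^sup>+x. (if L \<le> g x then ennreal (g x ^ (n - 1)) else 0) \<partial>lborel)) \<partial>lborel) \<le>
      (\<integral>\<^sup>+L. \<integral>\<^sup>+x. ennreal (A * \<bar>a\<bar>) * (ennreal (g x ^ (n - 1)) * (if 0 \<le> L \<and> L \<le> g x then ennreal (L powr a) else 0)) \<partial>lborel \<partial>lborel)"
  proof (rule nn_integral_mono)
    fix L :: real
    show "ennreal (if L > 0 then \<bar>a\<bar> * L powr (a - 1) else 0) *
      (ennreal (A * L) * (\<integral>\<^sup>+x. (if L \<le> g x then ennreal (g x ^ (n - 1)) else 0) \<partial>lborel)) \<le>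
      (\<integral>\<^sup>+x. ennreal (A * \<bar>a\<bar>) * (ennreal (g x ^ (n - 1)) * (if 0 \<le> L \<and> L \<le> g x then ennreal (L powr a) else 0)) \<partial>lborel)"
    proof (cases "L > 0")
      case True
      have "\<bar>a\<bar> * L powr (a - 1) * (A * L) = A * \<bar>a\<bar> * L powr a"
        using True by (simp add: powr_diff)
      then have "ennreal (\<bar>a\<bar> * L powr (a - 1)) * ennreal (A * L) = ennreal (A * \<bar>a\<bar> * L powr a)"
        using A True by (subst ennreal_mult[symmetric]) auto
      then have "ennreal (if L > 0 then \<bar>a\<bar> * L powr (a - 1) else 0) *
          (ennreal (A * L) * (\<integral>\<^sup>+x. (if L \<le> g x then ennreal (g x ^ (n - 1)) else 0) \<partial>lborel)) =
          ennreal (A * \<bar>a\<bar> * L powr a) * (\<integral>\<^sup>+x. (if L \<le> g x then ennreal (g x ^ (n - 1)) else 0) \<partial>lborel)"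
        using True by (simp add: mult.assoc[symmetric])
      also have "\<dots> = (\<integral>\<^sup>+x. ennreal (A * \<bar>a\<bar> * L powr a) * (if L \<le> g x then ennreal (g x ^ (n - 1)) else 0) \<partial>lborel)"
        by (rule nn_integral_cmult[symmetric]) measurable
      also have "\<dots> = (\<integral>\<^sup>+x. ennreal (A * \<bar>a\<bar>) * (ennreal (g x ^ (n - 1)) * (if 0 \<le> L \<and> L \<le> g x then ennreal (L powr a) else 0)) \<partial>lborel)"
        using True A by (intro nn_integral_cong) (auto simp: ennreal_mult mult_ac)
      finally show ?thesis by simp
    qed simp
  qed
  also have "\<dots> = (\<integral>\<^sup>+x. \<integral>\<^sup>+L. ennreal (A * \<bar>a\<bar>) * (ennreal (g x ^ (n - 1)) * (if 0 \<le> L \<and> L \<le> g x then ennreal (L powr a) else 0)) \<partial>lborel \<partial>lborel)"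
    by (rule lborel_pair.Fubini') measurable
  also have "\<dots> \<le> (\<integral>\<^sup>+x. ennreal (2 * A * \<bar>a\<bar>) * ennreal (g x powr (n + a)) \<partial>lborel)"
  proof (rule nn_integral_mono)
    fix x
    have a1: "a > -1" "a + 1 \<ge> 1 / 2" using a by auto
    have "(\<integral>\<^sup>+L. ennreal (A * \<bar>a\<bar>) * (ennreal (g x ^ (n - 1)) * (if 0 \<le> L \<and> L \<le> g x then ennreal (L powr a) else 0)) \<partial>lborel) =
        ennreal (A * \<bar>a\<bar>) * (ennreal (g x ^ (n - 1)) * ennreal (g x powr (a + 1) / (a + 1)))"
      using layer_cake_below[OF a1(1), of "g x"] g[of x] by (simp add: nn_integral_cmult)
    also have "\<dots> = ennreal (A * \<bar>a\<bar> * (g x ^ (n - 1) * (g x powr (a + 1) / (a + 1))))"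
    proof -
      have P: "g x powr (a + 1) / (a + 1) \<ge> 0" using a1 by simp
      have Q: "g x ^ (n - 1) * (g x powr (a + 1) / (a + 1)) \<ge> 0" using P g[of x] by (intro mult_nonneg_nonneg) auto
      show ?thesis by (simp only: ennreal_mult''[OF P] ennreal_mult''[OF Q])
    qed
    also have "\<dots> \<le> ennreal (2 * A * \<bar>a\<bar> * g x powr (n + a))"
    proof (rule ennreal_leI)
      have "g x ^ (n - 1) * g x powr (a + 1) = g x powr (n + a)"
        using g[of x] n by (simp add: powr_realpow[symmetric] powr_add[symmetric] of_nat_diff)
      then have "g x ^ (n - 1) * (g x powr (a + 1) / (a + 1)) = g x powr (n + a) / (a + 1)" by simp
      also have "\<dots> \<le> g x powr (n + a) / (1 / 2)"
        using a1 by (intro divide_left_mono) auto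
      finally have "A * \<bar>a\<bar> * (g x ^ (n - 1) * (g x powr (a + 1) / (a + 1))) \<le> A * \<bar>a\<bar> * (g x powr (n + a) / (1 / 2))"
        using A by (intro mult_left_mono) auto
      also have "\<dots> = 2 * A * \<bar>a\<bar> * g x powr (n + a)" by simp
      finally show "A * \<bar>a\<bar> * (g x ^ (n - 1) * (g x powr (a + 1) / (a + 1))) \<le> 2 * A * \<bar>a\<bar> * g x powr (n + a)" .
    qed
    also have "\<dots> = ennreal (2 * A * \<bar>a\<bar>) * ennreal (g x powr (n + a))" by (rule ennreal_mult'') simp
    finally show "(\<integral>\<^sup>+L. ennreal (A * \<bar>a\<bar>) * (ennreal (g x ^ (n - 1)) * (if 0 \<le> L \<and> L \<le> g x then ennreal (L powr a) else 0)) \<partial>lborel) \<le>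
        ennreal (2 * A * \<bar>a\<bar>) * ennreal (g x powr (n + a))" .
  qed
  also have "\<dots> = ennreal (2 * A * \<bar>a\<bar>) * (\<integral>\<^sup>+x. ennreal (g x powr (n + a)) \<partial>lborel)"
    by (rule nn_integral_cmult) measurable
  finally show ?thesis .
qed

text \<open>
  For \<open>a < 0\<close>, \<open>g powr a\<close> is the integral of \<open>\<bar>a\<bar> * L
  powr (a - 1)\<close> over \<open>L > g\<close>, and for \<open>a > 0\<close> over \<open>0 < L
  \<le> g\<close>. In the second case the sets are superlevel sets, on which \<open>d\<close> has
  the opposite integral since its total integral is 0. In both cases the density carries the
  factor \<open>\<bar>a\<bar>\<close>.
\<close>
lemma good_lambda_weighted:
  fixes d g :: "'a::euclidean_space \<Rightarrow> real"
  assumes dint: "integrable lborel d" and zero: "(\<integral>x. d x \<partial>lborel) = 0"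
    and gm[measurable]: "g \<in> borel_measurable borel" and g: "\<And>x. g x > 0" and a: "\<bar>a\<bar> \<le> 1 / 2" and A: "A \<ge> 0" and n: "n \<ge> 1"
    and fin: "integrable lborel (\<lambda>x. g x powr a * d x)"
    and gl: "\<And>L. L > 0 \<Longrightarrow> ennreal \<bar>\<integral>x. indicator {x. g x < L} x * d x \<partial>lborel\<bar> \<le>
      ennreal (A * L) * (\<integral>\<^sup>+x. (if L \<le> g x then ennreal (g x ^ (n - 1)) else 0) \<partial>lborel)"
  shows "ennreal \<bar>\<integral>x. g x powr a * d x \<partial>lborel\<bar> \<le> ennreal (2 * A * \<bar>a\<bar>) * (\<integral>\<^sup>+x. ennreal (g x powr (n + a)) \<partial>lborel)"
proof -
  have dm[measurable]: "d \<in> borel_measurable borel" using dint by auto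
  let ?k = "\<lambda>L. if L > 0 then \<bar>a\<bar> * L powr (a - 1) else 0"
  let ?B = "\<lambda>L. ennreal (A * L) * (\<integral>\<^sup>+x. (if L \<le> g x then ennreal (g x ^ (n - 1)) else 0) \<partial>lborel)"
  have km: "?k \<in> borel_measurable borel" by measurable
  consider "a = 0" | "a < 0" | "a > 0" by linarith
  then have "ennreal \<bar>\<integral>x. g x powr a * d x \<partial>lborel\<bar> \<le> (\<integral>\<^sup>+L. ennreal (?k L) * ?B L \<partial>lborel)"
  proof cases
    case 1
    have "(\<integral>x. g x powr a * d x \<partial>lborel) = (\<integral>x. d x \<partial>lborel)"
      using 1 g by (intro Bochner_Integration.integral_cong) (auto simp: less_imp_neq[THEN not_sym])
    then show ?thesis using zero by simp
  next
    case 2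
    show ?thesis
    proof (rule signed_layer_cake[where S="\<lambda>x L. g x < L", OF dm km _ _ _ _ fin])
      show "(\<lambda>p. g (fst p) < snd p) \<in> measurable (borel \<Otimes>\<^sub>M borel) (count_space UNIV)" by measurable
      fix x
      have "(\<integral>\<^sup>+L. (if g x < L then ennreal (?k L) else 0) \<partial>lborel) =
          (\<integral>\<^sup>+L. ennreal \<bar>a\<bar> * (if g x \<le> L then ennreal (L powr (a - 1)) else 0) \<partial>lborel)"
      proof (rule nn_integral_cong_AE)
        have "AE L in lborel. L \<noteq> g x" by (rule AE_lborel_singleton)
        then show "AE L in lborel. (if g x < L then ennreal (?k L) else 0) = ennreal \<bar>a\<bar> * (if g x \<le> L then ennreal (L powr (a - 1)) else 0)"
        proof (rule AE_mp, intro AE_I2 impI)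
          fix L assume "L \<noteq> g x"
          then show "(if g x < L then ennreal (?k L) else 0) = ennreal \<bar>a\<bar> * (if g x \<le> L then ennreal (L powr (a - 1)) else 0)"
            using g[of x] by (auto simp: ennreal_mult)
        qed
      qed
      also have "\<dots> = ennreal \<bar>a\<bar> * (\<integral>\<^sup>+L. (if g x \<le> L then ennreal (L powr (a - 1)) else 0) \<partial>lborel)"
        by (rule nn_integral_cmult) measurable
      also have "\<dots> = ennreal \<bar>a\<bar> * ennreal (g x powr a / - a)"
        using layer_cake_above[of "a - 1" "g x"] 2 g[of x] by simp
      also have "\<dots> = ennreal (g x powr a)" using 2 by (subst ennreal_mult[symmetric]) (auto simp: divide_nonneg_neg)
      finally show "(\<integral>\<^sup>+L. (if g x < L then ennreal (?k L) else 0) \<partial>lborel) = ennreal (g x powr a)" .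
    next
      fix L assume "?k L \<noteq> 0"
      then have "L > 0" by (auto split: if_splits)
      moreover have "(\<integral>x. (if g x < L then d x else 0) \<partial>lborel) = (\<integral>x. indicator {x. g x < L} x * d x \<partial>lborel)"
        by (intro Bochner_Integration.integral_cong) auto
      ultimately show "ennreal \<bar>\<integral>x. (if g x < L then d x else 0) \<partial>lborel\<bar> \<le> ?B L" using gl by simp
    qed auto
  next
    case 3
    show ?thesis
    proof (rule signed_layer_cake[where S="\<lambda>x L. L \<le> g x", OF dm km _ _ _ _ fin])
      show "(\<lambda>p. snd p \<le> g (fst p)) \<in> measurable (borel \<Otimes>\<^sub>M borel) (count_space UNIV)" by measurable
      fix x
      have "(\<integral>\<^sup>+L. (if L \<le> g x then ennreal (?k L) else 0) \<partial>lborel) =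
          (\<integral>\<^sup>+L. ennreal \<bar>a\<bar> * (if 0 \<le> L \<and> L \<le> g x then ennreal (L powr (a - 1)) else 0) \<partial>lborel)"
        by (intro nn_integral_cong) (auto simp: ennreal_mult)
      also have "\<dots> = ennreal \<bar>a\<bar> * (\<integral>\<^sup>+L. (if 0 \<le> L \<and> L \<le> g x then ennreal (L powr (a - 1)) else 0) \<partial>lborel)"
        by (rule nn_integral_cmult) measurable
      also have "\<dots> = ennreal \<bar>a\<bar> * ennreal (g x powr a / a)"
        using layer_cake_below[of "a - 1" "g x"] 3 g[of x] by (simp add: less_imp_le)
      also have "\<dots> = ennreal (g x powr a)" using 3 by (subst ennreal_mult[symmetric]) auto
      finally show "(\<integral>\<^sup>+L. (if L \<le> g x then ennreal (?k L) else 0) \<partial>lborel) = ennreal (g x powr a)" .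
    next
      fix L assume "?k L \<noteq> 0"
      then have L: "L > 0" by (auto split: if_splits)
      have i: "integrable lborel (\<lambda>x. indicator {x. g x < L} x * d x)"
        using integrable_mult_indicator[of "{x. g x < L}" lborel d] dint by simp
      have "(\<integral>x. (if L \<le> g x then d x else 0) \<partial>lborel) = (\<integral>x. d x - indicator {x. g x < L} x * d x \<partial>lborel)"
        by (intro Bochner_Integration.integral_cong) (auto simp: indicator_def)
      also have "\<dots> = - (\<integral>x. indicator {x. g x < L} x * d x \<partial>lborel)" using dint i zero by simp
      finally show "ennreal \<bar>\<integral>x. (if L \<le> g x then d x else 0) \<partial>lborel\<bar> \<le> ?B L" using gl[OF L] by simp
    qed auto
  qed
  also have "\<dots> \<le> ennreal (2 * A * \<bar>a\<bar>) * (\<integral>\<^sup>+x. ennreal (g x powr (n + a)) \<partial>lborel)"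
    by (rule superlevel_power_integral[OF gm g a A n])
  finally show ?thesis .
qed

text \<open>
  \<open>good_lambda\<close> asks for one constant as a derivative bound (first argument of the
  maximum) and as a Lipschitz constant on sublevel sets (second argument).
\<close>
definition grad_const :: "'n::finite itself \<Rightarrow> real" where
  "grad_const _ = max (moll_bound TYPE('n)) (2 ^ (CARD('n) + 1) / ball_vol TYPE('n) * avg_const TYPE('n))"

lemma grad_const_pos: "grad_const TYPE('n::finite) > 0"
  using moll_bound_pos[where 'n='n] by (simp add: grad_const_def)

context maximal
begin

lemma mollified_F_measurable: "\<rho> > 0 \<Longrightarrow> conv F (mollifier \<rho>) \<in> borel_measurable borel"
  using mollifier_outside[of \<rho>]
  by (intro borel_measurable_continuous_onI C_k_continuous[of 0] C_k_conv[OF integrable_imp_loc_integrable[OF int] C_k_mollifier, of \<rho>]) auto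

lemma partial_deriv_mollified:
  assumes "has_weak_gradient u G" "\<rho> > 0"
  shows "partial_deriv j (conv u (mollifier \<rho>)) = conv (\<lambda>x. G x $ j) (mollifier (\<rho>) :: real ^ 'n \<Rightarrow> real)"
proof -
  have out: "\<And>z :: real ^ 'n. norm z > \<rho> \<Longrightarrow> mollifier \<rho> z = 0" by (rule mollifier_outside[OF assms(2)])
  have "loc_integrable u" using assms(1) by (simp add: has_weak_gradient_def)
  from partial_deriv_conv[OF this C_k_mollifier out] conv_weak_gradient[OF assms(1) C_k_mollifier out]
  show ?thesis by simp
qed

text \<open>
  Testing the mollified gradient with itself yields the Euclidean norm instead of a sum over
  components.
\<close>
lemma mollified_gradient_le:
  assumes "has_weak_gradient u G" "\<And>x. norm (G x) \<le> F x" "\<rho> > 0"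
  shows "norm (gradient (conv u (mollifier \<rho>)) x) \<le> conv F (mollifier \<rho>) x"
proof -
  have out: "\<And>z :: real ^ 'n. norm z > \<rho> \<Longrightarrow> mollifier \<rho> z = 0" by (rule mollifier_outside[OF assms(3)])
  have mc: "continuous_on UNIV (mollifier \<rho> :: real ^ 'n \<Rightarrow> real)" by (rule C_k_continuous[OF C_k_mollifier])
  define w where "w = gradient (conv u (mollifier \<rho>)) x"
  have wj: "w $ j = (\<integral>y. G y $ j * mollifier \<rho> (x - y) \<partial>lborel)" for j
    unfolding w_def using partial_deriv_mollified[OF assms(1,3)] by (simp add: gradient_def conv_def)
  have ij: "integrable lborel (\<lambda>y. G y $ j * mollifier \<rho> (x - y))" for j
    using assms(1) conv_integrable[OF _ mc out] by (auto simp: has_weak_gradient_def)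
  have iF: "integrable lborel (\<lambda>y. F y * mollifier \<rho> (x - y))"
    by (rule conv_integrable[OF integrable_imp_loc_integrable[OF int] mc out])
  have "norm w * norm w = (\<Sum>j\<in>UNIV. w $ j * w $ j)"
    by (simp add: power2_eq_square[symmetric] power2_norm_eq_inner inner_vec_def)
  also have "\<dots> = (\<Sum>j\<in>UNIV. \<integral>y. w $ j * (G y $ j * mollifier \<rho> (x - y)) \<partial>lborel)"
    using ij by (simp add: wj)
  also have "\<dots> = (\<integral>y. (\<Sum>j\<in>UNIV. w $ j * (G y $ j * mollifier \<rho> (x - y))) \<partial>lborel)"
    using ij by (intro Bochner_Integration.integral_sum[symmetric]) auto
  also have "\<dots> \<le> (\<integral>y. norm w * (F y * mollifier \<rho> (x - y)) \<partial>lborel)"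
  proof (rule integral_mono)
    show "integrable lborel (\<lambda>y. \<Sum>j\<in>UNIV. w $ j * (G y $ j * mollifier \<rho> (x - y)))"
      using ij by (intro Bochner_Integration.integrable_sum integrable_mult_right)
    show "integrable lborel (\<lambda>y. norm w * (F y * mollifier \<rho> (x - y)))" using iF by simp
    fix y
    have "(\<Sum>j\<in>UNIV. w $ j * (G y $ j * mollifier \<rho> (x - y))) = (w \<bullet> G y) * mollifier \<rho> (x - y)"
      by (simp add: inner_vec_def sum_distrib_right mult.assoc)
    also have "\<dots> \<le> (norm w * F y) * mollifier \<rho> (x - y)"
    proof (intro mult_right_mono mollifier_nonneg)
      have "w \<bullet> G y \<le> norm w * norm (G y)" by (rule norm_cauchy_schwarz)
      also have "\<dots> \<le> norm w * F y" using assms(2) by (intro mult_left_mono) auto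
      finally show "w \<bullet> G y \<le> norm w * F y" .
    qed
    finally show "(\<Sum>j\<in>UNIV. w $ j * (G y $ j * mollifier \<rho> (x - y))) \<le> norm w * (F y * mollifier \<rho> (x - y))"
      by (simp add: mult.assoc)
  qed
  also have "\<dots> = norm w * conv F (mollifier \<rho>) x" by (simp add: conv_def)
  finally have "norm w * norm w \<le> norm w * conv F (mollifier \<rho>) x" .
  then show ?thesis
    using mollified_nonneg[of \<rho> x] by (cases "norm w = 0") (auto simp: w_def)
qed

lemma mollified_partial_le:
  assumes "has_weak_gradient u G" "\<And>x. norm (G x) \<le> F x" "\<rho> > 0"
  shows "\<bar>partial_deriv j (conv u (mollifier \<rho>)) x\<bar> \<le> grad_const TYPE('n) * maxf F \<rho> x"
proof -
  have "\<bar>partial_deriv j (conv u (mollifier \<rho>)) x\<bar> \<le> norm (gradient (conv u (mollifier \<rho>)) x)"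
    using component_le_norm_cart[of "gradient (conv u (mollifier \<rho>)) x" j] by (simp add: gradient_def)
  also have "\<dots> \<le> conv F (mollifier \<rho>) x" by (rule mollified_gradient_le[OF assms])
  also have "\<dots> \<le> moll_bound TYPE('n) * maxf F \<rho> x" by (rule mollified_le_maxf[OF assms(3)])
  also have "\<dots> \<le> grad_const TYPE('n) * maxf F \<rho> x"
    using maxf_nonneg[OF assms(3)] by (intro mult_right_mono) (auto simp: grad_const_def)
  finally show ?thesis .
qed

text \<open>
  The hypotheses of \<open>pointwise_lipschitz\<close> hold at the two points by
  \<open>mollified_ball_le_maxf\<close>.
\<close>
lemma mollified_lipschitz:
  assumes "has_weak_gradient u G" "\<And>x. norm (G x) \<le> F x" "\<rho> > 0"
    and L: "maxf F \<rho> x \<le> L" "maxf F \<rho> y \<le> L"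
  shows "\<bar>conv u (mollifier \<rho>) x - conv u (mollifier \<rho>) y\<bar> \<le> grad_const TYPE('n) * L * norm (x - y)"
proof -
  have out: "\<And>z :: real ^ 'n. norm z > \<rho> \<Longrightarrow> mollifier \<rho> z = 0" by (rule mollifier_outside[OF assms(3)])
  have loc: "loc_integrable u" using assms(1) by (simp add: has_weak_gradient_def)
  have L0: "L \<ge> 0" using maxf_nonneg[OF assms(3), of x] L(1) by simp
  have ac: "avg_const TYPE('n) \<ge> 0" unfolding avg_const_def using moll_bound_pos[where 'n='n] by simp
  have avg: "(\<integral>\<^sup>+z. ennreal (conv F (mollifier \<rho>) z) * indicator (cball w r) z \<partial>lborel) \<le> ennreal (r ^ CARD('n) * (avg_const TYPE('n) * L))"
    if "maxf F \<rho> w \<le> L" "r > 0" for w r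
  proof -
    have "avg_const TYPE('n) * (r ^ CARD('n) * maxf F \<rho> w) \<le> r ^ CARD('n) * (avg_const TYPE('n) * L)"
      using mult_left_mono[OF that(1), of "avg_const TYPE('n) * r ^ CARD('n)"] ac that(2) by (simp add: mult_ac)
    from ennreal_leI[OF this] mollified_ball_le_maxf[OF assms(3) that(2), of w] show ?thesis by (rule order_trans[rotated])
  qed
  have "\<bar>conv u (mollifier \<rho>) x - conv u (mollifier \<rho>) y\<bar> \<le>
      2 ^ (CARD('n) + 1) / ball_vol TYPE('n) * (avg_const TYPE('n) * L) * norm (x - y)"
  proof (rule pointwise_lipschitz)
    show "C_k 1 (conv u (mollifier \<rho>))" by (rule C_k_conv[OF loc C_k_mollifier out])
  qed (use avg L L0 ac mollified_F_measurable[OF assms(3)] mollified_gradient_le[OF assms(1-3)] in auto)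
  also have "\<dots> = (2 ^ (CARD('n) + 1) / ball_vol TYPE('n) * avg_const TYPE('n)) * (L * norm (x - y))" by simp
  also have "\<dots> \<le> grad_const TYPE('n) * (L * norm (x - y))"
    using L0 by (intro mult_right_mono) (auto simp: grad_const_def)
  finally show ?thesis by (simp add: mult.assoc)
qed

text \<open>
  Mollification at the truncation scale \<open>\<rho>\<close> of the maximal function makes
  \<open>good_lambda\<close> applicable, with constants that do not depend on
  \<open>\<rho>\<close>.
\<close>
theorem mollified_jacobian_estimate:
  fixes u :: "'n \<Rightarrow> real ^ 'n \<Rightarrow> real" and a :: real
  assumes N: "CARD('n) \<ge> 2" and wg: "\<And>i. has_weak_gradient (u i) (G i)" and GF: "\<And>i x. norm (G i x) \<le> F x"
    and supp: "\<And>i z. norm z > R \<Longrightarrow> u i z = 0" and \<rho>: "\<rho> > 0" and pos: "(\<integral>x. F x \<partial>lborel) > 0"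
    and a: "\<bar>a\<bar> \<le> 1 / 2"
  shows "ennreal \<bar>\<integral>x. maxf F \<rho> x powr a * jac (\<lambda>i. conv (u i) (mollifier \<rho>)) x \<partial>lborel\<bar> \<le>
    ennreal (2 * (fact CARD('n) * grad_const TYPE('n) ^ CARD('n)) * \<bar>a\<bar>) * (\<integral>\<^sup>+x. ennreal (maxf F \<rho> x powr (CARD('n) + a)) \<partial>lborel)"
proof -
  let ?v = "\<lambda>i. conv (u i) (mollifier \<rho>)"
  have out: "\<And>z :: real ^ 'n. norm z > \<rho> \<Longrightarrow> mollifier \<rho> z = 0" by (rule mollifier_outside[OF \<rho>])
  have loc: "loc_integrable (u i)" for i using wg[of i] by (simp add: has_weak_gradient_def)
  have C: "C_k l (?v i)" for l i by (rule C_k_conv[OF loc C_k_mollifier out])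
  have vsupp: "?v i z = 0" if "norm z > \<rho> + R" for i z
    by (rule conv_outside[where S=R and R=\<rho>]) (use supp out that in auto)
  have jsupp: "jac ?v z = 0" if "norm z > \<rho> + R" for z
    by (rule jac_outside[where R="\<rho> + R"]) (use vsupp that in auto)
  have jc: "continuous_on UNIV (jac ?v)" by (rule jac_continuous[OF C])
  have gc: "continuous_on UNIV (maxf F \<rho>)" by (rule maxf_continuous[OF \<rho>])
  have gpos: "maxf F \<rho> x > 0" for x by (rule maxf_pos[OF \<rho> pos])
  have sym: "partial_deriv i (partial_deriv j (?v k)) x = partial_deriv j (partial_deriv i (?v k)) x" for i j k x
  proof -
    have pd: "partial_deriv j (?v k) = conv (u k) (partial_deriv j (mollifier \<rho>))" for j
      by (rule partial_deriv_conv[OF loc C_k_mollifier out])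
    have p0: "partial_deriv j (mollifier \<rho>) z = 0" if "norm z > \<rho>" for j and z :: "real ^ 'n"
      by (rule partial_deriv_outside[OF out that])
    have C1: "C_k 1 (partial_deriv j (mollifier \<rho> :: real ^ 'n \<Rightarrow> real))" for j
      using C_k_mollifier[of 2 \<rho>, where 'n='n] by (simp add: numeral_2_eq_2)
    have "partial_deriv i (partial_deriv j (?v k)) = conv (u k) (partial_deriv i (partial_deriv j (mollifier \<rho>)))" for i j
      unfolding pd by (rule partial_deriv_conv[OF loc C1 p0])
    moreover have "partial_deriv i (partial_deriv j (mollifier \<rho>)) = partial_deriv j (partial_deriv i (mollifier \<rho> :: real ^ 'n \<Rightarrow> real))"
      by (intro ext mollifier_commute)
    ultimately show ?thesis by simp
  qed
  obtain k0 l0 :: 'n where kl: "l0 \<noteq> k0" using two_indices[OF N] by blast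
  show ?thesis
  proof (rule good_lambda_weighted[OF _ _ borel_measurable_maxf[OF \<rho>] gpos a])
    show "integrable lborel (jac ?v)" by (rule integrable_compact_support[OF jc jsupp])
    show "(\<integral>x. jac ?v x \<partial>lborel) = 0"
      by (rule integral_jac_eq_0[where ?k0.0=k0 and ?l0.0=l0 and R="\<rho> + R"]) (use C sym vsupp kl in auto)
    show "0 \<le> fact CARD('n) * grad_const TYPE('n) ^ CARD('n)" using grad_const_pos[where 'n='n] by simp
    show "1 \<le> CARD('n)" using N by simp
    show "integrable lborel (\<lambda>x. maxf F \<rho> x powr a * jac ?v x)"
      using gpos by (intro integrable_compact_support[of _ "\<rho> + R"] continuous_intros gc jc)
        (auto simp: jsupp less_imp_neq[THEN not_sym])
    fix L :: real assume L: "L > 0"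
    show "ennreal \<bar>\<integral>x. indicator {x. maxf F \<rho> x < L} x * jac ?v x \<partial>lborel\<bar> \<le>
        ennreal (fact CARD('n) * grad_const TYPE('n) ^ CARD('n) * L) *
        (\<integral>\<^sup>+x. (if L \<le> maxf F \<rho> x then ennreal (maxf F \<rho> x ^ (CARD('n) - 1)) else 0) \<partial>lborel)"
    proof (rule good_lambda[OF N C sym vsupp gc])
      show "grad_const TYPE('n) \<ge> 0" using grad_const_pos[where 'n='n] by simp
    qed (use L maxf_nonneg[OF \<rho>] mollified_partial_le[OF wg GF \<rho>] mollified_lipschitz[OF wg GF \<rho>] in auto)
  qed
qed

end

section \<open>Convergence of mollifications\<close>

text \<open>
  Truncated multiples of the distance to the complement increase to the indicator.
\<close>
lemma open_indicator_continuous_approx: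
  fixes U :: "'a::euclidean_space set"
  assumes U: "open U" "emeasure lborel U < \<infinity>" and e: "e > 0"
  shows "\<exists>c R. continuous_on UNIV c \<and> (\<forall>z. norm z > R \<longrightarrow> c z = 0) \<and> integrable lborel c \<and>
    (\<integral>x. \<bar>indicator U x - c x\<bar> \<partial>lborel) < (e :: real)"
proof -
  have ne: "- U \<noteq> {}"
  proof
    assume "- U = {}"
    then have "U = UNIV" by auto
    then show False using U(2) by simp
  qed
  have clo: "closed (- U)" using U(1) by (simp add: closed_def)
  define c where "c k x = min 1 (real k * infdist x (- U)) * max 0 (min 1 (real k - norm x))" for k and x :: 'a
  have cc: "continuous_on UNIV (c k)" for k
    unfolding c_def by (intro continuous_intros)
  have c01: "0 \<le> c k x" "c k x \<le> indicator U x" for k x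
  proof -
    show "0 \<le> c k x" unfolding c_def by (intro mult_nonneg_nonneg) (auto simp: infdist_nonneg)
    show "c k x \<le> indicator U x"
    proof (cases "x \<in> U")
      case True
      have "c k x \<le> 1 * 1" unfolding c_def by (intro mult_mono) (auto simp: infdist_nonneg)
      then show ?thesis using True by simp
    qed (simp add: c_def)
  qed
  have csupp: "c k z = 0" if "norm z > real k" for k z using that by (simp add: c_def)
  have lim: "(\<lambda>k. \<bar>indicator U x - c k x\<bar>) \<longlonglongrightarrow> 0" for x
  proof (cases "x \<in> U")
    case True
    then have d: "infdist x (- U) > 0"
      using in_closed_iff_infdist_zero[OF clo ne, of x] infdist_nonneg[of x "- U"] by simp
    obtain K :: nat where K: "real K > 1 / infdist x (- U)" "real K > norm x + 1"
    proof -
      obtain K :: nat where "real K > max (1 / infdist x (- U)) (norm x + 1)" using reals_Archimedean2 by blast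
      then show ?thesis using that[of K] by simp
    qed
    have "c k x = 1" if "k \<ge> K" for k
    proof -
      have "real k \<ge> real K" using that by simp
      then have k: "real k > 1 / infdist x (- U)" "real k > norm x + 1" using K by linarith+
      then have "real k * infdist x (- U) > 1" using d by (simp add: field_simps)
      then show ?thesis using k by (simp add: c_def)
    qed
    then have "eventually (\<lambda>k. \<bar>indicator U x - c k x\<bar> = 0) sequentially"
      using True by (auto simp: eventually_sequentially)
    then show ?thesis by (rule tendsto_eventually)
  next
    case False
    then have "c k x = 0" for k using c01[of k x] by simp
    then show ?thesis using False by simp
  qed
  have Um: "U \<in> sets lborel" using U(1) by simp
  have "(\<lambda>k. \<integral>x. \<bar>indicator U x - c k x\<bar> \<partial>lborel) \<longlonglongrightarrow> (\<integral>x. 0 \<partial>(lborel :: 'a measure))"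
  proof (rule integral_dominated_convergence[where w="indicator U"])
    show "integrable lborel (indicator U :: 'a \<Rightarrow> real)" using U(2) Um by (intro integrable_real_indicator)
    show "(\<lambda>x. \<bar>indicator U x - c k x\<bar>) \<in> borel_measurable lborel" for k
      using borel_measurable_continuous_onI[OF cc] Um by measurable
    show "AE x in lborel. norm \<bar>indicator U x - c k x\<bar> \<le> indicator U x" for k
      using c01[of k] by (intro AE_I2) (simp add: abs_le_iff)
  qed (use lim in auto)
  then have "eventually (\<lambda>k. (\<integral>x. \<bar>indicator U x - c k x\<bar> \<partial>lborel) < e) sequentially"
    using e by (auto dest: order_tendstoD(2))
  then obtain k where k: "(\<integral>x. \<bar>indicator U x - c k x\<bar> \<partial>lborel) < e" by (auto simp: eventually_sequentially)
  have "integrable lborel (c k)"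
  proof (rule Bochner_Integration.integrable_bound[where f="indicator U :: 'a \<Rightarrow> real"])
    show "integrable lborel (indicator U :: 'a \<Rightarrow> real)" using U(2) Um by (intro integrable_real_indicator)
    show "c k \<in> borel_measurable lborel" using borel_measurable_continuous_onI[OF cc] by simp
    show "AE x in lborel. norm (c k x) \<le> norm (indicator U x :: real)" using c01[of k] by (intro AE_I2) simp
  qed
  with k cc[of k] csupp[of k] show ?thesis by blast
qed

lemma integrable_continuous_approx:
  fixes f :: "'a::euclidean_space \<Rightarrow> real"
  assumes "integrable lborel f" "e > 0"
  shows "\<exists>c R. continuous_on UNIV c \<and> (\<forall>z. norm z > R \<longrightarrow> c z = 0) \<and> integrable lborel c \<and>
    (\<integral>x. \<bar>f x - c x\<bar> \<partial>lborel) < e"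
  using assms
proof (induction arbitrary: e rule: integrable_induct)
  case (base A a)
  define e' where "e' = e / (2 * (\<bar>a\<bar> + 1))"
  have a1: "\<bar>a\<bar> + 1 > 0" by linarith
  have e': "e' > 0" using base a1 by (simp add: e'_def)
  have ae: "\<bar>a\<bar> * (2 * e') < e"
  proof -
    have "\<bar>a\<bar> * (2 * e') = e * (\<bar>a\<bar> / (\<bar>a\<bar> + 1))" using a1 by (simp add: e'_def field_simps)
    also have "\<dots> < e * 1" using base a1 by (intro mult_strict_left_mono) auto
    finally show ?thesis by simp
  qed
  obtain U where U: "open U" "A \<subseteq> U" "emeasure lborel (U - A) < e'"
    using outer_regular_lborel[of A e'] base e' by auto
  have Am: "A \<in> sets lborel" and Um: "U \<in> sets lborel" using base U by auto
  have "emeasure lborel U \<le> emeasure lborel A + emeasure lborel (U - A)"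
    using U(2) Am Um emeasure_subadditive[of A lborel "U - A"] by (simp add: Un_absorb1)
  also have "\<dots> < \<infinity>" using base U(3) by (simp add: ennreal_add_eq_top less_top[symmetric]) (metis ennreal_less_top less_top order.strict_trans top.not_eq_extremum)
  finally have Ufin: "emeasure lborel U < \<infinity>" .
  obtain c R where c: "continuous_on UNIV c" "\<forall>z. norm z > R \<longrightarrow> c z = 0" "integrable lborel c"
      "(\<integral>x. \<bar>indicator U x - c x\<bar> \<partial>lborel) < e'"
    using open_indicator_continuous_approx[OF U(1) Ufin e'] by blast
  have iU: "integrable lborel (indicator U :: 'a \<Rightarrow> real)" using Ufin Um by (intro integrable_real_indicator)
  have iD: "integrable lborel (indicator (U - A) :: 'a \<Rightarrow> real)"
    using U(3) Um Am by (intro integrable_real_indicator) (auto intro: order.strict_trans)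
  have mD: "measure lborel (U - A) < e'"
  proof -
    have "emeasure lborel (U - A) = ennreal (measure lborel (U - A))"
      using U(3) by (intro emeasure_eq_ennreal_measure) auto
    then show ?thesis using U(3) e' by (simp add: ennreal_less_iff)
  qed
  have "(\<integral>x. \<bar>indicator A x *\<^sub>R a - a * c x\<bar> \<partial>lborel) \<le> (\<integral>x. \<bar>a\<bar> * (indicator (U - A) x + \<bar>indicator U x - c x\<bar>) \<partial>lborel)"
  proof (rule integral_mono)
    show "integrable lborel (\<lambda>x. \<bar>indicator A x *\<^sub>R a - a * c x\<bar>)"
      using c(3) base by (intro integrable_abs Bochner_Integration.integrable_diff integrable_mult_right)
        (auto intro!: integrable_mult_left integrable_real_indicator)
    show "integrable lborel (\<lambda>x. \<bar>a\<bar> * (indicator (U - A) x + \<bar>indicator U x - c x\<bar>))"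
      using iD iU c(3) by auto
    fix x
    have "\<bar>indicator A x *\<^sub>R a - a * c x\<bar> = \<bar>a\<bar> * \<bar>indicator A x - c x\<bar>"
      by (simp add: abs_mult[symmetric] algebra_simps)
    also have "\<dots> \<le> \<bar>a\<bar> * (indicator (U - A) x + \<bar>indicator U x - c x\<bar>)"
      using U(2) by (intro mult_left_mono) (auto simp: indicator_def)
    finally show "\<bar>indicator A x *\<^sub>R a - a * c x\<bar> \<le> \<bar>a\<bar> * (indicator (U - A) x + \<bar>indicator U x - c x\<bar>)" .
  qed
  also have "\<dots> = \<bar>a\<bar> * (measure lborel (U - A) + (\<integral>x. \<bar>indicator U x - c x\<bar> \<partial>lborel))"
    using iD iU c(3) by simp
  also have "\<dots> \<le> \<bar>a\<bar> * (2 * e')" using c(4) mD by (intro mult_left_mono) auto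
  also have "\<dots> < e" by (rule ae)
  finally have "(\<integral>x. \<bar>indicator A x *\<^sub>R a - a * c x\<bar> \<partial>lborel) < e" .
  moreover have "continuous_on UNIV (\<lambda>x. a * c x)" using c(1) by (intro continuous_intros)
  ultimately show ?case using c(2,3) by (intro exI[of _ "\<lambda>x. a * c x"] exI[of _ R]) auto
next
  case (add f g)
  obtain c R where c: "continuous_on UNIV c" "\<forall>z. norm z > R \<longrightarrow> c z = 0" "integrable lborel c"
      "(\<integral>x. \<bar>f x - c x\<bar> \<partial>lborel) < e / 2"
    using add.IH(1)[of "e / 2"] add.prems by auto
  obtain c' R' where c': "continuous_on UNIV c'" "\<forall>z. norm z > R' \<longrightarrow> c' z = 0" "integrable lborel c'"
      "(\<integral>x. \<bar>g x - c' x\<bar> \<partial>lborel) < e / 2"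
    using add.IH(2)[of "e / 2"] add.prems by auto
  have "(\<integral>x. \<bar>f x + g x - (c x + c' x)\<bar> \<partial>lborel) \<le> (\<integral>x. \<bar>f x - c x\<bar> + \<bar>g x - c' x\<bar> \<partial>lborel)"
    using add.hyps c(3) c'(3) by (intro integral_mono) auto
  also have "\<dots> < e" using add.hyps c(3,4) c'(3,4) by simp
  finally have "(\<integral>x. \<bar>f x + g x - (c x + c' x)\<bar> \<partial>lborel) < e" .
  moreover have "continuous_on UNIV (\<lambda>x. c x + c' x)" using c(1) c'(1) by (intro continuous_intros)
  ultimately show ?case using c(2,3) c'(2,3)
    by (intro exI[of _ "\<lambda>x. c x + c' x"] exI[of _ "max R R'"]) auto
next
  case (lim f s)
  have fm[measurable]: "f \<in> borel_measurable borel" using lim.hyps by auto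
  have "(\<lambda>i. \<integral>x. \<bar>f x - s i x\<bar> \<partial>lborel) \<longlonglongrightarrow> (\<integral>x. 0 \<partial>(lborel :: 'a measure))"
  proof (rule integral_dominated_convergence[where w="\<lambda>x. 3 * norm (f x)"])
    show "(\<lambda>x. \<bar>f x - s i x\<bar>) \<in> borel_measurable lborel" for i
      using borel_measurable_integrable[OF lim.hyps(1)] by measurable
    show "integrable lborel (\<lambda>x. 3 * norm (f x))" using lim.hyps by auto
    show "AE x in lborel. (\<lambda>i. \<bar>f x - s i x\<bar>) \<longlonglongrightarrow> 0"
    proof (rule AE_I2)
      fix x :: 'a
      have "(\<lambda>i. s i x) \<longlonglongrightarrow> f x" using lim.hyps by simp
      then have "(\<lambda>i. \<bar>f x - s i x\<bar>) \<longlonglongrightarrow> \<bar>f x - f x\<bar>" by (intro tendsto_intros)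
      then show "(\<lambda>i. \<bar>f x - s i x\<bar>) \<longlonglongrightarrow> 0" by simp
    qed
    show "AE x in lborel. norm \<bar>f x - s i x\<bar> \<le> 3 * norm (f x)" for i
    proof (rule AE_I2)
      fix x :: 'a
      have "norm (s i x) \<le> 2 * norm (f x)" using lim.hyps by simp
      then show "norm \<bar>f x - s i x\<bar> \<le> 3 * norm (f x)" by simp
    qed
  qed simp
  then have l0: "(\<lambda>i. \<integral>x. \<bar>f x - s i x\<bar> \<partial>lborel) \<longlonglongrightarrow> 0" by simp
  have "eventually (\<lambda>i. (\<integral>x. \<bar>f x - s i x\<bar> \<partial>lborel) < e / 2) sequentially"
    by (rule order_tendstoD(2)[OF l0]) (use lim.prems in simp)
  then obtain i where i: "(\<integral>x. \<bar>f x - s i x\<bar> \<partial>lborel) < e / 2" by (auto simp: eventually_sequentially)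
  obtain c R where c: "continuous_on UNIV c" "\<forall>z. norm z > R \<longrightarrow> c z = 0" "integrable lborel c"
      "(\<integral>x. \<bar>s i x - c x\<bar> \<partial>lborel) < e / 2"
    using lim.IH[of "e / 2" i] lim.prems by auto
  have "(\<integral>x. \<bar>f x - c x\<bar> \<partial>lborel) \<le> (\<integral>x. \<bar>f x - s i x\<bar> + \<bar>s i x - c x\<bar> \<partial>lborel)"
    using lim.hyps c(3) by (intro integral_mono) auto
  also have "\<dots> < e" using lim.hyps c(3,4) i by simp
  finally show ?case using c by blast
qed

lemma mollify_L1_contraction:
  fixes f :: "real ^ 'n::finite \<Rightarrow> real"
  assumes f: "integrable lborel f" and r: "r > 0"
  shows "integrable lborel (conv f (mollifier r))" "(\<integral>x. \<bar>conv f (mollifier r) x\<bar> \<partial>lborel) \<le> (\<integral>x. \<bar>f x\<bar> \<partial>lborel)"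
proof -
  have out: "\<And>z :: real ^ 'n. norm z > r \<Longrightarrow> mollifier r z = 0" by (rule mollifier_outside[OF r])
  have [measurable]: "f \<in> borel_measurable borel" using f by auto
  have cm: "conv f (mollifier r) \<in> borel_measurable borel"
    by (rule borel_measurable_continuous_onI[OF C_k_continuous[of 0]])
      (rule C_k_conv[OF integrable_imp_loc_integrable[OF f] C_k_mollifier out])
  have i: "integrable lborel (\<lambda>y. f y * mollifier r (x - y))" for x
    by (rule conv_integrable[OF integrable_imp_loc_integrable[OF f] C_k_continuous[OF C_k_mollifier] out])
  have "(\<integral>\<^sup>+x. ennreal \<bar>conv f (mollifier r) x\<bar> \<partial>lborel) \<le>
      (\<integral>\<^sup>+x. \<integral>\<^sup>+y. ennreal \<bar>f y\<bar> * ennreal (mollifier r (x - y)) \<partial>lborel \<partial>lborel)"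
  proof (rule nn_integral_mono)
    fix x
    have "ennreal \<bar>conv f (mollifier r) x\<bar> \<le> (\<integral>\<^sup>+y. ennreal (norm (f y * mollifier r (x - y))) \<partial>lborel)"
      using integral_norm_bound_ennreal[OF i[of x]] by (simp add: conv_def)
    also have "\<dots> = (\<integral>\<^sup>+y. ennreal \<bar>f y\<bar> * ennreal (mollifier r (x - y)) \<partial>lborel)"
      by (intro nn_integral_cong) (simp add: abs_mult abs_of_nonneg[OF mollifier_nonneg] ennreal_mult mollifier_nonneg)
    finally show "ennreal \<bar>conv f (mollifier r) x\<bar> \<le> (\<integral>\<^sup>+y. ennreal \<bar>f y\<bar> * ennreal (mollifier r (x - y)) \<partial>lborel)" .
  qed
  also have "\<dots> = (\<integral>\<^sup>+y. \<integral>\<^sup>+x. ennreal \<bar>f y\<bar> * ennreal (mollifier r (x - y)) \<partial>lborel \<partial>lborel)"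
    by (rule lborel_pair.Fubini') measurable
  also have "\<dots> = (\<integral>\<^sup>+y. ennreal \<bar>f y\<bar> \<partial>lborel)"
  proof (rule nn_integral_cong)
    fix y :: "real ^ 'n"
    have "(\<integral>\<^sup>+x. ennreal (mollifier r (x - y)) \<partial>lborel) = ennreal (\<integral>x. mollifier r (x + - y) \<partial>lborel)"
      using integral_lborel_shift(2)[OF integrable_mollifier[OF r], of "- y"]
      by (subst nn_integral_eq_integral) (auto simp: mollifier_nonneg)
    also have "\<dots> = 1" unfolding integral_lborel_shift(1) by (simp add: integral_mollifier[OF r])
    finally show "(\<integral>\<^sup>+x. ennreal \<bar>f y\<bar> * ennreal (mollifier r (x - y)) \<partial>lborel) = ennreal \<bar>f y\<bar>"
      by (subst nn_integral_cmult) auto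
  qed
  also have "\<dots> = ennreal (\<integral>x. \<bar>f x\<bar> \<partial>lborel)" using f by (intro nn_integral_eq_integral) auto
  finally have le: "(\<integral>\<^sup>+x. ennreal \<bar>conv f (mollifier r) x\<bar> \<partial>lborel) \<le> ennreal (\<integral>x. \<bar>f x\<bar> \<partial>lborel)" .
  show int: "integrable lborel (conv f (mollifier r))"
    by (rule integrableI_bounded) (use cm le in \<open>auto intro: le_less_trans\<close>)
  have "ennreal (\<integral>x. \<bar>conv f (mollifier r) x\<bar> \<partial>lborel) \<le> ennreal (\<integral>x. \<bar>f x\<bar> \<partial>lborel)"
    using le int by (subst nn_integral_eq_integral[symmetric]) auto
  then show "(\<integral>x. \<bar>conv f (mollifier r) x\<bar> \<partial>lborel) \<le> (\<integral>x. \<bar>f x\<bar> \<partial>lborel)"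
    by (subst (asm) ennreal_le_iff) auto
qed

lemma conv_diff:
  fixes f :: "real ^ 'n::finite \<Rightarrow> real"
  assumes "integrable lborel f" "integrable lborel c" "r > 0"
  shows "conv (\<lambda>x. f x - c x) (mollifier r) x = conv f (mollifier r) x - conv c (mollifier r) x"
proof -
  have "integrable lborel (\<lambda>y. u y * mollifier r (x - y))" if "integrable lborel u" for u :: "real ^ 'n \<Rightarrow> real"
    using that mollifier_outside[OF assms(3)]
    by (intro conv_integrable[OF integrable_imp_loc_integrable C_k_continuous[OF C_k_mollifier]]) auto
  from this[OF assms(1)] this[OF assms(2)] show ?thesis by (simp add: conv_def left_diff_distrib)
qed

text \<open>
  Approximation by a continuous function with compact support, which is uniformly continuous; the
  error does not grow under mollification.
\<close>
theorem mollify_L1_tendsto: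
  fixes f :: "real ^ 'n::finite \<Rightarrow> real"
  assumes f: "integrable lborel f" and \<rho>: "\<And>k :: nat. \<rho> k > 0" "\<rho> \<longlonglongrightarrow> 0"
  shows "(\<lambda>k. \<integral>x. \<bar>conv f (mollifier (\<rho> k)) x - f x\<bar> \<partial>lborel) \<longlonglongrightarrow> 0"
proof (rule LIMSEQ_I)
  fix e :: real assume e: "e > 0"
  obtain c R where c: "continuous_on UNIV c" "\<forall>z. norm z > R \<longrightarrow> c z = 0" "integrable lborel c"
      "(\<integral>x. \<bar>f x - c x\<bar> \<partial>lborel) < e / 4"
    using integrable_continuous_approx[OF f, of "e / 4"] e by auto
  let ?B = "cball (0 :: real ^ 'n) (\<bar>R\<bar> + 1)"
  define e' where "e' = e / 4 / (measure lborel ?B + 1)"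
  have mB: "measure lborel ?B + 1 > 0" using measure_nonneg[of lborel ?B] by linarith
  have e': "e' > 0" using e mB by (simp add: e'_def)
  have e'B: "e' * measure lborel ?B \<le> e / 4"
    unfolding e'_def using absorb_quotient[of "e / 4" 1 "measure lborel ?B"] e by simp
  have "uniformly_continuous_on (cball (0 :: real ^ 'n) (\<bar>R\<bar> + 2)) c"
    using c(1) by (intro compact_uniformly_continuous continuous_on_subset[OF c(1)]) auto
  then obtain d where d: "d > 0" "\<forall>x\<in>cball 0 (\<bar>R\<bar> + 2). \<forall>x'\<in>cball 0 (\<bar>R\<bar> + 2). dist x' x < d \<longrightarrow> dist (c x') (c x) < e'"
    using e' unfolding uniformly_continuous_on_def by blast
  obtain K where K: "\<And>k. k \<ge> K \<Longrightarrow> \<rho> k < min d 1"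
    using LIMSEQ_D[OF \<rho>(2), of "min d 1"] d \<rho>(1) by (auto simp: abs_of_pos)
  have "norm ((\<integral>x. \<bar>conv f (mollifier (\<rho> k)) x - f x\<bar> \<partial>lborel) - 0) < e" if k: "k \<ge> K" for k
  proof -
    let ?m = "mollifier (\<rho> k) :: real ^ 'n \<Rightarrow> real"
    have cl: "\<bar>conv c ?m x - c x\<bar> \<le> e' * indicator ?B x" for x
    proof (cases "x \<in> ?B")
      case True
      have "\<bar>conv c ?m x - c x\<bar> \<le> e'"
      proof (rule mollify_close[OF c(1) \<rho>(1)])
        fix y :: "real ^ 'n" assume y: "norm y \<le> \<rho> k"
        have "norm (x - y) \<le> \<bar>R\<bar> + 2" using norm_triangle_ineq4[of x y] True y K[OF k] by simp
        moreover have "norm x \<le> \<bar>R\<bar> + 2" using True by simp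
        moreover have "dist (x - y) x < d" using y K[OF k] by (simp add: dist_norm)
        ultimately have "dist (c (x - y)) (c x) < e'"
          using d(2)[rule_format, of x "x - y"] by (simp only: mem_cball dist_0_norm)
        then show "\<bar>c (x - y) - c x\<bar> \<le> e'" by (simp add: dist_norm)
      qed
      then show ?thesis using True by simp
    next
      case False
      then have x: "norm x > \<bar>R\<bar> + 1" by simp
      have "conv c ?m x = 0"
        by (rule conv_outside[where S="\<bar>R\<bar>" and R="\<rho> k"])
          (use c(2) x K[OF k] mollifier_outside[OF \<rho>(1)] in auto)
      then show ?thesis using c(2) x False by simp
    qed
    have ic: "integrable lborel (conv c ?m)" and if': "integrable lborel (conv f ?m)"
      using mollify_L1_contraction(1)[OF _ \<rho>(1)] c(3) f by blast+
    have ifc: "integrable lborel (\<lambda>x. f x - c x)" using f c(3) by simp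
    have icfc: "integrable lborel (conv (\<lambda>x. f x - c x) ?m)" by (rule mollify_L1_contraction(1)[OF ifc \<rho>(1)])
    have iB: "integrable lborel (\<lambda>x. e' * indicator ?B x)"
      by (intro integrable_mult_right integrable_real_indicator emeasure_lborel_cball_finite) auto
    have "(\<integral>x. \<bar>conv f ?m x - f x\<bar> \<partial>lborel) \<le>
        (\<integral>x. \<bar>conv (\<lambda>x. f x - c x) ?m x\<bar> + e' * indicator ?B x + \<bar>f x - c x\<bar> \<partial>lborel)"
    proof (rule integral_mono)
      show "integrable lborel (\<lambda>x. \<bar>conv f ?m x - f x\<bar>)" using if' f by auto
      show "integrable lborel (\<lambda>x. \<bar>conv (\<lambda>x. f x - c x) ?m x\<bar> + e' * indicator ?B x + \<bar>f x - c x\<bar>)"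
        using icfc iB ifc by (intro Bochner_Integration.integrable_add integrable_abs)
      fix x
      show "\<bar>conv f ?m x - f x\<bar> \<le> \<bar>conv (\<lambda>x. f x - c x) ?m x\<bar> + e' * indicator ?B x + \<bar>f x - c x\<bar>"
        using cl[of x] unfolding conv_diff[OF f c(3) \<rho>(1)] by linarith
    qed
    also have "\<dots> = (\<integral>x. \<bar>conv (\<lambda>x. f x - c x) ?m x\<bar> \<partial>lborel) + e' * measure lborel ?B + (\<integral>x. \<bar>f x - c x\<bar> \<partial>lborel)"
      using icfc iB ifc by simp
    also have "\<dots> \<le> e / 4 + e / 4 + e / 4"
      using mollify_L1_contraction(2)[OF ifc \<rho>(1)[of k]] c(4) e'B by (intro add_mono) auto
    also have "\<dots> < e" using e by simp
    finally show ?thesis by simp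
  qed
  then show "\<exists>K. \<forall>k\<ge>K. norm ((\<integral>x. \<bar>conv f (mollifier (\<rho> k)) x - f x\<bar> \<partial>lborel) - 0) < e" by blast
qed

text \<open>
  One subsequence serves all indices, since the sum of the errors tends to 0 in L^1.
\<close>
lemma mollify_AE_subseq:
  fixes f :: "'i \<Rightarrow> real ^ 'n::finite \<Rightarrow> real"
  assumes I: "finite I" and f: "\<And>i. i \<in> I \<Longrightarrow> integrable lborel (f i)" and \<rho>: "\<And>k :: nat. \<rho> k > 0" "\<rho> \<longlonglongrightarrow> 0"
  shows "\<exists>r :: nat \<Rightarrow> nat. strict_mono r \<and> (AE x in lborel. \<forall>i\<in>I. (\<lambda>k. conv (f i) (mollifier (\<rho> (r k))) x) \<longlonglongrightarrow> f i x)"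
proof -
  define u where "u k x = (\<Sum>i\<in>I. \<bar>conv (f i) (mollifier (\<rho> k)) x - f i x\<bar>)" for k x
  have i1: "integrable lborel (\<lambda>x. \<bar>conv (f i) (mollifier (\<rho> k)) x - f i x\<bar>)" if "i \<in> I" for i k
    using mollify_L1_contraction(1)[OF f[OF that] \<rho>(1)] f[OF that] by simp
  have ui: "integrable lborel (u k)" for k
    unfolding u_def[abs_def] using i1 by (intro Bochner_Integration.integrable_sum)
  have "(\<integral>x. norm (u k x) \<partial>lborel) = (\<Sum>i\<in>I. \<integral>x. \<bar>conv (f i) (mollifier (\<rho> k)) x - f i x\<bar> \<partial>lborel)" for k
    using i1 by (simp add: u_def sum_nonneg Bochner_Integration.integral_sum)
  moreover have "(\<lambda>k. \<Sum>i\<in>I. \<integral>x. \<bar>conv (f i) (mollifier (\<rho> k)) x - f i x\<bar> \<partial>lborel) \<longlonglongrightarrow> (\<Sum>i\<in>I. 0)"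
    using mollify_L1_tendsto[OF f \<rho>] by (intro tendsto_sum)
  ultimately have "(\<lambda>k. \<integral>x. norm (u k x) \<partial>lborel) \<longlonglongrightarrow> 0" by simp
  from tendsto_L1_AE_subseq[OF ui this] obtain r :: "nat \<Rightarrow> nat" where
    r: "strict_mono r" "AE x in lborel. (\<lambda>k. u (r k) x) \<longlonglongrightarrow> 0" by blast
  have "AE x in lborel. \<forall>i\<in>I. (\<lambda>k. conv (f i) (mollifier (\<rho> (r k))) x) \<longlonglongrightarrow> f i x"
    using r(2)
  proof (rule AE_mp, intro AE_I2 impI ballI)
    fix x i assume lim: "(\<lambda>k. u (r k) x) \<longlonglongrightarrow> 0" and i: "i \<in> I"
    have "(\<lambda>k. conv (f i) (mollifier (\<rho> (r k))) x - f i x) \<longlonglongrightarrow> 0"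
    proof (rule Lim_null_comparison[OF _ lim], rule always_eventually, rule allI)
      fix k
      show "norm (conv (f i) (mollifier (\<rho> (r k))) x - f i x) \<le> u (r k) x"
        unfolding u_def real_norm_def
        by (rule member_le_sum[of i I "\<lambda>i. \<bar>conv (f i) (mollifier (\<rho> (r k))) x - f i x\<bar>"]) (use i I in auto)
    qed
    then show "(\<lambda>k. conv (f i) (mollifier (\<rho> (r k))) x) \<longlonglongrightarrow> f i x" by (simp add: LIM_zero_iff)
  qed
  with r(1) show ?thesis by blast
qed

section \<open>The untruncated weight\<close>

text \<open>
  For \<open>s \<ge> 3 / 2\<close> the factor \<open>s / (s - 1)\<close> in
  \<open>strong_type\<close> is at most 3; so one constant is valid for all \<open>s\<close> near
  \<open>n\<close>.
\<close>
definition strong_const :: "'n::finite itself \<Rightarrow> real" where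
  "strong_const _ = 12 * weak_const TYPE('n) * (2 * kernel_bound TYPE('n)) ^ CARD('n)"

lemma strong_const_pos: "strong_const TYPE('n::finite) > 0"
  using weak_const_pos[where 'n='n] kernel_bound_ge_1[where 'n='n] by (simp add: strong_const_def)

definition jac_const :: "'n::finite itself \<Rightarrow> real" where
  "jac_const _ = 2 * (fact CARD('n) * grad_const TYPE('n) ^ CARD('n))"

lemma jac_const_pos: "jac_const TYPE('n::finite) > 0"
  using grad_const_pos[where 'n='n] by (simp add: jac_const_def)

context maximal
begin

lemma strong_type_uniform:
  fixes s :: real
  assumes \<rho>: "\<rho> > 0" and N: "CARD('n) \<ge> 2" and s: "\<bar>s - CARD('n)\<bar> \<le> 1 / 2"
  shows "(\<integral>\<^sup>+x. ennreal (maxf F \<rho> x powr s) \<partial>lborel) \<le>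
    ennreal (strong_const TYPE('n)) * (\<integral>\<^sup>+x. ennreal (F x powr s) \<partial>lborel)"
proof -
  let ?k = "2 * kernel_bound TYPE('n)" and ?W = "weak_const TYPE('n)"
  have N2: "real CARD('n) \<ge> 2" using N by linarith
  have s1: "s \<ge> 3 / 2" "s - 1 \<le> real CARD('n)" using N2 s by linarith+
  have k: "?k \<ge> 1" using kernel_bound_ge_1[where 'n='n] by simp
  have "4 * ?W * s / (s - 1) * ?k powr (s - 1) \<le> (12 * ?W) * ?k powr (real CARD('n))"
  proof (rule mult_mono)
    have "s / (s - 1) \<le> 3" using s1 by (simp add: divide_le_eq)
    then have "4 * ?W * (s / (s - 1)) \<le> 4 * ?W * 3" using weak_const_pos[where 'n='n] by (intro mult_left_mono) auto
    then show "4 * ?W * s / (s - 1) \<le> 12 * ?W" by simp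
    show "?k powr (s - 1) \<le> ?k powr (real CARD('n))" using k s1 by (intro powr_mono) auto
  qed (use weak_const_pos[where 'n='n] in auto)
  also have "\<dots> = strong_const TYPE('n)" using k by (simp add: strong_const_def powr_realpow)
  finally have le: "4 * ?W * s / (s - 1) * ?k powr (s - 1) \<le> strong_const TYPE('n)" .
  have "(\<integral>\<^sup>+x. ennreal (maxf F \<rho> x powr s) \<partial>lborel) \<le>
      ennreal (4 * ?W * s / (s - 1) * ?k powr (s - 1)) * (\<integral>\<^sup>+x. ennreal (F x powr s) \<partial>lborel)"
    by (rule strong_type[OF \<rho>]) (use s1 in simp)
  also have "\<dots> \<le> ennreal (strong_const TYPE('n)) * (\<integral>\<^sup>+x. ennreal (F x powr s) \<partial>lborel)"
    using le by (intro mult_right_mono ennreal_leI) auto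
  finally show ?thesis .
qed

text \<open>
  The weight is the increasing limit of the truncated maximal functions as \<open>\<rho>\<close>
  tends to 0; it is finite almost everywhere because of the uniform strong type bound. A multiple
  of \<open>g powr (n + a)\<close> dominates all weighted mollified Jacobians, so their integrals
  converge along a subsequence on which the mollified gradients converge almost everywhere. The
  weight is chosen before the functions \<open>u\<close>, because a single weight has to serve all
  minors.
\<close>
theorem maximal_weight:
  fixes a :: real
  assumes N: "CARD('n) \<ge> 2" and a: "\<bar>a\<bar> \<le> 1 / 2" and pos: "(\<integral>x. F x \<partial>lborel) > 0"
    and fin: "(\<integral>\<^sup>+x. ennreal (F x powr (CARD('n) + a)) \<partial>lborel) < \<infinity>"
  shows "\<exists>g. g \<in> borel_measurable borel \<and> (AE x in lborel. 0 < g x \<and> F x \<le> moll_bound TYPE('n) * g x) \<and>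
    integrable lborel (\<lambda>x. g x powr (CARD('n) + a)) \<and>
    (\<integral>\<^sup>+x. ennreal (g x powr (CARD('n) + a)) \<partial>lborel) \<le>
      ennreal (strong_const TYPE('n)) * (\<integral>\<^sup>+x. ennreal (F x powr (CARD('n) + a)) \<partial>lborel) \<and>
    (\<forall>(u :: 'n \<Rightarrow> real ^ 'n \<Rightarrow> real) G R.
      (\<forall>i. has_weak_gradient (u i) (G i)) \<longrightarrow> (\<forall>i x. norm (G i x) \<le> F x) \<longrightarrow> (\<forall>i z. norm z > R \<longrightarrow> u i z = 0) \<longrightarrow>
      integrable lborel (\<lambda>x. g x powr a * det (\<chi> i. G i x)) \<and>
      \<bar>\<integral>x. g x powr a * det (\<chi> i. G i x) \<partial>lborel\<bar> \<le>
        jac_const TYPE('n) * \<bar>a\<bar> * (\<integral>x. g x powr (CARD('n) + a) \<partial>lborel))"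
proof -
  let ?N = "CARD('n)"
  define s where "s = real ?N + a"
  have s: "\<bar>s - ?N\<bar> \<le> 1 / 2" "s > 0" using a N by (auto simp: s_def)
  define \<rho> where "\<rho> k = 1 / real (Suc k)" for k
  have \<rho>: "\<rho> k > 0" for k by (simp add: \<rho>_def)
  have \<rho>0: "\<rho> \<longlonglongrightarrow> 0" unfolding \<rho>_def using LIMSEQ_inverse_real_of_nat by (simp add: inverse_eq_divide)
  define p where "p k = maxf F (\<rho> k)" for k
  have pm[measurable]: "p k \<in> borel_measurable borel" for k unfolding p_def by (rule borel_measurable_maxf[OF \<rho>])
  have ppos: "p k x > 0" for k x unfolding p_def by (rule maxf_pos[OF \<rho> pos])
  have pmono: "p k x \<le> p l x" if "k \<le> l" for k l x
    unfolding p_def using that by (intro maxf_antimono \<rho>) (auto simp: \<rho>_def intro: frac_le)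
  define B where "B = ennreal (strong_const TYPE('n)) * (\<integral>\<^sup>+x. ennreal (F x powr s) \<partial>lborel)"
  have Bfin: "B < \<infinity>" using fin by (simp add: B_def s_def ennreal_mult_less_top)
  have pB: "(\<integral>\<^sup>+x. ennreal (p k x powr s) \<partial>lborel) \<le> B" for k
    unfolding p_def B_def by (rule strong_type_uniform[OF \<rho> N s(1)])
  have Sup: "(\<integral>\<^sup>+x. (SUP k. ennreal (p k x powr s)) \<partial>lborel) \<le> B"
  proof -
    have "incseq (\<lambda>k x. ennreal (p k x powr s))"
      using pmono ppos s(2) by (auto simp: incseq_def le_fun_def intro!: ennreal_leI powr_mono2 less_imp_le[OF ppos])
    then have "(\<integral>\<^sup>+x. (SUP k. ennreal (p k x powr s)) \<partial>lborel) = (SUP k. \<integral>\<^sup>+x. ennreal (p k x powr s) \<partial>lborel)"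
      by (intro nn_integral_monotone_convergence_SUP) auto
    also have "\<dots> \<le> B" using pB by (intro SUP_least) auto
    finally show ?thesis .
  qed
  \<comment> \<open>\<open>enn2real\<close> assigns the value 0 on the null set where the supremum is infinite\<close>
  define g where "g x = enn2real (SUP k. ennreal (p k x))" for x
  have gm[measurable]: "g \<in> borel_measurable borel" unfolding g_def by measurable
  have bdd: "AE x in lborel. bdd_above (range (\<lambda>k. p k x))"
  proof -
    have "(\<integral>\<^sup>+x. (SUP k. ennreal (p k x powr s)) \<partial>lborel) \<noteq> \<infinity>" using Sup Bfin by auto
    then have "AE x in lborel. (SUP k. ennreal (p k x powr s)) \<noteq> \<infinity>"
      by (intro nn_integral_PInf_AE) auto
    then show ?thesis
    proof (rule AE_mp, intro AE_I2 impI)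
      fix x assume fin: "(SUP k. ennreal (p k x powr s)) \<noteq> \<infinity>"
      define c where "c = enn2real (SUP k. ennreal (p k x powr s))"
      have "p k x powr s \<le> c" for k
      proof -
        have "(SUP k. ennreal (p k x powr s)) < top"
          using fin by (simp only: infinity_ennreal_def top.not_eq_extremum)
        then have "ennreal c = (SUP k. ennreal (p k x powr s))"
          unfolding c_def by (rule ennreal_enn2real)
        then have "ennreal (p k x powr s) \<le> ennreal c" by (simp only:) (intro SUP_upper UNIV_I)
        then show ?thesis by (subst (asm) ennreal_le_iff) (auto simp: c_def)
      qed
      then have *: "(p k x powr s) powr (1 / s) \<le> c powr (1 / s)" for k
        using s(2) by (intro powr_mono2) auto
      have "p k x \<le> c powr (1 / s)" for k
        using *[of k] s(2) ppos[of k x] by (simp add: powr_powr)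
      then show "bdd_above (range (\<lambda>k. p k x))" by (intro bdd_aboveI2)
    qed
  qed
  have gprop: "AE x in lborel. (\<lambda>k. p k x) \<longlonglongrightarrow> g x \<and> (\<forall>k. p k x \<le> g x)"
    using bdd
  proof (rule AE_mp, intro AE_I2 impI)
    fix x assume b: "bdd_above (range (\<lambda>k. p k x))"
    have inc: "incseq (\<lambda>k. p k x)" using pmono by (auto simp: incseq_def)
    note l1 = LIMSEQ_incseq_SUP[OF b inc]
    have "incseq (\<lambda>k. ennreal (p k x))" using inc by (auto simp: incseq_def intro: ennreal_leI)
    then have "(\<lambda>k. ennreal (p k x)) \<longlonglongrightarrow> (SUP k. ennreal (p k x))" by (rule LIMSEQ_SUP)
    then have "(SUP k. ennreal (p k x)) = ennreal (SUP k. p k x)"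
      using tendsto_ennrealI[OF l1] by (rule LIMSEQ_unique)
    moreover have "0 \<le> (SUP k. p k x)" by (rule cSUP_upper2[OF b, of 0]) (auto intro: less_imp_le[OF ppos])
    ultimately have g: "g x = (SUP k. p k x)" by (simp add: g_def)
    from l1 show "(\<lambda>k. p k x) \<longlonglongrightarrow> g x \<and> (\<forall>k. p k x \<le> g x)"
      unfolding g using b by (auto intro: cSUP_upper)
  qed
  have gB: "(\<integral>\<^sup>+x. ennreal (g x powr s) \<partial>lborel) \<le> B"
  proof -
    have "(\<integral>\<^sup>+x. ennreal (g x powr s) \<partial>lborel) \<le> (\<integral>\<^sup>+x. (SUP k. ennreal (p k x powr s)) \<partial>lborel)"
    proof (rule nn_integral_mono_AE, rule AE_mp[OF gprop], intro AE_I2 impI)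
      fix x assume g: "(\<lambda>k. p k x) \<longlonglongrightarrow> g x \<and> (\<forall>k. p k x \<le> g x)"
      have "g x > 0" using g ppos[of 0 x] by (meson less_le_trans)
      then have "(\<lambda>k. ennreal (p k x powr s)) \<longlonglongrightarrow> ennreal (g x powr s)"
        using g by (intro tendsto_ennrealI tendsto_powr tendsto_const) auto
      then show "ennreal (g x powr s) \<le> (SUP k. ennreal (p k x powr s))"
        by (rule LIMSEQ_le_const2) (intro exI[of _ 0] allI impI SUP_upper UNIV_I)
    qed
    with Sup show ?thesis by simp
  qed
  have gint: "integrable lborel (\<lambda>x. g x powr s)"
    by (rule integrableI_bounded) (use gB Bfin in \<open>auto intro: le_less_trans\<close>)
  have Fg: "AE x in lborel. 0 < g x \<and> F x \<le> moll_bound TYPE('n) * g x"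
  proof -
    obtain r :: "nat \<Rightarrow> nat" where r: "strict_mono r"
        "AE x in lborel. \<forall>i\<in>{()}. (\<lambda>k. conv F (mollifier (\<rho> (r k))) x) \<longlonglongrightarrow> F x"
      using mollify_AE_subseq[of "{()}" "\<lambda>_. F" \<rho>] int \<rho> \<rho>0 by auto
    show ?thesis using r(2) gprop
    proof eventually_elim
      case (elim x)
      have "conv F (mollifier (\<rho> (r k))) x \<le> moll_bound TYPE('n) * g x" for k
      proof -
        have "conv F (mollifier (\<rho> (r k))) x \<le> moll_bound TYPE('n) * p (r k) x"
          unfolding p_def by (rule mollified_le_maxf[OF \<rho>])
        also have "\<dots> \<le> moll_bound TYPE('n) * g x"
          using elim moll_bound_pos[where 'n='n] by (intro mult_left_mono) auto
        finally show ?thesis .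
      qed
      then have "F x \<le> moll_bound TYPE('n) * g x" using elim(1) by (auto intro: LIMSEQ_le_const2)
      moreover have "g x > 0" using elim(2) ppos[of 0 x] by (meson less_le_trans)
      ultimately show ?case by simp
    qed
  qed
  have key: "integrable lborel (\<lambda>x. g x powr a * det (\<chi> i. G i x)) \<and>
      \<bar>\<integral>x. g x powr a * det (\<chi> i. G i x) \<partial>lborel\<bar> \<le> jac_const TYPE('n) * \<bar>a\<bar> * (\<integral>x. g x powr s \<partial>lborel)"
    if wg: "\<And>i. has_weak_gradient (u i) (G i)" and GF: "\<And>i x. norm (G i x) \<le> F x"
      and supp: "\<And>i z. norm z > R \<Longrightarrow> u i z = 0"
    for u :: "'n \<Rightarrow> real ^ 'n \<Rightarrow> real" and G R
  proof -
    have Gm[measurable]: "(\<lambda>x. G i x $ j) \<in> borel_measurable borel" for i j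
      using wg[of i] by (simp add: has_weak_gradient_def loc_integrable_def)
    have Gint: "integrable lborel (\<lambda>x. G i x $ j)" for i j
    proof (rule Bochner_Integration.integrable_bound[OF int])
      show "AE x in lborel. norm (G i x $ j) \<le> norm (F x)"
        using GF[of i] component_le_norm_cart[of "G i _" j] nonneg by (intro AE_I2) (auto intro: order_trans)
    qed simp
    obtain r :: "nat \<Rightarrow> nat" where r: "strict_mono r"
        "AE x in lborel. \<forall>ij\<in>UNIV. (\<lambda>k. conv (\<lambda>x. G (fst ij) x $ snd ij) (mollifier (\<rho> (r k))) x) \<longlonglongrightarrow> G (fst ij) x $ snd ij"
      using mollify_AE_subseq[of UNIV "\<lambda>ij x. G (fst ij) x $ snd ij" \<rho>] Gint \<rho> \<rho>0 by auto
    define v where "v k i = conv (u i) (mollifier (\<rho> (r k)))" for k i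
    have pdv: "partial_deriv j (v k i) = conv (\<lambda>x. G i x $ j) (mollifier (\<rho> (r k)))" for k i j
      unfolding v_def by (rule partial_deriv_mollified[OF wg \<rho>])
    have jle: "\<bar>jac (v k) x\<bar> \<le> fact ?N * grad_const TYPE('n) ^ ?N * p (r k) x ^ ?N" for k x
    proof -
      have "\<bar>jac (v k) x\<bar> \<le> fact ?N * (\<Prod>i\<in>(UNIV :: 'n set). grad_const TYPE('n) * p (r k) x)"
        unfolding jac_def
      proof (rule det_le_fact_prod)
        fix i j
        show "\<bar>(\<chi> i j. partial_deriv j (v k i) x) $ i $ j\<bar> \<le> grad_const TYPE('n) * p (r k) x"
          using mollified_partial_le[OF wg GF \<rho>, where x=x] by (simp add: v_def p_def)
      qed
      also have "\<dots> = fact ?N * grad_const TYPE('n) ^ ?N * p (r k) x ^ ?N"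
        by (simp add: power_mult_distrib)
      finally show ?thesis .
    qed
    have bnd: "\<bar>p (r k) x powr a * jac (v k) x\<bar> \<le> fact ?N * grad_const TYPE('n) ^ ?N * p (r k) x powr s" for k x
    proof -
      have "\<bar>p (r k) x powr a * jac (v k) x\<bar> \<le> p (r k) x powr a * (fact ?N * grad_const TYPE('n) ^ ?N * p (r k) x ^ ?N)"
        unfolding abs_mult using jle by (intro mult_mono) auto
      also have "\<dots> = fact ?N * grad_const TYPE('n) ^ ?N * (p (r k) x ^ ?N * p (r k) x powr a)" by simp
      also have "p (r k) x ^ ?N * p (r k) x powr a = p (r k) x powr s"
        using ppos[of "r k" x] by (simp add: s_def powr_add powr_realpow)
      finally show ?thesis .
    qed
    have jm: "jac (v k) \<in> borel_measurable borel" for k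
    proof -
      have "C_k 1 (v k i)" for i
        unfolding v_def using wg[of i] mollifier_outside[OF \<rho>]
        by (intro C_k_conv[OF _ C_k_mollifier]) (auto simp: has_weak_gradient_def)
      then show ?thesis by (intro borel_measurable_continuous_onI jac_continuous)
    qed
    note [measurable] = jm
    have dm: "(\<lambda>x. det (\<chi> i. G i x)) \<in> borel_measurable borel" unfolding det_def by simp
    note [measurable] = dm
    have lim: "AE x in lborel. (\<lambda>k. p (r k) x powr a * jac (v k) x) \<longlonglongrightarrow> g x powr a * det (\<chi> i. G i x)"
      using r(2) gprop Fg
    proof eventually_elim
      case (elim x)
      have "(\<lambda>k. p (r k) x) \<longlonglongrightarrow> g x"
        using LIMSEQ_subseq_LIMSEQ[OF conjunct1[OF elim(2)] r(1)] by (simp add: comp_def)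
      moreover have "(\<lambda>k. jac (v k) x) \<longlonglongrightarrow> det (\<chi> i. G i x)"
      proof -
        have "(\<lambda>k. partial_deriv j (v k i) x) \<longlonglongrightarrow> G i x $ j" for i j
          using elim(1)[rule_format, of "(i, j)"] by (simp add: pdv)
        then show ?thesis unfolding jac_def det_def by (auto intro!: tendsto_intros)
      qed
      ultimately show ?case using elim(3) by (intro tendsto_mult tendsto_powr tendsto_const) auto
    qed
    have wint: "integrable lborel (\<lambda>x. fact ?N * grad_const TYPE('n) ^ ?N * g x powr s)" using gint by simp
    have dom: "AE x in lborel. norm (p (r k) x powr a * jac (v k) x) \<le> fact ?N * grad_const TYPE('n) ^ ?N * g x powr s" for k
      using gprop
    proof eventually_elim
      case (elim x)
      have "p (r k) x powr s \<le> g x powr s" using elim s(2) ppos[of "r k" x] by (intro powr_mono2) auto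
      then have "fact ?N * grad_const TYPE('n) ^ ?N * p (r k) x powr s \<le> fact ?N * grad_const TYPE('n) ^ ?N * g x powr s"
        using grad_const_pos[where 'n='n] by (intro mult_left_mono) auto
      with bnd[of k x] show ?case unfolding real_norm_def by (rule order_trans)
    qed
    have conv: "(\<lambda>k. \<integral>x. p (r k) x powr a * jac (v k) x \<partial>lborel) \<longlonglongrightarrow> (\<integral>x. g x powr a * det (\<chi> i. G i x) \<partial>lborel)"
      by (rule integral_dominated_convergence[OF _ _ wint lim dom]) measurable
    have int': "integrable lborel (\<lambda>x. g x powr a * det (\<chi> i. G i x))"
      by (rule integrable_dominated_convergence[OF _ _ wint lim dom]) measurable
    have est: "\<bar>\<integral>x. p (r k) x powr a * jac (v k) x \<partial>lborel\<bar> \<le> jac_const TYPE('n) * \<bar>a\<bar> * (\<integral>x. g x powr s \<partial>lborel)" for k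
    proof -
      have "ennreal \<bar>\<integral>x. p (r k) x powr a * jac (v k) x \<partial>lborel\<bar> \<le>
          ennreal (jac_const TYPE('n) * \<bar>a\<bar>) * (\<integral>\<^sup>+x. ennreal (p (r k) x powr s) \<partial>lborel)"
      proof -
        have vk: "v k = (\<lambda>i. conv (u i) (mollifier (\<rho> (r k))))" by (simp add: v_def fun_eq_iff)
        show ?thesis unfolding vk p_def jac_const_def s_def
          by (rule mollified_jacobian_estimate[OF N wg GF supp \<rho> pos a])
      qed
      also have "\<dots> \<le> ennreal (jac_const TYPE('n) * \<bar>a\<bar>) * (\<integral>\<^sup>+x. ennreal (g x powr s) \<partial>lborel)"
      proof (intro mult_left_mono nn_integral_mono_AE)
        show "AE x in lborel. ennreal (p (r k) x powr s) \<le> ennreal (g x powr s)"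
          using gprop
        proof eventually_elim
          case (elim x)
          then show ?case using s(2) ppos[of "r k" x] by (intro ennreal_leI powr_mono2) auto
        qed
      qed simp
      also have "(\<integral>\<^sup>+x. ennreal (g x powr s) \<partial>lborel) = ennreal (\<integral>x. g x powr s \<partial>lborel)"
        by (rule nn_integral_eq_integral[OF gint]) simp
      also have "ennreal (jac_const TYPE('n) * \<bar>a\<bar>) * \<dots> = ennreal (jac_const TYPE('n) * \<bar>a\<bar> * (\<integral>x. g x powr s \<partial>lborel))"
        by (rule ennreal_mult''[symmetric]) simp
      finally show ?thesis using jac_const_pos[where 'n='n] by (subst (asm) ennreal_le_iff) auto
    qed
    have "\<bar>\<integral>x. g x powr a * det (\<chi> i. G i x) \<partial>lborel\<bar> \<le> jac_const TYPE('n) * \<bar>a\<bar> * (\<integral>x. g x powr s \<partial>lborel)"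
      by (rule LIMSEQ_le_const2[OF tendsto_rabs[OF conv]]) (use est in auto)
    with int' show ?thesis by blast
  qed
  show ?thesis
    unfolding s_def[symmetric]
    using gm Fg gint gB[unfolded B_def] key by (intro exI[of _ g]) blast
qed

end

section \<open>Covectors, minors and the operator norm\<close>

lemma covector_cong:
  assumes "covector m \<omega>" "\<And>j i. i < m \<Longrightarrow> v j i = w j i"
  shows "\<omega> v = \<omega> w"
  using assms unfolding covector_def by blast

lemma covector_linear:
  assumes "covector m \<omega>"
  shows "\<omega> (v(j := (\<lambda>i. a * x i + b * y i))) = a * \<omega> (v(j := x)) + b * \<omega> (v(j := y))"
  using assms unfolding covector_def by blast

lemma covector_alternating:
  assumes "covector m \<omega>" "j \<noteq> k" "v j = v k"
  shows "\<omega> v = 0"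
  using assms unfolding covector_def by blast

lemma covector_sum:
  assumes "covector m \<omega>" "finite S"
  shows "\<omega> (v(j := (\<lambda>i. \<Sum>k\<in>S. c k * x k i))) = (\<Sum>k\<in>S. c k * \<omega> (v(j := x k)))"
  using assms(2)
proof (induction S rule: finite_induct)
  case empty
  show ?case using covector_linear[OF assms(1), of v j 0 "\<lambda>_. 0" 0 "\<lambda>_. 0"]
    by (simp only: sum.empty mult_zero_left add_0_left)
next
  case (insert k S)
  then show ?case
    using covector_linear[OF assms(1), of v j "c k" "x k" 1 "\<lambda>i. \<Sum>k\<in>S. c k * x k i"]
    by (simp add: fun_upd_def)
qed

text \<open>
  The arguments are expanded in the standard basis one after the other.
\<close>
lemma covector_eq_0I:
  assumes "covector m \<omega>" and basis: "\<And>J. range J \<subseteq> {..<m} \<Longrightarrow> \<omega> (\<lambda>j. std_basis (J j)) = 0"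
  shows "\<omega> v = 0"
proof -
  have "\<omega> v = 0" if "finite S" "\<And>j. j \<notin> S \<Longrightarrow> \<exists>k<m. v j = std_basis k" for S v
    using that
  proof (induction S arbitrary: v rule: finite_induct)
    case empty
    then have "\<forall>j. \<exists>k<m. v j = std_basis k" by simp
    then obtain J where J: "\<forall>j. J j < m \<and> v j = std_basis (J j)" by metis
    then have "v = (\<lambda>j. std_basis (J j))" "range J \<subseteq> {..<m}" by auto
    then show ?case using basis[of J] by simp
  next
    case (insert j S)
    have "\<omega> v = \<omega> (v(j := (\<lambda>i. \<Sum>k<m. v j k * std_basis k i)))"
      by (intro covector_cong[OF assms(1)])
        (auto simp: std_basis_def if_distrib[of "\<lambda>x. _ * x"] cong: if_cong)
    also have "\<dots> = (\<Sum>k<m. v j k * \<omega> (v(j := std_basis k)))"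
      by (rule covector_sum[OF assms(1)]) simp
    also have "\<dots> = 0"
    proof (intro sum.neutral ballI)
      fix k assume "k \<in> {..<m}"
      then have "\<omega> (v(j := std_basis k)) = 0"
        using insert.prems by (intro insert.IH) auto
      then show "v j k * \<omega> (v(j := std_basis k)) = 0" by simp
    qed
    finally show ?case .
  qed
  from this[of UNIV v] show ?thesis by simp
qed

text \<open>
  Polarization of \<open>f x x = 0\<close>.
\<close>
lemma covector_transpose:
  assumes "covector m \<omega>" "a \<noteq> b"
  shows "\<omega> (v \<circ> Transposition.transpose a b) = - \<omega> v"
proof -
  define f where "f x y = \<omega> (v(a := x, b := y))" for x y
  have add1: "f (\<lambda>i. x i + x' i) y = f x y + f x' y" for x x' y
    using covector_linear[OF assms(1), of "v(b := y)" a 1 x 1 x']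
    unfolding f_def fun_upd_twist[OF assms(2)] by simp
  have add2: "f x (\<lambda>i. y i + y' i) = f x y + f x y'" for x y y'
    using covector_linear[OF assms(1), of "v(a := x)" b 1 y 1 y'] by (simp add: f_def)
  have diag: "f x x = 0" for x
    unfolding f_def by (rule covector_alternating[OF assms]) (simp add: assms(2))
  have "f (v b) (v a) + f (v a) (v b) = 0"
    using diag[of "\<lambda>i. v a i + v b i"] by (simp add: add1 add2 diag)
  moreover have "f (v a) (v b) = \<omega> v" by (simp add: f_def)
  moreover have "v(a := v b, b := v a) = v \<circ> Transposition.transpose a b"
    by (auto simp: fun_eq_iff Transposition.transpose_def)
  ultimately show ?thesis by (simp add: f_def)
qed

lemma covector_permute_eq_0:
  assumes "covector m \<omega>" "p permutes (UNIV :: 'n::finite set)" "\<omega> v = 0"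
  shows "\<omega> (v \<circ> p) = 0"
proof -
  have "\<forall>v. \<omega> v = 0 \<longrightarrow> \<omega> (v \<circ> p) = 0"
    using assms(2) finite[of "UNIV :: 'n set"]
  proof (induction p rule: permutes_induct)
    case id
    then show ?case by simp
  next
    case (swap a b p)
    show ?case
    proof (intro allI impI)
      fix v assume "\<omega> v = 0"
      then have "\<omega> (v \<circ> Transposition.transpose a b) = 0"
        using covector_transpose[OF assms(1), of a b v] by (cases "a = b") auto
      then have "\<omega> ((v \<circ> Transposition.transpose a b) \<circ> p) = 0" using swap by blast
      then show "\<omega> (v \<circ> (Transposition.transpose a b \<circ> p)) = 0" by (simp add: comp_assoc)
    qed
  qed
  with assms(3) show ?thesis by blast
qed

definition rank :: "'n::{finite,wellorder} \<Rightarrow> nat" where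
  "rank x = card {y. y < x}"

lemma rank_less: "rank (x :: 'n::{finite,wellorder}) < CARD('n)"
  unfolding rank_def by (intro psubset_card_mono) auto

lemma rank_strict_mono: "x < y \<Longrightarrow> rank x < rank (y :: 'n::{finite,wellorder})"
  unfolding rank_def by (intro psubset_card_mono) auto

text \<open>
  Used to sort a tuple of distinct indices into a multi-index.
\<close>
lemma strict_mono_enumeration:
  fixes A :: "nat set"
  assumes "finite A" "card A = CARD('n::{finite,wellorder})"
  shows "\<exists>I :: 'n \<Rightarrow> nat. strict_mono I \<and> range I = A"
proof -
  let ?l = "sorted_list_of_set A"
  let ?I = "\<lambda>x :: 'n. ?l ! rank x"
  have len: "length ?l = CARD('n)" using assms by simp
  have mono: "strict_mono ?I"
  proof (rule strict_monoI)
    fix x y :: 'n assume "x < y"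
    then have "rank x < rank y" "rank y < length ?l" using rank_strict_mono rank_less len by auto
    moreover have "sorted_wrt (<) ?l" by (simp add: strict_sorted_list_of_set)
    ultimately show "?I x < ?I y" by (rule sorted_wrt_nth_less[rotated])
  qed
  have "?I x \<in> set ?l" for x using rank_less[of x] by (intro nth_mem) (simp add: assms)
  then have "range ?I \<subseteq> A" using assms(1) by auto
  moreover have "card (range ?I) = card A"
    using mono assms(2) by (simp add: card_image strict_mono_imp_inj_on)
  ultimately have "range ?I = A" using assms(1) card_subset_eq by blast
  with mono show ?thesis by blast
qed

lemma strict_mono_range_unique:
  fixes I J :: "'n::wellorder \<Rightarrow> nat"
  assumes "strict_mono I" "strict_mono J" "range I = range J"
  shows "I = J"
proof
  fix x show "I x = J x"
  proof (induction x rule: less_induct)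
    case (less x)
    have *: "J' x \<le> I' x" if IJ: "strict_mono I'" "strict_mono J'" "range I' = range J'" "\<And>y. y < x \<Longrightarrow> I' y = J' y"
      for I' J' :: "'n \<Rightarrow> nat"
    proof -
      obtain z where z: "I' x = J' z" using IJ(3) by blast
      have "\<not> z < x"
      proof
        assume "z < x"
        then have "I' z < I' x" by (rule strict_monoD[OF IJ(1)])
        moreover have "I' z = J' z" using \<open>z < x\<close> by (rule IJ(4))
        ultimately show False using z by simp
      qed
      then have "x \<le> z" by simp
      then show ?thesis using z IJ(2) by (simp add: strict_mono_less_eq)
    qed
    have "J x \<le> I x" by (rule *) (use assms less in auto)
    moreover have "I x \<le> J x" by (rule *) (use assms less in auto)
    ultimately show ?case by simp
  qed
qed

lemma finite_multi_indices: "finite (multi_indices m :: ('n::{finite,wellorder} \<Rightarrow> nat) set)"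
proof -
  have "multi_indices m \<subseteq> PiE (UNIV :: 'n set) (\<lambda>_. {..<m})"
    by (auto simp: multi_indices_def PiE_def)
  then show ?thesis by (rule finite_subset) (intro finite_PiE; simp)
qed

lemma covector_minor:
  fixes I :: "'n::{finite,wellorder} \<Rightarrow> nat"
  assumes "I \<in> multi_indices m"
  shows "covector m (\<lambda>v. det (\<chi> j k. v j (I k)))"
proof -
  have I: "I k < m" for k using assms by (auto simp: multi_indices_def)
  show ?thesis unfolding covector_def
  proof (intro conjI allI impI)
    fix v w :: "'n \<Rightarrow> nat \<Rightarrow> real" assume "\<forall>j. \<forall>i<m. v j i = w j i"
    then have "(\<chi> j k. v j (I k)) = (\<chi> j k. w j (I k))" using I by (simp add: vec_eq_iff)
    then show "det (\<chi> j k. v j (I k)) = det (\<chi> j k. w j (I k))" by simp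
  next
    fix v :: "'n \<Rightarrow> nat \<Rightarrow> real" and j and a b :: real and x y
    have upd: "(\<chi> l k. (v(j := z)) l (I k)) = (\<chi> l. if l = j then (\<chi> k. z (I k)) else (\<chi> k. v l (I k)))" for z
      by (simp add: vec_eq_iff)
    have eq: "(\<chi> k. a * x (I k) + b * y (I k)) = a *s (\<chi> k. x (I k)) + b *s (\<chi> k. y (I k))"
      by (simp add: vec_eq_iff)
    show "det (\<chi> l k. (v(j := \<lambda>i. a * x i + b * y i)) l (I k)) =
        a * det (\<chi> l k. (v(j := x)) l (I k)) + b * det (\<chi> l k. (v(j := y)) l (I k))"
      using det_row_add[of j "\<lambda>_. a *s (\<chi> k. x (I k))" "\<lambda>_. b *s (\<chi> k. y (I k))" "\<lambda>l. \<chi> k. v l (I k)"]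
        det_row_mul[of j a "\<lambda>_. \<chi> k. x (I k)" "\<lambda>l. \<chi> k. v l (I k)"]
        det_row_mul[of j b "\<lambda>_. \<chi> k. y (I k)" "\<lambda>l. \<chi> k. v l (I k)"]
      unfolding upd eq by simp
  next
    fix v :: "'n \<Rightarrow> nat \<Rightarrow> real" and j k assume "j \<noteq> k \<and> v j = v k"
    then show "det (\<chi> j k. v j (I k)) = 0"
      by (intro det_identical_rows[of j k]) (auto simp: row_def vec_eq_iff)
  qed
qed

lemma minor_std_basis:
  fixes I J :: "'n::{finite,wellorder} \<Rightarrow> nat"
  assumes "I \<in> multi_indices m" "J \<in> multi_indices m"
  shows "det (\<chi> j k. std_basis (J j) (I k)) = (if I = J then 1 else 0)"
proof (cases "I = J")
  case True
  have "(\<chi> j k. std_basis (J j) (I k)) = mat 1"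
    using assms(2) True
    by (auto simp: vec_eq_iff std_basis_def mat_def multi_indices_def strict_mono_eq)
  then show ?thesis using True by simp
next
  case False
  have "\<not> range J \<subseteq> range I"
  proof
    assume "range J \<subseteq> range I"
    moreover have "card (range J) = card (range I)"
      using assms by (simp add: multi_indices_def card_image strict_mono_imp_inj_on)
    ultimately have "range J = range I" by (intro card_subset_eq) auto
    then show False using strict_mono_range_unique[of I J] assms False by (auto simp: multi_indices_def)
  qed
  then obtain j where j: "J j \<notin> range I" by blast
  then have "I k \<noteq> J j" for k by (metis rangeI)
  then have "row j (\<chi> j k. std_basis (J j) (I k)) = 0"
    by (simp add: row_def vec_eq_iff std_basis_def)
  then show ?thesis using False by (simp add: det_zero_row)
qed

text \<open>
  The difference of the two sides is a covector that vanishes on increasing tuples of basis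
  vectors. By alternation it vanishes on all tuples of basis vectors, hence everywhere.
\<close>
theorem covector_expansion:
  fixes \<omega> :: "('n::{finite,wellorder} \<Rightarrow> nat \<Rightarrow> real) \<Rightarrow> real"
  assumes "covector m \<omega>"
  shows "\<omega> v = (\<Sum>I\<in>multi_indices m. \<omega> (\<lambda>j. std_basis (I j)) * det (\<chi> j k. v j (I k)))"
proof -
  define c where "c I = \<omega> (\<lambda>j. std_basis (I j))" for I
  define \<theta> where "\<theta> v = \<omega> v - (\<Sum>I\<in>multi_indices m. c I * det (\<chi> j k. v j (I k)))" for v
  have cov: "covector m \<theta>"
    unfolding covector_def
  proof (intro conjI allI impI)
    fix v w :: "'n \<Rightarrow> nat \<Rightarrow> real" assume "\<forall>j. \<forall>i<m. v j i = w j i"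
    then show "\<theta> v = \<theta> w"
      unfolding \<theta>_def using covector_cong[OF assms, of v w]
      by (intro arg_cong2[where f="(-)"] sum.cong arg_cong2[where f="(*)"] refl covector_cong[OF covector_minor]) auto
  next
    fix v :: "'n \<Rightarrow> nat \<Rightarrow> real" and j a b x y
    have "(\<Sum>I\<in>multi_indices m. c I * det (\<chi> l k. (v(j := \<lambda>i. a * x i + b * y i)) l (I k))) =
        (\<Sum>I\<in>multi_indices m. c I * (a * det (\<chi> l k. (v(j := x)) l (I k)) + b * det (\<chi> l k. (v(j := y)) l (I k))))"
      by (intro sum.cong refl arg_cong2[where f="(*)"] covector_linear[OF covector_minor])
    then show "\<theta> (v(j := \<lambda>i. a * x i + b * y i)) = a * \<theta> (v(j := x)) + b * \<theta> (v(j := y))"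
      unfolding \<theta>_def covector_linear[OF assms]
      by (simp add: sum.distrib sum_distrib_left algebra_simps)
  next
    fix v :: "'n \<Rightarrow> nat \<Rightarrow> real" and j k assume jk: "j \<noteq> k \<and> v j = v k"
    have "(\<Sum>I\<in>multi_indices m. c I * det (\<chi> j k. v j (I k))) = 0"
    proof (intro sum.neutral ballI)
      fix I :: "'n \<Rightarrow> nat" assume "I \<in> multi_indices m"
      then have "det (\<chi> j k. v j (I k)) = 0"
        using covector_alternating[OF covector_minor, of I m j k v] jk by blast
      then show "c I * det (\<chi> j k. v j (I k)) = 0" by simp
    qed
    then show "\<theta> v = 0" using covector_alternating[OF assms, of j k v] jk by (simp add: \<theta>_def)
  qed
  have mono: "\<theta> (\<lambda>j. std_basis (I j)) = 0" if "I \<in> multi_indices m" for I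
    unfolding \<theta>_def using that
    by (simp add: minor_std_basis[OF _ that] finite_multi_indices c_def sum.delta if_distrib[of "\<lambda>x. _ * x"] cong: if_cong)
  have "\<theta> v = 0"
  proof (rule covector_eq_0I[OF cov])
    fix J :: "'n \<Rightarrow> nat" assume J: "range J \<subseteq> {..<m}"
    show "\<theta> (\<lambda>j. std_basis (J j)) = 0"
    proof (cases "inj J")
      case False
      then obtain j k where "j \<noteq> k" "J j = J k" by (auto simp: inj_def)
      then show ?thesis by (intro covector_alternating[OF cov, of j k]) auto
    next
      case True
      have "card (range J) = CARD('n)" using True by (simp add: card_image)
      then obtain I :: "'n \<Rightarrow> nat" where I: "strict_mono I" "range I = range J"
        using strict_mono_enumeration[of "range J"] by auto
      define p where "p = inv I \<circ> J"
      have Ip: "I (p j) = J j" for j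
        using I(2) by (simp add: p_def f_inv_into_f)
      have "inj p"
      proof (rule injI)
        fix x y assume "p x = p y"
        then have "J x = J y" using Ip[of x] Ip[of y] by simp
        then show "x = y" using True by (simp add: inj_eq)
      qed
      then have "bij p" by (simp add: bij_def finite_UNIV_inj_surj)
      then have "p permutes UNIV" by (intro bij_imp_permutes) auto
      moreover have "I \<in> multi_indices m" using I J by (simp add: multi_indices_def)
      ultimately have "\<theta> ((\<lambda>j. std_basis (I j)) \<circ> p) = 0"
        using covector_permute_eq_0[OF cov] mono by blast
      then show ?thesis by (simp add: comp_def Ip)
    qed
  qed
  then show ?thesis by (simp add: \<theta>_def c_def)
qed

lemma star_pullback_expansion:
  fixes \<omega> :: "('n::{finite,wellorder} \<Rightarrow> nat \<Rightarrow> real) \<Rightarrow> real"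
  assumes "covector m \<omega>"
  shows "star_pullback \<omega> A = (\<Sum>I\<in>multi_indices m. \<omega> (\<lambda>j. std_basis (I j)) * det (\<chi> k. A (I k)))"
proof -
  have "det (\<chi> j k. A (I k) $ j) = det (\<chi> k. A (I k))" for I :: "'n \<Rightarrow> nat"
    using det_transpose[of "\<chi> k. A (I k)"] by (simp add: transpose_def)
  then show ?thesis
    unfolding star_pullback_def by (subst covector_expansion[OF assms]) simp
qed

text \<open>
  One factor is exchanged at a time.
\<close>
lemma prod_diff_le:
  fixes a b :: "'i \<Rightarrow> real"
  assumes "finite S" "S \<noteq> {}" "\<And>i. i \<in> S \<Longrightarrow> \<bar>a i\<bar> \<le> c" "\<And>i. i \<in> S \<Longrightarrow> \<bar>b i\<bar> \<le> c"
    "\<And>i. i \<in> S \<Longrightarrow> \<bar>a i - b i\<bar> \<le> d"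
  shows "\<bar>prod a S - prod b S\<bar> \<le> real (card S) * (d * c ^ (card S - 1))"
  using assms
proof (induction S rule: finite_ne_induct)
  case (singleton x)
  then show ?case by simp
next
  case (insert x S)
  have c: "c \<ge> 0" and d: "d \<ge> 0"
    using insert.prems(1,3)[of x] abs_ge_zero order_trans by blast+
  obtain k where k: "card S = Suc k" using insert(1,2) by (metis card_0_eq not0_implies_Suc)
  have "prod a (insert x S) - prod b (insert x S) = (a x - b x) * prod a S + b x * (prod a S - prod b S)"
    using insert by (simp add: algebra_simps)
  also have "\<bar>\<dots>\<bar> \<le> \<bar>a x - b x\<bar> * \<bar>prod a S\<bar> + \<bar>b x\<bar> * \<bar>prod a S - prod b S\<bar>"
    by (metis abs_mult abs_triangle_ineq)
  also have "\<dots> \<le> d * c ^ card S + c * (real (card S) * (d * c ^ (card S - 1)))"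
  proof (intro add_mono mult_mono)
    have "\<bar>prod a S\<bar> \<le> (\<Prod>i\<in>S. c)"
      unfolding abs_prod using insert.prems by (intro prod_mono) auto
    then show "\<bar>prod a S\<bar> \<le> c ^ card S" by simp
  qed (use insert c d in auto)
  also have "\<dots> = real (card (insert x S)) * (d * c ^ (card (insert x S) - 1))"
    using insert k by (simp add: algebra_simps)
  finally show ?case .
qed

lemma det_diff_le:
  fixes M L :: "real ^ 'n::finite ^ 'n"
  assumes "\<And>i j. \<bar>M $ i $ j\<bar> \<le> c" "\<And>i j. \<bar>L $ i $ j\<bar> \<le> c" "\<And>i j. \<bar>M $ i $ j - L $ i $ j\<bar> \<le> d"
  shows "\<bar>det M - det L\<bar> \<le> fact CARD('n) * real CARD('n) * (d * c ^ (CARD('n) - 1))"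
proof -
  have "\<bar>det M - det L\<bar> \<le> (\<Sum>p\<in>{p. p permutes (UNIV :: 'n set)}.
      \<bar>of_int (sign p) * ((\<Prod>i\<in>UNIV. M $ i $ p i) - (\<Prod>i\<in>UNIV. L $ i $ p i))\<bar>)"
    unfolding det_def sum_subtractf[symmetric] right_diff_distrib[symmetric] by (rule sum_abs)
  also have "\<dots> \<le> (\<Sum>p\<in>{p. p permutes (UNIV :: 'n set)}. real CARD('n) * (d * c ^ (CARD('n) - 1)))"
  proof (rule sum_mono)
    fix p
    have "\<bar>(\<Prod>i\<in>UNIV. M $ i $ p i) - (\<Prod>i\<in>UNIV. L $ i $ p i)\<bar> \<le> real CARD('n) * (d * c ^ (CARD('n) - 1))"
      using assms by (intro prod_diff_le) auto
    then show "\<bar>of_int (sign p) * ((\<Prod>i\<in>UNIV. M $ i $ p i) - (\<Prod>i\<in>UNIV. L $ i $ p i))\<bar> \<le>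
        real CARD('n) * (d * c ^ (CARD('n) - 1))"
      by (simp add: abs_mult sign_def)
  qed
  also have "\<dots> = fact CARD('n) * real CARD('n) * (d * c ^ (CARD('n) - 1))"
    by (simp add: card_permutations)
  finally show ?thesis .
qed

lemma star_pullback_le:
  fixes \<omega> :: "('n::{finite,wellorder} \<Rightarrow> nat \<Rightarrow> real) \<Rightarrow> real"
  assumes "covector m \<omega>" "\<And>i. i < m \<Longrightarrow> norm (A i) \<le> c"
  shows "\<bar>star_pullback \<omega> A\<bar> \<le> l1_norm m \<omega> * (fact CARD('n) * c ^ CARD('n))"
proof -
  have "\<bar>star_pullback \<omega> A\<bar> \<le> (\<Sum>I\<in>multi_indices m. \<bar>\<omega> (\<lambda>j. std_basis (I j)) * det (\<chi> k. A (I k))\<bar>)"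
    unfolding star_pullback_expansion[OF assms(1)] by (rule sum_abs)
  also have "\<dots> \<le> (\<Sum>I\<in>multi_indices m. \<bar>\<omega> (\<lambda>j. std_basis (I j))\<bar> * (fact CARD('n) * c ^ CARD('n)))"
  proof (rule sum_mono)
    fix I :: "'n \<Rightarrow> nat" assume "I \<in> multi_indices m"
    then have I: "I i < m" for i by (auto simp: multi_indices_def)
    have "\<bar>(\<chi> k. A (I k)) $ i $ j\<bar> \<le> c" for i j
      using assms(2)[OF I, of i] component_le_norm_cart[of "A (I i)" j] by simp
    then have "\<bar>det (\<chi> k. A (I k))\<bar> \<le> fact CARD('n) * c ^ CARD('n)"
      using det_le_fact_prod[of "\<chi> k. A (I k)" "\<lambda>_. c"] by simp
    then show "\<bar>\<omega> (\<lambda>j. std_basis (I j)) * det (\<chi> k. A (I k))\<bar> \<le>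
        \<bar>\<omega> (\<lambda>j. std_basis (I j))\<bar> * (fact CARD('n) * c ^ CARD('n))"
      by (simp add: abs_mult mult_left_mono)
  qed
  finally show ?thesis by (simp add: l1_norm_def sum_distrib_right)
qed

lemma star_pullback_diff_le:
  fixes \<omega> :: "('n::{finite,wellorder} \<Rightarrow> nat \<Rightarrow> real) \<Rightarrow> real"
  assumes "covector m \<omega>" "\<And>i. i < m \<Longrightarrow> norm (A i) \<le> c" "\<And>i. i < m \<Longrightarrow> norm (B i) \<le> c"
    "\<And>i. i < m \<Longrightarrow> norm (A i - B i) \<le> d"
  shows "\<bar>star_pullback \<omega> A - star_pullback \<omega> B\<bar> \<le>
    l1_norm m \<omega> * (fact CARD('n) * real CARD('n) * (d * c ^ (CARD('n) - 1)))"
proof -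
  have "\<bar>star_pullback \<omega> A - star_pullback \<omega> B\<bar> \<le>
      (\<Sum>I\<in>multi_indices m. \<bar>\<omega> (\<lambda>j. std_basis (I j)) * (det (\<chi> k. A (I k)) - det (\<chi> k. B (I k)))\<bar>)"
    unfolding star_pullback_expansion[OF assms(1)] sum_subtractf[symmetric] right_diff_distrib[symmetric]
    by (rule sum_abs)
  also have "\<dots> \<le> (\<Sum>I\<in>multi_indices m. \<bar>\<omega> (\<lambda>j. std_basis (I j))\<bar> *
      (fact CARD('n) * real CARD('n) * (d * c ^ (CARD('n) - 1))))"
  proof (rule sum_mono)
    fix I :: "'n \<Rightarrow> nat" assume "I \<in> multi_indices m"
    then have I: "I i < m" for i by (auto simp: multi_indices_def)
    have "\<bar>det (\<chi> k. A (I k)) - det (\<chi> k. B (I k))\<bar> \<le> fact CARD('n) * real CARD('n) * (d * c ^ (CARD('n) - 1))"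
    proof (rule det_diff_le)
      fix i j
      show "\<bar>(\<chi> k. A (I k)) $ i $ j\<bar> \<le> c" using assms(2)[OF I, of i] component_le_norm_cart[of "A (I i)" j] by simp
      show "\<bar>(\<chi> k. B (I k)) $ i $ j\<bar> \<le> c" using assms(3)[OF I, of i] component_le_norm_cart[of "B (I i)" j] by simp
      show "\<bar>(\<chi> k. A (I k)) $ i $ j - (\<chi> k. B (I k)) $ i $ j\<bar> \<le> d"
        using assms(4)[OF I, of i] component_le_norm_cart[of "A (I i) - B (I i)" j] by simp
    qed
    then show "\<bar>\<omega> (\<lambda>j. std_basis (I j)) * (det (\<chi> k. A (I k)) - det (\<chi> k. B (I k)))\<bar> \<le>
        \<bar>\<omega> (\<lambda>j. std_basis (I j))\<bar> * (fact CARD('n) * real CARD('n) * (d * c ^ (CARD('n) - 1)))"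
      by (simp only: abs_mult) (intro mult_left_mono, auto)
  qed
  finally show ?thesis by (simp add: l1_norm_def sum_distrib_right)
qed

text \<open>
  The minors of an orthonormal frame have entries bounded by 1 and are thus at most
  \<open>n!\<close>. This crude form of \<open>1 \<le> l1_norm m \<omega>\<close> makes \<open>K *
  l * t\<close> large for large \<open>l\<close>.
\<close>
lemma calibration_l1_norm_ge:
  fixes \<omega> :: "('n::{finite,wellorder} \<Rightarrow> nat \<Rightarrow> real) \<Rightarrow> real"
  assumes "calibration m \<omega>" "CARD('n) \<le> m"
  shows "1 \<le> fact CARD('n) * l1_norm m \<omega>"
proof -
  have cov: "covector m \<omega>" and "comass m \<omega> = 1" using assms(1) by (auto simp: calibration_def)
  then have "1 = (SUP v \<in> {v. orthonormal_frame m v}. \<omega> v)" by (simp add: comass_def)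
  also have "\<dots> \<le> fact CARD('n) * l1_norm m \<omega>"
  proof (rule cSUP_least)
    have "inner_upto m (std_basis (rank j)) (std_basis (rank k)) = (if j = k then 1 else 0)" for j k :: 'n
    proof -
      have "rank j < m" "rank k < m" using rank_less[of j] rank_less[of k] assms(2) by auto
      moreover have "rank j = rank k \<longleftrightarrow> j = k"
        using rank_strict_mono[of j k] rank_strict_mono[of k j] by (cases j k rule: linorder_cases) auto
      ultimately show ?thesis
        by (auto simp: inner_upto_def std_basis_def if_distrib[of "\<lambda>x. _ * x"] cong: if_cong)
    qed
    then have "(\<lambda>j :: 'n. std_basis (rank j)) \<in> {v. orthonormal_frame m v}"
      unfolding orthonormal_frame_def by simp
    then show "{v :: 'n \<Rightarrow> nat \<Rightarrow> real. orthonormal_frame m v} \<noteq> {}"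
      by (rule ex_in_conv[THEN iffD1, OF exI])
    fix v :: "'n \<Rightarrow> nat \<Rightarrow> real" assume "v \<in> {v. orthonormal_frame m v}"
    then have sq: "(\<Sum>i<m. v j i * v j i) = 1" for j
      by (simp add: orthonormal_frame_def inner_upto_def)
    have le1: "\<bar>v j i\<bar> \<le> 1" if "i < m" for i j
    proof -
      have "v j i * v j i \<le> (\<Sum>i<m. v j i * v j i)"
        using that by (intro member_le_sum) auto
      then show ?thesis using sq[of j] by (simp add: abs_square_le_1[symmetric] power2_eq_square)
    qed
    have "\<omega> v \<le> (\<Sum>I\<in>multi_indices m. \<bar>\<omega> (\<lambda>j. std_basis (I j))\<bar> * fact CARD('n))"
      unfolding covector_expansion[OF cov, of v]
    proof (rule sum_mono)
      fix I :: "'n \<Rightarrow> nat" assume "I \<in> multi_indices m"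
      then have I: "I i < m" for i by (auto simp: multi_indices_def)
      have "\<bar>det (\<chi> j k. v j (I k))\<bar> \<le> fact CARD('n)"
        using det_le_fact_prod[of "\<chi> j k. v j (I k)" "\<lambda>_. 1"] le1 I by simp
      then have "\<bar>\<omega> (\<lambda>j. std_basis (I j)) * det (\<chi> j k. v j (I k))\<bar> \<le> \<bar>\<omega> (\<lambda>j. std_basis (I j))\<bar> * fact CARD('n)"
        unfolding abs_mult by (intro mult_left_mono) auto
      then show "\<omega> (\<lambda>j. std_basis (I j)) * det (\<chi> j k. v j (I k)) \<le> \<bar>\<omega> (\<lambda>j. std_basis (I j))\<bar> * fact CARD('n)"
        by linarith
    qed
    then show "\<omega> v \<le> fact CARD('n) * l1_norm m \<omega>"
      by (simp add: l1_norm_def sum_distrib_left mult.commute)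
  qed
  finally show ?thesis .
qed

lemma op_norm_quotient_le:
  "L2_set (\<lambda>i. A i \<bullet> v) {..<m} / norm v \<le> (\<Sum>i<m. norm (A i))"
proof (cases "v = 0")
  case False
  have "L2_set (\<lambda>i. A i \<bullet> v) {..<m} \<le> (\<Sum>i<m. \<bar>A i \<bullet> v\<bar>)" by (rule L2_set_le_sum_abs)
  also have "\<dots> \<le> (\<Sum>i<m. norm (A i) * norm v)" by (intro sum_mono Cauchy_Schwarz_ineq2)
  finally show ?thesis using False by (simp add: divide_le_eq sum_distrib_right)
qed (simp add: sum_nonneg)

lemma op_norm_bdd: "bdd_above (range (\<lambda>v. L2_set (\<lambda>i. A i \<bullet> v) {..<m} / norm v))"
  using op_norm_quotient_le by (intro bdd_aboveI[of _ "\<Sum>i<m. norm (A i)"]) blast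

lemma op_norm_le_sum: "op_norm m A \<le> (\<Sum>i<m. norm (A i))"
  unfolding op_norm_def by (intro cSUP_least op_norm_quotient_le) auto

lemma op_norm_nonneg: "op_norm m A \<ge> 0"
  unfolding op_norm_def by (rule cSUP_upper2[OF op_norm_bdd, of 0]) auto

lemma row_le_op_norm:
  assumes "i < m"
  shows "norm (A i) \<le> op_norm m A"
proof (cases "A i = 0")
  case True
  then show ?thesis using op_norm_nonneg by simp
next
  case False
  have "norm (A i) * norm (A i) \<le> L2_set (\<lambda>k. A k \<bullet> A i) {..<m}"
    using member_le_L2_set[of "{..<m}" i "\<lambda>k. A k \<bullet> A i"] assms
    by (simp add: power2_norm_eq_inner[symmetric] power2_eq_square)
  then have "norm (A i) \<le> L2_set (\<lambda>k. A k \<bullet> A i) {..<m} / norm (A i)"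
    using False by (simp add: le_divide_eq)
  also have "\<dots> \<le> op_norm m A"
    unfolding op_norm_def by (rule cSUP_upper[OF _ op_norm_bdd]) simp
  finally show ?thesis .
qed

lemma op_norm_cong: "(\<And>i. i < m \<Longrightarrow> A i = B i) \<Longrightarrow> op_norm m A = op_norm m B"
  unfolding op_norm_def by (intro SUP_cong refl arg_cong2[where f="(/)"] L2_set_cong) auto

lemma op_norm_scaleR:
  assumes "c \<ge> 0"
  shows "op_norm m (\<lambda>i. c *\<^sub>R A i) = c * op_norm m A"
proof -
  have le: "op_norm m (\<lambda>i. c *\<^sub>R A i) \<le> c * op_norm m A" if "c \<ge> 0" for c and A :: "nat \<Rightarrow> real ^ 'b"
    unfolding op_norm_def[of m "\<lambda>i. c *\<^sub>R A i"]
  proof (rule cSUP_least)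
    fix v :: "real ^ 'b"
    have "L2_set (\<lambda>i. (c *\<^sub>R A i) \<bullet> v) {..<m} / norm v = c * (L2_set (\<lambda>i. A i \<bullet> v) {..<m} / norm v)"
      using that by (simp add: L2_set_right_distrib)
    also have "\<dots> \<le> c * op_norm m A"
      unfolding op_norm_def using that by (intro mult_left_mono cSUP_upper[OF _ op_norm_bdd]) auto
    finally show "L2_set (\<lambda>i. (c *\<^sub>R A i) \<bullet> v) {..<m} / norm v \<le> c * op_norm m A" .
  qed simp
  show ?thesis
  proof (cases "c = 0")
    case True
    then show ?thesis using le[of 0 A] op_norm_nonneg[of m "\<lambda>i. c *\<^sub>R A i"] by simp
  next
    case False
    then have "c > 0" using assms by simp
    have "op_norm m A = op_norm m (\<lambda>i. inverse c *\<^sub>R (c *\<^sub>R A i))" using False by simp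
    also have "\<dots> \<le> inverse c * op_norm m (\<lambda>i. c *\<^sub>R A i)" using assms by (intro le) simp
    finally have "c * op_norm m A \<le> op_norm m (\<lambda>i. c *\<^sub>R A i)"
      using \<open>c > 0\<close> by (simp add: field_simps)
    with le[OF assms, of A] show ?thesis by simp
  qed
qed

text \<open>
  A supremum over a countable set of directions is measurable in the matrix.
\<close>
lemma op_norm_eq_countable:
  fixes A :: "nat \<Rightarrow> real ^ 'n::finite"
  assumes D: "\<And>U :: (real ^ 'n) set. open U \<Longrightarrow> U \<noteq> {} \<Longrightarrow> \<exists>d\<in>D. d \<in> U"
  shows "op_norm m A = (SUP v\<in>insert 0 D. L2_set (\<lambda>i. A i \<bullet> v) {..<m} / norm v)" (is "_ = ?S")
proof (rule antisym)
  have bdd: "bdd_above ((\<lambda>v. L2_set (\<lambda>i. A i \<bullet> v) {..<m} / norm v) ` insert 0 D)"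
    by (rule bdd_above_mono[OF op_norm_bdd]) auto
  show "?S \<le> op_norm m A"
    unfolding op_norm_def by (rule cSUP_subset_mono[OF _ op_norm_bdd]) auto
  show "op_norm m A \<le> ?S"
    unfolding op_norm_def[of m A]
  proof (rule cSUP_least)
    fix v :: "real ^ 'n"
    show "L2_set (\<lambda>i. A i \<bullet> v) {..<m} / norm v \<le> ?S"
    proof (cases "v = 0")
      case True
      have "0 \<le> ?S" by (rule cSUP_upper2[OF bdd, of 0]) auto
      then show ?thesis using True by simp
    next
      case False
      show ?thesis
      proof (rule ccontr)
        assume nt: "\<not> ?thesis"
        let ?U = "{w. ?S * norm w < L2_set (\<lambda>i. A i \<bullet> w) {..<m}} \<inter> - {0}"
        have "open ?U"
          unfolding L2_set_def
          by (intro open_Int open_Collect_less continuous_intros)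
        moreover have "v \<in> ?U" using nt False by (simp add: not_le less_divide_eq)
        ultimately obtain d where d: "d \<in> D" "d \<in> ?U" using D by blast
        then have "?S < L2_set (\<lambda>i. A i \<bullet> d) {..<m} / norm d" by (simp add: less_divide_eq)
        moreover have "L2_set (\<lambda>i. A i \<bullet> d) {..<m} / norm d \<le> ?S"
          using d by (intro cSUP_upper[OF _ bdd]) auto
        ultimately show False by simp
      qed
    qed
  qed simp
qed

lemma borel_measurable_op_norm:
  fixes A :: "'a \<Rightarrow> nat \<Rightarrow> real ^ 'n::finite"
  assumes [measurable]: "\<And>i. i < m \<Longrightarrow> (\<lambda>x. A x i) \<in> borel_measurable M"
  shows "(\<lambda>x. op_norm m (A x)) \<in> borel_measurable M"
proof -
  obtain D :: "(real ^ 'n) set" where D: "countable D" "\<And>U. open U \<Longrightarrow> U \<noteq> {} \<Longrightarrow> \<exists>d\<in>D. d \<in> U"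
    using countable_dense_exists by blast
  have "(\<lambda>x. SUP v\<in>insert 0 D. L2_set (\<lambda>i. A x i \<bullet> v) {..<m} / norm v) \<in> borel_measurable M"
  proof (rule borel_measurable_cSUP)
    show "(\<lambda>x. L2_set (\<lambda>i. A x i \<bullet> v) {..<m} / norm v) \<in> borel_measurable M" for v
      unfolding L2_set_def by measurable
    show "bdd_above ((\<lambda>v. L2_set (\<lambda>i. A x i \<bullet> v) {..<m} / norm v) ` insert 0 D)" for x
      by (rule bdd_above_mono[OF op_norm_bdd]) auto
  qed (use D in auto)
  then show ?thesis using op_norm_eq_countable[OF D(2)] by simp
qed

section \<open>The inequality for Borel data\<close>

lemma absorb_quarters:
  fixes X Y q :: real
  assumes "X \<le> 1 / 4 * (X + Y) + 1 / 4 * (X + Y) + q"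
  shows "X \<le> Y + 2 * q"
  using assms by (simp add: field_simps)

text \<open>
  The price of replacing \<open>a powr e\<close> by the smaller weight \<open>M powr e\<close>
  when \<open>e\<close> is negative. The factor \<open>\<bar>e\<bar>\<close> comes from \<open>1 -
  x powr e \<le> \<bar>e\<bar> * ln x\<close>.
\<close>
lemma powr_difference_le:
  fixes a M e :: real
  assumes a: "0 < a" "a \<le> M" and e: "-1 / 2 \<le> e" "e \<le> 0" and n: "n \<ge> 2"
  shows "(a powr e - M powr e) * a ^ n \<le> \<bar>e\<bar> * M powr (n + e)"
proof -
  have M: "M > 0" using a by linarith
  have "a powr e - M powr e = a powr e * (1 - (M / a) powr e)"
    using a M by (simp add: powr_divide right_diff_distrib)
  also have "\<dots> \<le> a powr e * (\<bar>e\<bar> * (M / a))"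
  proof (intro mult_left_mono)
    have "1 + e * ln (M / a) \<le> exp (e * ln (M / a))" by (rule exp_ge_add_one_self)
    moreover have "(M / a) powr e = exp (e * ln (M / a))" using a M by (simp add: powr_def)
    moreover have "\<bar>e\<bar> * ln (M / a) = - (e * ln (M / a))" using e by simp
    ultimately have "1 - (M / a) powr e \<le> \<bar>e\<bar> * ln (M / a)" by linarith
    also have "\<dots> \<le> \<bar>e\<bar> * (M / a)"
      using a M by (intro mult_left_mono less_imp_le[OF ln_less_self] divide_pos_pos) auto
    finally show "1 - (M / a) powr e \<le> \<bar>e\<bar> * (M / a)" .
  qed simp
  finally have "(a powr e - M powr e) * a ^ n \<le> a powr e * (\<bar>e\<bar> * (M / a)) * a ^ n"
    using a by (intro mult_right_mono) auto
  also have "\<dots> = \<bar>e\<bar> * M * a powr (real n - 1 + e)"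
  proof -
    have "a ^ n = a powr (real n)" using a by (simp add: powr_realpow)
    moreover have "a powr e * a powr (real n) / a = a powr (real n - 1 + e)"
      using a by (simp add: powr_add powr_diff)
    moreover have "a powr e * (\<bar>e\<bar> * (M / a)) * a powr (real n) = \<bar>e\<bar> * M * (a powr e * a powr (real n) / a)"
      by simp
    ultimately show ?thesis by (simp only:)
  qed
  also have "\<dots> \<le> \<bar>e\<bar> * M * M powr (real n - 1 + e)"
    using a M e n by (intro mult_left_mono powr_mono2 mult_nonneg_nonneg) auto
  also have "\<dots> = \<bar>e\<bar> * M powr (real n + e)"
    using M by (simp add: powr_add powr_diff)
  finally show ?thesis .
qed

text \<open>
  According to whether \<open>b \<le> \<eta> * M\<close>, one of the two terms alone is
  sufficient.
\<close>
lemma young_powr: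
  fixes b M \<eta> s :: real
  assumes "b \<ge> 0" "M > 0" "\<eta> > 0" "s > 1"
  shows "b * M powr (s - 1) \<le> \<eta> * M powr s + \<eta> powr (1 - s) * b powr s"
proof (cases "b \<le> \<eta> * M")
  case True
  have "b * M powr (s - 1) \<le> \<eta> * M * M powr (s - 1)" using True by (intro mult_right_mono) auto
  also have "\<dots> = \<eta> * M powr s" using assms by (simp add: powr_diff)
  finally show ?thesis by (simp add: add_increasing2)
next
  case False
  then have "M \<le> b / \<eta>" using assms by (simp add: field_simps)
  then have b: "b > 0" using False assms by (meson linorder_not_less mult_pos_pos order_le_less_trans less_imp_le)
  have "b * M powr (s - 1) \<le> b * (b / \<eta>) powr (s - 1)"
    using \<open>M \<le> b / \<eta>\<close> assms by (intro mult_left_mono powr_mono2) auto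
  also have "\<dots> = \<eta> powr (1 - s) * b powr s"
    using b assms by (simp add: powr_divide powr_diff)
  finally show ?thesis using assms by (simp add: add_increasing)
qed

lemma powr_sum_le:
  fixes a b s :: real
  assumes "a \<ge> 0" "b \<ge> 0" "s > 0"
  shows "(a + b) powr s \<le> 2 powr s * (a powr s + b powr s)"
proof -
  have "(a + b) powr s \<le> (2 * max a b) powr s" using assms by (intro powr_mono2) auto
  also have "\<dots> = 2 powr s * max a b powr s" using assms by (simp add: powr_mult)
  also have "\<dots> \<le> 2 powr s * (a powr s + b powr s)" by (intro mult_left_mono) (auto simp: max_def)
  finally show ?thesis .
qed

text \<open>
  In the final estimate \<open>absorb_const\<close> is the factor of \<open>\<bar>s -
  n\<bar>\<close> and \<open>young_const\<close> that of the free parameter in Young's inequality,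
  both multiplied by \<open>K * l1_norm m \<omega>\<close>.
\<close>
definition absorb_const :: "'n::finite itself \<Rightarrow> real" where
  "absorb_const _ = (max 1 (moll_bound TYPE('n)) * jac_const TYPE('n) + fact CARD('n) * max 1 (moll_bound TYPE('n)) ^ (CARD('n) + 1)) *
     strong_const TYPE('n) * 2 ^ (CARD('n) + 1)"

definition young_const :: "'n::finite itself \<Rightarrow> real" where
  "young_const _ = fact CARD('n) * real CARD('n) * max 1 (moll_bound TYPE('n)) ^ (CARD('n) + 1) *
     strong_const TYPE('n) * 2 ^ (CARD('n) + 1)"

lemma young_const_pos: "young_const TYPE('n::finite) > 0"
  using strong_const_pos[where 'n='n] by (simp add: young_const_def)

lemma absorb_const_pos: "absorb_const TYPE('n::finite) > 0"
  unfolding absorb_const_def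
  using strong_const_pos[where 'n='n] jac_const_pos[where 'n='n]
  by (intro mult_pos_pos add_pos_pos) auto

text \<open>
  With \<open>M = \<mu> * g \<ge> a + b\<close>, where \<open>g\<close> is the weight of
  \<open>maximal_weight\<close> for \<open>a + b\<close>, and \<open>s = n + e\<close>, the proof
  bounds \<open>a powr s\<close> pointwise: \<open>a powr e\<close> is replaced by \<open>M powr
  e\<close> (error of order \<open>\<bar>e\<bar> * M powr s\<close>), then \<open>A\<close> by
  \<open>H\<close> (error of order \<open>b * M powr (s - 1)\<close>, split by Young's
  inequality). In the integrated bound the minors of \<open>H\<close> contribute another error of
  order \<open>\<bar>e\<bar>\<close>. All errors are multiples of the integral of \<open>g powr
  s\<close>, which is comparable to that of \<open>a powr s + b powr s\<close>; the first summand
  is absorbed.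
\<close>
theorem caccioppoli_borel:
  fixes A H :: "(real, 'n::{finite,wellorder}) vec \<Rightarrow> nat \<Rightarrow> (real, 'n) vec"
    and h :: "(real, 'n) vec \<Rightarrow> nat \<Rightarrow> real" and a b :: "(real, 'n) vec \<Rightarrow> real"
    and \<omega> :: "('n \<Rightarrow> nat \<Rightarrow> real) \<Rightarrow> real" and e K :: real
  assumes N: "CARD('n) \<ge> 2" and cov: "covector m \<omega>" and K: "K \<ge> 1" and t: "l1_norm m \<omega> > 0" and e: "\<bar>e\<bar> \<le> 1 / 2"
    and small: "K * l1_norm m \<omega> * \<bar>e\<bar> * absorb_const TYPE('n) \<le> 1 / 4"
    and [measurable]: "a \<in> borel_measurable borel" "b \<in> borel_measurable borel"
    and a0: "\<And>x. a x \<ge> 0" and b0: "\<And>x. b x \<ge> 0"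
    and Fint: "integrable lborel (\<lambda>x. a x + b x)"
    and as: "(\<integral>\<^sup>+x. ennreal (a x powr (CARD('n) + e)) \<partial>lborel) < \<infinity>"
    and bs: "(\<integral>\<^sup>+x. ennreal (b x powr (CARD('n) + e)) \<partial>lborel) < \<infinity>"
    and Aa: "\<And>x i. i < m \<Longrightarrow> norm (A x i) \<le> a x" and HF: "\<And>x i. i < m \<Longrightarrow> norm (H x i) \<le> a x + b x"
    and AH: "\<And>x i. i < m \<Longrightarrow> norm (A x i - H x i) \<le> b x"
    and wg: "\<And>i. i < m \<Longrightarrow> has_weak_gradient (\<lambda>x. h x i) (\<lambda>x. H x i)"
    and supp: "\<And>i z. i < m \<Longrightarrow> norm z > R \<Longrightarrow> h z i = 0"
    and qr: "AE x in lborel. a x ^ CARD('n) \<le> K * star_pullback \<omega> (A x)"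
  shows "(\<integral>x. a x powr (CARD('n) + e) \<partial>lborel) \<le>
    (1 + 2 * (K * l1_norm m \<omega> * (fact CARD('n) * real CARD('n)) *
      (1 / (4 * (K * l1_norm m \<omega> * young_const TYPE('n)))) powr (1 - (CARD('n) + e)))) *
    (\<integral>x. b x powr (CARD('n) + e) \<partial>lborel)"
proof -
  let ?N = "CARD('n)" and ?t = "l1_norm m \<omega>"
  define s where "s = real ?N + e"
  define F where "F x = a x + b x" for x
  define X where "X = (\<integral>x. a x powr s \<partial>lborel)"
  define Y where "Y = (\<integral>x. b x powr s \<partial>lborel)"
  define \<mu> where "\<mu> = max 1 (moll_bound TYPE('n))"
  \<comment> \<open>the parameter in Young's inequality, chosen such that its term contributes exactly a
     quarter\<close>
  define \<eta> where "\<eta> = 1 / (4 * (K * ?t * young_const TYPE('n)))"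
  define c where "c = K * ?t * (fact ?N * real ?N) * \<eta> powr (1 - s)"
  have N2: "real ?N \<ge> 2" using N by linarith
  have s1: "s > 1" "s > 0" "s \<le> real (?N + 1)" using N2 e by (auto simp: s_def)
  have \<mu>: "\<mu> \<ge> 1" "moll_bound TYPE('n) \<le> \<mu>" by (auto simp: \<mu>_def)
  have Kt: "K * ?t > 0" using K t by simp
  have \<eta>: "\<eta> > 0" unfolding \<eta>_def using Kt young_const_pos[where 'n='n] by simp
  have c0: "c \<ge> 0" unfolding c_def using Kt by simp
  have ias: "integrable lborel (\<lambda>x. a x powr s)" and ibs: "integrable lborel (\<lambda>x. b x powr s)"
    using as bs by (auto intro!: integrableI_bounded simp: s_def)
  have Y0: "Y \<ge> 0" unfolding Y_def by simp
  have goal: "X \<le> (1 + 2 * c) * Y"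
  proof (cases "(\<integral>x. F x \<partial>lborel) > 0")
    case False
    have F0: "F x \<ge> 0" for x using a0[of x] b0[of x] by (simp add: F_def)
    have Fi: "integrable lborel F" using Fint by (simp add: F_def[abs_def])
    have "(\<integral>x. F x \<partial>lborel) \<ge> 0" using F0 by simp
    with False have "(\<integral>x. F x \<partial>lborel) = 0" by simp
    then have "AE x in lborel. F x = 0" using integral_nonneg_eq_0_iff_AE[OF Fi] F0 by simp
    then have "AE x in lborel. a x powr s = 0"
    proof (rule AE_mp, intro AE_I2 impI)
      fix x assume "F x = 0"
      then have "a x = 0" using a0[of x] b0[of x] by (simp add: F_def)
      then show "a x powr s = 0" by simp
    qed
    then have "X = 0" unfolding X_def by (rule integral_eq_zero_AE)
    then show ?thesis using Y0 c0 by simp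
  next
    case Fpos: True
    interpret maximal F
      by unfold_locales (use Fint a0 b0 in \<open>auto simp: F_def[abs_def]\<close>)
    have Fs: "(\<integral>\<^sup>+x. ennreal (F x powr s) \<partial>lborel) \<le> ennreal (2 ^ (?N + 1) * (X + Y))"
    proof -
      have "(\<integral>\<^sup>+x. ennreal (F x powr s) \<partial>lborel) \<le> (\<integral>\<^sup>+x. ennreal (2 ^ (?N + 1) * (a x powr s + b x powr s)) \<partial>lborel)"
      proof (intro nn_integral_mono ennreal_leI)
        fix x
        have "F x powr s \<le> 2 powr s * (a x powr s + b x powr s)"
          unfolding F_def by (rule powr_sum_le[OF a0 b0 s1(2)])
        also have "\<dots> \<le> 2 powr (real (?N + 1)) * (a x powr s + b x powr s)"
          using s1 by (intro mult_right_mono powr_mono) auto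
        also have "2 powr (real (?N + 1)) = (2 :: real) ^ (?N + 1)" by (subst powr_realpow) auto
        finally show "F x powr s \<le> 2 ^ (?N + 1) * (a x powr s + b x powr s)" .
      qed
      also have "\<dots> = ennreal (\<integral>x. 2 ^ (?N + 1) * (a x powr s + b x powr s) \<partial>lborel)"
        using ias ibs by (intro nn_integral_eq_integral) auto
      also have "(\<integral>x. 2 ^ (?N + 1) * (a x powr s + b x powr s) \<partial>lborel) = 2 ^ (?N + 1) * (X + Y)"
        using ias ibs by (simp add: X_def Y_def)
      finally show ?thesis .
    qed
    then have Fsfin: "(\<integral>\<^sup>+x. ennreal (F x powr (?N + e)) \<partial>lborel) < \<infinity>"
      by (auto simp: s_def intro: le_less_trans)
    obtain g where gm[measurable]: "g \<in> borel_measurable borel"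
      and gF: "AE x in lborel. 0 < g x \<and> F x \<le> moll_bound TYPE('n) * g x"
      and gint: "integrable lborel (\<lambda>x. g x powr s)"
      and gS: "(\<integral>\<^sup>+x. ennreal (g x powr s) \<partial>lborel) \<le> ennreal (strong_const TYPE('n)) * (\<integral>\<^sup>+x. ennreal (F x powr s) \<partial>lborel)"
      and key: "\<forall>(u :: 'n \<Rightarrow> (real, 'n) vec \<Rightarrow> real) G R.
        (\<forall>i. has_weak_gradient (u i) (G i)) \<longrightarrow> (\<forall>i x. norm (G i x) \<le> F x) \<longrightarrow> (\<forall>i z. norm z > R \<longrightarrow> u i z = 0) \<longrightarrow>
        integrable lborel (\<lambda>x. g x powr e * det (\<chi> i. G i x)) \<and>
        \<bar>\<integral>x. g x powr e * det (\<chi> i. G i x) \<partial>lborel\<bar> \<le> jac_const TYPE('n) * \<bar>e\<bar> * (\<integral>x. g x powr s \<partial>lborel)"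
      using maximal_weight[OF N e Fpos Fsfin] unfolding s_def[symmetric] by blast
    define W where "W = (\<integral>x. g x powr s \<partial>lborel)"
    have W0: "W \<ge> 0" unfolding W_def by simp
    have WS: "W \<le> strong_const TYPE('n) * (2 ^ (?N + 1) * (X + Y))"
    proof -
      have "ennreal W = (\<integral>\<^sup>+x. ennreal (g x powr s) \<partial>lborel)"
        unfolding W_def by (rule nn_integral_eq_integral[OF gint, symmetric]) simp
      also have "\<dots> \<le> ennreal (strong_const TYPE('n)) * ennreal (2 ^ (?N + 1) * (X + Y))"
        using gS Fs by (meson mult_left_mono order_trans zero_le)
      also have "\<dots> = ennreal (strong_const TYPE('n) * (2 ^ (?N + 1) * (X + Y)))"
        using strong_const_pos[where 'n='n] by (intro ennreal_mult'[symmetric]) simp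
      finally show ?thesis
        using strong_const_pos[where 'n='n] Y0 by (subst (asm) ennreal_le_iff) (auto simp: X_def)
    qed
    have detI: "integrable lborel (\<lambda>x. g x powr e * det (\<chi> k. H x (I k))) \<and>
        \<bar>\<integral>x. g x powr e * det (\<chi> k. H x (I k)) \<partial>lborel\<bar> \<le> jac_const TYPE('n) * \<bar>e\<bar> * W"
      if "I \<in> multi_indices m" for I :: "'n \<Rightarrow> nat"
    proof -
      have I: "I k < m" for k using that by (auto simp: multi_indices_def)
      have "(\<forall>k. has_weak_gradient (\<lambda>x. h x (I k)) (\<lambda>x. H x (I k)))" using wg I by blast
      moreover have "\<forall>k x. norm (H x (I k)) \<le> F x" using HF I by (simp add: F_def)
      moreover have "\<forall>k z. norm z > R \<longrightarrow> h z (I k) = 0" using supp I by blast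
      ultimately show ?thesis
        using key[rule_format, of "\<lambda>k x. h x (I k)" "\<lambda>k x. H x (I k)" R] by (simp add: W_def)
    qed
    define w where "w I = \<omega> (\<lambda>j. std_basis (I j))" for I :: "'n \<Rightarrow> nat"
    have Hexp: "g x powr e * star_pullback \<omega> (H x) = (\<Sum>I\<in>multi_indices m. w I * (g x powr e * det (\<chi> k. H x (I k))))" for x
      unfolding star_pullback_expansion[OF cov] w_def by (simp add: sum_distrib_left mult_ac)
    have Hint: "integrable lborel (\<lambda>x. g x powr e * star_pullback \<omega> (H x))"
      unfolding Hexp using detI by (intro Bochner_Integration.integrable_sum integrable_mult_right) auto
    have Hle: "(\<integral>x. g x powr e * star_pullback \<omega> (H x) \<partial>lborel) \<le> ?t * (jac_const TYPE('n) * \<bar>e\<bar> * W)"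
    proof -
      have "(\<integral>x. g x powr e * star_pullback \<omega> (H x) \<partial>lborel) =
          (\<Sum>I\<in>multi_indices m. w I * (\<integral>x. g x powr e * det (\<chi> k. H x (I k)) \<partial>lborel))"
        unfolding Hexp using detI by (subst Bochner_Integration.integral_sum) auto
      also have "\<dots> \<le> (\<Sum>I\<in>multi_indices m. \<bar>w I\<bar> * (jac_const TYPE('n) * \<bar>e\<bar> * W))"
      proof (rule sum_mono)
        fix I :: "'n \<Rightarrow> nat" assume "I \<in> multi_indices m"
        then have "\<bar>w I\<bar> * \<bar>\<integral>x. g x powr e * det (\<chi> k. H x (I k)) \<partial>lborel\<bar> \<le> \<bar>w I\<bar> * (jac_const TYPE('n) * \<bar>e\<bar> * W)"
          using detI by (intro mult_left_mono) auto
        then show "w I * (\<integral>x. g x powr e * det (\<chi> k. H x (I k)) \<partial>lborel) \<le> \<bar>w I\<bar> * (jac_const TYPE('n) * \<bar>e\<bar> * W)"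
          unfolding abs_mult[symmetric] by linarith
      qed
      finally show ?thesis by (simp add: l1_norm_def w_def sum_distrib_right)
    qed
    \<comment> \<open>the pointwise majorant of \<open>a powr s\<close>\<close>
    define E where "E x = K * (\<mu> powr e * (g x powr e * star_pullback \<omega> (H x))) +
        K * ?t * (fact ?N * \<bar>e\<bar> * (\<mu> * g x) powr s) +
        K * ?t * (fact ?N * real ?N) * (\<eta> * (\<mu> * g x) powr s + \<eta> powr (1 - s) * b x powr s)" for x
    have point: "AE x in lborel. a x powr s \<le> E x"
      using gF qr
    proof eventually_elim
      case (elim x)
      define M where "M = \<mu> * g x"
      have g: "g x > 0" using elim(1) by simp
      have M: "M > 0" using g \<mu> by (simp add: M_def)
      have FM: "F x \<le> M"
        using elim(1) mult_right_mono[OF \<mu>(2) less_imp_le[OF g]] unfolding M_def by linarith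
      have aM: "a x \<le> M" "b x \<le> M" using FM a0[of x] b0[of x] by (auto simp: F_def)
      have "0 \<le> K * star_pullback \<omega> (A x)" using elim(2) a0[of x] by (meson order_trans zero_le_power)
      then have wA: "star_pullback \<omega> (A x) \<ge> 0" using K by (simp add: zero_le_mult_iff)
      have wAle: "star_pullback \<omega> (A x) \<le> ?t * (fact ?N * a x ^ ?N)"
      proof -
        have "\<bar>star_pullback \<omega> (A x)\<bar> \<le> ?t * (fact ?N * a x ^ ?N)" by (rule star_pullback_le[OF cov Aa])
        then show ?thesis by simp
      qed
      have step1: "a x powr s \<le> K * (M powr e * star_pullback \<omega> (A x)) + K * ?t * (fact ?N * \<bar>e\<bar> * M powr s)"
      proof (cases "a x = 0")
        case True
        then show ?thesis using wA K t M by (simp add: add_nonneg_nonneg)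
      next
        case False
        then have a: "a x > 0" using a0[of x] by simp
        have as: "a x powr s = a x powr e * a x ^ ?N" using a by (simp add: s_def powr_add powr_realpow)
        show ?thesis
        proof (cases "e \<ge> 0")
          case True
          have "a x powr s \<le> M powr e * (K * star_pullback \<omega> (A x))"
            unfolding as using elim(2) aM a True by (intro mult_mono powr_mono2) auto
          also have "\<dots> \<le> K * (M powr e * star_pullback \<omega> (A x)) + K * ?t * (fact ?N * \<bar>e\<bar> * M powr s)"
            using K t by (simp add: mult_ac)
          finally show ?thesis .
        next
          case False
          have "M powr e \<le> a x powr e" using powr_mono2'[of e "a x" M] False a aM by simp
          then have d0: "a x powr e - M powr e \<ge> 0" by simp
          have "a x powr s \<le> a x powr e * (K * star_pullback \<omega> (A x))"
            unfolding as using elim(2) by (intro mult_left_mono) auto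
          also have "\<dots> = K * (M powr e * star_pullback \<omega> (A x)) + K * ((a x powr e - M powr e) * star_pullback \<omega> (A x))"
            by (simp add: algebra_simps)
          also have "K * ((a x powr e - M powr e) * star_pullback \<omega> (A x)) \<le> K * ((a x powr e - M powr e) * (?t * (fact ?N * a x ^ ?N)))"
            using K d0 wAle by (intro mult_left_mono) auto
          also have "\<dots> = K * ?t * (fact ?N * ((a x powr e - M powr e) * a x ^ ?N))" by simp
          also have "\<dots> \<le> K * ?t * (fact ?N * (\<bar>e\<bar> * M powr s))"
            unfolding s_def using K t a aM e False N
            by (intro mult_left_mono powr_difference_le) auto
          finally show ?thesis by simp
        qed
      qed
      have step2: "M powr e * star_pullback \<omega> (A x) \<le> M powr e * star_pullback \<omega> (H x) + ?t * (fact ?N * real ?N) * (b x * M powr (s - 1))"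
      proof -
        have "star_pullback \<omega> (A x) - star_pullback \<omega> (H x) \<le> ?t * (fact ?N * real ?N * (b x * M ^ (?N - 1)))"
        proof -
          have "\<bar>star_pullback \<omega> (A x) - star_pullback \<omega> (H x)\<bar> \<le> ?t * (fact ?N * real ?N * (b x * M ^ (?N - 1)))"
          proof (rule star_pullback_diff_le[OF cov])
            fix i assume i: "i < m"
            show "norm (A x i) \<le> M" using Aa[OF i, of x] aM by simp
            show "norm (H x i) \<le> M" using HF[OF i, of x] FM by (simp add: F_def)
            show "norm (A x i - H x i) \<le> b x" by (rule AH[OF i])
          qed
          then show ?thesis by simp
        qed
        then have "M powr e * (star_pullback \<omega> (A x) - star_pullback \<omega> (H x)) \<le> M powr e * (?t * (fact ?N * real ?N * (b x * M ^ (?N - 1))))"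
          by (intro mult_left_mono) auto
        also have "\<dots> = ?t * (fact ?N * real ?N) * (b x * (M ^ (?N - 1) * M powr e))" by simp
        also have "M ^ (?N - 1) * M powr e = M powr (s - 1)"
        proof -
          have "M ^ (?N - 1) = M powr (real ?N - 1)" using M N by (subst powr_realpow[symmetric]) (auto simp: of_nat_diff)
          then show ?thesis by (simp add: powr_add[symmetric] s_def algebra_simps)
        qed
        finally show ?thesis by (simp add: algebra_simps)
      qed
      have step3: "b x * M powr (s - 1) \<le> \<eta> * M powr s + \<eta> powr (1 - s) * b x powr s"
        by (rule young_powr[OF b0 M \<eta> s1(1)])
      have Me: "M powr e = \<mu> powr e * g x powr e" using \<mu> g by (simp add: M_def powr_mult)
      have "a x powr s \<le> K * (M powr e * star_pullback \<omega> (H x) + ?t * (fact ?N * real ?N) * (b x * M powr (s - 1))) + K * ?t * (fact ?N * \<bar>e\<bar> * M powr s)"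
        using step1 mult_left_mono[OF step2, of K] K by linarith
      also have "\<dots> = K * (M powr e * star_pullback \<omega> (H x)) + K * ?t * (fact ?N * \<bar>e\<bar> * M powr s) + K * ?t * (fact ?N * real ?N) * (b x * M powr (s - 1))"
        by (simp add: algebra_simps)
      also have "\<dots> \<le> K * (M powr e * star_pullback \<omega> (H x)) + K * ?t * (fact ?N * \<bar>e\<bar> * M powr s) +
          K * ?t * (fact ?N * real ?N) * (\<eta> * M powr s + \<eta> powr (1 - s) * b x powr s)"
        using step3 K t by (intro add_left_mono mult_left_mono) auto
      also have "\<dots> = E x" unfolding E_def M_def[symmetric] Me by (simp add: mult_ac)
      finally show ?case .
    qed
    have iM: "integrable lborel (\<lambda>x. (\<mu> * g x) powr s)"
    proof (rule integrable_cong_AE_imp[OF integrable_mult_right[OF gint, of "\<mu> powr s"]])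
      show "AE x in lborel. \<mu> powr s * g x powr s = (\<mu> * g x) powr s"
        using gF by (rule AE_mp) (intro AE_I2 impI, use \<mu> in \<open>auto simp: powr_mult\<close>)
    qed measurable
    have MW: "(\<integral>x. (\<mu> * g x) powr s \<partial>lborel) = \<mu> powr s * W"
    proof -
      have "(\<integral>x. (\<mu> * g x) powr s \<partial>lborel) = (\<integral>x. \<mu> powr s * g x powr s \<partial>lborel)"
      proof (rule integral_cong_AE)
        show "AE x in lborel. (\<mu> * g x) powr s = \<mu> powr s * g x powr s"
          using gF by (rule AE_mp) (intro AE_I2 impI, use \<mu> in \<open>auto simp: powr_mult\<close>)
      qed measurable
      then show ?thesis by (simp add: W_def)
    qed
    have Eint: "integrable lborel E"
      unfolding E_def[abs_def] using Hint iM ibs by auto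
    have "X \<le> (\<integral>x. E x \<partial>lborel)"
      unfolding X_def by (rule integral_mono_AE[OF ias Eint point])
    also have "\<dots> = K * (\<mu> powr e * (\<integral>x. g x powr e * star_pullback \<omega> (H x) \<partial>lborel)) +
        K * ?t * (fact ?N * \<bar>e\<bar> * (\<mu> powr s * W)) + K * ?t * (fact ?N * real ?N) * (\<eta> * (\<mu> powr s * W) + \<eta> powr (1 - s) * Y)"
      unfolding E_def[abs_def] using Hint iM ibs by (simp add: MW Y_def)
    also have "\<dots> \<le> K * (\<mu> * (?t * (jac_const TYPE('n) * \<bar>e\<bar> * W))) +
        K * ?t * (fact ?N * \<bar>e\<bar> * (\<mu> ^ (?N + 1) * W)) + K * ?t * (fact ?N * real ?N) * (\<eta> * (\<mu> ^ (?N + 1) * W) + \<eta> powr (1 - s) * Y)"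
    proof -
      have me: "\<mu> powr e \<le> \<mu>" using powr_mono[of e 1 \<mu>] e \<mu>(1) by simp
      have ms: "\<mu> powr s \<le> \<mu> ^ (?N + 1)" using powr_mono[of s "real (?N + 1)" \<mu>] s1 \<mu>(1) by (subst powr_realpow[symmetric]) auto
      have j0: "0 \<le> ?t * (jac_const TYPE('n) * \<bar>e\<bar> * W)" using t jac_const_pos[where 'n='n] W0 by simp
      have 1: "\<mu> powr e * (\<integral>x. g x powr e * star_pullback \<omega> (H x) \<partial>lborel) \<le> \<mu> * (?t * (jac_const TYPE('n) * \<bar>e\<bar> * W))"
        using mult_left_mono[OF Hle, of "\<mu> powr e"] mult_right_mono[OF me j0] by simp
      have 2: "\<mu> powr s * W \<le> \<mu> ^ (?N + 1) * W" by (rule mult_right_mono[OF ms W0])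
      show ?thesis
        using 1 2 K t \<eta> by (intro add_mono mult_left_mono order_refl) auto
    qed
    also have "\<dots> = K * ?t * \<bar>e\<bar> * ((\<mu> * jac_const TYPE('n) + fact ?N * \<mu> ^ (?N + 1)) * W) +
        K * ?t * \<eta> * ((fact ?N * real ?N * \<mu> ^ (?N + 1)) * W) + c * Y"
      by (simp add: c_def algebra_simps)
    also have "\<dots> \<le> K * ?t * \<bar>e\<bar> * ((\<mu> * jac_const TYPE('n) + fact ?N * \<mu> ^ (?N + 1)) * (strong_const TYPE('n) * (2 ^ (?N + 1) * (X + Y)))) +
        K * ?t * \<eta> * ((fact ?N * real ?N * \<mu> ^ (?N + 1)) * (strong_const TYPE('n) * (2 ^ (?N + 1) * (X + Y)))) + c * Y"
      using WS K t \<eta> \<mu>(1) jac_const_pos[where 'n='n]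
      by (intro add_mono mult_left_mono order_refl) (auto intro!: mult_nonneg_nonneg add_nonneg_nonneg)
    also have "\<dots> = (K * ?t * \<bar>e\<bar> * absorb_const TYPE('n)) * (X + Y) + (K * ?t * \<eta> * young_const TYPE('n)) * (X + Y) + c * Y"
      by (simp add: absorb_const_def young_const_def \<mu>_def mult_ac)
    also have "\<dots> \<le> 1 / 4 * (X + Y) + 1 / 4 * (X + Y) + c * Y"
    proof -
      have "K * ?t * \<eta> * young_const TYPE('n) = 1 / 4"
        unfolding \<eta>_def using K t young_const_pos[where 'n='n] by (simp add: field_simps)
      moreover have "X + Y \<ge> 0" using Y0 by (simp add: X_def)
      ultimately show ?thesis using small Y0 by (intro add_mono mult_right_mono) auto
    qed
    finally have "X \<le> 1 / 4 * (X + Y) + 1 / 4 * (X + Y) + c * Y" .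
    then have "X \<le> Y + 2 * (c * Y)" by (rule absorb_quarters)
    then show ?thesis by (simp add: distrib_right mult.assoc)
  qed
  then show ?thesis unfolding X_def Y_def c_def \<eta>_def s_def .
qed

section \<open>Lebesgue measurable data\<close>

text \<open>
  The data of the theorem are Lebesgue measurable, the maximal function theory above is for Borel
  functions.
\<close>
lemma lebesgue_integral_borel_version:
  fixes u u' :: "'a::euclidean_space \<Rightarrow> real"
  assumes u: "u \<in> borel_measurable lebesgue" and u': "u' \<in> borel_measurable borel" and ae: "AE x in lborel. u x = u' x"
  shows "(\<integral>x. u x \<partial>lebesgue) = (\<integral>x. u' x \<partial>lborel)" "integrable lebesgue u \<longleftrightarrow> integrable lborel u'"
proof -
  have u'l: "u' \<in> borel_measurable lborel" using u' by simp
  have u'L: "u' \<in> borel_measurable lebesgue" using measurable_completion[OF u'l] .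
  have aeL: "AE x in lebesgue. u x = u' x" using ae by (rule AE_completion)
  have "(\<integral>x. u x \<partial>lebesgue) = (\<integral>x. u' x \<partial>lebesgue)" by (rule integral_cong_AE[OF u u'L aeL])
  then show "(\<integral>x. u x \<partial>lebesgue) = (\<integral>x. u' x \<partial>lborel)" by (simp add: integral_completion[OF u'l])
  have "integrable lebesgue u \<longleftrightarrow> integrable lebesgue u'" by (rule integrable_cong_AE[OF u u'L aeL])
  then show "integrable lebesgue u \<longleftrightarrow> integrable lborel u'" by (simp add: integrable_completion[OF u'l])
qed

lemma set_integral_eq_integral_zero_outside:
  assumes "\<And>x. x \<notin> S \<Longrightarrow> w x = (0 :: real)"
  shows "(LINT x:S|M. w x) = (\<integral>x. w x \<partial>M)"
proof -
  have "(\<lambda>x. indicator S x *\<^sub>R w x) = w"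
  proof
    fix x show "indicator S x *\<^sub>R w x = w x" by (cases "x \<in> S") (simp_all add: assms)
  qed
  then show ?thesis by (simp add: set_lebesgue_integral_def)
qed

lemma test_function_support:
  assumes "\<phi> \<in> test_functions \<Omega>"
  shows "\<exists>S. compact S \<and> S \<subseteq> \<Omega> \<and> (\<forall>x. x \<notin> S \<longrightarrow> \<phi> x = 0 \<and> (\<forall>j. partial_deriv j \<phi> x = 0))"
proof -
  define S where "S = closure {x. \<phi> x \<noteq> 0}"
  have z: "\<phi> y = 0" if "y \<notin> S" for y
  proof (rule ccontr)
    assume "\<phi> y \<noteq> 0"
    then have "y \<in> S" unfolding S_def by (intro subsetD[OF closure_subset]) simp
    then show False using that by simp
  qed
  have "partial_deriv j \<phi> x = 0" if x: "x \<notin> S" for x j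
  proof -
    have o: "open (- S)" unfolding S_def by (rule open_Compl[OF closed_closure])
    have "((\<lambda>x. 0) has_derivative (\<lambda>h. 0 :: real)) (at x)" by (rule has_derivative_const)
    then have "(\<phi> has_derivative (\<lambda>h. 0)) (at x)"
    proof (rule has_derivative_transform_within_open)
      show "open (- S)" by (rule o)
      show "x \<in> - S" using x by simp
      show "0 = \<phi> y" if "y \<in> - S" for y using z that by simp
    qed
    then show ?thesis by (rule partial_deriv_eqI)
  qed
  moreover have "compact S" "S \<subseteq> \<Omega>"
    using assms unfolding test_functions_def S_def by blast+
  ultimately show ?thesis using z by (intro exI[of _ S]) simp
qed

lemma zero_outside_compact:
  fixes \<psi> :: "'a::real_normed_vector \<Rightarrow> real"
  assumes "compact S" "\<And>x. x \<notin> S \<Longrightarrow> \<psi> x = 0"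
  shows "\<exists>R. \<forall>z. norm z > R \<longrightarrow> \<psi> z = 0"
proof -
  have "\<exists>R. \<forall>x\<in>S. norm x \<le> R" using compact_imp_bounded[OF assms(1)] by (simp add: bounded_iff)
  then obtain R where R: "\<And>x. x \<in> S \<Longrightarrow> norm x \<le> R" by blast
  have "\<psi> z = 0" if "norm z > R" for z
    using R[of z] that by (intro assms(2)) linarith
  then show ?thesis by blast
qed

lemma Lloc_mult:
  assumes u: "u \<in> Lloc p \<Omega>" and \<psi>: "continuous_on UNIV \<psi>" and S: "compact S" "S \<subseteq> \<Omega>" "\<And>x. x \<notin> S \<Longrightarrow> \<psi> x = 0" and p: "p > 0"
  shows "(\<lambda>x. u x * \<psi> x) \<in> borel_measurable lebesgue" "integrable lebesgue (\<lambda>x. \<bar>u x * \<psi> x\<bar> powr p)"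
proof -
  have \<psi>m: "\<psi> \<in> borel_measurable lebesgue"
    using borel_measurable_continuous_onI[OF \<psi>] by (intro measurable_completion) simp
  have "(\<lambda>x. indicator \<Omega> x *\<^sub>R u x) \<in> borel_measurable lebesgue"
    using u by (simp add: Lloc_def set_borel_measurable_def)
  then have "(\<lambda>x. (indicator \<Omega> x *\<^sub>R u x) * \<psi> x) \<in> borel_measurable lebesgue"
    using \<psi>m by (rule borel_measurable_times)
  moreover have "(\<lambda>x. (indicator \<Omega> x *\<^sub>R u x) * \<psi> x) = (\<lambda>x. u x * \<psi> x)"
    using S by (auto simp: indicator_def fun_eq_iff)
  ultimately show m: "(\<lambda>x. u x * \<psi> x) \<in> borel_measurable lebesgue" by simp
  obtain R where R': "\<forall>z. norm z > R \<longrightarrow> \<psi> z = 0"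
    using zero_outside_compact[where \<psi>=\<psi>, OF S(1,3)] by blast
  have R: "\<psi> z = 0" if "norm z > R" for z using R' that by blast
  have "\<exists>B>0. \<forall>z. \<bar>\<psi> z\<bar> \<le> B"
    using continuous_bounded_of_compact_support[OF \<psi> R] by metis
  then obtain B where B: "B > 0" "\<And>z. \<bar>\<psi> z\<bar> \<le> B" by blast
  have i: "integrable lebesgue (\<lambda>x. indicator S x *\<^sub>R \<bar>u x\<bar> powr p)"
    using u S by (simp add: Lloc_def set_integrable_def)
  show "integrable lebesgue (\<lambda>x. \<bar>u x * \<psi> x\<bar> powr p)"
  proof (rule Bochner_Integration.integrable_bound[OF integrable_mult_right[OF i, of "B powr p"]])
    show "(\<lambda>x. \<bar>u x * \<psi> x\<bar> powr p) \<in> borel_measurable lebesgue" using m by measurable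
    show "AE x in lebesgue. norm (\<bar>u x * \<psi> x\<bar> powr p) \<le> norm (B powr p * indicator S x *\<^sub>R \<bar>u x\<bar> powr p)"
    proof (rule AE_I2)
      fix x
      show "norm (\<bar>u x * \<psi> x\<bar> powr p) \<le> norm (B powr p * indicator S x *\<^sub>R \<bar>u x\<bar> powr p)"
      proof (cases "x \<in> S")
        case True
        have "\<bar>u x * \<psi> x\<bar> powr p \<le> (B * \<bar>u x\<bar>) powr p"
          using B p mult_right_mono[OF B(2)[of x] abs_ge_zero[of "u x"]]
          by (intro powr_mono2) (simp_all add: abs_mult mult.commute)
        also have "\<dots> = B powr p * \<bar>u x\<bar> powr p" using B by (simp add: powr_mult)
        finally show ?thesis using True by simp
      next
        case False
        then show ?thesis using S(3) p by simp
      qed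
    qed
  qed
qed

lemma Lloc_1_mult_integrable:
  assumes "u \<in> Lloc 1 \<Omega>" "continuous_on UNIV \<psi>" "compact S" "S \<subseteq> \<Omega>" "\<And>x. x \<notin> S \<Longrightarrow> \<psi> x = 0"
  shows "integrable lebesgue (\<lambda>x. u x * \<psi> x)"
proof -
  have "integrable lebesgue (\<lambda>x. \<bar>u x * \<psi> x\<bar>)" using Lloc_mult(2)[OF assms] by simp
  then show ?thesis using Lloc_mult(1)[OF assms] by (intro integrable_norm_cancel[where f="\<lambda>x. u x * \<psi> x"]) simp_all
qed

lemma borel_version:
  fixes u :: "'a::euclidean_space \<Rightarrow> real"
  assumes u: "u \<in> borel_measurable lebesgue"
  shows "\<exists>u'. u' \<in> borel_measurable borel \<and> (AE x in lborel. u x = u' x)"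
proof -
  have "\<exists>u'\<in>borel_measurable lborel. AE x in lborel. u x = u' x"
    by (rule completion_ex_borel_measurable_real[OF u])
  then obtain u' where "u' \<in> borel_measurable lborel" "AE x in lborel. u x = u' x" by blast
  then show ?thesis by (intro exI[of _ u']) simp
qed

text \<open>
  Identifies a given weak differential with the weak gradients that the Sobolev hypothesis
  provides. Cut off by \<open>\<phi>\<close>, the difference of two weak gradients is orthogonal
  to all smooth functions, in particular to reflected mollifiers; so its mollifications vanish.
\<close>
theorem weak_gradient_unique:
  fixes u :: "real ^ 'n::finite \<Rightarrow> real"
  assumes G: "weak_gradient \<Omega> u G" "weak_gradient \<Omega> u G'" and \<phi>: "\<phi> \<in> test_functions \<Omega>"
  shows "AE x in lborel. \<phi> x * G x $ j = \<phi> x * G' x $ j"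
proof -
  obtain S where S: "compact S" "S \<subseteq> \<Omega>" "\<And>x. x \<notin> S \<Longrightarrow> \<phi> x = 0"
    using test_function_support[OF \<phi>] by blast
  have \<phi>C: "C_k l \<phi>" for l using \<phi> by (simp add: test_functions_def)
  have \<phi>c: "continuous_on UNIV \<phi>" by (rule C_k_continuous[OF \<phi>C])
  have GL: "(\<lambda>x. G x $ j) \<in> Lloc 1 \<Omega>" "(\<lambda>x. G' x $ j) \<in> Lloc 1 \<Omega>" using G by (auto simp: weak_gradient_def)
  have i1: "integrable lebesgue (\<lambda>x. G x $ j * \<phi> x)" by (rule Lloc_1_mult_integrable[OF GL(1) \<phi>c S])
  have i2: "integrable lebesgue (\<lambda>x. G' x $ j * \<phi> x)" by (rule Lloc_1_mult_integrable[OF GL(2) \<phi>c S])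
  define w where "w x = G x $ j * \<phi> x - G' x $ j * \<phi> x" for x
  have wi: "integrable lebesgue w" unfolding w_def[abs_def] using i1 i2 by simp
  obtain w' where w': "w' \<in> borel_measurable borel" "AE x in lborel. w x = w' x"
    using borel_version[OF borel_measurable_integrable[OF wi]] by blast
  have w'i: "integrable lborel w'"
    using lebesgue_integral_borel_version(2)[OF borel_measurable_integrable[OF wi] w'] wi by simp
  have zero: "(\<integral>x. w' x * \<eta> x \<partial>lborel) = 0" if \<eta>: "\<And>l. C_k l \<eta>" for \<eta>
  proof -
    have \<eta>c: "continuous_on UNIV \<eta>" by (rule C_k_continuous[OF \<eta>])
    have pe: "(\<lambda>x. \<phi> x * \<eta> x) \<in> test_functions \<Omega>" by (rule test_functions_mult[OF \<phi> \<eta>])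
    have pc: "continuous_on UNIV (\<lambda>x. \<phi> x * \<eta> x)" using \<phi>c \<eta>c by (intro continuous_intros)
    have j1: "integrable lebesgue (\<lambda>x. G x $ j * (\<phi> x * \<eta> x))"
      by (rule Lloc_1_mult_integrable[OF GL(1) pc S(1,2)]) (simp add: S)
    have j2: "integrable lebesgue (\<lambda>x. G' x $ j * (\<phi> x * \<eta> x))"
      by (rule Lloc_1_mult_integrable[OF GL(2) pc S(1,2)]) (simp add: S)
    have out: "\<phi> x = 0" if "x \<notin> \<Omega>" for x using S that by blast
    have "(LINT x:\<Omega>|lebesgue. G x $ j * (\<phi> x * \<eta> x)) = (LINT x:\<Omega>|lebesgue. G' x $ j * (\<phi> x * \<eta> x))"
    proof -
      have "- (LINT x:\<Omega>|lebesgue. G x $ j * (\<phi> x * \<eta> x)) = (LINT x:\<Omega>|lebesgue. u x * partial_deriv j (\<lambda>x. \<phi> x * \<eta> x) x)"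
        using G(1) pe unfolding weak_gradient_def by simp
      also have "\<dots> = - (LINT x:\<Omega>|lebesgue. G' x $ j * (\<phi> x * \<eta> x))"
        using G(2) pe unfolding weak_gradient_def by simp
      finally show ?thesis by simp
    qed
    then have "(\<integral>x. G x $ j * (\<phi> x * \<eta> x) \<partial>lebesgue) = (\<integral>x. G' x $ j * (\<phi> x * \<eta> x) \<partial>lebesgue)"
      by (simp add: set_integral_eq_integral_zero_outside out)
    then have "(\<integral>x. G x $ j * (\<phi> x * \<eta> x) - G' x $ j * (\<phi> x * \<eta> x) \<partial>lebesgue) = 0" using j1 j2 by simp
    moreover have "(\<lambda>x. G x $ j * (\<phi> x * \<eta> x) - G' x $ j * (\<phi> x * \<eta> x)) = (\<lambda>x. w x * \<eta> x)"
      by (simp add: w_def fun_eq_iff algebra_simps)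
    ultimately have "(\<integral>x. w x * \<eta> x \<partial>lebesgue) = 0" by simp
    moreover have "(\<integral>x. w x * \<eta> x \<partial>lebesgue) = (\<integral>x. w' x * \<eta> x \<partial>lborel)"
    proof (rule lebesgue_integral_borel_version(1))
      have "\<eta> \<in> borel_measurable lebesgue"
        using borel_measurable_continuous_onI[OF \<eta>c] by (intro measurable_completion) simp
      then show "(\<lambda>x. w x * \<eta> x) \<in> borel_measurable lebesgue"
        using borel_measurable_integrable[OF wi] by (intro borel_measurable_times)
      show "(\<lambda>x. w' x * \<eta> x) \<in> borel_measurable borel"
        using borel_measurable_continuous_onI[OF \<eta>c] w'(1) by (intro borel_measurable_times)
      show "AE x in lborel. w x * \<eta> x = w' x * \<eta> x" using w'(2) by (rule AE_mp) (intro AE_I2 impI, simp)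
    qed
    ultimately show ?thesis by simp
  qed
  define \<rho> where "\<rho> k = 1 / real (Suc k)" for k
  have \<rho>: "\<rho> k > 0" for k by (simp add: \<rho>_def)
  have \<rho>0: "\<rho> \<longlonglongrightarrow> 0" unfolding \<rho>_def using LIMSEQ_inverse_real_of_nat by (simp add: inverse_eq_divide)
  have "conv w' (mollifier (\<rho> k)) x = 0" for k x
    unfolding conv_def by (rule zero) (intro C_k_reflect C_k_mollifier)
  then have "(\<lambda>k :: nat. \<integral>x. \<bar>w' x\<bar> \<partial>lborel) \<longlonglongrightarrow> 0"
    using mollify_L1_tendsto[OF w'i \<rho> \<rho>0] by simp
  then have "(\<integral>x. \<bar>w' x\<bar> \<partial>lborel) = 0" by (simp add: LIMSEQ_const_iff)
  then have "AE x in lborel. \<bar>w' x\<bar> = 0"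
    using w'i by (subst (asm) integral_nonneg_eq_0_iff_AE) auto
  with w'(2) show ?thesis by eventually_elim (simp add: w_def algebra_simps)
qed

text \<open>
  The Leibniz rule, in which \<open>\<phi> * \<eta>\<close> is used as a test function on
  \<open>\<Omega>\<close> for every smooth \<open>\<eta>\<close>.
\<close>
theorem has_weak_gradient_cutoff:
  fixes u :: "real ^ 'n::finite \<Rightarrow> real"
  assumes G: "weak_gradient \<Omega> u G" and \<phi>: "\<phi> \<in> test_functions \<Omega>"
    and u': "u' \<in> borel_measurable borel" "AE x in lborel. indicator \<Omega> x * u x = u' x"
    and A: "\<And>j. (\<lambda>x. A x $ j) \<in> borel_measurable borel" "\<And>j. AE x in lborel. \<phi> x * G x $ j = A x $ j"
  shows "has_weak_gradient (\<lambda>x. \<phi> x * u' x) (\<lambda>x. A x + u' x *\<^sub>R gradient \<phi> x)"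
    "integrable lborel (\<lambda>x. A x $ j)" "integrable lborel (\<lambda>x. u' x * partial_deriv j \<phi> x)"
proof -
  obtain S where S: "compact S" "S \<subseteq> \<Omega>" "\<And>x. x \<notin> S \<Longrightarrow> \<phi> x = 0" "\<And>x j. x \<notin> S \<Longrightarrow> partial_deriv j \<phi> x = 0"
    using test_function_support[OF \<phi>] by blast
  have \<phi>C: "C_k l \<phi>" for l using \<phi> by (simp add: test_functions_def)
  have \<phi>c: "continuous_on UNIV \<phi>" by (rule C_k_continuous[OF \<phi>C])
  have pc: "continuous_on UNIV (partial_deriv j \<phi>)" for j using \<phi>C[of 1] by simp
  have uL: "u \<in> Lloc 1 \<Omega>" and GL: "\<And>j. (\<lambda>x. G x $ j) \<in> Lloc 1 \<Omega>" using G by (auto simp: weak_gradient_def)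
  have um: "(\<lambda>x. u x * \<psi> x) \<in> borel_measurable lebesgue" "integrable lebesgue (\<lambda>x. u x * \<psi> x)"
    "integrable lborel (\<lambda>x. u' x * \<psi> x)" "(\<integral>x. u x * \<psi> x \<partial>lebesgue) = (\<integral>x. u' x * \<psi> x \<partial>lborel)"
    if \<psi>: "continuous_on UNIV \<psi>" "\<And>x. x \<notin> S \<Longrightarrow> \<psi> x = 0" for \<psi>
  proof -
    show i: "integrable lebesgue (\<lambda>x. u x * \<psi> x)" by (rule Lloc_1_mult_integrable[OF uL \<psi>(1) S(1,2) \<psi>(2)])
    then show m: "(\<lambda>x. u x * \<psi> x) \<in> borel_measurable lebesgue" by (rule borel_measurable_integrable)
    have m': "(\<lambda>x. u' x * \<psi> x) \<in> borel_measurable borel"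
      using borel_measurable_continuous_onI[OF \<psi>(1)] u'(1) by (intro borel_measurable_times)
    have ae: "AE x in lborel. u x * \<psi> x = u' x * \<psi> x"
      using u'(2)
    proof (rule AE_mp, intro AE_I2 impI)
      fix x assume e: "indicator \<Omega> x * u x = u' x"
      show "u x * \<psi> x = u' x * \<psi> x"
      proof (cases "x \<in> S")
        case True
        then show ?thesis using e S(2) by (auto simp: indicator_def)
      qed (simp add: \<psi>(2))
    qed
    show "integrable lborel (\<lambda>x. u' x * \<psi> x)" "(\<integral>x. u x * \<psi> x \<partial>lebesgue) = (\<integral>x. u' x * \<psi> x \<partial>lborel)"
      using lebesgue_integral_borel_version[OF m m' ae] i by auto
  qed
  have Gi: "integrable lebesgue (\<lambda>x. G x $ j * \<phi> x)" for j by (rule Lloc_1_mult_integrable[OF GL \<phi>c S(1-3)])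
  have AG: "AE x in lborel. G x $ j * \<phi> x = A x $ j" for j using A(2)[of j] by (simp add: mult.commute)
  show Ai: "integrable lborel (\<lambda>x. A x $ j)" for j
    using lebesgue_integral_borel_version(2)[OF borel_measurable_integrable[OF Gi] A(1) AG] Gi by simp
  show upi: "integrable lborel (\<lambda>x. u' x * partial_deriv j \<phi> x)" for j by (rule um(3)[OF pc S(4)])
  have hi: "integrable lborel (\<lambda>x. \<phi> x * u' x)" using um(3)[OF \<phi>c S(3)] by (simp add: mult.commute)
  show "has_weak_gradient (\<lambda>x. \<phi> x * u' x) (\<lambda>x. A x + u' x *\<^sub>R gradient \<phi> x)"
    unfolding has_weak_gradient_def
  proof (intro conjI allI ballI)
    show "loc_integrable (\<lambda>x. \<phi> x * u' x)" by (rule integrable_imp_loc_integrable[OF hi])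
    show "loc_integrable (\<lambda>x. (A x + u' x *\<^sub>R gradient \<phi> x) $ j)" for j
      using Ai[of j] upi[of j] by (intro integrable_imp_loc_integrable) (simp add: gradient_def)
    fix \<eta> :: "real ^ 'n \<Rightarrow> real" and j assume "\<eta> \<in> test_functions UNIV"
    then have \<eta>: "C_k l \<eta>" for l by (simp add: test_functions_def)
    have \<eta>c: "continuous_on UNIV \<eta>" "continuous_on UNIV (partial_deriv j \<eta>)"
      using C_k_continuous[OF \<eta>] \<eta>[of 1] by auto
    have pe: "(\<lambda>x. \<phi> x * \<eta> x) \<in> test_functions \<Omega>" by (rule test_functions_mult[OF \<phi> \<eta>])
    have dp: "partial_deriv j (\<lambda>x. \<phi> x * \<eta> x) x = \<phi> x * partial_deriv j \<eta> x + partial_deriv j \<phi> x * \<eta> x" for x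
      by (intro partial_deriv_mult C_k_differentiable[of 0] \<phi>C \<eta>)
    have out: "\<phi> x = 0" "partial_deriv j \<phi> x = 0" if "x \<notin> \<Omega>" for x using S that by blast+
    have c1: "continuous_on UNIV (\<lambda>x. \<phi> x * partial_deriv j \<eta> x)" using \<phi>c \<eta>c by (intro continuous_intros)
    have c2: "continuous_on UNIV (\<lambda>x. partial_deriv j \<phi> x * \<eta> x)" using pc \<eta>c by (intro continuous_intros)
    have s1: "x \<notin> S \<Longrightarrow> \<phi> x * partial_deriv j \<eta> x = 0" and s2: "x \<notin> S \<Longrightarrow> partial_deriv j \<phi> x * \<eta> x = 0" for x
      using S by auto
    have c3: "continuous_on UNIV (\<lambda>x. \<phi> x * \<eta> x)" using \<phi>c \<eta>c(1) by (rule continuous_on_mult)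
    have s3: "\<phi> x * \<eta> x = 0" if "x \<notin> S" for x using S(3)[OF that] by simp
    have Gpe: "integrable lebesgue (\<lambda>x. G x $ j * (\<phi> x * \<eta> x))"
      by (rule Lloc_1_mult_integrable[OF GL c3 S(1,2) s3])
    have Gj: "(\<integral>x. G x $ j * (\<phi> x * \<eta> x) \<partial>lebesgue) = (\<integral>x. A x $ j * \<eta> x \<partial>lborel)"
    proof (rule lebesgue_integral_borel_version(1))
      show "(\<lambda>x. G x $ j * (\<phi> x * \<eta> x)) \<in> borel_measurable lebesgue"
        by (rule borel_measurable_integrable[OF Gpe])
      show "(\<lambda>x. A x $ j * \<eta> x) \<in> borel_measurable borel"
        using borel_measurable_continuous_onI[OF \<eta>c(1)] A(1) by (intro borel_measurable_times)
      show "AE x in lborel. G x $ j * (\<phi> x * \<eta> x) = A x $ j * \<eta> x"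
        using AG[of j] by (rule AE_mp) (intro AE_I2 impI, metis mult.assoc)
    qed
    have "(LINT x:\<Omega>|lebesgue. u x * partial_deriv j (\<lambda>x. \<phi> x * \<eta> x) x) = - (LINT x:\<Omega>|lebesgue. G x $ j * (\<phi> x * \<eta> x))"
      using G pe unfolding weak_gradient_def by blast
    then have "(\<integral>x. u x * (\<phi> x * partial_deriv j \<eta> x) + u x * (partial_deriv j \<phi> x * \<eta> x) \<partial>lebesgue) = - (\<integral>x. G x $ j * (\<phi> x * \<eta> x) \<partial>lebesgue)"
      by (simp add: set_integral_eq_integral_zero_outside out dp distrib_left)
    then have main: "(\<integral>x. u' x * (\<phi> x * partial_deriv j \<eta> x) \<partial>lborel) + (\<integral>x. u' x * (partial_deriv j \<phi> x * \<eta> x) \<partial>lborel) = - (\<integral>x. A x $ j * \<eta> x \<partial>lborel)"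
      using um(2)[OF c1 s1] um(2)[OF c2 s2] um(4)[OF c1 s1] um(4)[OF c2 s2] by (simp add: Gj)
    have Ae: "integrable lborel (\<lambda>x. A x $ j * \<eta> x)"
    proof -
      note Gpe
      moreover have "(\<lambda>x. A x $ j * \<eta> x) \<in> borel_measurable borel"
        using borel_measurable_continuous_onI[OF \<eta>c(1)] A(1) by (intro borel_measurable_times)
      moreover have "AE x in lborel. G x $ j * (\<phi> x * \<eta> x) = A x $ j * \<eta> x"
        using AG[of j] by (rule AE_mp) (intro AE_I2 impI, metis mult.assoc)
      ultimately show ?thesis using lebesgue_integral_borel_version(2) borel_measurable_integrable by blast
    qed
    have "(\<integral>x. (A x + u' x *\<^sub>R gradient \<phi> x) $ j * \<eta> x \<partial>lborel) = (\<integral>x. A x $ j * \<eta> x + u' x * (partial_deriv j \<phi> x * \<eta> x) \<partial>lborel)"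
      by (intro Bochner_Integration.integral_cong) (auto simp: gradient_def algebra_simps)
    also have "\<dots> = (\<integral>x. A x $ j * \<eta> x \<partial>lborel) + (\<integral>x. u' x * (partial_deriv j \<phi> x * \<eta> x) \<partial>lborel)"
      using Ae um(3)[OF c2 s2] by simp
    also have "\<dots> = - (\<integral>x. \<phi> x * u' x * partial_deriv j \<eta> x \<partial>lborel)"
      using main by (simp add: mult_ac)
    finally show "(\<integral>x. \<phi> x * u' x * partial_deriv j \<eta> x \<partial>lborel) = - (\<integral>x. (A x + u' x *\<^sub>R gradient \<phi> x) $ j * \<eta> x \<partial>lborel)" by simp
  qed
qed

lemma nn_integral_sum_powr_finite:
  fixes y :: "'i \<Rightarrow> 'a \<Rightarrow> real"
  assumes "finite I" "s > 0" "\<And>i. i \<in> I \<Longrightarrow> y i \<in> borel_measurable M" "\<And>i x. i \<in> I \<Longrightarrow> y i x \<ge> 0"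
    "\<And>i. i \<in> I \<Longrightarrow> (\<integral>\<^sup>+x. ennreal (y i x powr s) \<partial>M) < \<infinity>"
  shows "(\<integral>\<^sup>+x. ennreal ((\<Sum>i\<in>I. y i x) powr s) \<partial>M) < \<infinity>"
  using assms
proof (induction I rule: finite_induct)
  case (insert i I)
  have [measurable]: "y i \<in> borel_measurable M" "(\<lambda>x. \<Sum>i\<in>I. y i x) \<in> borel_measurable M"
    using insert.prems by (auto intro!: borel_measurable_sum)
  have "(\<integral>\<^sup>+x. ennreal ((\<Sum>k\<in>insert i I. y k x) powr s) \<partial>M) \<le>
      (\<integral>\<^sup>+x. ennreal (2 powr s) * (ennreal (y i x powr s) + ennreal ((\<Sum>k\<in>I. y k x) powr s)) \<partial>M)"
  proof (rule nn_integral_mono)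
    fix x
    have "(y i x + (\<Sum>k\<in>I. y k x)) powr s \<le> 2 powr s * (y i x powr s + (\<Sum>k\<in>I. y k x) powr s)"
      using insert.prems by (intro powr_sum_le sum_nonneg) auto
    then show "ennreal ((\<Sum>k\<in>insert i I. y k x) powr s) \<le> ennreal (2 powr s) * (ennreal (y i x powr s) + ennreal ((\<Sum>k\<in>I. y k x) powr s))"
      using insert.hyps by (simp add: ennreal_plus[symmetric] ennreal_mult[symmetric] ennreal_leI del: ennreal_plus)
  qed
  also have "\<dots> = ennreal (2 powr s) * ((\<integral>\<^sup>+x. ennreal (y i x powr s) \<partial>M) + (\<integral>\<^sup>+x. ennreal ((\<Sum>k\<in>I. y k x) powr s) \<partial>M))"
    by (subst nn_integral_cmult, simp, subst nn_integral_add) auto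
  also have "\<dots> < \<infinity>"
    using insert by (simp add: ennreal_mult_less_top)
  finally show ?case .
qed simp

section \<open>The Caccioppoli inequality\<close>

lemma borel_measurable_vec_components:
  fixes F :: "'a \<Rightarrow> real ^ 'n::finite"
  assumes "\<And>j. (\<lambda>x. F x $ j) \<in> borel_measurable M"
  shows "F \<in> borel_measurable M"
  unfolding borel_measurable_euclidean_space[of F]
proof
  fix b :: "real ^ 'n" assume "b \<in> Basis"
  then obtain j where "b = axis j 1" unfolding Basis_vec_def by auto
  then show "(\<lambda>x. F x \<bullet> b) \<in> borel_measurable M" using assms[of j] by (simp add: inner_axis)
qed

lemma op_norm_le_sum_entries:
  fixes A :: "nat \<Rightarrow> real ^ 'n::finite"
  shows "op_norm m A \<le> (\<Sum>(i, j)\<in>{..<m} \<times> UNIV. \<bar>A i $ j\<bar>)"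
proof -
  have "op_norm m A \<le> (\<Sum>i<m. norm (A i))" by (rule op_norm_le_sum)
  also have "\<dots> \<le> (\<Sum>i<m. \<Sum>j\<in>UNIV. \<bar>A i $ j\<bar>)" by (intro sum_mono norm_le_l1_cart)
  finally show ?thesis by (simp add: sum.cartesian_product)
qed

lemma op_norm_integrable:
  fixes A :: "'a \<Rightarrow> nat \<Rightarrow> real ^ 'n::finite"
  assumes m: "(\<lambda>x. op_norm m (A x)) \<in> borel_measurable M"
    and int: "\<And>i j. i < m \<Longrightarrow> integrable M (\<lambda>x. A x i $ j)"
  shows "integrable M (\<lambda>x. op_norm m (A x))"
proof (rule Bochner_Integration.integrable_bound[OF _ m])
  show "integrable M (\<lambda>x. \<Sum>(i, j)\<in>{..<m} \<times> UNIV. \<bar>A x i $ j\<bar>)"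
    using int by (intro Bochner_Integration.integrable_sum) (auto split: prod.splits)
  show "AE x in M. norm (op_norm m (A x)) \<le> norm (\<Sum>(i, j)\<in>{..<m} \<times> UNIV. \<bar>A x i $ j\<bar>)"
  proof (rule AE_I2)
    fix x
    have "\<bar>op_norm m (A x)\<bar> = op_norm m (A x)" by (rule abs_of_nonneg[OF op_norm_nonneg])
    also have "\<dots> \<le> \<bar>\<Sum>(i, j)\<in>{..<m} \<times> UNIV. \<bar>A x i $ j\<bar>\<bar>"
      by (rule order_trans[OF op_norm_le_sum_entries abs_ge_self])
    finally show "norm (op_norm m (A x)) \<le> norm (\<Sum>(i, j)\<in>{..<m} \<times> UNIV. \<bar>A x i $ j\<bar>)" by simp
  qed
qed

lemma op_norm_powr_finite:
  fixes A :: "'a \<Rightarrow> nat \<Rightarrow> real ^ 'n::finite"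
  assumes s: "s > 0" and m: "\<And>i j. i < m \<Longrightarrow> (\<lambda>x. A x i $ j) \<in> borel_measurable M"
    and fin: "\<And>i j. i < m \<Longrightarrow> (\<integral>\<^sup>+x. ennreal (\<bar>A x i $ j\<bar> powr s) \<partial>M) < \<infinity>"
  shows "(\<integral>\<^sup>+x. ennreal (op_norm m (A x) powr s) \<partial>M) < \<infinity>"
proof -
  have "(\<integral>\<^sup>+x. ennreal (op_norm m (A x) powr s) \<partial>M) \<le>
      (\<integral>\<^sup>+x. ennreal ((\<Sum>p\<in>{..<m} \<times> UNIV. \<bar>A x (fst p) $ snd p\<bar>) powr s) \<partial>M)"
  proof (intro nn_integral_mono ennreal_leI powr_mono2 op_norm_nonneg)
    show "op_norm m (A x) \<le> (\<Sum>p\<in>{..<m} \<times> UNIV. \<bar>A x (fst p) $ snd p\<bar>)" for x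
      using op_norm_le_sum_entries[of m "A x"] by (simp add: case_prod_beta)
  qed (use s in simp)
  also have "\<dots> < \<infinity>"
    using s m fin by (intro nn_integral_sum_powr_finite) (auto intro!: borel_measurable_abs)
  finally show ?thesis .
qed

lemma star_pullback_cong:
  assumes "covector m \<omega>" "\<And>i. i < m \<Longrightarrow> A i = B i"
  shows "star_pullback \<omega> A = star_pullback \<omega> B"
proof -
  have "\<omega> (\<lambda>j i. A i $ j) = \<omega> (\<lambda>j i. B i $ j)"
  proof (rule covector_cong[OF assms(1)])
    fix j i assume "i < m"
    then show "A i $ j = B i $ j" using assms(2) by metis
  qed
  then show ?thesis by (simp add: star_pullback_def)
qed

lemma star_pullback_scaleR:
  fixes \<omega> :: "('n::{finite,wellorder} \<Rightarrow> nat \<Rightarrow> real) \<Rightarrow> real"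
  assumes "covector m \<omega>"
  shows "star_pullback \<omega> (\<lambda>i. c *\<^sub>R A i) = c ^ CARD('n) * star_pullback \<omega> A"
proof -
  have "det (\<chi> k. c *\<^sub>R A (I k)) = c ^ CARD('n) * det (\<chi> k. A (I k))" for I :: "'n \<Rightarrow> nat"
    using det_rows_mul[of "\<lambda>_. c" "\<lambda>k. A (I k)"] by (simp add: scalar_mult_eq_scaleR)
  then show ?thesis
    by (simp add: star_pullback_expansion[OF assms] sum_distrib_left mult_ac)
qed

text \<open>
  Nonnegative integrals with respect to a measure and its completion agree, also for
  non-measurable functions such as the operator norm of an arbitrary representative of the weak
  differential.
\<close>
lemma nn_integral_AE_borel_version:
  fixes g :: "'a::euclidean_space \<Rightarrow> real"
  assumes "AE x in lborel. indicator \<Omega> x * g x = g' x" "\<And>x. g' x \<ge> 0"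
  shows "(\<integral>\<^sup>+x\<in>\<Omega>. ennreal (g x) \<partial>lebesgue) = (\<integral>\<^sup>+x. ennreal (g' x) \<partial>lborel)"
proof -
  have "(\<integral>\<^sup>+x\<in>\<Omega>. ennreal (g x) \<partial>lebesgue) = (\<integral>\<^sup>+x\<in>\<Omega>. ennreal (g x) \<partial>lborel)"
    by (rule nn_integral_completion)
  also have "\<dots> = (\<integral>\<^sup>+x. ennreal (g' x) \<partial>lborel)"
    using assms(1)
  proof (intro nn_integral_cong_AE, elim AE_mp, intro AE_I2 impI)
    fix x assume "indicator \<Omega> x * g x = g' x"
    then show "ennreal (g x) * indicator \<Omega> x = ennreal (g' x)" by (cases "x \<in> \<Omega>") auto
  qed
  finally show ?thesis .
qed

lemma nn_integral_powr_AE_finite: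
  fixes w w' :: "'a::euclidean_space \<Rightarrow> real"
  assumes "integrable lebesgue (\<lambda>x. \<bar>w x\<bar> powr s)" "AE x in lborel. w x = w' x"
  shows "(\<integral>\<^sup>+x. ennreal (\<bar>w' x\<bar> powr s) \<partial>lborel) < \<infinity>"
proof -
  have "(\<integral>\<^sup>+x. ennreal (\<bar>w' x\<bar> powr s) \<partial>lborel) = (\<integral>\<^sup>+x. ennreal (\<bar>w x\<bar> powr s) \<partial>lborel)"
    using assms(2) by (intro nn_integral_cong_AE) (elim AE_mp, intro AE_I2 impI, simp)
  also have "\<dots> = (\<integral>\<^sup>+x. ennreal (\<bar>w x\<bar> powr s) \<partial>lebesgue)"
    by (rule nn_integral_completion[symmetric])
  also have "\<dots> < \<infinity>"
    using assms(1) by (simp add: integrable_iff_bounded)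
  finally show ?thesis .
qed

text \<open>
  The constant of \<open>caccioppoli_borel\<close> for the \<open>s\<close>-th powers of the
  norms.
\<close>
definition caccioppoli_const :: "'n::finite itself \<Rightarrow> real \<Rightarrow> real \<Rightarrow> real \<Rightarrow> real" where
  "caccioppoli_const _ K t s = 1 + 2 * (K * t * (fact CARD('n) * real CARD('n)) *
      (1 / (4 * (K * t * young_const TYPE('n)))) powr (1 - s))"

text \<open>
  \<open>caccioppoli_borel\<close> is applied to Borel versions of \<open>\<phi> Df\<close> and of
  \<open>f\<close> on \<open>\<Omega>\<close>. Outside of \<open>\<Omega>\<close> the function
  \<open>\<phi>\<close> and its gradient vanish, so all functions extend by zero. Finiteness of
  both integrals, which the absorption requires, follows from the local integrability of
  \<open>f\<close> and of its weak gradient.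
\<close>
theorem caccioppoli_integral:
  fixes \<Omega> :: "(real, 'n::{finite,wellorder}) vec set" and f :: "(real, 'n) vec \<Rightarrow> nat \<Rightarrow> real"
    and Df :: "(real, 'n) vec \<Rightarrow> nat \<Rightarrow> (real, 'n) vec" and \<omega> :: "('n \<Rightarrow> nat \<Rightarrow> real) \<Rightarrow> real"
    and s K :: real
  assumes N: "CARD('n) \<ge> 2" and cov: "covector m \<omega>" and K: "K \<ge> 1" and t: "l1_norm m \<omega> > 0"
    and e: "\<bar>s - CARD('n)\<bar> \<le> 1 / 2"
    and small: "K * l1_norm m \<omega> * \<bar>s - CARD('n)\<bar> * absorb_const TYPE('n) \<le> 1 / 4"
    and f: "f \<in> W1loc s m \<Omega>" and Df: "weak_differential m \<Omega> f Df"
    and qr: "AE x\<in>\<Omega> in lebesgue. op_norm m (Df x) ^ CARD('n) \<le> K * star_pullback \<omega> (Df x)"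
    and \<phi>: "\<phi> \<in> test_functions \<Omega>" "\<And>x. \<phi> x \<ge> 0"
  shows "\<exists>X Y. X \<ge> 0 \<and> Y \<ge> 0 \<and> X \<le> caccioppoli_const TYPE('n) K (l1_norm m \<omega>) s * Y \<and>
    (\<integral>\<^sup>+x\<in>\<Omega>. ennreal (op_norm m (\<lambda>i. \<phi> x *\<^sub>R Df x i) powr s) \<partial>lebesgue) = ennreal X \<and>
    (\<integral>\<^sup>+x\<in>\<Omega>. ennreal (op_norm m (\<lambda>i. f x i *\<^sub>R gradient \<phi> x) powr s) \<partial>lebesgue) = ennreal Y"
proof -
  have s: "s > 0" using N e by linarith
  obtain S where S: "compact S" "S \<subseteq> \<Omega>" "\<forall>x. x \<notin> S \<longrightarrow> \<phi> x = 0 \<and> (\<forall>j. partial_deriv j \<phi> x = 0)"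
    using test_function_support[OF \<phi>(1)] by blast
  have S\<phi>: "\<phi> x = 0" if "x \<notin> S" for x using S(3) that by blast
  have Sd: "partial_deriv j \<phi> x = 0" if "x \<notin> S" for x j using S(3) that by blast
  have out: "\<phi> x = 0" "gradient \<phi> x = 0" if "x \<notin> \<Omega>" for x
  proof -
    have x: "x \<notin> S" using S(2) that by blast
    show "\<phi> x = 0" by (rule S\<phi>[OF x])
    show "gradient \<phi> x = 0" by (simp add: gradient_def vec_eq_iff Sd[OF x])
  qed
  have \<phi>C: "C_k l \<phi>" for l using \<phi> by (simp add: test_functions_def)
  have \<phi>c: "continuous_on UNIV \<phi>" by (rule C_k_continuous[OF \<phi>C])
  have dc: "continuous_on UNIV (partial_deriv j \<phi>)" for j using \<phi>C[of 1] by simp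
  have dm: "partial_deriv j \<phi> \<in> borel_measurable borel" for j by (rule borel_measurable_continuous_onI[OF dc])
  have \<phi>m: "\<phi> \<in> borel_measurable borel" by (rule borel_measurable_continuous_onI[OF \<phi>c])
  have wd: "weak_gradient \<Omega> (\<lambda>x. f x i) (\<lambda>x. Df x i)" if "i < m" for i
    using Df that by (simp add: weak_differential_def)
  have fL: "(\<lambda>x. f x i) \<in> Lloc s \<Omega>" if "i < m" for i using f that by (simp add: W1loc_def)
  have "\<forall>i. \<exists>u. i < m \<longrightarrow> u \<in> borel_measurable borel \<and> (AE x in lborel. indicator \<Omega> x * f x i = u x)"
  proof (intro allI)
    fix i
    show "\<exists>u. i < m \<longrightarrow> u \<in> borel_measurable borel \<and> (AE x in lborel. indicator \<Omega> x * f x i = u x)"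
    proof (cases "i < m")
      case True
      then have "(\<lambda>x. indicator \<Omega> x * f x i) \<in> borel_measurable lebesgue"
        using fL by (simp add: Lloc_def set_borel_measurable_def)
      from borel_version[OF this] show ?thesis by blast
    qed simp
  qed
  from choice[OF this] obtain fB
    where "\<forall>i. i < m \<longrightarrow> fB i \<in> borel_measurable borel \<and> (AE x in lborel. indicator \<Omega> x * f x i = fB i x)" ..
  then have fB: "fB i \<in> borel_measurable borel" "AE x in lborel. indicator \<Omega> x * f x i = fB i x" if "i < m" for i
    using that by auto
  have "\<forall>p :: nat \<times> 'n. \<exists>u. fst p < m \<longrightarrow> u \<in> borel_measurable borel \<and> (AE x in lborel. Df x (fst p) $ snd p * \<phi> x = u x)"
  proof (intro allI)
    fix p :: "nat \<times> 'n"
    show "\<exists>u. fst p < m \<longrightarrow> u \<in> borel_measurable borel \<and> (AE x in lborel. Df x (fst p) $ snd p * \<phi> x = u x)"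
    proof (cases "fst p < m")
      case True
      then have "(\<lambda>x. Df x (fst p) $ snd p) \<in> Lloc 1 \<Omega>" using wd by (simp add: weak_gradient_def)
      then have "(\<lambda>x. Df x (fst p) $ snd p * \<phi> x) \<in> borel_measurable lebesgue"
        by (rule Lloc_mult(1)[OF _ \<phi>c S(1,2) S\<phi>]) simp_all
      from borel_version[OF this] show ?thesis by blast
    qed simp
  qed
  from choice[OF this] obtain AB where AB: "\<forall>p :: nat \<times> 'n. fst p < m \<longrightarrow> AB p \<in> borel_measurable borel \<and>
      (AE x in lborel. Df x (fst p) $ snd p * \<phi> x = AB p x)" ..
  have A': "AB (i, j) \<in> borel_measurable borel" "AE x in lborel. Df x i $ j * \<phi> x = AB (i, j) x" if "i < m" for i j
    using spec[OF AB, of "(i, j)"] that by simp_all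
  define A where "A x i = (\<chi> j. AB (i, j) x)" for x i
  have Am: "(\<lambda>x. A x i $ j) \<in> borel_measurable borel" if "i < m" for i j
    using A'(1)[OF that] by (simp add: A_def)
  have Aae: "AE x in lborel. \<phi> x * Df x i $ j = A x i $ j" if "i < m" for i j
  proof -
    show ?thesis using A'(2)[OF that] by (rule AE_mp) (intro AE_I2 impI, simp add: A_def mult.commute)
  qed
  define T where "T x i = fB i x *\<^sub>R gradient \<phi> x" for x i
  define H where "H x i = A x i + fB i x *\<^sub>R gradient \<phi> x" for x i
  define h where "h x i = \<phi> x * fB i x" for x i
  define a where "a x = op_norm m (A x)" for x
  define b where "b x = op_norm m (T x)" for x
  have Tm: "(\<lambda>x. T x i $ j) \<in> borel_measurable borel" if "i < m" for i j
    using fB(1)[OF that] dm[of j] by (simp add: T_def gradient_def)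
  have am: "a \<in> borel_measurable borel" and bm: "b \<in> borel_measurable borel"
    unfolding a_def[abs_def] b_def[abs_def]
    by (intro borel_measurable_op_norm borel_measurable_vec_components Am Tm; assumption)+
  have Aall: "AE x in lborel. \<forall>i<m. A x i = \<phi> x *\<^sub>R Df x i"
  proof -
    have "AE x in lborel. \<forall>i. \<forall>j. i < m \<longrightarrow> \<phi> x * Df x i $ j = A x i $ j"
      unfolding AE_all_countable using Aae by auto
    then show ?thesis by (rule AE_mp) (intro AE_I2 impI, auto simp: vec_eq_iff)
  qed
  have Fall: "AE x in lborel. \<forall>i<m. indicator \<Omega> x * f x i = fB i x"
  proof -
    have "AE x in lborel. \<forall>i. i < m \<longrightarrow> indicator \<Omega> x * f x i = fB i x"
      unfolding AE_all_countable using fB(2) by auto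
    then show ?thesis by simp
  qed
  have op0: "op_norm m (\<lambda>i. 0 :: (real, 'n) vec) = 0"
    using op_norm_scaleR[of 0 m "\<lambda>i. 0"] by simp
  have aae: "AE x in lborel. a x = \<phi> x * op_norm m (Df x)"
    using Aall
  proof (rule AE_mp, intro AE_I2 impI)
    fix x assume "\<forall>i<m. A x i = \<phi> x *\<^sub>R Df x i"
    then have "a x = op_norm m (\<lambda>i. \<phi> x *\<^sub>R Df x i)" unfolding a_def by (intro op_norm_cong) simp
    then show "a x = \<phi> x * op_norm m (Df x)" using op_norm_scaleR[OF \<phi>(2)] by simp
  qed
  have J1: "(\<integral>\<^sup>+x\<in>\<Omega>. ennreal (op_norm m (\<lambda>i. \<phi> x *\<^sub>R Df x i) powr s) \<partial>lebesgue) = (\<integral>\<^sup>+x. ennreal (a x powr s) \<partial>lborel)"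
  proof (rule nn_integral_AE_borel_version)
    show "AE x in lborel. indicator \<Omega> x * op_norm m (\<lambda>i. \<phi> x *\<^sub>R Df x i) powr s = a x powr s"
      using aae
    proof (rule AE_mp, intro AE_I2 impI)
      fix x assume x: "a x = \<phi> x * op_norm m (Df x)"
      show "indicator \<Omega> x * op_norm m (\<lambda>i. \<phi> x *\<^sub>R Df x i) powr s = a x powr s"
        using x out(1)[of x] s by (cases "x \<in> \<Omega>") (simp_all add: op_norm_scaleR[OF \<phi>(2)])
    qed
  qed simp
  have J2: "(\<integral>\<^sup>+x\<in>\<Omega>. ennreal (op_norm m (\<lambda>i. f x i *\<^sub>R gradient \<phi> x) powr s) \<partial>lebesgue) = (\<integral>\<^sup>+x. ennreal (b x powr s) \<partial>lborel)"
  proof (rule nn_integral_AE_borel_version)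
    show "AE x in lborel. indicator \<Omega> x * op_norm m (\<lambda>i. f x i *\<^sub>R gradient \<phi> x) powr s = b x powr s"
      using Fall
    proof (rule AE_mp, intro AE_I2 impI)
      fix x assume x: "\<forall>i<m. indicator \<Omega> x * f x i = fB i x"
      show "indicator \<Omega> x * op_norm m (\<lambda>i. f x i *\<^sub>R gradient \<phi> x) powr s = b x powr s"
      proof (cases "x \<in> \<Omega>")
        case True
        have "op_norm m (\<lambda>i. f x i *\<^sub>R gradient \<phi> x) = b x"
          unfolding b_def by (rule op_norm_cong) (use x True in \<open>simp add: T_def\<close>)
        then show ?thesis using True by simp
      next
        case False
        then have "b x = 0" by (simp add: b_def T_def[abs_def] out(2) op0)
        then show ?thesis using False s by simp
      qed
    qed
  qed simp
  have afin: "(\<integral>\<^sup>+x. ennreal (a x powr s) \<partial>lborel) < \<infinity>"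
    unfolding a_def
  proof (rule op_norm_powr_finite[OF s])
    fix i j assume i: "i < m"
    show "(\<lambda>x. A x i $ j) \<in> borel_measurable lborel" using Am[OF i] by simp
    obtain G where G: "weak_gradient \<Omega> (\<lambda>x. f x i) G" "\<forall>j. (\<lambda>x. G x $ j) \<in> Lloc s \<Omega>"
      using f i unfolding W1loc_def by blast
    show "(\<integral>\<^sup>+x. ennreal (\<bar>A x i $ j\<bar> powr s) \<partial>lborel) < \<infinity>"
    proof (rule nn_integral_powr_AE_finite)
      show "integrable lebesgue (\<lambda>x. \<bar>G x $ j * \<phi> x\<bar> powr s)"
        using G(2) by (intro Lloc_mult(2)[OF _ \<phi>c S(1,2) S\<phi> s]) auto
      show "AE x in lborel. G x $ j * \<phi> x = A x i $ j"
        using Aae[OF i, of j] weak_gradient_unique[OF wd[OF i] G(1) \<phi>(1), of j]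
        by eventually_elim (simp add: mult.commute)
    qed
  qed
  have Tae: "AE x in lborel. f x i * partial_deriv j \<phi> x = T x i $ j" if "i < m" for i j
    using fB(2)[OF that]
  proof (rule AE_mp, intro AE_I2 impI)
    fix x assume x: "indicator \<Omega> x * f x i = fB i x"
    show "f x i * partial_deriv j \<phi> x = T x i $ j"
    proof (cases "x \<in> \<Omega>")
      case True
      then show ?thesis using x by (simp add: T_def gradient_def)
    next
      case False
      then have "partial_deriv j \<phi> x = 0" using S(2) by (intro Sd) blast
      then show ?thesis by (simp add: T_def gradient_def)
    qed
  qed
  have bfin: "(\<integral>\<^sup>+x. ennreal (b x powr s) \<partial>lborel) < \<infinity>"
    unfolding b_def
  proof (rule op_norm_powr_finite[OF s])
    fix i j assume i: "i < m"
    show "(\<lambda>x. T x i $ j) \<in> borel_measurable lborel" using Tm[OF i] by simp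
    show "(\<integral>\<^sup>+x. ennreal (\<bar>T x i $ j\<bar> powr s) \<partial>lborel) < \<infinity>"
      by (rule nn_integral_powr_AE_finite[OF Lloc_mult(2)[OF fL[OF i] dc S(1,2) Sd s] Tae[OF i]])
  qed
  have cut: "has_weak_gradient (\<lambda>x. \<phi> x * fB i x) (\<lambda>x. A x i + fB i x *\<^sub>R gradient \<phi> x)"
      "integrable lborel (\<lambda>x. A x i $ j)" "integrable lborel (\<lambda>x. fB i x * partial_deriv j \<phi> x)" if i: "i < m" for i j
    using has_weak_gradient_cutoff[OF wd[OF i] \<phi>(1) fB[OF i] Am[OF i] Aae[OF i]] by auto
  have abi: "integrable lborel (\<lambda>x. a x + b x)"
  proof (intro Bochner_Integration.integrable_add)
    show "integrable lborel a" unfolding a_def[abs_def]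
      using am cut(2) by (intro op_norm_integrable) (simp_all add: a_def[abs_def])
    show "integrable lborel b" unfolding b_def[abs_def]
      using bm cut(3) by (intro op_norm_integrable) (simp_all add: b_def[abs_def] T_def gradient_def)
  qed
  obtain R where R: "\<forall>z. norm z > R \<longrightarrow> \<phi> z = 0" using zero_outside_compact[where \<psi>=\<phi>, OF S(1) S\<phi>] by blast
  have qrB: "AE x in lborel. a x ^ CARD('n) \<le> K * star_pullback \<omega> (A x)"
  proof -
    have "AE x in lborel. x \<in> \<Omega> \<longrightarrow> op_norm m (Df x) ^ CARD('n) \<le> K * star_pullback \<omega> (Df x)"
      using qr by (simp add: AE_completion_iff)
    then show ?thesis using Aall aae
    proof eventually_elim
      fix x assume x: "x \<in> \<Omega> \<longrightarrow> op_norm m (Df x) ^ CARD('n) \<le> K * star_pullback \<omega> (Df x)"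
        "\<forall>i<m. A x i = \<phi> x *\<^sub>R Df x i" "a x = \<phi> x * op_norm m (Df x)"
      have "star_pullback \<omega> (A x) = star_pullback \<omega> (\<lambda>i. \<phi> x *\<^sub>R Df x i)"
        using x(2) by (intro star_pullback_cong[OF cov]) simp
      also have "\<dots> = \<phi> x ^ CARD('n) * star_pullback \<omega> (Df x)" by (rule star_pullback_scaleR[OF cov])
      finally have *: "star_pullback \<omega> (A x) = \<phi> x ^ CARD('n) * star_pullback \<omega> (Df x)" .
      show "a x ^ CARD('n) \<le> K * star_pullback \<omega> (A x)"
      proof (cases "x \<in> \<Omega>")
        case True
        then have "\<phi> x ^ CARD('n) * op_norm m (Df x) ^ CARD('n) \<le> \<phi> x ^ CARD('n) * (K * star_pullback \<omega> (Df x))"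
          using x(1) \<phi>(2)[of x] by (intro mult_left_mono) simp_all
        then show ?thesis by (simp add: * x(3) power_mult_distrib mult_ac)
      next
        case False
        then show ?thesis using out(1)[OF False] by (simp add: * x(3) zero_power)
      qed
    qed
  qed
  have Ns: "real CARD('n) + (s - real CARD('n)) = s" by simp
  have core: "(\<integral>x. a x powr (CARD('n) + (s - CARD('n))) \<partial>lborel) \<le>
    (1 + 2 * (K * l1_norm m \<omega> * (fact CARD('n) * real CARD('n)) *
      (1 / (4 * (K * l1_norm m \<omega> * young_const TYPE('n)))) powr (1 - (CARD('n) + (s - CARD('n)))))) *
    (\<integral>x. b x powr (CARD('n) + (s - CARD('n))) \<partial>lborel)"
  proof (rule caccioppoli_borel[OF N cov K t e small am bm])
    show "a x \<ge> 0" "b x \<ge> 0" for x by (simp_all add: a_def b_def op_norm_nonneg)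
    show "integrable lborel (\<lambda>x. a x + b x)" by (rule abi)
    show "(\<integral>\<^sup>+x. ennreal (a x powr (CARD('n) + (s - CARD('n)))) \<partial>lborel) < \<infinity>" unfolding Ns by (rule afin)
    show "(\<integral>\<^sup>+x. ennreal (b x powr (CARD('n) + (s - CARD('n)))) \<partial>lborel) < \<infinity>" unfolding Ns by (rule bfin)
    show "AE x in lborel. a x ^ CARD('n) \<le> K * star_pullback \<omega> (A x)" by (rule qrB)
    fix i x assume i: "i < m"
    have 1: "norm (A x i) \<le> a x" unfolding a_def by (rule row_le_op_norm[OF i])
    have 2: "norm (T x i) \<le> b x" unfolding b_def by (rule row_le_op_norm[OF i])
    have 3: "H x i = A x i + T x i" by (simp add: H_def T_def)
    show "norm (A x i) \<le> a x" by (rule 1)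
    show "norm (H x i) \<le> a x + b x" unfolding 3 by (rule order_trans[OF norm_triangle_ineq add_mono[OF 1 2]])
    show "norm (A x i - H x i) \<le> b x" using 2 by (simp add: 3)
  next
    fix i assume "i < m"
    then show "has_weak_gradient (\<lambda>x. h x i) (\<lambda>x. H x i)" unfolding h_def H_def by (rule cut(1))
  next
    fix i :: nat and z :: "(real, 'n) vec" assume "norm z > R"
    then show "h z i = 0" using R by (simp add: h_def)
  qed
  show ?thesis
  proof (intro exI conjI)
    show "0 \<le> (\<integral>x. a x powr s \<partial>lborel)" "0 \<le> (\<integral>x. b x powr s \<partial>lborel)" by (simp_all add: integral_nonneg_AE)
    show "(\<integral>x. a x powr s \<partial>lborel) \<le> caccioppoli_const TYPE('n) K (l1_norm m \<omega>) s * (\<integral>x. b x powr s \<partial>lborel)"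
      using core unfolding Ns caccioppoli_const_def .
    have "(\<lambda>x. a x powr s) \<in> borel_measurable lborel" "(\<lambda>x. b x powr s) \<in> borel_measurable lborel" using am bm by simp_all
    then have "integrable lborel (\<lambda>x. a x powr s)" "integrable lborel (\<lambda>x. b x powr s)"
      using afin bfin by (simp_all add: integrable_iff_bounded)
    then show "(\<integral>\<^sup>+x\<in>\<Omega>. ennreal (op_norm m (\<lambda>i. \<phi> x *\<^sub>R Df x i) powr s) \<partial>lebesgue) = ennreal (\<integral>x. a x powr s \<partial>lborel)"
      "(\<integral>\<^sup>+x\<in>\<Omega>. ennreal (op_norm m (\<lambda>i. f x i *\<^sub>R gradient \<phi> x) powr s) \<partial>lebesgue) = ennreal (\<integral>x. b x powr s \<partial>lborel)"
      unfolding J1 J2 by (simp_all add: nn_integral_eq_integral)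
  qed
qed

text \<open>
  Both endpoints differ from \<open>n\<close> by at most \<open>n / (\<tau> - 1)\<close>, and
  \<open>\<tau> - 1 \<ge> \<tau> / 2\<close>.
\<close>
lemma exponent_window:
  fixes s \<tau> :: real and n :: nat
  assumes \<tau>: "\<tau> \<ge> 4 * real n" "\<tau> \<ge> 2" and q: "\<tau> / (\<tau> + 1) * n < s" and p: "s < \<tau> / (\<tau> - 1) * n"
  shows "\<bar>s - n\<bar> \<le> 2 * real n / \<tau>" "\<bar>s - n\<bar> \<le> 1 / 2"
proof -
  have "n - s \<le> n - \<tau> / (\<tau> + 1) * n" using q by simp
  also have "\<dots> = n / (\<tau> + 1)" using \<tau> by (simp add: field_simps)
  also have "\<dots> \<le> n / (\<tau> / 2)" using \<tau> by (intro divide_left_mono) auto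
  finally have 1: "n - s \<le> 2 * real n / \<tau>" by (simp add: mult.commute)
  have "s - n \<le> \<tau> / (\<tau> - 1) * n - n" using p by simp
  also have "\<dots> = n / (\<tau> - 1)" using \<tau> by (simp add: field_simps)
  also have "\<dots> \<le> n / (\<tau> / 2)" using \<tau> by (intro divide_left_mono) auto
  finally have "s - n \<le> 2 * real n / \<tau>" by (simp add: mult.commute)
  with 1 show le: "\<bar>s - n\<bar> \<le> 2 * real n / \<tau>" by linarith
  have "2 * real n / \<tau> \<le> 1 / 2" using \<tau> by (simp add: field_simps)
  with le show "\<bar>s - n\<bar> \<le> 1 / 2" by linarith
qed

theorem theorem1p4:
  assumes "CARD('n::{finite,wellorder}) \<ge> 2"
  shows "\<exists>l::real. l \<ge> 1 \<and>
    (\<forall>(K::real) (t::real) (s::real). K \<ge> 1 \<longrightarrow>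
       (\<exists>C::real. C > 0 \<and>
         (\<forall>(m::nat) (\<omega> :: ('n \<Rightarrow> nat \<Rightarrow> real) \<Rightarrow> real) (\<Omega> :: (real ^ 'n::{finite,wellorder}) set)
            (f :: real ^ 'n::{finite,wellorder} \<Rightarrow> nat \<Rightarrow> real) (Df :: real ^ 'n::{finite,wellorder} \<Rightarrow> nat \<Rightarrow> real ^ 'n::{finite,wellorder}).
            m \<ge> CARD('n) \<longrightarrow> calibration m \<omega> \<longrightarrow> l1_norm m \<omega> = t \<longrightarrow> open \<Omega> \<longrightarrow>
            q_exp l K CARD('n) t < s \<longrightarrow> ereal s < p_exp l K CARD('n) t \<longrightarrow>
            f \<in> W1loc s m \<Omega> \<longrightarrow> weak_differential m \<Omega> f Df \<longrightarrow>
            (AE x\<in>\<Omega> in lebesgue. op_norm m (Df x) ^ CARD('n) \<le> K * star_pullback \<omega> (Df x)) \<longrightarrow>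
            (\<forall>\<phi>\<in>test_functions \<Omega>. (\<forall>x. \<phi> x \<ge> 0) \<longrightarrow>
               matrix_Lnorm s m \<Omega> (\<lambda>x i. \<phi> x *\<^sub>R Df x i)
                 \<le> ennreal C * matrix_Lnorm s m \<Omega> (\<lambda>x i. f x i *\<^sub>R gradient \<phi> x)))))"
proof -
  let ?N = "CARD('n)" and ?D = "absorb_const TYPE('n)"
  \<comment> \<open>The first argument forces \<open>K * l * t \<ge> 4 * n\<close>, hence \<open>\<bar>s -
     n\<bar> \<le> 1 / 2\<close>; the second one makes the error proportional to \<open>\<bar>s -
     n\<bar>\<close> at most a quarter.\<close>
  define l where "l = max (4 * real ?N * fact ?N) (8 * real ?N * ?D)"
  have N2: "real ?N \<ge> 2" using assms by linarith
  have fN: "fact ?N \<ge> (1 :: real)" by (rule fact_ge_1)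
  have N4: "4 * real ?N * fact ?N \<ge> 4 * real ?N" using mult_left_mono[OF fN, of "4 * real ?N"] by simp
  have l2: "l \<ge> 4 * real ?N * fact ?N" and l3: "l \<ge> 8 * real ?N * ?D" unfolding l_def by simp_all
  have "l \<ge> 1" using N4 N2 l2 by linarith
  note l = this l2 l3
  have main: "matrix_Lnorm s m \<Omega> (\<lambda>x i. \<phi> x *\<^sub>R Df x i)
      \<le> ennreal ((1 + \<bar>caccioppoli_const TYPE('n) K (l1_norm m \<omega>) s\<bar>) powr (1 / s)) * matrix_Lnorm s m \<Omega> (\<lambda>x i. f x i *\<^sub>R gradient \<phi> x)"
    if K: "K \<ge> 1" and m: "m \<ge> ?N" and cal: "calibration m \<omega>"
      and q: "q_exp l K ?N (l1_norm m \<omega>) < s" and p: "ereal s < p_exp l K ?N (l1_norm m \<omega>)"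
      and f: "f \<in> W1loc s m \<Omega>" "weak_differential m \<Omega> f Df"
      and qr: "AE x\<in>\<Omega> in lebesgue. op_norm m (Df x) ^ ?N \<le> K * star_pullback \<omega> (Df x)"
      and \<phi>: "\<phi> \<in> test_functions \<Omega>" "\<forall>x. \<phi> x \<ge> 0"
    for K s :: real and m \<omega> and \<Omega> :: "(real, 'n) vec set" and f and Df :: "(real, 'n) vec \<Rightarrow> nat \<Rightarrow> (real, 'n) vec" and \<phi>
  proof -
    let ?t = "l1_norm m \<omega>"
    \<comment> \<open>for a calibration \<open>\<tau> > 1\<close>, so the value \<open>\<infinity>\<close> of
       the upper exponent does not occur\<close>
    define \<tau> where "\<tau> = K * l * ?t"
    have cov: "covector m \<omega>" using cal by (simp add: calibration_def)
    have t1: "1 \<le> fact ?N * ?t" by (rule calibration_l1_norm_ge[OF cal m])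
    then have t: "?t > 0" using fN by (metis less_le_trans zero_less_one zero_less_mult_pos fact_gt_zero)
    have "4 * real ?N * 1 \<le> 4 * real ?N * (fact ?N * ?t)" using t1 by (intro mult_left_mono) auto
    also have "\<dots> \<le> l * ?t" using mult_right_mono[OF l(2), of ?t] t by (simp add: mult_ac)
    also have "\<dots> \<le> K * (l * ?t)" using mult_right_mono[OF K, of "l * ?t"] l(1) t by simp
    finally have \<tau>: "\<tau> \<ge> 4 * real ?N" by (simp add: \<tau>_def mult_ac)
    then have \<tau>2: "\<tau> \<ge> 2" "\<tau> \<noteq> 1" "\<tau> > 0" using N2 by linarith+
    have qs: "\<tau> / (\<tau> + 1) * ?N < s" using q by (simp add: q_exp_def \<tau>_def)
    have ps: "s < \<tau> / (\<tau> - 1) * ?N" using p \<tau>2(2) by (simp add: p_exp_def \<tau>_def)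
    note w = exponent_window[OF \<tau> \<tau>2(1) qs ps]
    have "K * ?t * \<bar>s - ?N\<bar> * ?D \<le> K * ?t * (2 * real ?N / \<tau>) * ?D"
      using w(1) K t absorb_const_pos[where 'n='n] by (intro mult_right_mono mult_left_mono) auto
    also have "\<dots> = 2 * real ?N * ?D / l" using K t l(1) by (simp add: \<tau>_def field_simps)
    also have "\<dots> \<le> 1 / 4" using l(1,3) by (simp add: field_simps)
    finally have small: "K * ?t * \<bar>s - ?N\<bar> * ?D \<le> 1 / 4" .
    obtain X Y where XY: "X \<ge> 0" "Y \<ge> 0" "X \<le> caccioppoli_const TYPE('n) K ?t s * Y"
      "(\<integral>\<^sup>+x\<in>\<Omega>. ennreal (op_norm m (\<lambda>i. \<phi> x *\<^sub>R Df x i) powr s) \<partial>lebesgue) = ennreal X"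
      "(\<integral>\<^sup>+x\<in>\<Omega>. ennreal (op_norm m (\<lambda>i. f x i *\<^sub>R gradient \<phi> x) powr s) \<partial>lebesgue) = ennreal Y"
      using caccioppoli_integral[OF assms cov K t w(2) small f qr \<phi>(1)] \<phi>(2) by blast
    define c where "c = 1 + \<bar>caccioppoli_const TYPE('n) K ?t s\<bar>"
    have c: "c \<ge> 0" by (simp add: c_def)
    have s: "s > 0" using w(2) N2 by linarith
    have "caccioppoli_const TYPE('n) K ?t s \<le> c" unfolding c_def by linarith
    then have "X \<le> c * Y" using XY(2,3) mult_right_mono order_trans by blast
    then have "X powr (1 / s) \<le> (c * Y) powr (1 / s)" using s XY(1) by (intro powr_mono2) auto
    also have "\<dots> = c powr (1 / s) * Y powr (1 / s)" using c XY(2) by (simp add: powr_mult)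
    finally have "ennreal (X powr (1 / s)) \<le> ennreal (c powr (1 / s)) * ennreal (Y powr (1 / s))"
      by (simp add: ennreal_mult[symmetric] ennreal_leI)
    then show ?thesis
      using XY(1,2) by (simp add: matrix_Lnorm_def XY(4,5) c_def)
  qed
  show ?thesis
  proof (rule exI[of _ l], intro conjI allI impI)
    show "l \<ge> 1" by (rule l(1))
    fix K t s :: real assume K: "K \<ge> 1"
    show "\<exists>C::real. C > 0 \<and>
         (\<forall>(m::nat) (\<omega> :: ('n \<Rightarrow> nat \<Rightarrow> real) \<Rightarrow> real) (\<Omega> :: (real, 'n) vec set)
            (f :: (real, 'n) vec \<Rightarrow> nat \<Rightarrow> real) (Df :: (real, 'n) vec \<Rightarrow> nat \<Rightarrow> (real, 'n) vec).
            m \<ge> CARD('n) \<longrightarrow> calibration m \<omega> \<longrightarrow> l1_norm m \<omega> = t \<longrightarrow> open \<Omega> \<longrightarrow>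
            q_exp l K CARD('n) t < s \<longrightarrow> ereal s < p_exp l K CARD('n) t \<longrightarrow>
            f \<in> W1loc s m \<Omega> \<longrightarrow> weak_differential m \<Omega> f Df \<longrightarrow>
            (AE x\<in>\<Omega> in lebesgue. op_norm m (Df x) ^ CARD('n) \<le> K * star_pullback \<omega> (Df x)) \<longrightarrow>
            (\<forall>\<phi>\<in>test_functions \<Omega>. (\<forall>x. \<phi> x \<ge> 0) \<longrightarrow>
               matrix_Lnorm s m \<Omega> (\<lambda>x i. \<phi> x *\<^sub>R Df x i)
                 \<le> ennreal C * matrix_Lnorm s m \<Omega> (\<lambda>x i. f x i *\<^sub>R gradient \<phi> x)))"
    proof (rule exI[of _ "(1 + \<bar>caccioppoli_const TYPE('n) K t s\<bar>) powr (1 / s)"], intro conjI allI impI ballI)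
      show "(1 + \<bar>caccioppoli_const TYPE('n) K t s\<bar>) powr (1 / s) > 0" by simp
    qed (use main[OF K] in blast)
  qed
qed

end
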